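(* Let $F\colon Q^{\Delta}\to Q^{I_2(2n)}$ be a weighted folding (one of the five families $\Delta\in\{A_{2n-1},D_{n+1},E_6,E_7,E_8\}$ listed in the context) and let $\mathcal{A}$ be either $\operatorname{mod} KQ^{\Delta}$ or $\mathcal{D}^b(\operatorname{mod} KQ^{\Delta})$. Let $m\in\mathbb{Z}$, where in the case $\mathcal{A}=\operatorname{mod}KQ^{\Delta}$ only those $m$ with $\tau^m I(i)\neq 0$ are considered. Then: (a) For any $i\in Q^{\Delta}_0$ with $F(i)=[0]$, we have $\delta^{\mathcal{A}}_F(\tau^m I(i))=\varepsilon_i\alpha_m$, where $\alpha_m$ is the short root of $I_2(2n)$ corresponding to the point $\varsigma([0])\exp\left(\frac{m\pi \mathrm{i}}{n}\right)$. (b) For any $i\in Q^{\Delta}_0$ with $F(i)=[1]$, we have $\delta^{\mathcal{A}}_F(\tau^m I(i))=\varepsilon_i\beta_m$, where $\beta_m$ is the long root of $I_2(2n)$ corresponding to the point $\varsigma([1])\exp\left(\frac{(2m+1)\pi \mathrm{i}}{2n}\right)$.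
   Context: Conventions. $K$ is an algebraically closed field; modules are finitely generated right modules and paths are read left to right. $P(i)$, $I(i)$, $S(i)$ are the indecomposable projective, indecomposable injective and simple $KQ^{\Delta}$-modules at the vertex $i$, so $P(i)$ is simple iff $i$ is a sink and $I(i)$ is simple iff $i$ is a source. $\tau$ is the Auslander--Reiten translate of $\mathcal{A}$ ($\tau^{m}$ with $m<0$ means powers of $\tau^{-1}$), and $\Sigma$ is the shift functor; a module is viewed in $\mathcal{D}^b$ as a complex in degree $0$. $U_i$ is the $i$-th Chebyshev polynomial of the second kind, $U_i(\cos\theta)\sin\theta=\sin((i+1)\theta)$. $R=\mathbb{Z}[2\cos\frac{\pi}{2n}]\subset\mathbb{R}$ with field of fractions $\operatorname{Frac}(R)$. Weighted foldings. $Q^{I_2(2n)}$ has two vertices and one arrow $[0]\to[1]$ (of weight $2\cos\frac{\pi}{2n}$). In every case below $F$ maps each source of $Q^\Delta$ to $[0]$ and each sink to $[1]$; $\kappa\colon Q^\Delta_0\to R_{>0}$ and $\varsigma\colon\{[0],[1]\}\to R_{>0}$ are the vertex weights. - $\Delta=A_{2n-1}$ ($n\ge 2$): vertices $0,1,\dots,2n-2$, one arrow between $i$ and $i+1$ for each $i$, directed from the even to the odd vertex; $\kappa(i)=U_i(\cos\frac{\pi}{2n})$; $\varsigma([0])=1$, $\varsigma([1])=2\cos\frac{\pi}{2n}$. - $\Delta=D_{n+1}$ ($n\geq 3$): vertices $0,1,\dots,n-2,(n-1)^+,(n-1)^-$; edges $i - (i+1)$ for $0\le i\le n-3$ and $(n-2)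 - (n-1)^{\pm}$, each directed from the even to the odd vertex ($(n-1)^\pm$ has the parity of $n-1$); $\kappa(i)=2U_i(\cos\frac{\pi}{2n})$ for $0\le i\le n-2$, $\kappa((n-1)^{\pm})=U_{n-1}(\cos\frac{\pi}{2n})$; $\varsigma([0])=2$, $\varsigma([1])=4\cos\frac{\pi}{2n}$. - $\Delta=E_6$ ($n=6$): arrows $0^+\to1^+$, $0^-\to 1^-$, $2\to1^+$, $2\to1^-$, $2\to v_6$; $\kappa(i^{\pm})=U_i(\cos\frac{\pi}{12})$, $\kappa(2)=U_2(\cos\frac{\pi}{12})$, $\kappa(v_6)=\sqrt2$. - $\Delta=E_7$ ($n=9$): arrows $0\to1$, $2\to1$, $2\to3$, $\widetilde1\to3$, $\widetilde2\to3$, $\widetilde2\to v_7$; $\kappa(i)=U_i(\cos\frac{\pi}{18})$, $\kappa(\widetilde i)=U_i(\cos\frac{\pi}{9})$, $\kappa(v_7)=2\cos\frac{5\pi}{18}$. - $\Delta=E_8$ ($n=15$): arrows $0\to1$, $2\to1$, $2\to3$, $4\to3$, $4\to v_8$, $4\to\phi_1$, $\phi_0\to\phi_1$; $\kappa(i)=U_i(\cos\frac{\pi}{30})$, $\kappa(\phi_i)=\varphi U_i(\cos\frac{\pi}{30})$, $\kappa(v_8)=\varphi^{-1}U_3(\cos\frac{\pi}{30})$, with $\varphi=2\cos\frac{\pi}{5}$. For $E_6,E_7,E_8$: $\varsigma([0])=1$, $\varsigma([1])=2\cos\frac{\pi}{2n}$. The weight of $i\in Q_0^\Delta$ is $\varepsilon_i=\kappa(i)/\varsigma(F(i))\in\operatorname{Frac}(R)$.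 Root system. Put $\lambda=\varsigma([0])$, so $\varsigma([1])=2\lambda\cos\frac{\pi}{2n}$. The (standard) root system of $I_2(2n)$ in $\mathbb{C}=\mathbb{R}^2$ consists of the short roots $\lambda\exp(\frac{k\pi \mathrm{i}}{n})$ and the long roots $2\lambda\cos(\frac{\pi}{2n})\exp(\frac{(2k+1)\pi \mathrm{i}}{2n})$, $k\in\mathbb{Z}$; those with $0\le k\le n-1$ are positive. The simple roots are $\lambda$ (short) and $2\lambda\cos(\frac{\pi}{2n})\exp(\frac{(2n-1)\pi \mathrm{i}}{2n})$ (long). A vector $(a,b)\in\operatorname{Frac}(R)^2$ is identified with the point $a\lambda+b\cdot2\lambda\cos(\frac{\pi}{2n})\exp(\frac{(2n-1)\pi \mathrm{i}}{2n})$, i.e. coordinates are taken with respect to the simple roots. Projection. $d_F\colon\mathbb{Z}^{Q_0^\Delta}\to\operatorname{Frac}(R)^2$ is $d_F((u_i)_i)=\left(\sum_{F(i)=[0]}\frac{\kappa(i)}{\varsigma([0])}u_i,\ \sum_{F(i)=[1]}\frac{\kappa(i)}{\varsigma([1])}u_i\right)$. For a module $M$, $\delta_F^{\operatorname{mod}KQ^\Delta}(M)=d_F(\underline{\dim}M)$. For $X=\bigoplus_j\Sigma^jM_j\in\mathcal{D}^b(\operatorname{mod}KQ^\Delta)$ with $M_j$ modules, $\delta_F^{\mathcal{D}^b}(X)=\sum_{j\text{ even}}\delta_F^{\operatorname{mod}}(M_j)-\sum_{j\text{ odd}}\delta_F^{\operatorname{mod}}(M_j)$. *)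

theory Defs
  imports
    "HOL-Library.Function_Algebras"
    "HOL-Analysis.Product_Vector"
    "HOL-Computational_Algebra.Polynomial"
begin

section \<open>Algebras and finitely generated right modules\<close>

text \<open>
  Algebras and modules are subspaces, with an explicit scalar multiplication, of an ambient
  type that is an abelian group. Existential and universal quantification over modules is
  over modules whose elements lie in \<^typ>\<open>nat \<Rightarrow> 'k\<close>; every finite-dimensional module is
  isomorphic to one of these. Other ambient types only arise from constructions such as duals.
\<close>

record ('k, 'a) alg =
  acar :: "'a set"
  ascl :: "'k \<Rightarrow> 'a \<Rightarrow> 'a"
  amul :: "'a \<Rightarrow> 'a \<Rightarrow> 'a"
  aone :: 'a

record ('k, 'a, 'v) rmod =
  mcar :: "'v set"
  mscl :: "'k \<Rightarrow> 'v \<Rightarrow> 'v"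
  mact :: "'v \<Rightarrow> 'a \<Rightarrow> 'v"

type_synonym ('k, 'a) umod = "('k, 'a, nat \<Rightarrow> 'k) rmod"

definition op_alg :: "('k, 'a) alg \<Rightarrow> ('k, 'a) alg" where
  "op_alg A = A\<lparr>amul := \<lambda>a b. amul A b a\<rparr>"

definition is_rmod ::
    "('k::field, 'a::ab_group_add) alg \<Rightarrow> ('k, 'a, 'v::ab_group_add) rmod \<Rightarrow> bool" where
  "is_rmod A M \<longleftrightarrow>
     vector_space (mscl M) \<and> module.subspace (mscl M) (mcar M) \<and>
     (\<forall>v\<in>mcar M. \<forall>a\<in>acar A. mact M v a \<in> mcar M) \<and>
     (\<forall>v\<in>mcar M. \<forall>w\<in>mcar M. \<forall>a\<in>acar A. mact M (v + w) a = mact M v a + mact M w a) \<and>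
     (\<forall>v\<in>mcar M. \<forall>a\<in>acar A. \<forall>b\<in>acar A. mact M v (a + b) = mact M v a + mact M v b) \<and>
     (\<forall>c. \<forall>v\<in>mcar M. \<forall>a\<in>acar A. mact M (mscl M c v) a = mscl M c (mact M v a)) \<and>
     (\<forall>c. \<forall>v\<in>mcar M. \<forall>a\<in>acar A. mact M v (ascl A c a) = mscl M c (mact M v a)) \<and>
     (\<forall>v\<in>mcar M. mact M v (aone A) = v) \<and>
     (\<forall>v\<in>mcar M. \<forall>a\<in>acar A. \<forall>b\<in>acar A. mact M v (amul A a b) = mact M (mact M v a) b)"

definition fg_mod ::
    "('k::field, 'a::ab_group_add) alg \<Rightarrow> ('k, 'a, 'v::ab_group_add) rmod \<Rightarrow> bool" where
  "fg_mod A M \<longleftrightarrow> is_rmod A M \<and>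
     (\<exists>S. finite S \<and> S \<subseteq> mcar M \<and>
        (\<forall>v\<in>mcar M. \<exists>c. (\<forall>s\<in>S. c s \<in> acar A) \<and> v = (\<Sum>s\<in>S. mact M s (c s))))"

text \<open>
  Homomorphisms are normalised to be zero outside the carrier of the domain, so that equality
  of homomorphisms is equality of functions; likewise for functionals below.
\<close>

definition hom_mod ::
    "('k, 'a) alg \<Rightarrow> ('k, 'a, 'v::ab_group_add) rmod \<Rightarrow> ('k, 'a, 'w::ab_group_add) rmod \<Rightarrow>
     ('v \<Rightarrow> 'w) set" where
  "hom_mod A M N = {h.
     (\<forall>v. v \<notin> mcar M \<longrightarrow> h v = 0) \<and>
     (\<forall>v\<in>mcar M. h v \<in> mcar N) \<and>
     (\<forall>v\<in>mcar M. \<forall>w\<in>mcar M. h (v + w) = h v + h w) \<and>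
     (\<forall>c. \<forall>v\<in>mcar M. h (mscl M c v) = mscl N c (h v)) \<and>
     (\<forall>v\<in>mcar M. \<forall>a\<in>acar A. h (mact M v a) = mact N (h v) a)}"

definition iso_mod ::
    "('k, 'a) alg \<Rightarrow> ('k, 'a, 'v::ab_group_add) rmod \<Rightarrow> ('k, 'a, 'w::ab_group_add) rmod \<Rightarrow>
     bool" where
  "iso_mod A M N \<longleftrightarrow> (\<exists>h\<in>hom_mod A M N. bij_betw h (mcar M) (mcar N))"

definition ker_mod ::
    "('k, 'a, 'v) rmod \<Rightarrow> ('v \<Rightarrow> 'w::zero) \<Rightarrow> ('k, 'a, 'v) rmod" where
  "ker_mod M h = M\<lparr>mcar := {v \<in> mcar M. h v = 0}\<rparr>"

text \<open>
  The \<open>K\<close>-dual \<open>DM\<close> of a right \<open>A\<close>-module: a left \<open>A\<close>-module, i.e. a right module over the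
  opposite algebra.
\<close>

definition dual_mod ::
    "('k::field, 'a, 'v::ab_group_add) rmod \<Rightarrow> ('k, 'a, 'v \<Rightarrow> 'k) rmod" where
  "dual_mod M = \<lparr>
     mcar = {\<phi>. (\<forall>v. v \<notin> mcar M \<longrightarrow> \<phi> v = 0) \<and>
                (\<forall>v\<in>mcar M. \<forall>w\<in>mcar M. \<phi> (v + w) = \<phi> v + \<phi> w) \<and>
                (\<forall>c. \<forall>v\<in>mcar M. \<phi> (mscl M c v) = c * \<phi> v)},
     mscl = (\<lambda>c \<phi> v. c * \<phi> v),
     mact = (\<lambda>\<phi> a v. if v \<in> mcar M then \<phi> (mact M v a) else 0)\<rparr>"

text \<open>The regular right module and the left \<open>A\<close>-module \<open>Hom\<^sub>A(M,A)\<close>.\<close>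

definition reg_mod :: "('k, 'a) alg \<Rightarrow> ('k, 'a, 'a) rmod" where
  "reg_mod A = \<lparr>mcar = acar A, mscl = ascl A, mact = amul A\<rparr>"

definition hom_reg ::
    "('k, 'a::ab_group_add) alg \<Rightarrow> ('k, 'a, 'v::ab_group_add) rmod \<Rightarrow>
     ('k, 'a, 'v \<Rightarrow> 'a) rmod" where
  "hom_reg A M = \<lparr>
     mcar = hom_mod A M (reg_mod A),
     mscl = (\<lambda>c h v. ascl A c (h v)),
     mact = (\<lambda>h a v. amul A a (h v))\<rparr>"

text \<open>The Nakayama functor \<open>\<nu> = D Hom\<^sub>A(-,A)\<close> on objects and on \<open>f : M \<rightarrow> N\<close>;
  its values are again right \<open>A\<close>-modules.\<close>

definition nak ::
    "('k::field, 'a::ab_group_add) alg \<Rightarrow> ('k, 'a, 'v::ab_group_add) rmod \<Rightarrow>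
     ('k, 'a, ('v \<Rightarrow> 'a) \<Rightarrow> 'k) rmod" where
  "nak A M = dual_mod (hom_reg A M)"

definition nak_map ::
    "('k::field, 'a::ab_group_add) alg \<Rightarrow> ('k, 'a, 'v::ab_group_add) rmod \<Rightarrow>
     ('k, 'a, 'w::ab_group_add) rmod \<Rightarrow> ('v \<Rightarrow> 'w) \<Rightarrow>
     (('v \<Rightarrow> 'a) \<Rightarrow> 'k) \<Rightarrow> (('w \<Rightarrow> 'a) \<Rightarrow> 'k)" where
  "nak_map A M N f = (\<lambda>\<phi> h.
     if \<phi> \<in> mcar (nak A M) \<and> h \<in> mcar (hom_reg A N)
     then \<phi> (\<lambda>v. if v \<in> mcar M then h (f v) else 0) else 0)"


section \<open>The Auslander--Reiten translate of the module category\<close>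

definition projective_mod ::
    "('k::field, 'a::ab_group_add) alg \<Rightarrow> ('k, 'a, 'v::ab_group_add) rmod \<Rightarrow> bool" where
  "projective_mod A P \<longleftrightarrow> fg_mod A P \<and>
     (\<forall>(X :: ('k, 'a) umod) (Y :: ('k, 'a) umod) g f.
        fg_mod A X \<and> fg_mod A Y \<and> g \<in> hom_mod A X Y \<and> g ` mcar X = mcar Y \<and>
        f \<in> hom_mod A P Y \<longrightarrow>
        (\<exists>h\<in>hom_mod A P X. \<forall>v\<in>mcar P. g (h v) = f v))"

definition submod_set ::
    "('k::field, 'a) alg \<Rightarrow> ('k, 'a, 'v::ab_group_add) rmod \<Rightarrow> 'v set \<Rightarrow> bool" where
  "submod_set A M L \<longleftrightarrow> L \<subseteq> mcar M \<and> module.subspace (mscl M) L \<and>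
     (\<forall>v\<in>L. \<forall>a\<in>acar A. mact M v a \<in> L)"

definition superfluous ::
    "('k::field, 'a) alg \<Rightarrow> ('k, 'a, 'v::ab_group_add) rmod \<Rightarrow> 'v set \<Rightarrow> bool" where
  "superfluous A M N \<longleftrightarrow> submod_set A M N \<and>
     (\<forall>L. submod_set A M L \<and> {l + v | l v. l \<in> L \<and> v \<in> N} = mcar M \<longrightarrow> L = mcar M)"

text \<open>
  \<open>P1 \<rightarrow> P0 \<rightarrow> M \<rightarrow> 0\<close> exact, where \<open>p : P0 \<rightarrow> M\<close> and \<open>f : P1 \<rightarrow> Ker p\<close> are projective covers.
\<close>

definition min_proj_pres ::
    "('k::field, 'a::ab_group_add) alg \<Rightarrow> ('k, 'a, 'u::ab_group_add) rmod \<Rightarrow> ('u \<Rightarrow> 'v) \<Rightarrow>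
     ('k, 'a, 'v::ab_group_add) rmod \<Rightarrow> ('v \<Rightarrow> 'w) \<Rightarrow>
     ('k, 'a, 'w::ab_group_add) rmod \<Rightarrow> bool" where
  "min_proj_pres A P1 f P0 p M \<longleftrightarrow>
     projective_mod A P1 \<and> projective_mod A P0 \<and>
     f \<in> hom_mod A P1 P0 \<and> p \<in> hom_mod A P0 M \<and>
     p ` mcar P0 = mcar M \<and> f ` mcar P1 = {v \<in> mcar P0. p v = 0} \<and>
     superfluous A P0 {v \<in> mcar P0. p v = 0} \<and> superfluous A P1 {v \<in> mcar P1. f v = 0}"

text \<open>
  \<open>\<tau>\<close> is only determined up to isomorphism, so it is a relation: \<open>tau_mod A M N\<close> says
  \<open>N \<cong> \<tau> M = D Tr M\<close>. Since \<open>Tr M\<close> is the cokernel of \<open>Hom\<^sub>A(f,A)\<close> for a minimal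
  presentation \<open>f : P1 \<rightarrow> P0\<close>, its dual is the kernel of \<open>\<nu> f : \<nu> P1 \<rightarrow> \<nu> P0\<close>.
\<close>

definition tau_mod ::
    "('k::field, 'a::ab_group_add) alg \<Rightarrow> ('k, 'a, 'v::ab_group_add) rmod \<Rightarrow>
     ('k, 'a, 'w::ab_group_add) rmod \<Rightarrow> bool" where
  "tau_mod A M N \<longleftrightarrow> fg_mod A M \<and> fg_mod A N \<and>
     (\<exists>(P1 :: ('k, 'a) umod) (P0 :: ('k, 'a) umod) f p.
        min_proj_pres A P1 f P0 p M \<and>
        iso_mod A N (ker_mod (nak A P1) (nak_map A P1 P0 f)))"

text \<open>\<open>N \<cong> \<tau>\<^sup>-M = Tr D M\<close>, expressed after applying \<open>D\<close>: \<open>D N \<cong> (D Tr) (D M)\<close> as left modules.\<close>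

definition tau_inv_mod ::
    "('k::field, 'a::ab_group_add) alg \<Rightarrow> ('k, 'a, 'v::ab_group_add) rmod \<Rightarrow>
     ('k, 'a, 'w::ab_group_add) rmod \<Rightarrow> bool" where
  "tau_inv_mod A M N \<longleftrightarrow> fg_mod A M \<and> fg_mod A N \<and>
     tau_mod (op_alg A) (dual_mod M) (dual_mod N)"

text \<open>\<open>tau_pow_mod A m M N\<close> says \<open>N \<cong> \<tau>\<^sup>m M\<close>.\<close>

definition tau_pow_mod ::
    "('k::field, 'a::ab_group_add) alg \<Rightarrow> int \<Rightarrow> ('k, 'a, 'v::ab_group_add) rmod \<Rightarrow>
     ('k, 'a) umod \<Rightarrow> bool" where
  "tau_pow_mod A m M N \<longleftrightarrow> (\<exists>X :: ('k, 'a) umod.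
     fg_mod A M \<and> fg_mod A X \<and> iso_mod A X M \<and>
     (if m \<ge> 0 then (tau_mod A ^^ nat m) X N else (tau_inv_mod A ^^ nat (- m)) X N))"


section \<open>The bounded derived category and its Auslander--Reiten translate\<close>

text \<open>Cochain complexes; \<open>cdif C j\<close> is the differential from degree \<open>j\<close> to degree \<open>j + 1\<close>.\<close>

record ('k, 'a, 'v) cpx =
  cobj :: "int \<Rightarrow> ('k, 'a, 'v) rmod"
  cdif :: "int \<Rightarrow> 'v \<Rightarrow> 'v"

type_synonym ('k, 'a) ucpx = "('k, 'a, nat \<Rightarrow> 'k) cpx"

definition bounded_cpx ::
    "('k::field, 'a::ab_group_add) alg \<Rightarrow> ('k, 'a, 'v::ab_group_add) cpx \<Rightarrow> bool" where
  "bounded_cpx A C \<longleftrightarrow>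
     (\<forall>j. fg_mod A (cobj C j)) \<and>
     (\<forall>j. cdif C j \<in> hom_mod A (cobj C j) (cobj C (j + 1))) \<and>
     (\<forall>j. \<forall>v\<in>mcar (cobj C j). cdif C (j + 1) (cdif C j v) = 0) \<and>
     finite {j. mcar (cobj C j) \<noteq> {0}}"

definition chain_map ::
    "('k, 'a) alg \<Rightarrow> ('k, 'a, 'v::ab_group_add) cpx \<Rightarrow> ('k, 'a, 'w::ab_group_add) cpx \<Rightarrow>
     (int \<Rightarrow> 'v \<Rightarrow> 'w) \<Rightarrow> bool" where
  "chain_map A C D f \<longleftrightarrow>
     (\<forall>j. f j \<in> hom_mod A (cobj C j) (cobj D j)) \<and>
     (\<forall>j. \<forall>v\<in>mcar (cobj C j). f (j + 1) (cdif C j v) = cdif D j (f j v))"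

definition cocycles :: "('k, 'a, 'v::ab_group_add) cpx \<Rightarrow> int \<Rightarrow> 'v set" where
  "cocycles C j = {v \<in> mcar (cobj C j). cdif C j v = 0}"

definition coboundaries :: "('k, 'a, 'v::ab_group_add) cpx \<Rightarrow> int \<Rightarrow> 'v set" where
  "coboundaries C j = cdif C (j - 1) ` mcar (cobj C (j - 1))"

text \<open>The two conditions: the map induced on \<open>H\<^sup>j\<close> is injective, resp. surjective.\<close>

definition quasi_iso ::
    "('k, 'a) alg \<Rightarrow> ('k, 'a, 'v::ab_group_add) cpx \<Rightarrow> ('k, 'a, 'w::ab_group_add) cpx \<Rightarrow>
     (int \<Rightarrow> 'v \<Rightarrow> 'w) \<Rightarrow> bool" where
  "quasi_iso A C D f \<longleftrightarrow> chain_map A C D f \<and>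
     (\<forall>j. (\<forall>v\<in>cocycles C j. f j v \<in> coboundaries D j \<longrightarrow> v \<in> coboundaries C j) \<and>
          (\<forall>w\<in>cocycles D j. \<exists>v\<in>cocycles C j. w - f j v \<in> coboundaries D j))"

text \<open>
  Isomorphism in \<open>\<D>\<^sup>b\<close>: an isomorphism of the localisation at quasi-isomorphisms is
  represented by a roof both of whose legs are quasi-isomorphisms.
\<close>

definition Db_iso ::
    "('k::field, 'a::ab_group_add) alg \<Rightarrow> ('k, 'a, 'v::ab_group_add) cpx \<Rightarrow>
     ('k, 'a, 'w::ab_group_add) cpx \<Rightarrow> bool" where
  "Db_iso A C D \<longleftrightarrow> bounded_cpx A C \<and> bounded_cpx A D \<and>
     (\<exists>(Z :: ('k, 'a) ucpx) f g. bounded_cpx A Z \<and> quasi_iso A Z C f \<and> quasi_iso A Z D g)"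

text \<open>The power \<open>\<Sigma>\<^sup>k\<close> of the shift functor.\<close>

definition shift_cpx :: "int \<Rightarrow> ('k, 'a, 'v::ab_group_add) cpx \<Rightarrow> ('k, 'a, 'v) cpx" where
  "shift_cpx k C = \<lparr>
     cobj = (\<lambda>j. cobj C (j + k)),
     cdif = (\<lambda>j v. if even k then cdif C (j + k) v else - cdif C (j + k) v)\<rparr>"

definition nak_cpx ::
    "('k::field, 'a::ab_group_add) alg \<Rightarrow> ('k, 'a, 'v::ab_group_add) cpx \<Rightarrow>
     ('k, 'a, ('v \<Rightarrow> 'a) \<Rightarrow> 'k) cpx" where
  "nak_cpx A C = \<lparr>
     cobj = (\<lambda>j. nak A (cobj C j)),
     cdif = (\<lambda>j. nak_map A (cobj C j) (cobj C (j + 1)) (cdif C j))\<rparr>"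

definition stalk_cpx :: "('k, 'a, 'v::ab_group_add) rmod \<Rightarrow> ('k, 'a, 'v) cpx" where
  "stalk_cpx M = \<lparr>cobj = (\<lambda>j. if j = 0 then M else M\<lparr>mcar := {0}\<rparr>), cdif = (\<lambda>j v. 0)\<rparr>"

text \<open>\<open>\<Oplus>\<^sub>j \<Sigma>\<^sup>j M\<^sub>j\<close>: the module \<open>M\<^sub>j\<close> sits in cohomological degree \<open>-j\<close>.\<close>

definition shift_sum_cpx ::
    "(int \<Rightarrow> ('k, 'a, 'v::ab_group_add) rmod) \<Rightarrow> ('k, 'a, 'v) cpx" where
  "shift_sum_cpx M = \<lparr>cobj = (\<lambda>j. M (- j)), cdif = (\<lambda>j v. 0)\<rparr>"

text \<open>
  \<open>Y \<cong> \<tau> X\<close> in \<open>\<D>\<^sup>b\<close>, where \<open>\<tau> = \<Sigma>\<^sup>-\<^sup>1 \<nu>\<close> for the Serre functor \<open>\<nu>\<close>, which is the derived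
  Nakayama functor: \<open>\<nu> X\<close> is computed termwise on a bounded complex of projectives
  isomorphic to \<open>X\<close>. Such a complex exists when the algebra has finite global dimension.
\<close>

definition tau_Db ::
    "('k::field, 'a::ab_group_add) alg \<Rightarrow> ('k, 'a, 'v::ab_group_add) cpx \<Rightarrow>
     ('k, 'a, 'w::ab_group_add) cpx \<Rightarrow> bool" where
  "tau_Db A X Y \<longleftrightarrow> (\<exists>P :: ('k, 'a) ucpx.
     bounded_cpx A P \<and> (\<forall>j. projective_mod A (cobj P j)) \<and>
     Db_iso A P X \<and> Db_iso A (shift_cpx (- 1) (nak_cpx A P)) Y)"

text \<open>
  \<open>tau_pow_Db A m X Y\<close> says \<open>Y \<cong> \<tau>\<^sup>m X\<close>. As \<open>\<tau>\<close> is an autoequivalence here, \<open>\<tau>\<^sup>-\<^sup>1\<close> is the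
  converse relation.
\<close>

definition tau_pow_Db ::
    "('k::field, 'a::ab_group_add) alg \<Rightarrow> int \<Rightarrow> ('k, 'a, 'v::ab_group_add) cpx \<Rightarrow>
     ('k, 'a) ucpx \<Rightarrow> bool" where
  "tau_pow_Db A m X Y \<longleftrightarrow> (\<exists>X' :: ('k, 'a) ucpx. Db_iso A X' X \<and>
     (if m \<ge> 0 then (tau_Db A ^^ nat m) X' Y else ((tau_Db A)\<inverse>\<inverse> ^^ nat (- m)) X' Y))"


section \<open>Path algebras\<close>

text \<open>Quivers without parallel arrows, so that a path is its nonempty list of vertices.\<close>

record 'q quiver =
  qverts :: "'q set"
  qarrows :: "('q \<times> 'q) set"

definition is_path :: "'q quiver \<Rightarrow> 'q list \<Rightarrow> bool" where
  "is_path Q p \<longleftrightarrow> p \<noteq> [] \<and> set p \<subseteq> qverts Q \<and> successively (\<lambda>x y. (x, y) \<in> qarrows Q) p"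

text \<open>
  Elements of \<open>KQ\<close> are coefficient functions on paths. The product reads paths from left to
  right: the coefficient at \<open>p\<close> sums over the ways to cut \<open>p\<close> at one of its vertices into
  an initial and a final piece sharing that vertex.
\<close>

definition path_alg :: "'q quiver \<Rightarrow> ('k::field, 'q list \<Rightarrow> 'k) alg" where
  "path_alg Q = \<lparr>
     acar = {f. finite {p. f p \<noteq> 0} \<and> (\<forall>p. f p \<noteq> 0 \<longrightarrow> is_path Q p)},
     ascl = (\<lambda>c f p. c * f p),
     amul = (\<lambda>f g p. \<Sum>k<length p. f (take (Suc k) p) * g (drop k p)),
     aone = (\<lambda>p. if \<exists>i\<in>qverts Q. p = [i] then 1 else 0)\<rparr>"

definition idem :: "'q \<Rightarrow> 'q list \<Rightarrow> 'k::field" where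
  "idem i = (\<lambda>p. if p = [i] then 1 else 0)"

definition principal_mod :: "('k, 'a) alg \<Rightarrow> 'a \<Rightarrow> ('k, 'a, 'a) rmod" where
  "principal_mod A e = (reg_mod A)\<lparr>mcar := {amul A e a | a. a \<in> acar A}\<rparr>"

text \<open>\<open>I(i) = D(KQ e\<^sub>i)\<close>; the left ideal \<open>KQ e\<^sub>i\<close> is a principal right ideal over the opposite
  algebra.\<close>

definition I_mod ::
    "'q quiver \<Rightarrow> 'q \<Rightarrow> ('k::field, 'q list \<Rightarrow> 'k, ('q list \<Rightarrow> 'k) \<Rightarrow> 'k) rmod" where
  "I_mod Q i = dual_mod (principal_mod (op_alg (path_alg Q)) (idem i))"

definition dimvec :: "('k::field, 'q list \<Rightarrow> 'k, 'v::ab_group_add) rmod \<Rightarrow> 'q \<Rightarrow> int" where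
  "dimvec M i = int (vector_space.dim (mscl M) ((\<lambda>v. mact M v (idem i)) ` mcar M))"


section \<open>The weighted foldings onto \<open>I\<^sub>2(2n)\<close>\<close>

text \<open>\<open>FA n\<close>, \<open>FD n\<close> are the foldings of \<open>A\<^bsub>2n-1\<^esub>\<close> and \<open>D\<^bsub>n+1\<^esub>\<close>.\<close>

datatype folding = FA nat | FD nat | FE6 | FE7 | FE8

fun admissible :: "folding \<Rightarrow> bool" where
  "admissible (FA n) \<longleftrightarrow> n \<ge> 2"
| "admissible (FD n) \<longleftrightarrow> n \<ge> 3"
| "admissible _ \<longleftrightarrow> True"

fun fold_n :: "folding \<Rightarrow> nat" where
  "fold_n (FA n) = n"
| "fold_n (FD n) = n"
| "fold_n FE6 = 6"
| "fold_n FE7 = 9"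
| "fold_n FE8 = 15"

text \<open>
  \<open>Std i\<close>, \<open>Plus i\<close>, \<open>Minus i\<close>, \<open>Tilde i\<close>, \<open>Phi i\<close> are the vertices written \<open>i\<close>, \<open>i\<^sup>+\<close>, \<open>i\<^sup>-\<close>,
  \<open>i\<close> with a tilde, and \<open>\<phi>\<^sub>i\<close>; \<open>Exc\<close> is the exceptional vertex \<open>v\<^sub>6\<close>, \<open>v\<^sub>7\<close> or \<open>v\<^sub>8\<close>.
\<close>

datatype vertex = Std nat | Plus nat | Minus nat | Tilde nat | Phi nat | Exc

fun quiver_A :: "nat \<Rightarrow> vertex quiver" where
  "quiver_A n = \<lparr>
     qverts = Std ` {0..2 * n - 2},
     qarrows = {(Std i, Std j) | i j.
       i \<le> 2 * n - 2 \<and> j \<le> 2 * n - 2 \<and> (j = i + 1 \<or> i = j + 1) \<and> even i}\<rparr>"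

fun quiver_D :: "nat \<Rightarrow> vertex quiver" where
  "quiver_D n = \<lparr>
     qverts = Std ` {0..n - 2} \<union> {Plus (n - 1), Minus (n - 1)},
     qarrows =
       {(Std i, Std j) | i j.
          i \<le> n - 2 \<and> j \<le> n - 2 \<and> (j = i + 1 \<or> i = j + 1) \<and> even i} \<union>
       (if even (n - 2)
        then {(Std (n - 2), Plus (n - 1)), (Std (n - 2), Minus (n - 1))}
        else {(Plus (n - 1), Std (n - 2)), (Minus (n - 1), Std (n - 2))})\<rparr>"

fun fold_quiver :: "folding \<Rightarrow> vertex quiver" where
  "fold_quiver (FA n) = quiver_A n"
| "fold_quiver (FD n) = quiver_D n"
| "fold_quiver FE6 = \<lparr>
     qverts = {Plus 0, Minus 0, Plus 1, Minus 1, Std 2, Exc},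
     qarrows = {(Plus 0, Plus 1), (Minus 0, Minus 1), (Std 2, Plus 1), (Std 2, Minus 1),
                (Std 2, Exc)}\<rparr>"
| "fold_quiver FE7 = \<lparr>
     qverts = {Std 0, Std 1, Std 2, Std 3, Tilde 1, Tilde 2, Exc},
     qarrows = {(Std 0, Std 1), (Std 2, Std 1), (Std 2, Std 3), (Tilde 1, Std 3),
                (Tilde 2, Std 3), (Tilde 2, Exc)}\<rparr>"
| "fold_quiver FE8 = \<lparr>
     qverts = {Std 0, Std 1, Std 2, Std 3, Std 4, Exc, Phi 0, Phi 1},
     qarrows = {(Std 0, Std 1), (Std 2, Std 1), (Std 2, Std 3), (Std 4, Std 3),
                (Std 4, Exc), (Std 4, Phi 1), (Phi 0, Phi 1)}\<rparr>"

text \<open>The two vertices \<open>[0]\<close> and \<open>[1]\<close> of the quiver of \<open>I\<^sub>2(2n)\<close>.\<close>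

datatype I2_vertex = V0 | V1

text \<open>Every vertex of these quivers is either a source or a sink, and not both.\<close>

definition fold_map :: "folding \<Rightarrow> vertex \<Rightarrow> I2_vertex" where
  "fold_map \<Delta> i = (if \<exists>j. (j, i) \<in> qarrows (fold_quiver \<Delta>) then V1 else V0)"

fun chebU :: "nat \<Rightarrow> real \<Rightarrow> real" where
  "chebU 0 x = 1"
| "chebU (Suc 0) x = 2 * x"
| "chebU (Suc (Suc i)) x = 2 * x * chebU (Suc i) x - chebU i x"

lemma chebU_cos: "chebU i (cos t) * sin t = sin (real (i + 1) * t)"
proof (induction i "cos t" rule: chebU.induct)
  case (3 i)
  have "sin (real (i + 2) * t + t) + sin (real (i + 2) * t - t)
      = 2 * cos t * sin (real (i + 2) * t)"
    by (simp add: sin_add sin_diff)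
  moreover have "real (i + 2) * t + t = real (Suc (Suc i) + 1) * t"
    "real (i + 2) * t - t = real (i + 1) * t"
    by (simp_all add: algebra_simps)
  ultimately have "sin (real (Suc (Suc i) + 1) * t) + sin (real (i + 1) * t)
      = 2 * cos t * sin (real (Suc i + 1) * t)"
    by (simp add: add.commute)
  then show ?case
    using 3 by (simp add: algebra_simps)
qed (simp_all add: sin_double)

definition golden :: real where
  "golden = 2 * cos (pi / 5)"

fun kappa :: "folding \<Rightarrow> vertex \<Rightarrow> real" where
  "kappa (FA n) x = (case x of Std i \<Rightarrow> chebU i (cos (pi / (2 * n))) | _ \<Rightarrow> 0)"
| "kappa (FD n) x = (case x of
       Std i \<Rightarrow> 2 * chebU i (cos (pi / (2 * n)))
     | Plus i \<Rightarrow> chebU i (cos (pi / (2 * n)))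
     | Minus i \<Rightarrow> chebU i (cos (pi / (2 * n)))
     | _ \<Rightarrow> 0)"
| "kappa FE6 x = (case x of
       Std i \<Rightarrow> chebU i (cos (pi / 12))
     | Plus i \<Rightarrow> chebU i (cos (pi / 12))
     | Minus i \<Rightarrow> chebU i (cos (pi / 12))
     | Exc \<Rightarrow> sqrt 2
     | _ \<Rightarrow> 0)"
| "kappa FE7 x = (case x of
       Std i \<Rightarrow> chebU i (cos (pi / 18))
     | Tilde i \<Rightarrow> chebU i (cos (pi / 9))
     | Exc \<Rightarrow> 2 * cos (5 * pi / 18)
     | _ \<Rightarrow> 0)"
| "kappa FE8 x = (case x of
       Std i \<Rightarrow> chebU i (cos (pi / 30))
     | Phi i \<Rightarrow> golden * chebU i (cos (pi / 30))
     | Exc \<Rightarrow> inverse golden * chebU 3 (cos (pi / 30))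
     | _ \<Rightarrow> 0)"

fun sigma :: "folding \<Rightarrow> I2_vertex \<Rightarrow> real" where
  "sigma (FD n) V0 = 2"
| "sigma (FD n) V1 = 4 * cos (pi / (2 * n))"
| "sigma \<Delta> V0 = 1"
| "sigma \<Delta> V1 = 2 * cos (pi / (2 * fold_n \<Delta>))"

definition weight :: "folding \<Rightarrow> vertex \<Rightarrow> real" where
  "weight \<Delta> i = kappa \<Delta> i / sigma \<Delta> (fold_map \<Delta> i)"


section \<open>The root system and the projections\<close>

text \<open>
  The point of the plane with the given coordinates with respect to the simple roots, and the
  inverse identification.
\<close>

definition root_point :: "folding \<Rightarrow> real \<times> real \<Rightarrow> complex" where
  "root_point \<Delta> v = (let l = sigma \<Delta> V0; n = fold_n \<Delta> in
     of_real (fst v) * of_real l +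
     of_real (snd v) * (of_real (2 * l * cos (pi / (2 * n))) *
       exp (of_real (real (2 * n - 1) * pi / (2 * n)) * \<i>)))"

definition root_coords :: "folding \<Rightarrow> complex \<Rightarrow> real \<times> real" where
  "root_coords \<Delta> z = (THE v. root_point \<Delta> v = z)"

definition short_roots :: "folding \<Rightarrow> complex set" where
  "short_roots \<Delta> = (let l = sigma \<Delta> V0; n = fold_n \<Delta> in
     range (\<lambda>k::int. of_real l * exp (of_real (k * pi / n) * \<i>)))"

definition long_roots :: "folding \<Rightarrow> complex set" where
  "long_roots \<Delta> = (let l = sigma \<Delta> V0; n = fold_n \<Delta> in
     range (\<lambda>k::int. of_real (2 * l * cos (pi / (2 * n))) *
       exp (of_real ((2 * k + 1) * pi / (2 * n)) * \<i>)))"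

definition d_F :: "folding \<Rightarrow> (vertex \<Rightarrow> int) \<Rightarrow> real \<times> real" where
  "d_F \<Delta> u =
     ((\<Sum>i | i \<in> qverts (fold_quiver \<Delta>) \<and> fold_map \<Delta> i = V0.
         kappa \<Delta> i / sigma \<Delta> V0 * of_int (u i)),
      (\<Sum>i | i \<in> qverts (fold_quiver \<Delta>) \<and> fold_map \<Delta> i = V1.
         kappa \<Delta> i / sigma \<Delta> V1 * of_int (u i)))"

definition delta_mod ::
    "folding \<Rightarrow> ('k::field, vertex list \<Rightarrow> 'k, 'v::ab_group_add) rmod \<Rightarrow> real \<times> real" where
  "delta_mod \<Delta> M = d_F \<Delta> (dimvec M)"

text \<open>The value at \<open>\<Oplus>\<^sub>j \<Sigma>\<^sup>j M\<^sub>j\<close>, for finitely many nonzero \<open>M\<^sub>j\<close>.\<close>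

definition delta_Db ::
    "folding \<Rightarrow> (int \<Rightarrow> ('k::field, vertex list \<Rightarrow> 'k, 'v::ab_group_add) rmod) \<Rightarrow> real \<times> real"
  where
  "delta_Db \<Delta> M =
     (\<Sum>j | even j \<and> mcar (M j) \<noteq> {0}. delta_mod \<Delta> (M j)) -
     (\<Sum>j | odd j \<and> mcar (M j) \<noteq> {0}. delta_mod \<Delta> (M j))"

end

theory Submission
  imports Defs
begin

text \<open>
  All the quivers are bipartite, so a module \<open>M\<close> is a family of spaces \<open>M\<^sub>s\<close> (sources) and \<open>M\<^sub>t\<close> (sinks)
  with a map \<open>M\<^sub>s \<rightarrow> M\<^sub>t\<close> for each arrow. Evaluating the Nakayama functor on a minimal projective
  presentation shows that \<open>N = \<tau>M\<close> is obtained from \<open>M\<close> by reflecting at all sinks and then at all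
  sources: there are left exact sequences \<open>0 \<rightarrow> N\<^sub>t \<rightarrow> \<Oplus> M\<^sub>s \<rightarrow> M\<^sub>t\<close> and \<open>0 \<rightarrow> N\<^sub>s \<rightarrow> \<Oplus> N\<^sub>t \<rightarrow> M\<^sub>s\<close>.
  If \<open>M\<close> is indecomposable and \<open>\<tau>M \<noteq> 0\<close>, the maps on the right are surjective and \<open>\<tau>M\<close> is again
  indecomposable, so along the orbit of \<open>I(i)\<close> dimension vectors are transformed by the Coxeter
  transformation. In the derived category the same transformation acts on Euler characteristics,
  because it describes the dimensions of \<open>\<nu>P\<close> for every projective \<open>P\<close>.

  The function \<open>\<kappa>\<close> is an eigenvector of the adjacency matrix for the eigenvalue \<open>2 cos (\<pi>/2n)\<close>. Hence
  \<open>d\<^sub>F\<close> carries the Coxeter transformation to the product of the two simple reflections of \<open>I\<^sub>2(2n)\<close>,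
  the rotation by \<open>\<pi>/n\<close>, and it remains to compare the values at \<open>I(i)\<close>, that is at \<open>m = 0\<close>.
\<close>

section \<open>Linear algebra on subspaces\<close>

text \<open>The orientation leaves only paths of length at most one, so all algebra reduces to
  linear algebra at the vertices and along single arrows. Projectivity is given as a lifting
  property and \<tau> through an arbitrary minimal presentation. Projectives are never classified:
  lifting against one two-dimensional module per arrow is enough, because it makes the arrows into a
  sink act injectively on the direct sum of the source components of a projective.

  Left exactness needs nothing about M. Right exactness fails only when a line in the cokernel
  splits off, as a simple projective summand at a sink or an indecomposable projective summand at a
  source. If M is indecomposable, it is then itself projective and \<tau>M = 0.

  Negative powers differ in the two settings. On modules they annihilate I(i), whose dual is
  projective, so only m \<ge> 0 occurs. In the derived category an orbit is read backwards and the
  rotation is inverted. Both settings meet in one complex-valued function of dimension vectors that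
  the Coxeter transformation multiplies by a fixed root of unity.\<close>

definition lin_on ::
    "('k::field \<Rightarrow> 'v::ab_group_add \<Rightarrow> 'v) \<Rightarrow> ('k \<Rightarrow> 'w::ab_group_add \<Rightarrow> 'w) \<Rightarrow> 'v set \<Rightarrow>
     ('v \<Rightarrow> 'w) \<Rightarrow> bool" where
  "lin_on s1 s2 V f \<longleftrightarrow>
     (\<forall>v\<in>V. \<forall>w\<in>V. f (v + w) = f v + f w) \<and> (\<forall>c. \<forall>v\<in>V. f (s1 c v) = s2 c (f v))"

text \<open>\<open>dim\<close> is 0 on infinite-dimensional spaces, so finite-dimensionality has to
  be carried along separately. It is a property of the subspace alone: ambient types such as duals
  are infinite-dimensional in general.\<close>

definition fd_space :: "('k::field \<Rightarrow> 'v::ab_group_add \<Rightarrow> 'v) \<Rightarrow> 'v set \<Rightarrow> bool" where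
  "fd_space s V \<longleftrightarrow>
     vector_space s \<and> module.subspace s V \<and> (\<exists>B. finite B \<and> V \<subseteq> module.span s B)"

lemma vector_space_mult: "vector_space ((*) :: 'k::field \<Rightarrow> 'k \<Rightarrow> 'k)"
  by unfold_locales (auto simp: algebra_simps)

lemma lin_on_subset: "lin_on s1 s2 V f \<Longrightarrow> U \<subseteq> V \<Longrightarrow> lin_on s1 s2 U f"
  unfolding lin_on_def by blast

lemma lin_on_linear: "Vector_Spaces.linear s1 s2 f \<Longrightarrow> lin_on s1 s2 V f"
  unfolding Vector_Spaces.linear_iff by (simp add: lin_on_def)

lemma lin_on_add: "lin_on s1 s2 V f \<Longrightarrow> v \<in> V \<Longrightarrow> w \<in> V \<Longrightarrow> f (v + w) = f v + f w"
  by (auto simp: lin_on_def)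

lemma lin_on_scl: "lin_on s1 s2 V f \<Longrightarrow> v \<in> V \<Longrightarrow> f (s1 c v) = s2 c (f v)"
  by (auto simp: lin_on_def)

lemma lin_on_0:
  assumes "vector_space s1" "vector_space s2" "module.subspace s1 V" "lin_on s1 s2 V f"
  shows "f 0 = 0"
proof -
  interpret vector_space_pair s1 s2 using assms by unfold_locales (auto simp: vector_space_def)
  have "f (s1 0 0) = s2 0 (f 0)"
    using assms(4) vs1.subspace_0[OF assms(3)] unfolding lin_on_def by blast
  then show ?thesis by simp
qed

lemma lin_on_sum:
  assumes "vector_space s1" "vector_space s2" "module.subspace s1 V" "lin_on s1 s2 V f"
    and "\<And>i. i \<in> I \<Longrightarrow> g i \<in> V"
  shows "f (\<Sum>i\<in>I. g i) = (\<Sum>i\<in>I. f (g i))"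
proof -
  interpret vector_space_pair s1 s2 using assms by unfold_locales (auto simp: vector_space_def)
  show ?thesis using assms(5)
  proof (induction I rule: infinite_finite_induct)
    case (insert i I)
    have "(\<Sum>i\<in>I. g i) \<in> V" using insert by (intro vs1.subspace_sum[OF assms(3)]) auto
    then show ?case using insert lin_on_add[OF assms(4)] by simp
  qed (simp_all add: lin_on_0[OF assms(1-4)])
qed

lemma fd_space_subset:
  assumes "fd_space s V" "U \<subseteq> V" "module.subspace s U"
  shows "fd_space s U"
  using assms unfolding fd_space_def by blast

text \<open>Normalised homomorphisms vanish off their carrier and are in general not linear on the
  ambient type. Replacing them by a globally linear map with the same values on V makes the theory
  of linear maps applicable.\<close>

lemma lin_on_extend:
  assumes "vector_space s1" "vector_space s2" "module.subspace s1 V" "lin_on s1 s2 V f"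
  shows "\<exists>g. Vector_Spaces.linear s1 s2 g \<and> (\<forall>v\<in>V. g v = f v)"
proof -
  interpret vector_space_pair s1 s2 using assms by unfold_locales (auto simp: vector_space_def)
  obtain B where B: "B \<subseteq> V" "vs1.independent B" "V \<subseteq> vs1.span B"
    using vs1.maximal_independent_subset by blast
  obtain g where g: "Vector_Spaces.linear s1 s2 g" "\<And>b. b \<in> B \<Longrightarrow> g b = f b"
    using linear_independent_extend[OF B(2)] by blast
  have "g v = f v \<and> v \<in> V" if "v \<in> vs1.span B" for v
    using that
  proof (induction rule: vs1.span_induct_alt)
    case base
    then show ?case
      using lin_on_0[OF assms] linear_0[OF g(1)] vs1.subspace_0[OF assms(3)] by simp
  next
    case (step c x y)
    have "s1 c x \<in> V" using step B(1) vs1.subspace_scale[OF assms(3)] by blast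
    moreover have "x \<in> V" using step B(1) by blast
    ultimately show ?case
      using step g lin_on_add[OF assms(4)] lin_on_scl[OF assms(4)] vs1.subspace_add[OF assms(3)]
      by (simp add: linear_add linear_scale)
  qed
  then show ?thesis using g(1) B(3) by blast
qed

lemma fd_space_image:
  assumes "fd_space s1 V" "vector_space s2" "lin_on s1 s2 V f"
  shows "fd_space s2 (f ` V)"
proof -
  interpret vector_space_pair s1 s2
    using assms by unfold_locales (auto simp: vector_space_def fd_space_def)
  obtain g where g: "Vector_Spaces.linear s1 s2 g" "\<And>v. v \<in> V \<Longrightarrow> g v = f v"
    using lin_on_extend[OF _ assms(2) _ assms(3)] assms(1) unfolding fd_space_def by blast
  obtain B where B: "finite B" "V \<subseteq> vs1.span B" using assms(1) unfolding fd_space_def by blast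
  have im: "f ` V = g ` V" using g(2) by force
  show ?thesis unfolding fd_space_def im
  proof (intro conjI exI[of _ "g ` B"])
    show "vs2.subspace (g ` V)"
      using linear_subspace_image[OF g(1)] assms(1) unfolding fd_space_def by blast
    show "g ` V \<subseteq> vs2.span (g ` B)" using B(2) linear_span_image[OF g(1)] by blast
  qed (use B(1) assms(2) in auto)
qed

lemma rank_nullity:
  assumes "fd_space s1 V" "vector_space s2" "lin_on s1 s2 V f"
  shows "vector_space.dim s1 V =
    vector_space.dim s2 (f ` V) + vector_space.dim s1 {v \<in> V. f v = 0}"
proof -
  interpret vector_space_pair s1 s2
    using assms by unfold_locales (auto simp: vector_space_def fd_space_def)
  have V: "vs1.subspace V" using assms(1) unfolding fd_space_def by blast
  obtain g where g: "Vector_Spaces.linear s1 s2 g" "\<And>v. v \<in> V \<Longrightarrow> g v = f v"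
    using lin_on_extend[OF _ assms(2) V assms(3)] assms(1) unfolding fd_space_def by blast
  have im: "f ` V = g ` V" using g(2) by force
  have ke: "{v \<in> V. f v = 0} = {v \<in> V. g v = 0}" using g(2) by auto
  let ?K = "{v \<in> V. g v = 0}"
  obtain B0 where B0: "B0 \<subseteq> ?K" "vs1.independent B0" "?K \<subseteq> vs1.span B0"
    using vs1.maximal_independent_subset by blast
  obtain B where B: "B0 \<subseteq> B" "B \<subseteq> V" "vs1.independent B" "V \<subseteq> vs1.span B"
    using vs1.maximal_independent_subset_extend[OF _ B0(2), of V] B0(1) by blast
  obtain W where W: "finite W" "V \<subseteq> vs1.span W" using assms(1) unfolding fd_space_def by blast
  have finB: "finite B" using vs1.independent_span_bound[OF W(1) B(3)] B(2) W(2) by blast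
  let ?C = "B - B0"
  \<comment> \<open>The coordinates of such an x with respect to B are supported both in the
    complement \<open>?C\<close> and in the basis \<open>B0\<close> of the kernel, so they all
    vanish.\<close>
  have C0: "x = 0" if "x \<in> vs1.span ?C" "g x = 0" for x
  proof -
    have xV: "x \<in> V" using that(1) vs1.span_minimal[OF _ V, of ?C] B(2) by blast
    then have x0: "x \<in> vs1.span B0" using that(2) B0(3) by blast
    have r1: "vs1.representation B x = vs1.representation ?C x"
      using vs1.representation_extend[OF B(3) that(1)] by blast
    have r2: "vs1.representation B x = vs1.representation B0 x"
      using vs1.representation_extend[OF B(3) x0] B(1) by blast
    have "vs1.representation B x b = 0" for b
      using fun_cong[OF r1, of b] fun_cong[OF r2, of b] vs1.representation_ne_zero[of ?C x b]
        vs1.representation_ne_zero[of B0 x b] by auto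
    then show ?thesis
      using vs1.sum_nonzero_representation_eq[OF B(3)] xV B(4) by fastforce
  qed
  have inj: "inj_on g (vs1.span ?C)"
  proof (rule inj_onI)
    fix x y assume *: "x \<in> vs1.span ?C" "y \<in> vs1.span ?C" "g x = g y"
    then show "x = y" using C0[of "x - y"] vs1.span_diff linear_diff[OF g(1)] by fastforce
  qed
  have indC: "vs1.independent ?C" using vs1.independent_mono[OF B(3)] by blast
  have ind: "vs2.independent (g ` ?C)"
    using linear_independent_injective_image[OF g(1) indC inj] .
  have sp: "g ` V \<subseteq> vs2.span (g ` ?C)"
  proof
    fix y assume "y \<in> g ` V"
    then obtain v where v: "v \<in> V" "y = g v" by blast
    have "v \<in> vs1.span (B0 \<union> ?C)" using v B(1,4) by (auto simp: Un_absorb1)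
    then obtain a c where ac: "v = a + c" "a \<in> vs1.span B0" "c \<in> vs1.span ?C"
      unfolding vs1.span_Un by blast
    have "g a = 0" using linear_eq_0_on_span[OF g(1) _ ac(2)] B0(1) by blast
    then have "y = g c" using v ac linear_add[OF g(1)] by simp
    then show "y \<in> vs2.span (g ` ?C)" using ac(3) linear_span_image[OF g(1)] by blast
  qed
  have "vs2.dim (g ` V) = card (g ` ?C)"
    using vs2.dim_unique[OF _ sp ind refl] B(2) by blast
  also have "\<dots> = card ?C"
    by (rule card_image) (rule inj_on_subset[OF inj vs1.span_superset])
  finally have d1: "vs2.dim (g ` V) = card ?C" .
  have d2: "vs1.dim ?K = card B0" using vs1.dim_unique[OF B0(1,3,2) refl] .
  have d3: "vs1.dim V = card B" using vs1.dim_unique[OF B(2,4,3) refl] .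
  have "card B = card ?C + card B0"
    using card_Un_disjoint[of ?C B0] finB B(1) finite_subset[OF B(1) finB] by (auto simp: Un_absorb2)
  then show ?thesis using d1 d2 d3 im ke by simp
qed

lemma dim_zero_space:
  assumes "vector_space s" shows "vector_space.dim s {0} = 0"
proof -
  interpret vector_space s by fact
  show ?thesis using dim_unique[of "{}" "{0}" 0] independent_empty by simp
qed

lemma dim_inj_image:
  assumes "fd_space s1 V" "vector_space s2" "lin_on s1 s2 V f"
    and "\<And>v. v \<in> V \<Longrightarrow> f v = 0 \<Longrightarrow> v = 0"
  shows "vector_space.dim s2 (f ` V) = vector_space.dim s1 V"
proof -
  interpret vector_space s1 using assms(1) unfolding fd_space_def by blast
  have V: "subspace V" using assms(1) unfolding fd_space_def by blast
  have "{v \<in> V. f v = 0} = {0}"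
    using assms(4) subspace_0[OF V] lin_on_0[OF vector_space_axioms assms(2) V assms(3)] by auto
  then show ?thesis
    using rank_nullity[OF assms(1-3)] dim_zero_space[OF vector_space_axioms] by simp
qed

lemma dim_one:
  assumes "vector_space s" "v \<noteq> 0" "v \<in> V" "\<And>w. w \<in> V \<Longrightarrow> \<exists>c. w = s c v"
  shows "vector_space.dim s V = 1"
proof -
  interpret vector_space s by fact
  have "V \<subseteq> span {v}" using assms(4) span_base span_scale by blast
  then show ?thesis using dim_unique[of "{v}" V 1] assms by simp
qed

text \<open>A basis of U together with v is independent, so a functional may be prescribed as 0 on
  the basis and 1 at v. This replaces quotient spaces throughout.\<close>

lemma functional_separates:
  assumes "vector_space s" "module.subspace s U" "v \<notin> U"
  shows "\<exists>l. Vector_Spaces.linear s (*) l \<and> (\<forall>u\<in>U. l u = 0) \<and> l v = (1::'k::field)"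
proof -
  interpret vector_space_pair s "(*) :: 'k \<Rightarrow> 'k \<Rightarrow> 'k"
    using assms(1) vector_space_mult by (simp add: vector_space_pair_def)
  obtain B where B: "B \<subseteq> U" "vs1.independent B" "U \<subseteq> vs1.span B"
    using vs1.maximal_independent_subset by blast
  have sp: "vs1.span B = U" using B assms(2) vs1.span_minimal by blast
  have ind: "vs1.independent (insert v B)"
    using vs1.independent_insertI[of v B] B(2) assms(3) sp by blast
  obtain l where l: "Vector_Spaces.linear s (*) l" "\<And>b. b \<in> insert v B \<Longrightarrow> l b = (if b = v then 1 else 0)"
    using linear_independent_extend[OF ind, of "\<lambda>b. if b = v then 1 else (0::'k)"] by blast
  have "l u = 0" if "u \<in> U" for u
  proof (rule linear_eq_0_on_span[OF l(1), of B])
    show "u \<in> vs1.span B" using that sp by blast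
    show "l b = 0" if "b \<in> B" for b using that l(2) B(1) assms(3) by auto
  qed
  then show ?thesis using l by auto
qed

lemma functional_nonzero:
  assumes "vector_space s" "v \<noteq> 0"
  shows "\<exists>l. Vector_Spaces.linear s (*) l \<and> l v = (1::'k::field)"
proof -
  interpret vector_space s by fact
  show ?thesis using functional_separates[OF assms(1) subspace_single_0, of v] assms(2) by auto
qed

section \<open>Dual spaces, biduality and finite products\<close>

definition dual_space :: "('k::field \<Rightarrow> 'v::ab_group_add \<Rightarrow> 'v) \<Rightarrow> 'v set \<Rightarrow> ('v \<Rightarrow> 'k) set" where
  "dual_space s V = {l. (\<forall>v. v \<notin> V \<longrightarrow> l v = 0) \<and> lin_on s (*) V l}"

definition fun_scl :: "('k \<Rightarrow> 'w \<Rightarrow> 'w) \<Rightarrow> 'k \<Rightarrow> ('i \<Rightarrow> 'w) \<Rightarrow> ('i \<Rightarrow> 'w)" where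
  "fun_scl s c f = (\<lambda>i. s c (f i))"

lemma vector_space_fun_scl:
  assumes "vector_space s" shows "vector_space (fun_scl s)"
proof -
  interpret vector_space s by fact
  show ?thesis
    by unfold_locales (auto simp: fun_scl_def scale_right_distrib scale_left_distrib)
qed

lemma fun_sum_at: "(\<Sum>i\<in>I. f i) x = (\<Sum>i\<in>I. f i x)" for f :: "'i \<Rightarrow> 'b \<Rightarrow> 'c::comm_monoid_add"
  by (induction I rule: infinite_finite_induct) auto

text \<open>Only surjectivity of the evaluation map is stated: in finite dimension a functional on
  the dual is determined by its values on the coordinate functionals of a basis, and those values
  are the coordinates of the vector sought.\<close>

lemma double_dual:
  assumes "fd_space s V"
    and "lin_on (fun_scl (*)) (*) (dual_space s V) \<Phi>"
  shows "\<exists>w\<in>V. \<forall>l\<in>dual_space s V. \<Phi> l = (l w :: 'k::field)"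
proof -
  interpret vector_space_pair s "(*) :: 'k \<Rightarrow> 'k \<Rightarrow> 'k"
    using assms(1) vector_space_mult by (simp add: vector_space_pair_def fd_space_def)
  have V: "vs1.subspace V" using assms(1) unfolding fd_space_def by blast
  obtain B where B: "B \<subseteq> V" "vs1.independent B" "V \<subseteq> vs1.span B"
    using vs1.maximal_independent_subset by blast
  obtain W where "finite W" "V \<subseteq> vs1.span W" using assms(1) unfolding fd_space_def by blast
  then have fin: "finite B" using vs1.independent_span_bound[of W B] B by blast
  let ?d = "\<lambda>b v. if v \<in> V then vs1.representation B v b else 0"
  have dlin: "?d b \<in> dual_space s V" for b
  proof -
    have "vs1.representation B (v + w) b = vs1.representation B v b + vs1.representation B w b"
      if "v \<in> V" "w \<in> V" for v w
      using vs1.representation_add[OF B(2) subsetD[OF B(3)] subsetD[OF B(3)], of w v] that by auto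
    moreover have "vs1.representation B (s c v) b = c * vs1.representation B v b"
      if "v \<in> V" for c v
      using vs1.representation_scale[OF B(2) subsetD[OF B(3)], of v c] that by auto
    ultimately show ?thesis
      using vs1.subspace_add[OF V] vs1.subspace_scale[OF V]
      by (auto simp: dual_space_def lin_on_def)
  qed
  have DS: "module.subspace (fun_scl (*)) (dual_space s V)"
  proof -
    interpret f: vector_space "fun_scl (*) :: 'k \<Rightarrow> ('a \<Rightarrow> 'k) \<Rightarrow> _"
      by (rule vector_space_fun_scl[OF vector_space_mult])
    show ?thesis
      by (rule f.subspaceI)
        (auto simp: dual_space_def lin_on_def fun_scl_def distrib_left mult.left_commute)
  qed
  have DSc: "fun_scl (*) c l \<in> dual_space s V" if "l \<in> dual_space s V" for c l
    using that by (auto simp: dual_space_def lin_on_def fun_scl_def distrib_left mult.left_commute)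
  define w where "w = (\<Sum>b\<in>B. s (\<Phi> (?d b)) b)"
  have wV: "w \<in> V"
    unfolding w_def using B(1) by (intro vs1.subspace_sum[OF V] vs1.subspace_scale[OF V]) auto
  have "\<Phi> l = l w" if l: "l \<in> dual_space s V" for l
  proof -
    have ll: "lin_on s (*) V l" using l by (simp add: dual_space_def)
    have lsum: "l (\<Sum>b\<in>B. s (c b) b) = (\<Sum>b\<in>B. c b * l b)" for c
    proof -
      have "l (\<Sum>b\<in>B. s (c b) b) = (\<Sum>b\<in>B. l (s (c b) b))"
        using B(1) vs1.subspace_scale[OF V]
        by (intro lin_on_sum[OF _ _ V ll]) (auto intro: vs1.vector_space_axioms vector_space_mult)
      then show ?thesis using lin_on_scl[OF ll] B(1) by (simp add: subset_iff)
    qed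
    have "l = (\<Sum>b\<in>B. fun_scl (*) (l b) (?d b))"
    proof
      fix v
      show "l v = (\<Sum>b\<in>B. fun_scl (*) (l b) (?d b)) v"
      proof (cases "v \<in> V")
        case True
        then have "v = (\<Sum>b\<in>B. s (vs1.representation B v b) b)"
          using vs1.sum_representation_eq[OF B(2) _ fin, of v] B(3) by auto
        then have "l v = (\<Sum>b\<in>B. vs1.representation B v b * l b)" using lsum by metis
        then show ?thesis using True by (simp add: fun_scl_def fun_sum_at mult.commute)
      next
        case False
        then show ?thesis using l by (simp add: fun_scl_def fun_sum_at dual_space_def)
      qed
    qed
    then have "\<Phi> l = \<Phi> (\<Sum>b\<in>B. fun_scl (*) (l b) (?d b))" by simp
    also have "\<dots> = (\<Sum>b\<in>B. \<Phi> (fun_scl (*) (l b) (?d b)))"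
      using DSc dlin
      by (intro lin_on_sum[OF vector_space_fun_scl[OF vector_space_mult] vector_space_mult DS assms(2)]) auto
    also have "\<dots> = (\<Sum>b\<in>B. \<Phi> (?d b) * l b)"
      using lin_on_scl[OF assms(2)] dlin by (simp add: mult.commute)
    also have "\<dots> = l w" unfolding w_def lsum ..
    finally show ?thesis .
  qed
  then show ?thesis using wV by blast
qed

lemma subspace_kernel:
  assumes "vector_space s1" "vector_space s2" "module.subspace s1 V" "lin_on s1 s2 V f"
  shows "module.subspace s1 {v \<in> V. f v = 0}"
proof -
  interpret vector_space_pair s1 s2 using assms by unfold_locales (auto simp: vector_space_def)
  show ?thesis
    using lin_on_0[OF assms] vs1.subspace_0[OF assms(3)] vs1.subspace_add[OF assms(3)]
      vs1.subspace_scale[OF assms(3)] lin_on_add[OF assms(4)] lin_on_scl[OF assms(4)]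
    by (intro vs1.subspaceI) auto
qed

text \<open>An extension of finite-dimensional spaces is finite-dimensional: lifts of a basis of the
  image together with generators of the kernel span. This has to precede rank-nullity for products
  and duals, where no finite spanning set is available at the outset.\<close>

lemma fd_space_ext:
  assumes "vector_space s1" "module.subspace s1 V" "lin_on s1 s2 V f"
    and "fd_space s2 (f ` V)" "fd_space s1 {v \<in> V. f v = 0}"
  shows "fd_space s1 V"
proof -
  interpret vector_space_pair s1 s2
    using assms by (simp add: vector_space_pair_def fd_space_def)
  obtain g where g: "Vector_Spaces.linear s1 s2 g" "\<And>v. v \<in> V \<Longrightarrow> g v = f v"
    using lin_on_extend[OF vs1.vector_space_axioms vs2.vector_space_axioms assms(2,3)] by blast
  obtain B where B: "B \<subseteq> f ` V" "vs2.independent B" "f ` V \<subseteq> vs2.span B"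
    using vs2.maximal_independent_subset by blast
  obtain W where "finite W" "f ` V \<subseteq> vs2.span W" using assms(4) unfolding fd_space_def by blast
  then have fin: "finite B" using vs2.independent_span_bound[of W B] B by blast
  obtain C where C: "finite C" "{v \<in> V. f v = 0} \<subseteq> vs1.span C"
    using assms(5) unfolding fd_space_def by blast
  obtain D where D: "D \<subseteq> V" "finite D" "B = f ` D"
    using finite_subset_image[OF fin B(1)] by blast
  have BD: "B = g ` D" unfolding D(3) using g(2) D(1) by (auto intro!: image_cong)
  have "v \<in> vs1.span (D \<union> C)" if v: "v \<in> V" for v
  proof -
    have "g v \<in> vs2.span (g ` D)" using v B(3) g(2) BD by (metis image_eqI subsetD)
    then obtain d where d: "d \<in> vs1.span D" "g v = g d"
      unfolding linear_span_image[OF g(1)] by blast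
    have dV: "d \<in> V" using d(1) vs1.span_minimal[OF D(1) assms(2)] by blast
    have "f (v - d) = g (v - d)" using g(2) vs1.subspace_diff[OF assms(2) v dV] by simp
    also have "\<dots> = 0" using d(2) linear_diff[OF g(1)] by simp
    finally have "v - d \<in> vs1.span C" using C(2) vs1.subspace_diff[OF assms(2) v dV] by blast
    then have "d + (v - d) \<in> vs1.span (D \<union> C)" using d(1) unfolding vs1.span_Un by blast
    then show ?thesis by simp
  qed
  then show ?thesis
    unfolding fd_space_def using assms(1,2) C(1) D(2) by (auto intro!: exI[of _ "D \<union> C"])
qed

lemma fd_space_zero: "vector_space s \<Longrightarrow> fd_space s {0}"
  unfolding fd_space_def
  by (auto simp: vector_space.dependent_def module.subspace_single_0 module_iff_vector_space
      intro!: exI[of _ "{}"] module.span_zero)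

text \<open>The direct sum over I, with all summands in one ambient type. The default value 0 off I
  makes equality of elements equality of functions.\<close>

definition prod_space :: "'i set \<Rightarrow> ('i \<Rightarrow> 'v::zero set) \<Rightarrow> ('i \<Rightarrow> 'v) set" where
  "prod_space I V = {F. (\<forall>i\<in>I. F i \<in> V i) \<and> (\<forall>i. i \<notin> I \<longrightarrow> F i = 0)}"

lemma subspace_prod_space:
  assumes "vector_space s" "\<And>i. i \<in> I \<Longrightarrow> module.subspace s (V i)"
  shows "module.subspace (fun_scl s) (prod_space I V)"
proof -
  interpret vector_space s by fact
  interpret f: vector_space "fun_scl s" by (rule vector_space_fun_scl) fact
  show ?thesis
    using assms(2) subspace_0 subspace_add subspace_scale
    by (intro f.subspaceI) (auto simp: prod_space_def fun_scl_def)
qed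

text \<open>Evaluation at the new index is onto \<open>V i\<close>, and its kernel is literally the
  product over the smaller index set.\<close>

lemma prod_space_dim:
  assumes "vector_space s" "finite I" "\<And>i. i \<in> I \<Longrightarrow> fd_space s (V i)"
  shows "fd_space (fun_scl s) (prod_space I V) \<and>
    vector_space.dim (fun_scl s) (prod_space I V) = (\<Sum>i\<in>I. vector_space.dim s (V i))"
  using assms(2,3)
proof (induction I rule: finite_induct)
  case empty
  have "prod_space {} V = {0}" by (auto simp: prod_space_def)
  then show ?case
    using fd_space_zero dim_zero_space vector_space_fun_scl[OF assms(1)] by (metis sum.empty)
next
  case (insert i I)
  interpret vector_space s by fact
  let ?P = "prod_space (insert i I) V"
  have sub: "subspace (V j)" if "j \<in> insert i I" for j
    using insert.prems that unfolding fd_space_def by blast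
  note vs = vector_space_fun_scl[OF assms(1)]
  have lin: "lin_on (fun_scl s) s ?P (\<lambda>F. F i)" by (auto simp: lin_on_def fun_scl_def)
  have im: "(\<lambda>F. F i) ` ?P = V i"
  proof
    show "V i \<subseteq> (\<lambda>F. F i) ` ?P"
    proof
      fix v assume "v \<in> V i"
      then have "(\<lambda>j. if j = i then v else 0) \<in> ?P"
        using subspace_0[OF sub] by (auto simp: prod_space_def)
      then show "v \<in> (\<lambda>F. F i) ` ?P" by (intro image_eqI[where x = "\<lambda>j. if j = i then v else 0"]) auto
    qed
  qed (auto simp: prod_space_def)
  have ker: "{F \<in> ?P. F i = 0} = prod_space I V"
    using subspace_0[OF sub] insert.hyps(2) by (auto simp: prod_space_def) metis
  have subP: "module.subspace (fun_scl s) ?P" by (rule subspace_prod_space[OF assms(1) sub])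
  have fd: "fd_space (fun_scl s) ?P"
    using fd_space_ext[OF vs subP lin, unfolded im ker] insert by auto
  show ?case
    using fd rank_nullity[OF fd assms(1) lin, unfolded im ker] insert by auto
qed

text \<open>Restriction to a basis B identifies the dual with the functions supported on B.\<close>

lemma dual_space_dim:
  fixes s :: "'k::field \<Rightarrow> 'v::ab_group_add \<Rightarrow> 'v"
  assumes "fd_space s V"
  shows "fd_space (fun_scl (*)) (dual_space s V) \<and>
    vector_space.dim (fun_scl (*)) (dual_space s V) = vector_space.dim s V"
proof -
  interpret vector_space_pair s "(*) :: 'k \<Rightarrow> 'k \<Rightarrow> 'k"
    using assms(1) vector_space_mult by (simp add: vector_space_pair_def fd_space_def)
  interpret f: vector_space "fun_scl (*) :: 'k \<Rightarrow> ('v \<Rightarrow> 'k) \<Rightarrow> _"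
    by (rule vector_space_fun_scl[OF vector_space_mult])
  have V: "vs1.subspace V" using assms(1) unfolding fd_space_def by blast
  obtain B where B: "B \<subseteq> V" "vs1.independent B" "V \<subseteq> vs1.span B"
    using vs1.maximal_independent_subset by blast
  obtain W where "finite W" "V \<subseteq> vs1.span W" using assms(1) unfolding fd_space_def by blast
  then have fin: "finite B" using vs1.independent_span_bound[of W B] B by blast
  let ?r = "\<lambda>l b. if b \<in> B then l b else (0::'k)"
  let ?D = "dual_space s V" and ?P = "prod_space B (\<lambda>b. UNIV :: 'k set)"
  have sub: "f.subspace ?D"
    by (rule f.subspaceI)
      (auto simp: dual_space_def lin_on_def fun_scl_def distrib_left mult.left_commute)
  have lin: "lin_on (fun_scl (*)) (fun_scl (*)) ?D ?r"
    by (auto simp: lin_on_def fun_scl_def)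
  have im: "?r ` ?D = ?P"
  proof
    show "?P \<subseteq> ?r ` ?D"
    proof
      fix F assume F: "F \<in> ?P"
      obtain g where g: "Vector_Spaces.linear s (*) g" "\<And>b. b \<in> B \<Longrightarrow> g b = F b"
        using linear_independent_extend[OF B(2), of F] by blast
      let ?g = "\<lambda>v. if v \<in> V then g v else 0"
      have "?g \<in> ?D"
        using vs1.subspace_add[OF V] vs1.subspace_scale[OF V]
        by (auto simp: dual_space_def lin_on_def linear_add[OF g(1)] linear_scale[OF g(1)])
      moreover have "F = ?r ?g"
      proof
        fix b show "F b = ?r ?g b" using F B(1) g(2)[of b] by (auto simp: prod_space_def)
      qed
      ultimately show "F \<in> ?r ` ?D" by (intro image_eqI)
    qed
  qed (auto simp: prod_space_def)
  have ker: "{l \<in> ?D. ?r l = 0} = {0}"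
  proof -
    have "l = 0" if l: "l \<in> ?D" "?r l = 0" for l
    proof -
      have lV: "lin_on s (*) V l" using l(1) by (simp add: dual_space_def)
      have b0: "l b = 0" if "b \<in> B" for b using fun_cong[OF l(2), of b] that by simp
      obtain g where g: "Vector_Spaces.linear s (*) g" "\<And>v. v \<in> V \<Longrightarrow> g v = l v"
        using lin_on_extend[OF vs1.vector_space_axioms vs2.vector_space_axioms V lV] by blast
      have "g v = 0" if "v \<in> V" for v
        using linear_eq_0_on_span[OF g(1), of B v] b0 g(2) B that by (simp add: subset_iff)
      then show ?thesis using g(2) l(1) by (auto simp: dual_space_def fun_eq_iff)
    qed
    moreover have "0 \<in> ?D" using sub f.subspace_0 by blast
    ultimately show ?thesis by (auto simp: zero_fun_def)
  qed
  have one: "vs2.dim (UNIV :: 'k set) = 1" "fd_space (*) (UNIV :: 'k set)"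
  proof -
    have sp: "vs2.span {1} = UNIV"
    proof -
      have "x \<in> vs2.span {1}" for x :: 'k
        using vs2.span_scale[OF vs2.span_base[of 1 "{1}"], of x] by simp
      then show ?thesis by blast
    qed
    show "vs2.dim (UNIV :: 'k set) = 1" by (rule dim_one[OF vector_space_mult, of 1]) auto
    show "fd_space (*) (UNIV :: 'k set)"
      unfolding fd_space_def using vector_space_mult sp vs2.subspace_UNIV
      by (intro conjI exI[of _ "{1}"]) auto
  qed
  have pd: "fd_space (fun_scl (*)) ?P" "vector_space.dim (fun_scl (*)) ?P = card B"
    using prod_space_dim[OF vector_space_mult fin, of "\<lambda>b. UNIV :: 'k set"] one by auto
  have vsB: "vector_space (fun_scl (*) :: 'k \<Rightarrow> ('v \<Rightarrow> 'k) \<Rightarrow> _)" by (rule f.vector_space_axioms)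
  have fd: "fd_space (fun_scl (*)) ?D"
    using fd_space_ext[OF vsB sub lin, unfolded im ker] pd(1) fd_space_zero[OF vsB] by blast
  moreover have "vector_space.dim (fun_scl (*)) ?D = card B"
    using rank_nullity[OF fd vsB lin, unfolded im ker] pd(2) dim_zero_space[OF vsB] by simp
  moreover have "card B = vector_space.dim s V" using vs1.dim_unique[OF B(1,3,2)] by simp
  ultimately show ?thesis by simp
qed

section \<open>Algebras of bipartite quivers\<close>

text \<open>A path algebra without paths of length two, described by its basis \<open>b i j\<close>
  (idempotents for i = j, arrows otherwise), its coordinate functionals \<open>cf\<close> and its
  multiplication table. The axioms are stable under passing to the opposite algebra with reversed
  arrows. Left modules, which arise as duals and as Hom(P,A), are therefore covered by the same
  results.\<close>

locale bipartite_algebra =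
  fixes A :: "('k::field, 'a::ab_group_add) alg" and V :: "'q set" and E :: "('q \<times> 'q) set"
    and b :: "'q \<Rightarrow> 'q \<Rightarrow> 'a" and cf :: "'a \<Rightarrow> 'q \<Rightarrow> 'q \<Rightarrow> 'k"
  assumes finite_V: "finite V" and E_sub: "E \<subseteq> V \<times> V"
    and bipartite: "(i, j) \<in> E \<Longrightarrow> (j, l) \<notin> E"
    and vs_A: "vector_space (ascl A)" and sub_A: "module.subspace (ascl A) (acar A)"
    and b_in: "(i, j) \<in> Id_on V \<union> E \<Longrightarrow> b i j \<in> acar A"
    and cf_add: "x \<in> acar A \<Longrightarrow> y \<in> acar A \<Longrightarrow> cf (x + y) i j = cf x i j + cf y i j"
    and cf_scl: "x \<in> acar A \<Longrightarrow> cf (ascl A c x) i j = c * cf x i j"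
    and cf_b: "(i, j) \<in> Id_on V \<union> E \<Longrightarrow> cf (b i j) k l = (if k = i \<and> l = j then 1 else 0)"
    and cf_ext: "x \<in> acar A \<Longrightarrow> y \<in> acar A \<Longrightarrow>
      (\<And>i j. (i, j) \<in> Id_on V \<union> E \<Longrightarrow> cf x i j = cf y i j) \<Longrightarrow> x = y"
    and cf_off: "x \<in> acar A \<Longrightarrow> (i, j) \<notin> Id_on V \<union> E \<Longrightarrow> cf x i j = 0"
    and mul_in: "x \<in> acar A \<Longrightarrow> y \<in> acar A \<Longrightarrow> amul A x y \<in> acar A"
    and cf_mul_diag: "x \<in> acar A \<Longrightarrow> y \<in> acar A \<Longrightarrow> i \<in> V \<Longrightarrow>
      cf (amul A x y) i i = cf x i i * cf y i i"
    and cf_mul_arrow: "x \<in> acar A \<Longrightarrow> y \<in> acar A \<Longrightarrow> (i, j) \<in> E \<Longrightarrow>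
      cf (amul A x y) i j = cf x i i * cf y i j + cf x i j * cf y j j"
    and one_in: "aone A \<in> acar A"
    and cf_one: "cf (aone A) i j = (if i = j \<and> i \<in> V then 1 else 0)"
begin

abbreviation R :: "('q \<times> 'q) set" where "R \<equiv> Id_on V \<union> E"

text \<open>The component M e_i, written as the fixed points of the idempotent so that membership
  involves no existential; \<open>piece_image\<close> identifies it with the image.\<close>

definition piece :: "('k, 'a, 'v) rmod \<Rightarrow> 'q \<Rightarrow> 'v set" where
  "piece M i = {v \<in> mcar M. mact M v (b i i) = v}"

abbreviation sinks :: "'q set" where "sinks \<equiv> Range E"
abbreviation sources :: "'q set" where "sources \<equiv> V - Range E"
abbreviation inn :: "'q \<Rightarrow> 'q set" where "inn t \<equiv> {s. (s, t) \<in> E}"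
abbreviation outn :: "'q \<Rightarrow> 'q set" where "outn s \<equiv> {t. (s, t) \<in> E}"

lemma finite_E: "finite E"
  using finite_subset[OF E_sub] finite_V by simp

lemma finite_R: "finite R"
  using finite_V finite_E by (simp add: Id_on_def)

lemma finite_inn [simp]: "finite (inn t)"
  by (rule finite_subset[OF _ finite_V]) (use E_sub in auto)

lemma finite_outn [simp]: "finite (outn t)"
  by (rule finite_subset[OF _ finite_V]) (use E_sub in auto)

lemma E_V: "(i, j) \<in> E \<Longrightarrow> i \<in> V" "(i, j) \<in> E \<Longrightarrow> j \<in> V"
  using E_sub by auto

lemma E_irrefl: "(i, i) \<notin> E"
  using bipartite by blast

lemma E_source: "(s, t) \<in> E \<Longrightarrow> s \<in> sources"
  using bipartite E_V by blast

lemma E_neq: "(i, j) \<in> E \<Longrightarrow> i \<noteq> j"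
  using E_irrefl by blast

lemma b_in_diag: "i \<in> V \<Longrightarrow> b i i \<in> acar A"
  by (rule b_in) auto

lemma b_in_arrow: "(i, j) \<in> E \<Longrightarrow> b i j \<in> acar A"
  by (rule b_in) auto

lemma cf_b_diag: "i \<in> V \<Longrightarrow> cf (b i i) k l = (if k = i \<and> l = i then 1 else 0)"
  by (rule cf_b) auto

lemma cf_b_arrow: "(i, j) \<in> E \<Longrightarrow> cf (b i j) k l = (if k = i \<and> l = j then 1 else 0)"
  by (rule cf_b) auto

lemma A_add: "x \<in> acar A \<Longrightarrow> y \<in> acar A \<Longrightarrow> x + y \<in> acar A"
  using module.subspace_add[OF _ sub_A] vs_A unfolding module_iff_vector_space by blast

lemma A_scl: "x \<in> acar A \<Longrightarrow> ascl A c x \<in> acar A"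
  using module.subspace_scale[OF _ sub_A] vs_A unfolding module_iff_vector_space by blast

lemma A_zero: "0 \<in> acar A"
  using module.subspace_0[OF _ sub_A] vs_A unfolding module_iff_vector_space by blast

lemma A_sum: "(\<And>i. i \<in> I \<Longrightarrow> f i \<in> acar A) \<Longrightarrow> sum f I \<in> acar A"
  using module.subspace_sum[OF _ sub_A] vs_A unfolding module_iff_vector_space by blast

lemma cf_lin: "lin_on (ascl A) (*) (acar A) (\<lambda>x. cf x i j)"
  by (auto simp: lin_on_def cf_add cf_scl)

lemma cf_zero [simp]: "cf 0 i j = 0"
  using lin_on_0[OF vs_A vector_space_mult sub_A cf_lin] .

lemma cf_sum: "(\<And>i. i \<in> I \<Longrightarrow> f i \<in> acar A) \<Longrightarrow> cf (sum f I) k l = (\<Sum>i\<in>I. cf (f i) k l)"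
  using lin_on_sum[OF vs_A vector_space_mult sub_A cf_lin] .

lemma A_expand:
  assumes "x \<in> acar A"
  shows "x = (\<Sum>p\<in>R. ascl A (cf x (fst p) (snd p)) (b (fst p) (snd p)))"
proof (rule cf_ext[OF assms])
  have *: "ascl A (cf x (fst p) (snd p)) (b (fst p) (snd p)) \<in> acar A" if "p \<in> R" for p
    using that b_in A_scl by (metis prod.collapse)
  then show "(\<Sum>p\<in>R. ascl A (cf x (fst p) (snd p)) (b (fst p) (snd p))) \<in> acar A"
    by (rule A_sum)
  fix i j assume ij: "(i, j) \<in> R"
  have "cf (\<Sum>p\<in>R. ascl A (cf x (fst p) (snd p)) (b (fst p) (snd p))) i j =
     (\<Sum>p\<in>R. cf (ascl A (cf x (fst p) (snd p)) (b (fst p) (snd p))) i j)"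
    by (rule cf_sum) (rule *)
  also have "\<dots> = (\<Sum>p\<in>R. if p = (i, j) then cf x i j else 0)"
  proof (rule sum.cong[OF refl])
    fix p assume p: "p \<in> R"
    then have "(fst p, snd p) \<in> R" by simp
    then show "cf (ascl A (cf x (fst p) (snd p)) (b (fst p) (snd p))) i j =
        (if p = (i, j) then cf x i j else 0)"
      using cf_b[of "fst p" "snd p" i j] b_in[of "fst p" "snd p"] by (auto simp: cf_scl)
  qed
  also have "\<dots> = cf x i j" using ij finite_R by simp
  finally show "cf x i j =
      cf (\<Sum>p\<in>R. ascl A (cf x (fst p) (snd p)) (b (fst p) (snd p))) i j" ..
qed

lemma one_expand: "aone A = (\<Sum>i\<in>V. b i i)"
proof (rule cf_ext[OF one_in])
  show "(\<Sum>i\<in>V. b i i) \<in> acar A" by (rule A_sum) (rule b_in_diag)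
  fix i j assume "(i, j) \<in> R"
  have "cf (\<Sum>i\<in>V. b i i) i j = (\<Sum>k\<in>V. cf (b k k) i j)"
    by (rule cf_sum) (rule b_in_diag)
  also have "\<dots> = (\<Sum>k\<in>V. if k = i then (if i = j then 1 else 0) else 0)"
    by (rule sum.cong[OF refl]) (auto simp: cf_b_diag)
  also have "\<dots> = (if i = j \<and> i \<in> V then 1 else 0)" using finite_V by simp
  finally show "cf (aone A) i j = cf (\<Sum>i\<in>V. b i i) i j" by (simp add: cf_one)
qed

lemma cf_ext2:
  assumes "x \<in> acar A" "y \<in> acar A" "\<And>i. i \<in> V \<Longrightarrow> cf x i i = cf y i i"
    and "\<And>i j. (i, j) \<in> E \<Longrightarrow> i \<noteq> j \<Longrightarrow> cf x i j = cf y i j"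
  shows "x = y"
  by (rule cf_ext[OF assms(1,2)]) (use assms(3,4) E_neq in auto)

lemma mul_diag_diag:
  assumes "i \<in> V" "j \<in> V"
  shows "amul A (b i i) (b j j) = (if i = j then b i i else 0)"
  by (rule cf_ext2)
    (auto simp: assms mul_in b_in_diag A_zero cf_mul_diag cf_mul_arrow cf_b_diag)

lemma mul_diag_arrow:
  assumes "i \<in> V" "(s, t) \<in> E"
  shows "amul A (b i i) (b s t) = (if i = s then b s t else 0)"
  by (rule cf_ext2)
    (use E_neq[OF assms(2)] in \<open>auto simp: assms mul_in b_in_diag b_in_arrow A_zero cf_mul_diag
      cf_mul_arrow cf_b_diag cf_b_arrow\<close>)

lemma mul_arrow_diag:
  assumes "i \<in> V" "(s, t) \<in> E"
  shows "amul A (b s t) (b i i) = (if i = t then b s t else 0)"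
  by (rule cf_ext2)
    (use E_neq[OF assms(2)] in \<open>auto simp: assms mul_in b_in_diag b_in_arrow A_zero cf_mul_diag
      cf_mul_arrow cf_b_diag cf_b_arrow\<close>)

text \<open>The axioms are symmetric: transposing the coefficients exchanges the two summands in the
  product rule for arrows.\<close>

lemma op_bipartite: "bipartite_algebra (op_alg A) V (E\<inverse>) (\<lambda>i j. b j i) (\<lambda>x i j. cf x j i)"
proof (intro bipartite_algebra.intro)
  show "cf (aone (op_alg A)) j i = (if i = j \<and> i \<in> V then 1 else 0)" for i j
    by (auto simp: op_alg_def cf_one)
  show "(j, l) \<notin> E\<inverse>" if "(i, j) \<in> E\<inverse>" for i j l
    using that bipartite by blast
  show "x = y" if "x \<in> acar (op_alg A)" "y \<in> acar (op_alg A)"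
    "\<And>i j. (i, j) \<in> Id_on V \<union> E\<inverse> \<Longrightarrow> cf x j i = cf y j i" for x y
    using that(1,2) that(3)[of j i for i j] by (intro cf_ext) (auto simp: op_alg_def)
  show "cf (b j i) l k = (if k = i \<and> l = j then 1 else 0)" if "(i, j) \<in> Id_on V \<union> E\<inverse>" for i j k l
    using that by (auto simp: cf_b_diag cf_b_arrow)
  show "b j i \<in> acar (op_alg A)" if "(i, j) \<in> Id_on V \<union> E\<inverse>" for i j
    using that b_in[of j i] by (auto simp: op_alg_def)
  show "cf x j i = 0" if "x \<in> acar (op_alg A)" "(i, j) \<notin> Id_on V \<union> E\<inverse>" for x i j
    using that cf_off[of x j i] by (auto simp: op_alg_def)
  show "E\<inverse> \<subseteq> V \<times> V" using E_sub by blast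
qed (simp_all add: op_alg_def finite_V vs_A sub_A cf_add cf_scl mul_in one_in cf_one cf_mul_diag
    cf_mul_arrow mult.commute add.commute)

end

locale bip_module = bipartite_algebra A V E b cf
  for A :: "('k::field, 'a::ab_group_add) alg" and V :: "'q set" and E b cf +
  fixes M :: "('k, 'a, 'v::ab_group_add) rmod"
  assumes rmod: "is_rmod A M"
begin

lemma vs: "vector_space (mscl M)"
  and sub: "module.subspace (mscl M) (mcar M)"
  and act_in: "v \<in> mcar M \<Longrightarrow> x \<in> acar A \<Longrightarrow> mact M v x \<in> mcar M"
  and act_add: "v \<in> mcar M \<Longrightarrow> w \<in> mcar M \<Longrightarrow> x \<in> acar A \<Longrightarrow>
     mact M (v + w) x = mact M v x + mact M w x"
  and act_add2: "v \<in> mcar M \<Longrightarrow> x \<in> acar A \<Longrightarrow> y \<in> acar A \<Longrightarrow>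
     mact M v (x + y) = mact M v x + mact M v y"
  and act_scl: "v \<in> mcar M \<Longrightarrow> x \<in> acar A \<Longrightarrow> mact M (mscl M c v) x = mscl M c (mact M v x)"
  and act_scl2: "v \<in> mcar M \<Longrightarrow> x \<in> acar A \<Longrightarrow> mact M v (ascl A c x) = mscl M c (mact M v x)"
  and act_one: "v \<in> mcar M \<Longrightarrow> mact M v (aone A) = v"
  and act_mul: "v \<in> mcar M \<Longrightarrow> x \<in> acar A \<Longrightarrow> y \<in> acar A \<Longrightarrow>
     mact M v (amul A x y) = mact M (mact M v x) y"
  using rmod unfolding is_rmod_def by blast+

sublocale m: vector_space "mscl M" by (rule vs)

lemma car_add: "v \<in> mcar M \<Longrightarrow> w \<in> mcar M \<Longrightarrow> v + w \<in> mcar M"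
  and car_scl: "v \<in> mcar M \<Longrightarrow> mscl M c v \<in> mcar M"
  and car_zero: "0 \<in> mcar M"
  and car_sum: "(\<And>i. i \<in> I \<Longrightarrow> f i \<in> mcar M) \<Longrightarrow> sum f I \<in> mcar M"
  using m.subspace_add[OF sub] m.subspace_scale[OF sub] m.subspace_0[OF sub]
    m.subspace_sum[OF sub] by blast+

lemma act_lin: "x \<in> acar A \<Longrightarrow> lin_on (mscl M) (mscl M) (mcar M) (\<lambda>v. mact M v x)"
  by (simp add: lin_on_def act_add act_scl)

lemma act_lin2: "v \<in> mcar M \<Longrightarrow> lin_on (ascl A) (mscl M) (acar A) (mact M v)"
  by (simp add: lin_on_def act_add2 act_scl2)

lemma act_zero: "x \<in> acar A \<Longrightarrow> mact M 0 x = 0"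
  using lin_on_0[OF vs vs sub act_lin] .

lemma act_zero2: "v \<in> mcar M \<Longrightarrow> mact M v 0 = 0"
  using lin_on_0[OF vs_A vs sub_A act_lin2] .

lemma act_sum: "x \<in> acar A \<Longrightarrow> (\<And>i. i \<in> I \<Longrightarrow> f i \<in> mcar M) \<Longrightarrow>
    mact M (sum f I) x = (\<Sum>i\<in>I. mact M (f i) x)"
  using lin_on_sum[OF vs vs sub act_lin] .

lemma act_sum2: "v \<in> mcar M \<Longrightarrow> (\<And>i. i \<in> I \<Longrightarrow> f i \<in> acar A) \<Longrightarrow>
    mact M v (sum f I) = (\<Sum>i\<in>I. mact M v (f i))"
  using lin_on_sum[OF vs_A vs sub_A act_lin2] .

lemma piece_car: "v \<in> piece M i \<Longrightarrow> v \<in> mcar M"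
  by (simp add: piece_def)

lemma piece_act: "v \<in> piece M i \<Longrightarrow> mact M v (b i i) = v"
  by (simp add: piece_def)

lemma act_piece: "v \<in> mcar M \<Longrightarrow> i \<in> V \<Longrightarrow> mact M v (b i i) \<in> piece M i"
  using act_mul[of v "b i i" "b i i"] by (simp add: piece_def act_in b_in_diag mul_diag_diag)

lemma act_arrow: "v \<in> mcar M \<Longrightarrow> (s, t) \<in> E \<Longrightarrow> mact M v (b s t) \<in> piece M t"
  using act_mul[of v "b s t" "b t t"] E_V
  by (simp add: piece_def act_in b_in_diag b_in_arrow mul_arrow_diag)

lemma piece_act_other: "v \<in> piece M i \<Longrightarrow> i \<in> V \<Longrightarrow> j \<in> V \<Longrightarrow> i \<noteq> j \<Longrightarrow> mact M v (b j j) = 0"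
  using act_mul[of v "b i i" "b j j"]
  by (simp add: piece_def b_in_diag mul_diag_diag act_zero2)

lemma act_via_source: "v \<in> mcar M \<Longrightarrow> (s, t) \<in> E \<Longrightarrow> mact M (mact M v (b s s)) (b s t) = mact M v (b s t)"
  using act_mul[of v "b s s" "b s t"] E_V by (simp add: b_in_diag b_in_arrow mul_diag_arrow)

lemma piece_decomp: "v \<in> mcar M \<Longrightarrow> v = (\<Sum>i\<in>V. mact M v (b i i))"
  using act_one[of v] act_sum2[of v V "\<lambda>i. b i i"] by (simp add: one_expand b_in_diag)

lemma piece_sub: "i \<in> V \<Longrightarrow> m.subspace (piece M i)"
  by (rule m.subspaceI)
    (auto simp: piece_def car_zero car_add car_scl act_zero act_add act_scl b_in_diag)

lemma piece_image: "i \<in> V \<Longrightarrow> (\<lambda>v. mact M v (b i i)) ` mcar M = piece M i"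
  using act_piece by (auto simp: piece_def image_iff) metis

lemma act_expand:
  assumes "v \<in> mcar M" "x \<in> acar A"
  shows "mact M v x = (\<Sum>p\<in>R. mscl M (cf x (fst p) (snd p)) (mact M v (b (fst p) (snd p))))"
proof -
  have *: "b (fst p) (snd p) \<in> acar A" if "p \<in> R" for p
    using that b_in by (metis prod.collapse)
  have "mact M v x = mact M v (\<Sum>p\<in>R. ascl A (cf x (fst p) (snd p)) (b (fst p) (snd p)))"
    using A_expand[OF assms(2)] by simp
  also have "\<dots> = (\<Sum>p\<in>R. mact M v (ascl A (cf x (fst p) (snd p)) (b (fst p) (snd p))))"
    by (rule act_sum2[OF assms(1)]) (use * A_scl in blast)
  also have "\<dots> = (\<Sum>p\<in>R. mscl M (cf x (fst p) (snd p)) (mact M v (b (fst p) (snd p))))"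
    using * by (intro sum.cong refl act_scl2[OF assms(1)])
  finally show ?thesis .
qed

lemma piece_0_iff: "mcar M = {0} \<longleftrightarrow> (\<forall>i\<in>V. piece M i = {0})"
proof
  assume "mcar M = {0}"
  then show "\<forall>i\<in>V. piece M i = {0}"
    using piece_car m.subspace_0[OF piece_sub] by blast
next
  assume *: "\<forall>i\<in>V. piece M i = {0}"
  have "v = 0" if v: "v \<in> mcar M" for v
    using piece_decomp[OF v] act_piece[OF v] * by (metis (no_types, lifting) singletonD sum.neutral)
  then show "mcar M = {0}" using car_zero by blast
qed

lemma submodI:
  assumes "L \<subseteq> mcar M" "m.subspace L" "\<And>v i j. v \<in> L \<Longrightarrow> (i, j) \<in> R \<Longrightarrow> mact M v (b i j) \<in> L"
  shows "submod_set A M L"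
  unfolding submod_set_def
proof (intro conjI ballI)
  fix v x assume "v \<in> L" "x \<in> acar A"
  then show "mact M v x \<in> L"
    unfolding act_expand[OF subsetD[OF assms(1) \<open>v \<in> L\<close>] \<open>x \<in> acar A\<close>]
    using assms(3)[of v] by (intro m.subspace_sum[OF assms(2)] m.subspace_scale[OF assms(2)]) auto
qed (use assms in auto)

end

lemma (in bipartite_algebra) rmod_module: "is_rmod A M \<Longrightarrow> bip_module A V E b cf M"
  by (rule bip_module.intro[OF bipartite_algebra_axioms bip_module_axioms.intro])

text \<open>The algebra itself is finite-dimensional, so the products of finitely many generators
  with the basis elements \<open>b i j\<close> span.\<close>

lemma (in bipartite_algebra) fg_fd:
  assumes "fg_mod A M" shows "fd_space (mscl M) (mcar M)"
proof -
  interpret bip_module A V E b cf M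
    using assms by (intro rmod_module) (simp add: fg_mod_def)
  obtain S where S: "finite S" "S \<subseteq> mcar M"
    "\<And>v. v \<in> mcar M \<Longrightarrow> \<exists>c. (\<forall>s\<in>S. c s \<in> acar A) \<and> v = (\<Sum>s\<in>S. mact M s (c s))"
    using assms unfolding fg_mod_def by blast
  let ?B = "(\<lambda>(s, p). mact M s (b (fst p) (snd p))) ` (S \<times> R)"
  have "v \<in> m.span ?B" if "v \<in> mcar M" for v
  proof -
    obtain c where c: "\<forall>s\<in>S. c s \<in> acar A" "v = (\<Sum>s\<in>S. mact M s (c s))" using S(3)[OF \<open>v \<in> mcar M\<close>] by blast
    have "mact M s (c s) \<in> m.span ?B" if "s \<in> S" for s
      unfolding act_expand[OF subsetD[OF S(2) that] c(1)[rule_format, OF that]]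
    proof (intro m.span_sum m.span_scale m.span_base)
      fix p assume "p \<in> R"
      then show "mact M s (b (fst p) (snd p)) \<in> ?B" using that by (intro image_eqI[of _ _ "(s, p)"]) auto
    qed
    then show ?thesis unfolding c(2) by (rule m.span_sum)
  qed
  moreover have "finite ?B" using S(1) finite_R by simp
  ultimately show ?thesis unfolding fd_space_def using vs sub by blast
qed

lemma (in bipartite_algebra) fg_module: "fg_mod A M \<Longrightarrow> bip_module A V E b cf M"
  by (rule rmod_module) (simp add: fg_mod_def)

lemma (in bip_module) fd_piece:
  "fd_space (mscl M) (mcar M) \<Longrightarrow> i \<in> V \<Longrightarrow> fd_space (mscl M) (piece M i)"
  by (rule fd_space_subset[OF _ _ piece_sub]) (auto simp: piece_def)

context bipartite_algebra begin

section \<open>Homomorphisms as families of maps on the vertex components\<close>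

lemma hom_car: "h \<in> hom_mod A M N \<Longrightarrow> v \<in> mcar M \<Longrightarrow> h v \<in> mcar N"
  and hom_add: "h \<in> hom_mod A M N \<Longrightarrow> v \<in> mcar M \<Longrightarrow> w \<in> mcar M \<Longrightarrow> h (v + w) = h v + h w"
  and hom_scl: "h \<in> hom_mod A M N \<Longrightarrow> v \<in> mcar M \<Longrightarrow> h (mscl M c v) = mscl N c (h v)"
  and hom_act: "h \<in> hom_mod A M N \<Longrightarrow> v \<in> mcar M \<Longrightarrow> x \<in> acar A \<Longrightarrow> h (mact M v x) = mact N (h v) x"
  and hom_off: "h \<in> hom_mod A M N \<Longrightarrow> v \<notin> mcar M \<Longrightarrow> h v = 0"
  by (auto simp: hom_mod_def)

lemma hom_lin: "h \<in> hom_mod A M N \<Longrightarrow> lin_on (mscl M) (mscl N) (mcar M) h"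
  by (auto simp: hom_mod_def lin_on_def)

lemma hom_piece: "h \<in> hom_mod A M N \<Longrightarrow> v \<in> piece M i \<Longrightarrow> i \<in> V \<Longrightarrow> h v \<in> piece N i"
  using hom_act[of h M N v "b i i"] by (auto simp: piece_def hom_car b_in_diag)

text \<open>A module over the path algebra is a representation of the quiver, so compatibility with
  single arrows is the only condition on a family of linear maps.\<close>

lemma hom_from_pieces:
  assumes M: "is_rmod A M" and N: "is_rmod A N"
    and lin: "\<And>i. i \<in> V \<Longrightarrow> lin_on (mscl M) (mscl N) (piece M i) (H i)"
    and into: "\<And>i v. i \<in> V \<Longrightarrow> v \<in> piece M i \<Longrightarrow> H i v \<in> piece N i"
    and arrow: "\<And>s t v. (s, t) \<in> E \<Longrightarrow> v \<in> piece M s \<Longrightarrow> H t (mact M v (b s t)) = mact N (H s v) (b s t)"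
  shows "\<exists>h\<in>hom_mod A M N. \<forall>i\<in>V. \<forall>v\<in>piece M i. h v = H i v"
proof -
  define h where "h = (\<lambda>v. if v \<in> mcar M then \<Sum>i\<in>V. H i (mact M v (b i i)) else 0)"
  interpret M: bip_module A V E b cf M by (rule rmod_module[OF M])
  interpret N: bip_module A V E b cf N by (rule rmod_module[OF N])
  have Hin: "H i (mact M v (b i i)) \<in> mcar N" if "i \<in> V" "v \<in> mcar M" for i v
    by (rule N.piece_car[OF into[OF that(1) M.act_piece[OF that(2,1)]]])
  have H0: "H i 0 = 0" if "i \<in> V" for i
    using lin_on_0[OF M.vs N.vs M.piece_sub[OF that] lin[OF that]] .
  have on_piece: "h v = H i v" if iv: "i \<in> V" "v \<in> piece M i" for i v
  proof -
    have "h v = (\<Sum>j\<in>V. H j (mact M v (b j j)))" using M.piece_car[OF iv(2)] by (simp add: h_def)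
    also have "\<dots> = (\<Sum>j\<in>V. if j = i then H i v else 0)"
      using iv M.piece_act M.piece_act_other[OF iv(2,1)] H0 by (intro sum.cong refl) auto
    finally show ?thesis using finite_V iv by simp
  qed
  have car: "h v \<in> mcar N" if "v \<in> mcar M" for v
    using that Hin by (auto simp: h_def intro!: N.car_sum)
  have add: "h (v + w) = h v + h w" if "v \<in> mcar M" "w \<in> mcar M" for v w
    using that lin_on_add[OF lin] M.act_piece
    by (auto simp: h_def M.car_add M.act_add b_in_diag sum.distrib[symmetric] intro!: sum.cong)
  have scl: "h (mscl M c v) = mscl N c (h v)" if "v \<in> mcar M" for c v
    using that lin_on_scl[OF lin] M.act_piece
    by (auto simp: h_def M.car_scl M.act_scl b_in_diag N.m.scale_sum_right intro!: sum.cong)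
  have hlin: "lin_on (mscl M) (mscl N) (mcar M) h" by (simp add: lin_on_def add scl)
  have hsum: "h (sum f I) = (\<Sum>i\<in>I. h (f i))" if "\<And>i. i \<in> I \<Longrightarrow> f i \<in> mcar M" for I :: "('q \<times> 'q) set" and f
    using lin_on_sum[OF M.vs N.vs M.sub hlin that] .
  have proj: "mact N (h v) (b i i) = H i (mact M v (b i i))" if "v \<in> mcar M" "i \<in> V" for v i
  proof -
    have "mact N (h v) (b i i) = (\<Sum>j\<in>V. mact N (H j (mact M v (b j j))) (b i i))"
      using that Hin by (simp add: h_def N.act_sum b_in_diag)
    also have "\<dots> = (\<Sum>j\<in>V. if j = i then H i (mact M v (b i i)) else 0)"
      using N.piece_act[OF into[OF _ M.act_piece]] N.piece_act_other[OF into[OF _ M.act_piece]] that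
      by (intro sum.cong refl) auto
    finally show ?thesis using finite_V that by simp
  qed
  have act_b: "h (mact M v (b i j)) = mact N (h v) (b i j)" if "v \<in> mcar M" "(i, j) \<in> R" for v i j
  proof (cases "i = j")
    case True
    then have "i \<in> V" using that(2) E_irrefl by auto
    then show ?thesis using True proj that(1) on_piece M.act_piece by metis
  next
    case False
    then have ij: "(i, j) \<in> E" using that by auto
    have "h (mact M v (b i j)) = H j (mact M (mact M v (b i i)) (b i j))"
      using on_piece[OF E_V(2)[OF ij]] M.act_arrow[OF that(1) ij] M.act_via_source[OF that(1) ij] by simp
    also have "\<dots> = mact N (H i (mact M v (b i i))) (b i j)"
      using arrow[OF ij] M.act_piece[OF that(1) E_V(1)[OF ij]] by blast
    also have "\<dots> = mact N (h v) (b i j)"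
      using proj[OF that(1) E_V(1)[OF ij]] N.act_via_source[OF car[OF that(1)] ij] by simp
    finally show ?thesis .
  qed
  have "h (mact M v x) = mact N (h v) x" if "v \<in> mcar M" "x \<in> acar A" for v x
  proof -
    have *: "mact M v (b (fst p) (snd p)) \<in> mcar M" if "p \<in> R" for p
      using b_in[of "fst p" "snd p"] M.act_in[OF \<open>v \<in> mcar M\<close>] that by simp
    have "h (mact M v x) = (\<Sum>p\<in>R. h (mscl M (cf x (fst p) (snd p)) (mact M v (b (fst p) (snd p)))))"
      unfolding M.act_expand[OF that] by (rule hsum) (rule M.car_scl[OF *])
    also have "\<dots> = (\<Sum>p\<in>R. mscl N (cf x (fst p) (snd p)) (mact N (h v) (b (fst p) (snd p))))"
      using scl[OF *] act_b[OF that(1)] by (intro sum.cong refl) simp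
    also have "\<dots> = mact N (h v) x" using N.act_expand[OF car[OF that(1)] that(2)] by simp
    finally show ?thesis .
  qed
  then have "h \<in> hom_mod A M N"
    unfolding hom_mod_def using car add scl by (simp add: h_def)
  then show ?thesis using on_piece by blast
qed

end

section \<open>Projective modules\<close>

lemma fd_space_field: "fd_space (*) (UNIV :: 'k::field set)"
proof -
  interpret vector_space "(*) :: 'k \<Rightarrow> 'k \<Rightarrow> 'k" by (rule vector_space_mult)
  have "x \<in> span {1}" for x :: 'k
    using span_scale[OF span_base[of 1 "{1}"], of x] by simp
  then show ?thesis
    unfolding fd_space_def using vector_space_mult subspace_UNIV
    by (intro conjI exI[of _ "{1}"]) auto
qed

context bipartite_algebra begin

lemma fg_of_fd:
  assumes "is_rmod A M" "fd_space (mscl M) (mcar M)" shows "fg_mod A M"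
proof -
  interpret bip_module A V E b cf M by (rule rmod_module) fact
  obtain B where B: "B \<subseteq> mcar M" "m.independent B" "mcar M \<subseteq> m.span B"
    using m.maximal_independent_subset by blast
  obtain W where "finite W" "mcar M \<subseteq> m.span W" using assms(2) unfolding fd_space_def by blast
  then have fin: "finite B" using m.independent_span_bound[of W B] B by blast
  have "\<exists>c. (\<forall>s\<in>B. c s \<in> acar A) \<and> v = (\<Sum>s\<in>B. mact M s (c s))" if v: "v \<in> mcar M" for v
  proof -
    have "v \<in> m.span B" using B(3) v by blast
    then obtain u where u: "v = (\<Sum>s\<in>B. mscl M (u s) s)"
      unfolding m.span_finite[OF fin] by blast
    have "v = (\<Sum>s\<in>B. mact M s (ascl A (u s) (aone A)))"
      unfolding u using B(1) by (intro sum.cong refl) (simp add: act_scl2 one_in act_one subset_iff)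
    then show ?thesis using A_scl one_in by (intro exI[of _ "\<lambda>s. ascl A (u s) (aone A)"]) auto
  qed
  then show ?thesis unfolding fg_mod_def using assms(1) fin B(1) by blast
qed

text \<open>The simple module S(s), realised in the zeroth coordinate of \<open>nat => 'k\<close>.
  The ambient type is dictated by \<open>projective_mod\<close>, which quantifies over test modules
  in this type only.\<close>

definition simple_test :: "'q \<Rightarrow> ('k, 'a) umod" where
  "simple_test s = \<lparr>mcar = {f. \<forall>n\<ge>1. f n = 0}, mscl = fun_scl (*),
     mact = (\<lambda>f x n. if n = 0 then cf x s s * f 0 else 0)\<rparr>"

text \<open>The uniserial module with top S(s) and socle S(t): coordinate 0 is the component at s,
  coordinate 1 the component at t, and the arrow from s to t carries the first to the
  second.\<close>

definition arrow_test :: "'q \<Rightarrow> 'q \<Rightarrow> ('k, 'a) umod" where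
  "arrow_test s t = \<lparr>mcar = {f. \<forall>n\<ge>2. f n = 0}, mscl = fun_scl (*),
     mact = (\<lambda>f x n. if n = 0 then cf x s s * f 0
       else if n = 1 then cf x s t * f 0 + cf x t t * f 1 else 0)\<rparr>"

lemma subspace_vanishing:
  "module.subspace (fun_scl (*)) {f :: nat \<Rightarrow> 'k. \<forall>n\<ge>k. f n = 0}"
proof -
  interpret vector_space "fun_scl (*) :: 'k \<Rightarrow> (nat \<Rightarrow> 'k) \<Rightarrow> _"
    by (rule vector_space_fun_scl[OF vector_space_mult])
  show ?thesis by (rule subspaceI) (auto simp: fun_scl_def)
qed

lemma fd_vanishing: "fd_space (fun_scl (*)) {f :: nat \<Rightarrow> 'k. \<forall>n\<ge>k. f n = 0}"
proof -
  have "{f :: nat \<Rightarrow> 'k. \<forall>n\<ge>k. f n = 0} = prod_space {..<k} (\<lambda>_. UNIV)"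
    by (auto simp: prod_space_def)
  then show ?thesis
    using prod_space_dim[OF vector_space_mult, of "{..<k}" "\<lambda>_. UNIV :: 'k set"] fd_space_field
    by auto
qed

lemma fg_simple_test:
  assumes "s \<in> V" shows "fg_mod A (simple_test s)"
proof (rule fg_of_fd)
  show "is_rmod A (simple_test s)"
    unfolding is_rmod_def
    using assms
    by (auto simp: simple_test_def vector_space_fun_scl[OF vector_space_mult] subspace_vanishing
        cf_add cf_scl cf_mul_diag cf_one fun_scl_def algebra_simps fun_eq_iff)
qed (simp add: simple_test_def fd_vanishing)

lemma fg_arrow_test:
  assumes "(s, t) \<in> E" shows "fg_mod A (arrow_test s t)"
proof (rule fg_of_fd)
  have two: "f n = 0" if "\<forall>n\<ge>2. f n = 0" "n \<noteq> 0" "n \<noteq> Suc 0" for f :: "nat \<Rightarrow> 'k" and n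
    using that by auto
  show "is_rmod A (arrow_test s t)"
    unfolding is_rmod_def
    using E_neq[OF assms] E_V[OF assms] assms
    by (auto simp: arrow_test_def vector_space_fun_scl[OF vector_space_mult] subspace_vanishing
        cf_add cf_scl cf_mul_diag cf_mul_arrow cf_one fun_scl_def algebra_simps fun_eq_iff two)
qed (simp add: arrow_test_def fd_vanishing)

text \<open>
  For a projective \<open>P\<close> and an arrow \<open>s \<rightarrow> t\<close>, lifting along the surjection from the
  two-dimensional uniserial module at \<open>s \<rightarrow> t\<close> to its top shows that functionals on \<open>P e\<^sub>s\<close>
  can be transported to \<open>P e\<^sub>t\<close>; this is the only consequence of projectivity that is needed.
\<close>

lemma projective_functional:
  fixes P :: "('k, 'a, 'v::ab_group_add) rmod"
  assumes P: "projective_mod A P" and st: "(s, t) \<in> E"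
    and l: "lin_on (mscl P) (*) (piece P s) l"
  shows "\<exists>\<mu>. lin_on (mscl P) (*) (piece P t) \<mu> \<and>
    (\<forall>s' v. (s', t) \<in> E \<and> v \<in> piece P s' \<longrightarrow> \<mu> (mact P v (b s' t)) = (if s' = s then l v else 0))"
proof -
  have fgP: "fg_mod A P" using P by (simp add: projective_mod_def)
  interpret P: bip_module A V E b cf P by (rule fg_module) fact
  let ?X = "arrow_test s t" and ?Y = "simple_test s"
  have sV: "s \<in> V" and tV: "t \<in> V" and ne: "s \<noteq> t" using E_V[OF st] E_neq[OF st] by auto
  interpret X: bip_module A V E b cf ?X by (rule fg_module[OF fg_arrow_test[OF st]])
  interpret Y: bip_module A V E b cf ?Y by (rule fg_module[OF fg_simple_test[OF sV]])
  let ?g = "\<lambda>f. if f \<in> mcar ?X then (\<lambda>n::nat. if n = 0 then f 0 else 0) else 0"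
  have g: "?g \<in> hom_mod A ?X ?Y"
    unfolding hom_mod_def using X.car_add X.car_scl X.act_in
    by (auto simp: simple_test_def arrow_test_def fun_scl_def fun_eq_iff)
  have gs: "?g ` mcar ?X = mcar ?Y"
  proof -
    have "f = ?g f" "f \<in> mcar ?X" if "f \<in> mcar ?Y" for f
      using that by (auto simp: simple_test_def arrow_test_def fun_eq_iff)
    moreover have "?g f \<in> mcar ?Y" for f by (auto simp: simple_test_def)
    ultimately show ?thesis by blast
  qed
  \<comment> \<open>The functional l becomes a homomorphism to S(s) when extended by 0 at the other
    vertices: no arrow ends at the source s, so nothing has to be respected.\<close>
  define H where "H = (\<lambda>i v. if i = s then (\<lambda>n::nat. if n = 0 then l v else 0) else 0)"
  have "\<exists>f\<in>hom_mod A P ?Y. \<forall>i\<in>V. \<forall>v\<in>piece P i. f v = H i v"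
  proof (rule hom_from_pieces[OF P.rmod Y.rmod])
    show "lin_on (mscl P) (mscl ?Y) (piece P i) (H i)" if "i \<in> V" for i
      using lin_on_add[OF l] lin_on_scl[OF l]
      by (auto simp: lin_on_def H_def simple_test_def fun_scl_def fun_eq_iff)
    show "H i v \<in> piece ?Y i" if "i \<in> V" for i v
      using that by (auto simp: H_def piece_def simple_test_def cf_b_diag fun_eq_iff)
    show "H j (mact P v (b i j)) = mact ?Y (H i v) (b i j)" if "(i, j) \<in> E" for i j v
      using bipartite[OF that] st E_neq[OF that] cf_b_arrow[OF that, of s s]
      by (auto simp: H_def simple_test_def fun_eq_iff)
  qed
  then obtain f where fY: "f \<in> hom_mod A P ?Y" and
    fv: "\<And>i v. i \<in> V \<Longrightarrow> v \<in> piece P i \<Longrightarrow> f v = H i v" by blast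
  obtain h where h: "h \<in> hom_mod A P ?X" "\<And>v. v \<in> mcar P \<Longrightarrow> ?g (h v) = f v"
    using P fg_arrow_test[OF st] fg_simple_test[OF sV] g gs fY unfolding projective_mod_def by blast
  \<comment> \<open>The top coordinate of the lift is forced to be l. Since the arrow moves
    coordinate 0 to coordinate 1, the socle coordinate of the lift is the functional sought.\<close>
  have h0: "h v 0 = (if i = s then l v else 0)" if "v \<in> piece P i" "i \<in> V" for v i
    using h(2)[OF P.piece_car[OF that(1)]] hom_car[OF h(1) P.piece_car[OF that(1)]] fv[OF that(2,1)]
    by (auto simp: H_def fun_eq_iff split: if_splits)
  show ?thesis
  proof (intro exI[of _ "\<lambda>v. h v 1"] conjI allI impI)
    show "lin_on (mscl P) (*) (piece P t) (\<lambda>v. h v 1)"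
      using hom_add[OF h(1)] hom_scl[OF h(1)] P.piece_car
      by (auto simp: lin_on_def arrow_test_def fun_scl_def)
    fix s' v assume *: "(s', t) \<in> E \<and> v \<in> piece P s'"
    then have "h (mact P v (b s' t)) = mact ?X (h v) (b s' t)"
      using hom_act[OF h(1) P.piece_car] b_in_arrow by blast
    then show "h (mact P v (b s' t)) 1 = (if s' = s then l v else 0)"
      using * h0[of v s'] E_V(1) ne E_neq[of s' t] by (auto simp: arrow_test_def cf_b_arrow)
  qed
qed

section \<open>The multiplication table and homomorphisms into the regular module\<close>

lemma cf_mul_right_diag:
  assumes "x \<in> acar A" "i \<in> V"
  shows "cf (amul A x (b i i)) k j = (if j = i then cf x k j else 0)"
proof (cases "(k, j) \<in> R")
  case True
  then show ?thesis
    using assms E_neq[of k j]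
    by (auto simp: cf_mul_diag cf_mul_arrow b_in_diag cf_b_diag E_irrefl)
next
  case False
  then show ?thesis using assms cf_off[of x k j] cf_off[of "amul A x (b i i)" k j]
    by (auto simp: mul_in b_in_diag)
qed

lemma cf_mul_left_diag:
  assumes "x \<in> acar A" "i \<in> V"
  shows "cf (amul A (b i i) x) k j = (if k = i then cf x k j else 0)"
proof (cases "(k, j) \<in> R")
  case True
  then show ?thesis
    using assms E_neq[of k j]
    by (auto simp: cf_mul_diag cf_mul_arrow b_in_diag cf_b_diag E_irrefl)
next
  case False
  then show ?thesis using assms cf_off[of x k j] cf_off[of "amul A (b i i) x" k j]
    by (auto simp: mul_in b_in_diag)
qed

lemma cf_mul_right_arrow:
  assumes "x \<in> acar A" "(s, t) \<in> E"
  shows "cf (amul A x (b s t)) k j = (if k = s \<and> j = t then cf x s s else 0)"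
proof (cases "(k, j) \<in> R")
  case True
  then show ?thesis
    using assms E_neq[of k j] E_neq[of s t] bipartite[of k j]
    by (auto simp: cf_mul_diag cf_mul_arrow b_in_arrow cf_b_arrow E_irrefl)
next
  case False
  then show ?thesis using assms cf_off[of "amul A x (b s t)" k j]
    by (auto simp: mul_in b_in_arrow)
qed

lemma cf_mul_left_arrow:
  assumes "x \<in> acar A" "(s, t) \<in> E"
  shows "cf (amul A (b s t) x) k j = (if k = s \<and> j = t then cf x t t else 0)"
proof (cases "(k, j) \<in> R")
  case True
  then show ?thesis
    using assms E_neq[of k j] E_neq[of s t] bipartite[of s t]
    by (auto simp: cf_mul_diag cf_mul_arrow b_in_arrow cf_b_arrow E_irrefl)
next
  case False
  then show ?thesis using assms cf_off[of "amul A (b s t) x" k j]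
    by (auto simp: mul_in b_in_arrow)
qed

lemma mul_assoc:
  assumes "x \<in> acar A" "y \<in> acar A" "z \<in> acar A"
  shows "amul A x (amul A y z) = amul A (amul A x y) z"
  by (rule cf_ext2)
    (use assms E_V in \<open>simp_all add: mul_in cf_mul_diag cf_mul_arrow algebra_simps\<close>)

lemma mul_add_left: "x \<in> acar A \<Longrightarrow> y \<in> acar A \<Longrightarrow> z \<in> acar A \<Longrightarrow>
    amul A (x + y) z = amul A x z + amul A y z"
  by (rule cf_ext2) (simp_all add: mul_in A_add cf_add cf_mul_diag cf_mul_arrow algebra_simps)

lemma mul_add_right: "x \<in> acar A \<Longrightarrow> y \<in> acar A \<Longrightarrow> z \<in> acar A \<Longrightarrow>
    amul A x (y + z) = amul A x y + amul A x z"
  by (rule cf_ext2) (simp_all add: mul_in A_add cf_add cf_mul_diag cf_mul_arrow algebra_simps)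

lemma mul_scl_left: "x \<in> acar A \<Longrightarrow> y \<in> acar A \<Longrightarrow> amul A (ascl A c x) y = ascl A c (amul A x y)"
  by (rule cf_ext2) (simp_all add: mul_in A_scl cf_scl cf_mul_diag cf_mul_arrow algebra_simps)

lemma mul_scl_right: "x \<in> acar A \<Longrightarrow> y \<in> acar A \<Longrightarrow> amul A x (ascl A c y) = ascl A c (amul A x y)"
  by (rule cf_ext2) (simp_all add: mul_in A_scl cf_scl cf_mul_diag cf_mul_arrow algebra_simps)

lemma mul_one_right: "x \<in> acar A \<Longrightarrow> amul A x (aone A) = x"
  by (rule cf_ext2)
    (auto simp add: mul_in one_in cf_mul_diag cf_mul_arrow cf_one dest: E_V)

lemma mul_one_left: "x \<in> acar A \<Longrightarrow> amul A (aone A) x = x"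
  by (rule cf_ext2)
    (auto simp add: mul_in one_in cf_mul_diag cf_mul_arrow cf_one dest: E_V)

lemma reg_rmod: "is_rmod A (reg_mod A)"
  unfolding is_rmod_def reg_mod_def
  by (simp add: vs_A sub_A mul_in mul_add_left mul_add_right mul_scl_left mul_scl_right
      mul_one_right mul_assoc)

lemma hom_reg_car: "mcar (hom_reg A P) = hom_mod A P (reg_mod A)"
  and hom_reg_scl: "mscl (hom_reg A P) = fun_scl (ascl A)"
  and hom_reg_act: "mact (hom_reg A P) h x = (\<lambda>v. amul A x (h v))"
  by (simp_all add: hom_reg_def fun_scl_def fun_eq_iff)

lemma mul_zero_right: "x \<in> acar A \<Longrightarrow> amul A x 0 = 0"
  by (rule cf_ext2) (simp_all add: mul_in A_zero cf_mul_diag cf_mul_arrow)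

lemma hom_reg_rmod:
  assumes "is_rmod A P" shows "is_rmod (op_alg A) (hom_reg A P)"
proof -
  interpret P: bip_module A V E b cf P by (rule rmod_module) fact
  interpret va: vector_space "ascl A" by (rule vs_A)
  interpret f: vector_space "fun_scl (ascl A) :: 'k \<Rightarrow> ('c \<Rightarrow> 'a) \<Rightarrow> _"
    by (rule vector_space_fun_scl[OF vs_A])
  let ?H = "hom_mod A P (reg_mod A)"
  have H: "h \<in> ?H \<longleftrightarrow> (\<forall>v. v \<notin> mcar P \<longrightarrow> h v = 0) \<and> (\<forall>v\<in>mcar P. h v \<in> acar A) \<and>
    (\<forall>v\<in>mcar P. \<forall>w\<in>mcar P. h (v + w) = h v + h w) \<and>
    (\<forall>c. \<forall>v\<in>mcar P. h (mscl P c v) = ascl A c (h v)) \<and>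
    (\<forall>v\<in>mcar P. \<forall>x\<in>acar A. h (mact P v x) = amul A (h v) x)" for h
    by (simp add: hom_mod_def reg_mod_def)
  have val: "h v \<in> acar A" if "h \<in> ?H" for h v
    using that A_zero by (cases "v \<in> mcar P") (auto simp: H)
  have sub: "f.subspace ?H"
  proof (rule f.subspaceI)
    show "0 \<in> ?H" unfolding H
      by (auto simp: A_zero fun_eq_iff) (metis mul_scl_left A_zero va.scale_zero_left mul_in)
    show "h + h' \<in> ?H" if "h \<in> ?H" "h' \<in> ?H" for h h'
      using that unfolding H by (auto simp: A_add mul_add_left va.scale_right_distrib)
    show "fun_scl (ascl A) c h \<in> ?H" if "h \<in> ?H" for c h
      using that unfolding H fun_scl_def
      by (auto simp: A_scl mul_scl_left va.scale_right_distrib mult.commute)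
  qed
  have act: "(\<lambda>v. amul A x (h v)) \<in> ?H" if "h \<in> ?H" "x \<in> acar A" for h x
    using that unfolding H
    by (auto simp: mul_in mul_add_right mul_scl_right mul_assoc mul_zero_right)
  show ?thesis
    unfolding is_rmod_def hom_reg_car hom_reg_scl hom_reg_act
    using sub act f.vector_space_axioms val
    by (auto simp: op_alg_def mul_add_right mul_add_left mul_scl_right mul_scl_left mul_one_left
        mul_assoc mul_in one_in fun_scl_def fun_eq_iff)
qed

text \<open>The right ideal e_k A has the basis \<open>b k i\<close>, so a homomorphism into it is a
  family of functionals on the components of P. Right multiplication by an arrow is nonzero only on
  \<open>b k k\<close>, which gives the condition on \<open>m\<close>.\<close>

lemma hom_reg_from_row:
  fixes P :: "('k, 'a, 'v::ab_group_add) rmod"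
  assumes P: "is_rmod A P" and k: "k \<in> V"
    and lin: "\<And>i. (k, i) \<in> R \<Longrightarrow> lin_on (mscl P) (*) (piece P i) (m i)"
    and arrow: "\<And>i j v. (i, j) \<in> E \<Longrightarrow> (k, j) \<in> R \<Longrightarrow> v \<in> piece P i \<Longrightarrow>
      m j (mact P v (b i j)) = (if i = k then m i v else 0)"
  shows "\<exists>h\<in>hom_mod A P (reg_mod A). \<forall>i\<in>V. \<forall>v\<in>piece P i.
    h v = (if (k, i) \<in> R then ascl A (m i v) (b k i) else 0)"
proof -
  interpret P: bip_module A V E b cf P by (rule rmod_module) fact
  interpret va: vector_space "ascl A" by (rule vs_A)
  define H where "H = (\<lambda>i v. if (k, i) \<in> R then ascl A (m i v) (b k i) else 0)"
  have diag: "amul A (b k i) (b i i) = b k i" if "(k, i) \<in> R" for i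
    using that by (auto simp: mul_diag_diag mul_arrow_diag E_V)
  have "\<exists>h\<in>hom_mod A P (reg_mod A). \<forall>i\<in>V. \<forall>v\<in>piece P i. h v = H i v"
  proof (rule hom_from_pieces[OF P reg_rmod])
    show "lin_on (mscl P) (mscl (reg_mod A)) (piece P i) (H i)" for i
    proof (cases "(k, i) \<in> R")
      case True
      then show ?thesis using lin_on_add[OF lin[OF True]] lin_on_scl[OF lin[OF True]]
        by (auto simp: lin_on_def H_def reg_mod_def va.scale_left_distrib)
    qed (auto simp: lin_on_def H_def reg_mod_def)
    show "H i v \<in> piece (reg_mod A) i" if "i \<in> V" for i v
    proof (cases "(k, i) \<in> R")
      case True
      then show ?thesis using diag[OF True] b_in[OF True] that
        by (simp add: H_def piece_def reg_mod_def A_scl mul_scl_left b_in_diag)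
    next
      case False
      then have "H i v = 0" unfolding H_def by (simp only: if_False)
      moreover have "amul A 0 (b i i) = 0"
        using mul_scl_left[OF A_zero b_in_diag[OF that], of 0] by simp
      ultimately show ?thesis by (simp add: piece_def reg_mod_def A_zero)
    qed
    show "H j (mact P v (b i j)) = mact (reg_mod A) (H i v) (b i j)"
      if ij: "(i, j) \<in> E" and v: "v \<in> piece P i" for i j v
    proof -
      have z: "amul A 0 (b i j) = 0"
        using mul_scl_left[OF A_zero b_in_arrow[OF ij], of 0] by simp
      \<comment> \<open>No arrow ends where another starts, so row k has an entry at the tail i of
        an arrow only when i = k.\<close>
      consider "i = k" | "i \<noteq> k" "(k, i) \<notin> R" using ij bipartite by blast
      then show ?thesis
      proof cases
        case 1
        then have "(k, j) \<in> R" "(k, i) \<in> R" using ij k by auto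
        then show ?thesis
          using arrow[OF ij _ v] 1 ij k
          by (simp add: H_def reg_mod_def mul_scl_left b_in_diag b_in_arrow mul_diag_arrow)
      next
        case 2
        have "H j (mact P v (b i j)) = 0"
          using arrow[OF ij _ v] 2 by (simp add: H_def)
        moreover have "H i v = 0" using 2(2) unfolding H_def by (simp only: if_False)
        ultimately show ?thesis using z by (simp add: reg_mod_def)
      qed
    qed
  qed
  then show ?thesis unfolding H_def by blast
qed

end

section \<open>The Auslander--Reiten translate as a double reflection\<close>

context bipartite_algebra begin

text \<open>For \<open>X = piece M\<close> this is the component at t of the radical of M.\<close>

definition arrow_sums where
  "arrow_sums M X t = {\<Sum>s\<in>inn t. mact M (m s) (b s t) | m. \<forall>s\<in>inn t. m s \<in> X s}"

lemma arrow_sums_subspace: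
  assumes M: "is_rmod A M" and X: "\<And>s. s \<in> inn t \<Longrightarrow> module.subspace (mscl M) (X s)"
    "\<And>s. s \<in> inn t \<Longrightarrow> X s \<subseteq> piece M s"
  shows "module.subspace (mscl M) (arrow_sums M X t)"
proof -
  interpret M: bip_module A V E b cf M by (rule rmod_module[OF M])
  have car: "m s \<in> mcar M" if "\<forall>s\<in>inn t. m s \<in> X s" "s \<in> inn t" for m s
    using that X(2) M.piece_car by blast
  show ?thesis
  proof (rule M.m.subspaceI)
    show "0 \<in> arrow_sums M X t"
      unfolding arrow_sums_def using M.m.subspace_0[OF X(1)] b_in_arrow
      by (intro CollectI exI[of _ "\<lambda>_. 0"]) (auto simp: M.act_zero)
    show "v + w \<in> arrow_sums M X t" if vw: "v \<in> arrow_sums M X t" "w \<in> arrow_sums M X t" for v w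
    proof -
      obtain q r where qr: "\<forall>s\<in>inn t. q s \<in> X s" "v = (\<Sum>s\<in>inn t. mact M (q s) (b s t))"
        "\<forall>s\<in>inn t. r s \<in> X s" "w = (\<Sum>s\<in>inn t. mact M (r s) (b s t))"
        using vw unfolding arrow_sums_def by blast
      then have "v + w = (\<Sum>s\<in>inn t. mact M (q s + r s) (b s t))"
        using car[OF qr(1)] car[OF qr(3)] b_in_arrow by (simp add: sum.distrib[symmetric] M.act_add)
      then show ?thesis
        unfolding arrow_sums_def using M.m.subspace_add[OF X(1)] qr
        by (intro CollectI exI[of _ "\<lambda>s. q s + r s"]) auto
    qed
    show "mscl M c v \<in> arrow_sums M X t" if v: "v \<in> arrow_sums M X t" for c v
    proof -
      obtain q where q: "\<forall>s\<in>inn t. q s \<in> X s" "v = (\<Sum>s\<in>inn t. mact M (q s) (b s t))"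
        using v unfolding arrow_sums_def by blast
      then have "mscl M c v = (\<Sum>s\<in>inn t. mact M (mscl M c (q s)) (b s t))"
        using car[OF q(1)] b_in_arrow by (simp add: M.m.scale_sum_right M.act_scl)
      then show ?thesis
        unfolding arrow_sums_def using M.m.subspace_scale[OF X(1)] q
        by (intro CollectI exI[of _ "\<lambda>s. mscl M c (q s)"]) auto
    qed
  qed
qed

lemma arrow_sums_piece:
  assumes M: "is_rmod A M" and t: "t \<in> V" and X: "\<And>s. s \<in> inn t \<Longrightarrow> X s \<subseteq> piece M s"
  shows "arrow_sums M X t \<subseteq> piece M t"
proof -
  interpret M: bip_module A V E b cf M by (rule rmod_module[OF M])
  have "(\<Sum>s\<in>inn t. mact M (m s) (b s t)) \<in> piece M t" if m: "\<forall>s\<in>inn t. m s \<in> X s" for m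
  proof (rule M.m.subspace_sum[OF M.piece_sub[OF t]])
    fix s assume s: "s \<in> inn t"
    then have "m s \<in> mcar M" using m X M.piece_car by blast
    then show "mact M (m s) (b s t) \<in> piece M t" using M.act_arrow s by blast
  qed
  then show ?thesis unfolding arrow_sums_def by blast
qed

lemma arrow_sums_single:
  assumes M: "is_rmod A M" and st: "(s, t) \<in> E" and v: "v \<in> X s" "X s \<subseteq> piece M s"
    and 0: "\<And>s'. s' \<in> inn t \<Longrightarrow> 0 \<in> X s'"
  shows "mact M v (b s t) \<in> arrow_sums M X t"
proof -
  interpret M: bip_module A V E b cf M by (rule rmod_module[OF M])
  have "mact M v (b s t) = (\<Sum>s'\<in>inn t. if s' = s then mact M v (b s t) else 0)" using st by simp
  also have "\<dots> = (\<Sum>s'\<in>inn t. mact M (if s' = s then v else 0) (b s' t))"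
    using b_in_arrow by (intro sum.cong refl) (auto simp: M.act_zero)
  finally show ?thesis
    unfolding arrow_sums_def using v 0
    by (intro CollectI exI[of _ "\<lambda>s'. if s' = s then v else 0"]) auto
qed

lemma superfluous_rad:
  assumes P: "is_rmod A P" and K: "superfluous A P K" and i: "i \<in> V" and x: "x \<in> K" "x \<in> piece P i"
  shows "\<exists>q. (\<forall>s\<in>inn i. q s \<in> piece P s) \<and> x = (\<Sum>s\<in>inn i. mact P (q s) (b s i))"
proof (rule ccontr)
  assume neg: "\<not> ?thesis"
  interpret P: bip_module A V E b cf P by (rule rmod_module) fact
  let ?rad = "arrow_sums P (piece P) i"
  have pc: "P.m.subspace (piece P s)" if "s \<in> inn i" for s using that P.piece_sub E_V by blast
  have sub: "P.m.subspace ?rad" by (rule arrow_sums_subspace[OF P pc]) auto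
  have "x \<notin> ?rad" using neg unfolding arrow_sums_def by blast
  then obtain l where l: "Vector_Spaces.linear (mscl P) (*) l" "\<forall>u\<in>?rad. l u = 0" "l x = (1::'k)"
    using functional_separates[OF P.vs sub] by blast
  interpret l: Vector_Spaces.linear "mscl P" "(*)" l by (rule l(1))
  \<comment> \<open>The kernel of v -> l(v e_i). It is a submodule because whatever an arrow brings
    to i lies in the radical, where l vanishes.\<close>
  let ?L = "{v \<in> mcar P. l (mact P v (b i i)) = 0}"
  have "submod_set A P ?L"
  proof (rule P.submodI)
    show "P.m.subspace ?L"
      using i by (intro P.m.subspaceI)
        (auto simp: P.car_zero P.car_add P.car_scl P.act_zero P.act_add P.act_scl b_in_diag
          l.zero l.add l.scale)
    fix v j k assume v: "v \<in> ?L" and jk: "(j, k) \<in> R"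
    have vc: "v \<in> mcar P" using v by simp
    have "l (mact P (mact P v (b j k)) (b i i)) = 0"
    proof (cases "j = k")
      case True
      then have j: "j \<in> V" using jk E_irrefl by auto
      show ?thesis
        using True v P.act_mul[OF vc b_in_diag[OF j] b_in_diag[OF i], symmetric]
          mul_diag_diag[OF j i] P.act_zero2[OF vc]
        by (cases "j = i") (simp_all add: l.zero)
    next
      case False
      then have E: "(j, k) \<in> E" using jk by auto
      show ?thesis
      proof (cases "k = i")
        case True
        have "mact P (mact P v (b j j)) (b j i) \<in> ?rad"
          using P.act_piece[OF vc E_V(1)[OF E]] P.m.subspace_0[OF pc] E True
          by (intro arrow_sums_single[OF P]) auto
        then have "mact P v (b j k) \<in> ?rad" using P.act_via_source[OF vc E] True by simp
        then have "l (mact P v (b j k)) = 0" using l(2) by blast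
        moreover have "mact P (mact P v (b j k)) (b i i) = mact P v (b j k)"
          using P.act_arrow[OF vc E] True by (simp add: piece_def)
        ultimately show ?thesis by simp
      next
        case False
        then show ?thesis
          using P.piece_act_other[OF P.act_arrow[OF vc E] E_V(2)[OF E] i] by (simp add: l.zero)
      qed
    qed
    then show "mact P v (b j k) \<in> ?L" using P.act_in[OF vc b_in[OF jk]] by simp
  qed auto
  moreover have "{l + v | l v. l \<in> ?L \<and> v \<in> K} = mcar P"
  proof -
    have KP: "K \<subseteq> mcar P" and Ksub: "P.m.subspace K"
      using K unfolding superfluous_def submod_set_def by auto
    have "\<exists>l' v. w = l' + v \<and> l' \<in> ?L \<and> v \<in> K" if w: "w \<in> mcar P" for w
    proof -
      \<comment> \<open>Since l x = 1, subtracting c times x brings w into \<open>?L\<close>, and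
        this multiple of x stays in K.\<close>
      define c where "c = l (mact P w (b i i))"
      have k: "mscl P c x \<in> K" using x P.m.subspace_scale[OF Ksub] by blast
      have dc: "w - mscl P c x \<in> mcar P" using w k KP P.m.subspace_diff[OF P.sub] by blast
      have "mact P ((w - mscl P c x) + mscl P c x) (b i i) =
          mact P (w - mscl P c x) (b i i) + mact P (mscl P c x) (b i i)"
        using dc k KP b_in_diag[OF i] P.act_add by blast
      then have "mact P w (b i i) = mact P (w - mscl P c x) (b i i) + mscl P c x"
        using P.act_scl[OF P.piece_car[OF x(2)] b_in_diag[OF i]] P.piece_act[OF x(2)] by simp
      then have "c = l (mact P (w - mscl P c x) (b i i)) + c"
        using l(3) unfolding c_def[symmetric] by (metis c_def l.add l.scale mult.right_neutral)
      then have "w - mscl P c x \<in> ?L" using dc by simp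
      moreover have "w = (w - mscl P c x) + mscl P c x" by simp
      ultimately show ?thesis using k by blast
    qed
    then show ?thesis using KP P.car_add by blast
  qed
  ultimately have "?L = mcar P" using K unfolding superfluous_def by blast
  then have "x \<in> ?L" using P.piece_car[OF x(2)] by blast
  then show False using l(3) P.piece_act[OF x(2)] by simp
qed

text \<open>The functional transported along one arrow picks out a single summand, so the arrows
  into t are jointly injective on a projective.\<close>

lemma projective_unique:
  assumes P: "projective_mod A P" and q: "\<And>s. s \<in> inn t \<Longrightarrow> q s \<in> piece P s"
    and 0: "(\<Sum>s\<in>inn t. mact P (q s) (b s t)) = 0" and s: "(s, t) \<in> E"
  shows "q s = 0"
proof (rule ccontr)
  assume ne: "q s \<noteq> 0"
  have "is_rmod A P" using P by (simp add: projective_mod_def fg_mod_def)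
  then interpret P: bip_module A V E b cf P by (rule rmod_module)
  obtain l where l: "Vector_Spaces.linear (mscl P) (*) l" "l (q s) = (1::'k)"
    using functional_nonzero[OF P.vs ne] by blast
  obtain \<mu> where \<mu>: "lin_on (mscl P) (*) (piece P t) \<mu>"
    "\<And>s' v. (s', t) \<in> E \<Longrightarrow> v \<in> piece P s' \<Longrightarrow> \<mu> (mact P v (b s' t)) = (if s' = s then l v else 0)"
    using projective_functional[OF P s lin_on_linear[OF l(1)]] by blast
  have "0 = \<mu> (\<Sum>s\<in>inn t. mact P (q s) (b s t))"
    using 0 lin_on_0[OF P.vs vector_space_mult P.piece_sub \<mu>(1)] E_V(2)[OF s] by simp
  also have "\<dots> = (\<Sum>s\<in>inn t. \<mu> (mact P (q s) (b s t)))"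
    using E_V(2)[OF s] P.act_arrow P.piece_car[OF q]
    by (intro lin_on_sum[OF P.vs vector_space_mult P.piece_sub \<mu>(1)]) auto
  also have "\<dots> = (\<Sum>s'\<in>inn t. if s' = s then l (q s) else 0)"
    using \<mu>(2) q by (intro sum.cong refl) auto
  also have "\<dots> = 1" using s l(2) by simp
  finally show False by simp
qed

text \<open>The two left exact sequences of the double reflection, with \<open>u s t\<close> the components \<open>N\<^sub>t \<rightarrow> M\<^sub>s\<close>.\<close>

definition ar_seq where
  "ar_seq M N u \<longleftrightarrow>
    (\<forall>s t. (s, t) \<in> E \<longrightarrow> lin_on (mscl N) (mscl M) (piece N t) (u s t) \<and>
      (\<forall>y\<in>piece N t. u s t y \<in> piece M s)) \<and>
    (\<forall>t\<in>sinks. \<forall>y\<in>piece N t. (\<Sum>s\<in>inn t. mact M (u s t y) (b s t)) = 0) \<and>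
    (\<forall>t\<in>sinks. \<forall>y\<in>piece N t. (\<forall>s\<in>inn t. u s t y = 0) \<longrightarrow> y = 0) \<and>
    (\<forall>t\<in>sinks. \<forall>m. (\<forall>s\<in>inn t. m s \<in> piece M s) \<and> (\<Sum>s\<in>inn t. mact M (m s) (b s t)) = 0 \<longrightarrow>
      (\<exists>y\<in>piece N t. \<forall>s\<in>inn t. u s t y = m s)) \<and>
    (\<forall>s\<in>sources. \<forall>z\<in>piece N s. (\<Sum>t\<in>outn s. u s t (mact N z (b s t))) = 0) \<and>
    (\<forall>s\<in>sources. \<forall>z\<in>piece N s. (\<forall>t\<in>outn s. mact N z (b s t) = 0) \<longrightarrow> z = 0) \<and>
    (\<forall>s\<in>sources. \<forall>y. (\<forall>t\<in>outn s. y t \<in> piece N t) \<and> (\<Sum>t\<in>outn s. u s t (y t)) = 0 \<longrightarrow>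
      (\<exists>z\<in>piece N s. \<forall>t\<in>outn s. mact N z (b s t) = y t))"

lemmas ar_seq_props = ar_seq_def[THEN iffD1]
lemmas ar_lin = ar_seq_props[THEN conjunct1, rule_format, THEN conjunct1]
lemmas ar_in = ar_seq_props[THEN conjunct1, rule_format, THEN conjunct2, rule_format]
lemmas ar_sink_sum = ar_seq_props[THEN conjunct2, THEN conjunct1, rule_format]
lemmas ar_sink_inj = ar_seq_props[THEN conjunct2, THEN conjunct2, THEN conjunct1, rule_format]
lemmas ar_sink_ex = ar_seq_props[THEN conjunct2, THEN conjunct2, THEN conjunct2, THEN conjunct1, rule_format]
lemmas ar_source_sum = ar_seq_props[THEN conjunct2, THEN conjunct2, THEN conjunct2, THEN conjunct2, THEN conjunct1, rule_format]
lemmas ar_source_inj = ar_seq_props[THEN conjunct2, THEN conjunct2, THEN conjunct2, THEN conjunct2, THEN conjunct2, THEN conjunct1, rule_format]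
lemmas ar_source_ex = ar_seq_props[THEN conjunct2, THEN conjunct2, THEN conjunct2, THEN conjunct2, THEN conjunct2, THEN conjunct2, rule_format]

lemma ar_seq_iso:
  assumes N: "is_rmod A N" and iso: "iso_mod A N N'" and seq: "ar_seq M N' u"
  shows "\<exists>u'. ar_seq M N u'"
proof -
  interpret N: bip_module A V E b cf N by (rule rmod_module) fact
  obtain g where g: "g \<in> hom_mod A N N'" "bij_betw g (mcar N) (mcar N')"
    using iso unfolding iso_mod_def by blast
  have inj: "y = y'" if "y \<in> mcar N" "y' \<in> mcar N" "g y = g y'" for y y'
    using that g(2) unfolding bij_betw_def inj_on_def by blast
  have g0: "g 0 = 0"
  proof -
    have "g 0 = g 0 + g 0" using hom_add[OF g(1) N.car_zero N.car_zero] by simp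
    then show ?thesis by simp
  qed
  have into: "g y \<in> piece N' i" if "y \<in> piece N i" "i \<in> V" for y i
    by (rule hom_piece[OF g(1) that])
  have onto: "\<exists>y\<in>piece N i. g y = z" if z: "z \<in> piece N' i" and i: "i \<in> V" for z i
  proof -
    obtain y where y: "y \<in> mcar N" "g y = z"
    proof -
      have "z \<in> g ` mcar N" using z g(2) by (simp add: piece_def bij_betw_def)
      then show ?thesis using that by auto
    qed
    have "g (mact N y (b i i)) = z"
      using hom_act[OF g(1) y(1) b_in_diag[OF i]] y(2) z by (simp add: piece_def)
    then have "mact N y (b i i) = y"
      using inj[OF N.act_in[OF y(1) b_in_diag[OF i]] y(1)] y(2) by simp
    then show ?thesis using y by (auto simp: piece_def)
  qed
  have arr: "g (mact N y (b s t)) = mact N' (g y) (b s t)" if "y \<in> piece N i" "(s, t) \<in> E" for y s t i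
    using hom_act[OF g(1) N.piece_car[OF that(1)] b_in_arrow[OF that(2)]] .
  have zero: "y = 0" if "y \<in> piece N i" "g y = 0" for y i
    using inj[OF N.piece_car[OF that(1)] N.car_zero] that g0 by simp
  show ?thesis
    unfolding ar_seq_def
  proof (intro exI[of _ "\<lambda>s t y. u s t (g y)"] conjI allI impI ballI)
    fix s t assume st: "(s, t) \<in> E"
    note u = ar_lin[OF seq st]
    show "lin_on (mscl N) (mscl M) (piece N t) (\<lambda>y. u s t (g y))"
      using lin_on_add[OF u into into] lin_on_scl[OF u into] E_V(2)[OF st] N.piece_car
      by (auto simp: lin_on_def hom_add[OF g(1)] hom_scl[OF g(1)])
    show "u s t (g y) \<in> piece M s" if "y \<in> piece N t" for y
      by (rule ar_in[OF seq st into[OF that E_V(2)[OF st]]])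
  next
    fix t y assume t: "t \<in> sinks" and y: "y \<in> piece N t"
    have tV: "t \<in> V" using t E_V by blast
    show "(\<Sum>s\<in>inn t. mact M (u s t (g y)) (b s t)) = 0"
      by (rule ar_sink_sum[OF seq t into[OF y tV]])
    assume *: "\<forall>s\<in>inn t. u s t (g y) = 0"
    have "g y = 0" by (rule ar_sink_inj[OF seq t into[OF y tV]]) (use * in blast)
    then show "y = 0" by (rule zero[OF y])
  next
    fix t m assume t: "t \<in> sinks"
      and m: "(\<forall>s\<in>inn t. m s \<in> piece M s) \<and> (\<Sum>s\<in>inn t. mact M (m s) (b s t)) = 0"
    have tV: "t \<in> V" using t E_V by blast
    obtain z where "z \<in> piece N' t" "\<forall>s\<in>inn t. u s t z = m s"
      using ar_sink_ex[OF seq t, of m] m by auto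
    then show "\<exists>y\<in>piece N t. \<forall>s\<in>inn t. u s t (g y) = m s" using onto[of z t] tV by auto
  next
    fix s z assume s: "s \<in> sources" and z: "z \<in> piece N s"
    have sV: "s \<in> V" using s by blast
    have "(\<Sum>t\<in>outn s. u s t (g (mact N z (b s t)))) = (\<Sum>t\<in>outn s. u s t (mact N' (g z) (b s t)))"
      using arr[OF z] by (intro sum.cong) auto
    then show "(\<Sum>t\<in>outn s. u s t (g (mact N z (b s t)))) = 0"
      using ar_source_sum[OF seq s into[OF z sV]] by simp
    assume "\<forall>t\<in>outn s. mact N z (b s t) = 0"
    then have *: "\<forall>t\<in>outn s. mact N' (g z) (b s t) = 0" using arr[OF z, symmetric] g0 by auto
    have "g z = 0" by (rule ar_source_inj[OF seq s into[OF z sV]]) (use * in blast)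
    then show "z = 0" by (rule zero[OF z])
  next
    fix s y assume s: "s \<in> sources"
      and y: "(\<forall>t\<in>outn s. y t \<in> piece N t) \<and> (\<Sum>t\<in>outn s. u s t (g (y t))) = 0"
    have sV: "s \<in> V" using s by blast
    have "\<forall>t\<in>outn s. g (y t) \<in> piece N' t" using y into E_V(2) by auto
    then obtain z' where z': "z' \<in> piece N' s" "\<forall>t\<in>outn s. mact N' z' (b s t) = g (y t)"
      using ar_source_ex[OF seq s, of "\<lambda>t. g (y t)"] y by auto
    obtain z where z: "z \<in> piece N s" "g z = z'" using onto[OF z'(1) sV] by blast
    have "mact N z (b s t) = y t" if "t \<in> outn s" for t
    proof (rule inj)
      show "mact N z (b s t) \<in> mcar N" using that N.act_in N.piece_car[OF z(1)] b_in_arrow by blast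
      show "y t \<in> mcar N" using that y N.piece_car by blast
      show "g (mact N z (b s t)) = g (y t)" using arr[OF z(1)] z z' that by auto
    qed
    then show "\<exists>z\<in>piece N s. \<forall>t\<in>outn s. mact N z (b s t) = y t" using z(1) by blast
  qed
qed

section \<open>The kernel of \<nu>f for a minimal presentation\<close>

lemma dual_apply_sum:
  assumes P: "is_rmod A P" and \<phi>: "\<phi> \<in> mcar (nak A P)" and h: "\<And>i. i \<in> I \<Longrightarrow> h i \<in> hom_mod A P (reg_mod A)"
  shows "\<phi> (\<Sum>i\<in>I. h i) = (\<Sum>i\<in>I. \<phi> (h i))"
proof -
  interpret op: bipartite_algebra "op_alg A" V "E\<inverse>" "\<lambda>i j. b j i" "\<lambda>x i j. cf x j i" by (rule op_bipartite)
  interpret H: bip_module "op_alg A" V "E\<inverse>" "\<lambda>i j. b j i" "\<lambda>x i j. cf x j i" "hom_reg A P"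
    by (rule op.rmod_module[OF hom_reg_rmod[OF P]])
  have lin: "lin_on (mscl (hom_reg A P)) (*) (mcar (hom_reg A P)) \<phi>"
    using \<phi> by (simp add: nak_def dual_mod_def lin_on_def)
  show ?thesis
    by (rule lin_on_sum[OF H.vs vector_space_mult H.sub lin]) (simp add: h hom_reg_car)
qed

lemma hom_reg_val: "h \<in> hom_mod A P (reg_mod A) \<Longrightarrow> h v \<in> acar A"
  using A_zero by (cases "v \<in> mcar P") (auto simp: hom_mod_def reg_mod_def)

lemma hom_reg_act_in:
  assumes "is_rmod A P" "h \<in> hom_mod A P (reg_mod A)" "x \<in> acar A"
  shows "(\<lambda>v. amul A x (h v)) \<in> hom_mod A P (reg_mod A)"
proof -
  have "is_rmod (op_alg A) (hom_reg A P)" by (rule hom_reg_rmod[OF assms(1)])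
  then show ?thesis using assms(2,3) unfolding is_rmod_def by (simp add: hom_reg_car hom_reg_act op_alg_def)
qed

lemma hom_reg_mul: "h \<in> hom_mod A P (reg_mod A) \<Longrightarrow> v \<in> mcar P \<Longrightarrow> x \<in> acar A \<Longrightarrow>
    h (mact P v x) = amul A (h v) x"
  by (simp add: hom_mod_def reg_mod_def)

lemma min_pres_structure:
  fixes P1 P0 :: "('k, 'a) umod" and M :: "('k, 'a, 'w::ab_group_add) rmod"
  assumes pres: "min_proj_pres A P1 f P0 p M" and M: "is_rmod A M"
  shows min_pres_source: "\<And>s. s \<in> sources \<Longrightarrow> piece P1 s = {0}"
    and min_pres_inj: "\<And>t w. t \<in> V \<Longrightarrow> w \<in> piece P1 t \<Longrightarrow> f w = 0 \<Longrightarrow> w = 0"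
    and min_pres_inj0: "\<And>s x. s \<in> sources \<Longrightarrow> x \<in> piece P0 s \<Longrightarrow> p x = 0 \<Longrightarrow> x = 0"
    and min_pres_rad: "\<And>t x. t \<in> sinks \<Longrightarrow> x \<in> piece P0 t \<Longrightarrow> p x = 0 \<Longrightarrow>
      \<exists>q. (\<forall>s\<in>inn t. q s \<in> piece P0 s) \<and> x = (\<Sum>s\<in>inn t. mact P0 (q s) (b s t))"
proof -
  have rm: "is_rmod A P1" "is_rmod A P0"
    using pres by (auto simp: min_proj_pres_def projective_mod_def fg_mod_def)
  interpret P1: bip_module A V E b cf P1 by (rule rmod_module[OF rm(1)])
  interpret P0: bip_module A V E b cf P0 by (rule rmod_module[OF rm(2)])
  have f: "f \<in> hom_mod A P1 P0" and im: "f ` mcar P1 = {v \<in> mcar P0. p v = 0}"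
    and sup: "superfluous A P0 {v \<in> mcar P0. p v = 0}" "superfluous A P1 {v \<in> mcar P1. f v = 0}"
    using pres by (auto simp: min_proj_pres_def)
  have rad: "\<exists>q. (\<forall>s\<in>inn i. q s \<in> piece P0 s) \<and> x = (\<Sum>s\<in>inn i. mact P0 (q s) (b s i))"
    if "i \<in> V" "x \<in> piece P0 i" "p x = 0" for i x
    by (rule superfluous_rad[OF rm(2) sup(1) that(1) _ that(2)]) (use that P0.piece_car in auto)
  have rad1: "\<exists>q. (\<forall>s\<in>inn i. q s \<in> piece P1 s) \<and> w = (\<Sum>s\<in>inn i. mact P1 (q s) (b s i))"
    if "i \<in> V" "w \<in> piece P1 i" "f w = 0" for i w
    by (rule superfluous_rad[OF rm(1) sup(2) that(1) _ that(2)]) (use that P1.piece_car in auto)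
  have no_in: "inn s = {}" if "s \<in> sources" for s using that by auto
  show inj0: "x = 0" if "s \<in> sources" "x \<in> piece P0 s" "p x = 0" for s x
    using rad[of s x] that no_in[OF that(1)] by simp
  show src: "piece P1 s = {0}" if s: "s \<in> sources" for s
  proof -
    have sV: "s \<in> V" using s by blast
    have "w = 0" if w: "w \<in> piece P1 s" for w
    proof -
      have "f w \<in> {v \<in> mcar P0. p v = 0}" using im P1.piece_car[OF w] by blast
      then have "f w = 0" using inj0[OF s hom_piece[OF f w sV]] by simp
      then show ?thesis using rad1[OF sV w] no_in[OF s] by simp
    qed
    then show ?thesis using P1.m.subspace_0[OF P1.piece_sub[OF sV]] by blast
  qed
  show "w = 0" if t: "t \<in> V" and w: "w \<in> piece P1 t" "f w = 0" for t w
  proof -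
    obtain q where q: "\<forall>s\<in>inn t. q s \<in> piece P1 s" "w = (\<Sum>s\<in>inn t. mact P1 (q s) (b s t))"
      using rad1[OF t w] by blast
    have "q s = 0" if "s \<in> inn t" for s using src[OF E_source] q(1) that by blast
    then show ?thesis using q(2) P1.act_zero[OF b_in_arrow] by simp
  qed
  show "\<exists>q. (\<forall>s\<in>inn t. q s \<in> piece P0 s) \<and> x = (\<Sum>s\<in>inn t. mact P0 (q s) (b s t))"
    if "t \<in> sinks" "x \<in> piece P0 t" "p x = 0" for t x
    by (rule rad) (use that E_V in auto)
qed

text \<open>At a sink, e_t A is the line spanned by \<open>b t t\<close>. If P has no source
  components, no arrow imposes a condition, and every functional on P e_t is a homomorphism.\<close>

lemma hom_reg_sink:
  assumes P: "is_rmod A P" and t: "t \<in> sinks"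
    and src: "\<And>s. s \<in> sources \<Longrightarrow> piece P s = {0}"
    and l: "lin_on (mscl P) (*) (piece P t) l"
  shows "(\<lambda>v. if v \<in> mcar P then ascl A (l (mact P v (b t t))) (b t t) else 0) \<in> hom_mod A P (reg_mod A)"
proof -
  interpret P: bip_module A V E b cf P by (rule rmod_module[OF P])
  interpret va: vector_space "ascl A" by (rule vs_A)
  have tV: "t \<in> V" using t E_V by blast
  have tt: "(t, i) \<in> R \<longleftrightarrow> i = t" for i using t tV bipartite by auto
  have l0: "l 0 = 0" by (rule lin_on_0[OF P.vs vector_space_mult P.piece_sub[OF tV] l])
  have "\<exists>h\<in>hom_mod A P (reg_mod A). \<forall>i\<in>V. \<forall>v\<in>piece P i.
      h v = (if (t, i) \<in> R then ascl A (l v) (b t i) else 0)"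
  proof (rule hom_reg_from_row[OF P tV, where m = "\<lambda>_. l"])
    fix i j v assume ij: "(i, j) \<in> E" "(t, j) \<in> R" "v \<in> piece P i"
    then have "v = 0" "i \<noteq> t" using src[OF E_source[OF ij(1)]] t bipartite by auto
    then show "l (mact P v (b i j)) = (if i = t then l v else 0)"
      using P.act_zero[OF b_in_arrow[OF ij(1)]] l0 by simp
  qed (use l tt in auto)
  then obtain h where h: "h \<in> hom_mod A P (reg_mod A)"
    "\<And>i v. i \<in> V \<Longrightarrow> v \<in> piece P i \<Longrightarrow> h v = (if i = t then ascl A (l v) (b t i) else 0)"
    using tt by auto
  have "h v = ascl A (l (mact P v (b t t))) (b t t)" if v: "v \<in> mcar P" for v
  proof -
    have "h v = h (\<Sum>i\<in>V. mact P v (b i i))" using P.piece_decomp[OF v] by simp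
    also have "\<dots> = (\<Sum>i\<in>V. h (mact P v (b i i)))"
      using P.act_in[OF v] b_in_diag vs_A
      by (intro lin_on_sum[OF P.vs _ P.sub hom_lin[OF h(1)]]) (auto simp: reg_mod_def)
    also have "\<dots> = (\<Sum>i\<in>V. if i = t then ascl A (l (mact P v (b t t))) (b t t) else 0)"
      using h(2) P.act_piece[OF v] by (intro sum.cong refl) auto
    finally show ?thesis using finite_V tV by simp
  qed
  moreover have "h v = 0" if "v \<notin> mcar P" for v using hom_off[OF h(1) that] .
  ultimately have "h = (\<lambda>v. if v \<in> mcar P then ascl A (l (mact P v (b t t))) (b t t) else 0)"
    by auto
  then show ?thesis using h(1) by simp
qed

lemma nak_car: "\<phi> \<in> mcar (nak A P) \<longleftrightarrow> (\<forall>h. h \<notin> hom_mod A P (reg_mod A) \<longrightarrow> \<phi> h = 0) \<and>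
    lin_on (fun_scl (ascl A)) (*) (hom_mod A P (reg_mod A)) \<phi>"
  unfolding hom_reg_scl[symmetric, of P] hom_reg_car[symmetric, of P]
  by (auto simp: nak_def dual_mod_def lin_on_def)

lemma nak_act: "h \<in> hom_mod A P (reg_mod A) \<Longrightarrow> mact (nak A P) \<phi> x h = \<phi> (\<lambda>v. amul A x (h v))"
  "h \<notin> hom_mod A P (reg_mod A) \<Longrightarrow> mact (nak A P) \<phi> x h = 0"
  by (auto simp: nak_def dual_mod_def hom_reg_car hom_reg_act)

lemma nak_scl: "mscl (nak A P) = fun_scl (*)"
  by (simp add: nak_def dual_mod_def fun_scl_def fun_eq_iff)

text \<open>
  The minimal presentation has \<open>P\<^sub>1\<close> concentrated in the sinks, so a homomorphism from \<open>P\<^sub>1\<close>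
  to \<open>A\<close> is a family of functionals on the spaces \<open>P\<^sub>1 e\<^sub>t\<close>; by biduality the elements of
  \<open>(\<nu> P\<^sub>1) e\<^sub>t\<close> are the evaluations at elements of \<open>P\<^sub>1 e\<^sub>t\<close>.
\<close>

lemma ar_seq_kernel:
  fixes P1 P0 :: "('k, 'a) umod" and M :: "('k, 'a, 'w::ab_group_add) rmod"
  assumes pres: "min_proj_pres A P1 f P0 p M" and M: "is_rmod A M"
  shows "\<exists>u. ar_seq M (ker_mod (nak A P1) (nak_map A P1 P0 f)) u"
proof -
  have proj0: "projective_mod A P0" and "projective_mod A P1"
    using pres by (simp_all add: min_proj_pres_def)
  then have fg1: "fg_mod A P1" and "fg_mod A P0" by (simp_all add: projective_mod_def)
  then have rm: "is_rmod A P1" "is_rmod A P0" by (simp_all add: fg_mod_def)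
  interpret P1: bip_module A V E b cf P1 by (rule rmod_module[OF rm(1)])
  interpret P0: bip_module A V E b cf P0 by (rule rmod_module[OF rm(2)])
  interpret M: bip_module A V E b cf M by (rule rmod_module[OF M])
  interpret va: vector_space "ascl A" by (rule vs_A)
  have f: "f \<in> hom_mod A P1 P0" and p: "p \<in> hom_mod A P0 M" and psurj: "p ` mcar P0 = mcar M"
    and im: "f ` mcar P1 = {v \<in> mcar P0. p v = 0}"
    using pres by (auto simp: min_proj_pres_def)
  note src = min_pres_source[OF pres M] and finj = min_pres_inj[OF pres M]
    and pinj = min_pres_inj0[OF pres M] and rad = min_pres_rad[OF pres M]
  let ?H1 = "hom_mod A P1 (reg_mod A)" and ?H0 = "hom_mod A P0 (reg_mod A)"
  let ?N = "nak A P1" and ?K = "ker_mod (nak A P1) (nak_map A P1 P0 f)"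
  have sV: "t \<in> V" if "t \<in> sinks" for t using that E_V by blast
  have val1: "h v \<in> acar A" if "h \<in> ?H1" for h v by (rule hom_reg_val[OF that])
  have st_R: "(t, i) \<in> R \<longleftrightarrow> i = t" if "t \<in> sinks" for t i using that sV[OF that] bipartite by auto
  have p0: "p 0 = 0"
    using lin_on_0[OF P0.vs M.vs P0.sub hom_lin[OF p]] .
  \<comment> \<open>Hom(f,A), normalised off the carrier; the kernel of \<nu>f consists of the
    functionals that vanish on its image.\<close>
  define pull where "pull h = (\<lambda>v. if v \<in> mcar P1 then h (f v) else (0::'a))" for h
  have pull: "pull h \<in> ?H1" if "h \<in> ?H0" for h
    using that f P1.car_add P1.car_scl P1.act_in unfolding hom_mod_def pull_def by auto
  have K: "\<phi> \<in> mcar ?K \<longleftrightarrow> \<phi> \<in> mcar ?N \<and> (\<forall>h\<in>?H0. \<phi> (pull h) = 0)" for \<phi>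
    by (auto simp: ker_mod_def nak_map_def hom_reg_car pull_def fun_eq_iff)
  have Kact: "mact ?K = mact ?N" and Kscl: "mscl ?K = mscl ?N" by (simp_all add: ker_mod_def)
  have cf_piece: "cf (h (mact P v (b t t))) i t = cf (h v) i t"
    if "h \<in> hom_mod A P (reg_mod A)" "v \<in> mcar P" "t \<in> V" for P :: "('k, 'a) umod" and h v t i
    using hom_reg_mul[OF that(1,2) b_in_diag[OF that(3)]] hom_reg_val[OF that(1)] that(3)
    by (simp add: cf_mul_right_diag)
  have cf_lin1: "lin_on (mscl P1) (*) (piece P1 t) (\<lambda>v. cf (h v) i t)" if "h \<in> ?H1" for h i t
    using hom_add[OF that] hom_scl[OF that] P1.piece_car hom_reg_val[OF that]
    by (auto simp: lin_on_def reg_mod_def cf_add cf_scl)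

  \<comment> \<open>The homomorphism to e_t A attached to a functional l on P1 e_t. Conversely l is
    recovered as its (t,t) coefficient.\<close>
  define hl where "hl t l = (\<lambda>v. if v \<in> mcar P1 then ascl A (l (mact P1 v (b t t))) (b t t) else 0)"
    for t and l :: "_ \<Rightarrow> 'k"
  have hl: "hl t l \<in> ?H1" if "t \<in> sinks" "lin_on (mscl P1) (*) (piece P1 t) l" for t l
    unfolding hl_def by (rule hom_reg_sink[OF rm(1) that(1) src that(2)])
  have cf_hl: "cf (hl t l w) t t = l w" if "t \<in> sinks" "w \<in> piece P1 t" for t l w
    using that sV[OF that(1)] P1.piece_car[OF that(2)] P1.piece_act[OF that(2)]
    by (simp add: hl_def cf_scl b_in_diag cf_b_diag)
  have et_h: "(\<lambda>v. amul A (b t t) (h v)) = hl t (\<lambda>v. cf (h v) t t)" if "t \<in> sinks" "h \<in> ?H1" for t h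
  proof
    fix v
    show "amul A (b t t) (h v) = hl t (\<lambda>v. cf (h v) t t) v"
    proof (cases "v \<in> mcar P1")
      case True
      show ?thesis
      proof (rule cf_ext)
        fix i j assume ij: "(i, j) \<in> R"
        show "cf (amul A (b t t) (h v)) i j = cf (hl t (\<lambda>v. cf (h v) t t) v) i j"
          using True that ij st_R[OF that(1), of j] sV[OF that(1)] hom_reg_val[OF that(2)]
            cf_piece[OF that(2) True sV[OF that(1)]]
          by (auto simp: hl_def cf_mul_left_diag cf_scl b_in_diag cf_b_diag)
      qed (use True sV[OF that(1)] hom_reg_val[OF that(2)] in \<open>auto simp: hl_def mul_in b_in_diag A_scl\<close>)
    next
      case False
      then show ?thesis
        using hom_off[OF that(2) False] sV[OF that(1)] by (simp add: hl_def mul_zero_right b_in_diag)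
    qed
  qed

  \<comment> \<open>\<open>W t \<phi> w\<close> says that \<phi> is evaluation at w in the
    coefficient (t,t). Existence of w is biduality for P1 e_t, uniqueness the separation of points
    by functionals.\<close>
  define W where "W t \<phi> w \<longleftrightarrow> w \<in> piece P1 t \<and> (\<forall>h\<in>?H1. \<phi> h = cf (h w) t t)" for t \<phi> w
  have W_ex: "\<exists>w. W t \<phi> w" if t: "t \<in> sinks" and \<phi>: "\<phi> \<in> piece ?K t" for t \<phi>
  proof -
    have \<phi>N: "\<phi> \<in> mcar ?N" and \<phi>t: "mact ?N \<phi> (b t t) = \<phi>"
      using \<phi> K Kact by (auto simp: piece_def)
    have \<phi>lin: "lin_on (fun_scl (ascl A)) (*) ?H1 \<phi>" using \<phi>N by (simp add: nak_car)
    have Dl: "lin_on (mscl P1) (*) (piece P1 t) l" if "l \<in> dual_space (mscl P1) (piece P1 t)" for l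
      using that by (simp add: dual_space_def)
    have "lin_on (fun_scl (*)) (*) (dual_space (mscl P1) (piece P1 t)) (\<lambda>l. \<phi> (hl t l))"
    proof -
      have "hl t (l + l') = hl t l + hl t l'" for l l' :: "_ \<Rightarrow> 'k"
        by (auto simp: hl_def va.scale_left_distrib fun_eq_iff)
      moreover have "hl t (fun_scl (*) c l) = fun_scl (ascl A) c (hl t l)" for c and l :: "_ \<Rightarrow> 'k"
        by (auto simp: hl_def fun_scl_def fun_eq_iff)
      ultimately show ?thesis
        using lin_on_add[OF \<phi>lin hl[OF t Dl] hl[OF t Dl]] lin_on_scl[OF \<phi>lin hl[OF t Dl]]
        by (simp add: lin_on_def)
    qed
    then obtain w where w: "w \<in> piece P1 t"
      "\<And>l. l \<in> dual_space (mscl P1) (piece P1 t) \<Longrightarrow> \<phi> (hl t l) = l w"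
      using double_dual[OF P1.fd_piece[OF fg_fd[OF fg1] sV[OF t]]] by blast
    have "\<phi> h = cf (h w) t t" if h: "h \<in> ?H1" for h
    proof -
      let ?l = "\<lambda>v. if v \<in> piece P1 t then cf (h v) t t else 0"
      have pc: "P1.m.subspace (piece P1 t)" by (rule P1.piece_sub[OF sV[OF t]])
      have lD: "?l \<in> dual_space (mscl P1) (piece P1 t)"
        using lin_on_add[OF cf_lin1[OF h]] lin_on_scl[OF cf_lin1[OF h]]
          P1.m.subspace_add[OF pc] P1.m.subspace_scale[OF pc]
        by (auto simp: dual_space_def lin_on_def)
      have "hl t ?l = hl t (\<lambda>v. cf (h v) t t)"
        using P1.act_piece[OF _ sV[OF t]] by (auto simp: hl_def fun_eq_iff)
      then have "\<phi> (hl t ?l) = mact ?N \<phi> (b t t) h"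
        using et_h[OF t h] nak_act(1)[OF h] by simp
      then show ?thesis using w(2)[OF lD] w(1) \<phi>t by simp
    qed
    then show ?thesis unfolding W_def using w(1) by blast
  qed
  have W_unique: "w = w'" if t: "t \<in> sinks" and "W t \<phi> w" "W t \<phi> w'" for t \<phi> w w'
  proof (rule ccontr)
    assume "w \<noteq> w'"
    have w: "w \<in> piece P1 t" "w' \<in> piece P1 t" "\<And>h. h \<in> ?H1 \<Longrightarrow> cf (h w) t t = cf (h w') t t"
      using that by (auto simp: W_def)
    obtain l where l: "Vector_Spaces.linear (mscl P1) (*) l" "l (w - w') = (1::'k)"
      using functional_nonzero[OF P1.vs, of "w - w'"] \<open>w \<noteq> w'\<close> by auto
    interpret l: Vector_Spaces.linear "mscl P1" "(*)" l by (rule l(1))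
    have "l w = l w'"
      using w(3)[OF hl[OF t lin_on_linear[OF l(1)]]] cf_hl[OF t w(1)] cf_hl[OF t w(2)] by simp
    then show False using l(2) by (simp add: l.diff)
  qed

  \<comment> \<open>f w lies in the radical by minimality, so it is a sum of arrow images from P0.
    The summands are unique because P0 is projective, which makes the choice linear in w.\<close>
  define Q where "Q t w = (SOME q. (\<forall>s\<in>inn t. q s \<in> piece P0 s) \<and>
    f w = (\<Sum>s\<in>inn t. mact P0 (q s) (b s t)))" for t w
  have Q_ex: "(\<forall>s\<in>inn t. Q t w s \<in> piece P0 s) \<and> f w = (\<Sum>s\<in>inn t. mact P0 (Q t w s) (b s t))"
    if "t \<in> sinks" "w \<in> piece P1 t" for t w
  proof -
    have "f w \<in> {v \<in> mcar P0. p v = 0}" using im P1.piece_car[OF that(2)] by blast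
    then have "\<exists>q. (\<forall>s\<in>inn t. q s \<in> piece P0 s) \<and> f w = (\<Sum>s\<in>inn t. mact P0 (q s) (b s t))"
      using hom_piece[OF f that(2) sV[OF that(1)]] by (intro rad[OF that(1)]) auto
    then show ?thesis unfolding Q_def by (rule someI_ex)
  qed
  have Q: "\<And>t w s. t \<in> sinks \<Longrightarrow> w \<in> piece P1 t \<Longrightarrow> s \<in> inn t \<Longrightarrow> Q t w s \<in> piece P0 s"
    "\<And>t w. t \<in> sinks \<Longrightarrow> w \<in> piece P1 t \<Longrightarrow> f w = (\<Sum>s\<in>inn t. mact P0 (Q t w s) (b s t))"
    using Q_ex by simp_all
  have Q_unique: "q s = Q t w s"
    if t: "t \<in> sinks" and w: "w \<in> piece P1 t" and q: "\<And>s. s \<in> inn t \<Longrightarrow> q s \<in> piece P0 s"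
      "f w = (\<Sum>s\<in>inn t. mact P0 (q s) (b s t))" and s: "s \<in> inn t" for t w q s
  proof -
    have "q s - Q t w s = 0"
    proof (rule projective_unique[OF proj0, where q = "\<lambda>s. q s - Q t w s" and t = t])
      show "q s - Q t w s \<in> piece P0 s" if "s \<in> inn t" for s
        using q(1)[OF that] Q(1)[OF t w that] P0.m.subspace_diff[OF P0.piece_sub] E_V that by blast
      have "mact P0 (q s - Q t w s) (b s t) = mact P0 (q s) (b s t) - mact P0 (Q t w s) (b s t)"
        if s: "s \<in> inn t" for s
      proof -
        have c: "q s \<in> mcar P0" "Q t w s \<in> mcar P0"
          using q(1)[OF s] Q(1)[OF t w s] P0.piece_car by blast+
        have "mact P0 ((q s - Q t w s) + Q t w s) (b s t) =
            mact P0 (q s - Q t w s) (b s t) + mact P0 (Q t w s) (b s t)"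
          using c s b_in_arrow P0.m.subspace_diff[OF P0.sub] by (intro P0.act_add) auto
        then show ?thesis by (simp add: algebra_simps)
      qed
      then show "(\<Sum>s\<in>inn t. mact P0 (q s - Q t w s) (b s t)) = 0"
        using q(2) Q(2)[OF t w] by (simp add: sum_subtractf)
      show "(s, t) \<in> E" using s by simp
    qed
    then show ?thesis by simp
  qed
  \<comment> \<open>The vanishing (t,t) coefficient shows that at a sink every evaluation functional
    already lies in the kernel of \<nu>f. The (s,t) coefficient is what the source components have
    to satisfy.\<close>
  have K5: "cf (h (f w)) s t = cf (h (Q t w s)) s s" "cf (h (f w)) t t = 0"
    if h: "h \<in> ?H0" and st: "(s, t) \<in> E" and w: "w \<in> piece P1 t" for h s t w
  proof -
    have t: "t \<in> sinks" using st by blast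
    have c: "Q t w s' \<in> mcar P0" if "s' \<in> inn t" for s' using Q(1)[OF t w that] P0.piece_car by blast
    have "h (f w) = (\<Sum>s'\<in>inn t. h (mact P0 (Q t w s') (b s' t)))"
      unfolding Q(2)[OF t w] using c P0.act_in b_in_arrow vs_A
      by (intro lin_on_sum[OF P0.vs _ P0.sub hom_lin[OF h]]) (auto simp: reg_mod_def)
    also have "\<dots> = (\<Sum>s'\<in>inn t. amul A (h (Q t w s')) (b s' t))"
      using hom_reg_mul[OF h c] b_in_arrow by (intro sum.cong refl) auto
    finally have "cf (h (f w)) i t = (\<Sum>s'\<in>inn t. cf (amul A (h (Q t w s')) (b s' t)) i t)" for i
      using cf_sum[of "inn t" "\<lambda>s'. amul A (h (Q t w s')) (b s' t)"] hom_reg_val[OF h]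
      by (simp add: mul_in b_in_arrow)
    also have "\<dots> i = (\<Sum>s'\<in>inn t. if s' = i then cf (h (Q t w i)) i i else 0)" for i
      using hom_reg_val[OF h] by (intro sum.cong refl) (auto simp: cf_mul_right_arrow)
    finally have "cf (h (f w)) i t = (if i \<in> inn t then cf (h (Q t w i)) i i else 0)" for i
      by simp
    then show "cf (h (f w)) s t = cf (h (Q t w s)) s s" "cf (h (f w)) t t = 0"
      using st E_irrefl by auto
  qed

  \<comment> \<open>The inverse of the map \<open>\<theta>\<close> defined below: together they
    identify the kernel at the sink t with P1 e_t.\<close>
  define ev where "ev t w = (\<lambda>h. if h \<in> ?H1 then cf (h w) t t else 0)" for t w
  have lin_ev: "lin_on (fun_scl (ascl A)) (*) ?H1 (\<lambda>h. cf (h w) i j)" for w i j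
    using cf_add[OF val1 val1] cf_scl[OF val1] by (auto simp: lin_on_def fun_scl_def)
  interpret H: vector_space "fun_scl (ascl A) :: 'k \<Rightarrow> ((nat \<Rightarrow> 'k) \<Rightarrow> 'a) \<Rightarrow> _"
    by (rule vector_space_fun_scl[OF vs_A])
  have H1sub: "H.subspace ?H1"
    using hom_reg_rmod[OF rm(1)] unfolding is_rmod_def by (simp add: hom_reg_car hom_reg_scl)
  have ev: "ev t w \<in> piece ?K t" "W t (ev t w) w" if t: "t \<in> sinks" and w: "w \<in> piece P1 t" for t w
  proof -
    have N: "ev t w \<in> mcar ?N"
      unfolding nak_car
      using lin_on_add[OF lin_ev] lin_on_scl[OF lin_ev] H.subspace_add[OF H1sub] H.subspace_scale[OF H1sub]
      by (auto simp: ev_def lin_on_def)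
    obtain s where s: "(s, t) \<in> E" using t by blast
    have "ev t w (pull h) = 0" if "h \<in> ?H0" for h
      using K5(2)[OF that s w] P1.piece_car[OF w] pull[OF that] by (simp add: ev_def pull_def)
    then have "ev t w \<in> mcar ?K" using N K by blast
    moreover have "mact ?N (ev t w) (b t t) = ev t w"
    proof
      fix h show "mact ?N (ev t w) (b t t) h = ev t w h"
        using nak_act[of h P1 "ev t w" "b t t"] hom_reg_act_in[OF rm(1) _ b_in_diag[OF sV[OF t]], of h]
          val1[of h] sV[OF t]
        by (cases "h \<in> ?H1") (auto simp: ev_def cf_mul_left_diag)
    qed
    ultimately show "ev t w \<in> piece ?K t" by (simp add: piece_def Kact)
    show "W t (ev t w) w" using w by (auto simp: W_def ev_def)
  qed

  define \<theta> where "\<theta> t \<phi> = (SOME w. W t \<phi> w)" for t \<phi>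
  have \<theta>: "W t \<phi> (\<theta> t \<phi>)" if "t \<in> sinks" "\<phi> \<in> piece ?K t" for t \<phi>
    unfolding \<theta>_def by (rule someI_ex[OF W_ex[OF that]])
  have \<theta>_piece: "\<theta> t \<phi> \<in> piece P1 t" if "t \<in> sinks" "\<phi> \<in> piece ?K t" for t \<phi>
    using \<theta>[OF that] by (simp add: W_def)
  have \<theta>_ev: "\<theta> t (ev t w) = w" if "t \<in> sinks" "w \<in> piece P1 t" for t w
    by (rule W_unique[OF that(1) \<theta>[OF that(1) ev(1)[OF that]] ev(2)[OF that]])

  \<comment> \<open>P1 has no component at s, so e_s h has no (s,s) coefficient and is the sum over
    t of the products of \<open>b s t\<close> with homomorphisms \<open>hl t\<close>. Thus z is
    determined by its images under the arrows out of s.\<close>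
  have source_ev: "z h = (\<Sum>t\<in>outn s. cf (h (\<theta> t (mact ?N z (b s t)))) s t)"
    if s: "s \<in> sources" and z: "z \<in> piece ?K s" and h: "h \<in> ?H1"
      and zp: "\<And>t. t \<in> outn s \<Longrightarrow> mact ?N z (b s t) \<in> piece ?K t" for s z h
  proof -
    have zN: "z \<in> mcar ?N" "mact ?N z (b s s) = z" using z K Kact by (auto simp: piece_def)
    have sinVV: "s \<in> V" using s by blast
    let ?l = "\<lambda>t v. cf (h v) s t"
    have hl_t: "hl t (?l t) \<in> ?H1" if "t \<in> outn s" for t
      using that by (intro hl cf_lin1[OF h]) auto
    have es: "(\<lambda>v. amul A (b s s) (h v)) = (\<Sum>t\<in>outn s. (\<lambda>v. amul A (b s t) (hl t (?l t) v)))"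
    proof
      fix v
      show "amul A (b s s) (h v) = (\<Sum>t\<in>outn s. (\<lambda>v. amul A (b s t) (hl t (?l t) v))) v"
      proof (cases "v \<in> mcar P1")
        case True
        have inA: "amul A (b s t) (hl t (?l t) v) \<in> acar A" if "t \<in> outn s" for t
          using that hom_reg_val[OF hl_t[OF that]] by (simp add: mul_in b_in_arrow)
        show ?thesis
          unfolding fun_sum_at
        proof (rule cf_ext)
          fix i j assume ij: "(i, j) \<in> R"
          have "cf (\<Sum>t\<in>outn s. amul A (b s t) (hl t (?l t) v)) i j =
              (\<Sum>t\<in>outn s. cf (amul A (b s t) (hl t (?l t) v)) i j)"
            by (rule cf_sum[OF inA])
          also have "\<dots> = (\<Sum>t\<in>outn s. if t = j then (if i = s then cf (h v) s j else 0) else 0)"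
          proof (rule sum.cong[OF refl])
            fix t assume t: "t \<in> outn s"
            then have tV: "t \<in> V" using E_V by blast
            have "cf (hl t (?l t) v) t t = cf (h v) s t"
              using True tV cf_piece[OF h True tV] by (simp add: hl_def cf_scl b_in_diag cf_b_diag)
            then show "cf (amul A (b s t) (hl t (?l t) v)) i j =
                (if t = j then (if i = s then cf (h v) s j else 0) else 0)"
              using t hom_reg_val[OF hl_t[OF t]] by (auto simp: cf_mul_left_arrow)
          qed
          also have "\<dots> = (if i = s \<and> (s, j) \<in> E then cf (h v) s j else 0)" by simp
          also have "\<dots> = cf (amul A (b s s) (h v)) i j"
          proof (cases "i = s \<and> j = s")
            case True2: True
            have "h (mact P1 v (b s s)) = h 0"
              using src[OF s] P1.act_piece[OF True sinVV] by auto
            also have "\<dots> = 0"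
              using lin_on_0[OF P1.vs _ P1.sub hom_lin[OF h]] vs_A by (simp add: reg_mod_def)
            finally have "cf (h v) s s = 0" using cf_piece[OF h True sinVV, of s] by simp
            then show ?thesis
              using True2 hom_reg_val[OF h] sinVV E_irrefl by (simp add: cf_mul_left_diag)
          next
            case False
            then show ?thesis using ij hom_reg_val[OF h] sinVV by (auto simp: cf_mul_left_diag)
          qed
          finally show "cf (amul A (b s s) (h v)) i j =
              cf (\<Sum>t\<in>outn s. amul A (b s t) (hl t (?l t) v)) i j" ..
        qed (use inA hom_reg_val[OF h] sinVV in \<open>auto simp: mul_in b_in_diag intro!: A_sum\<close>)
      next
        case False
        then show ?thesis
          using hom_off[OF h False] sinVV
          by (simp add: fun_sum_at hl_def mul_zero_right b_in_diag b_in_arrow)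
      qed
    qed
    have "z h = z (\<lambda>v. amul A (b s s) (h v))" using nak_act(1)[OF h, of z "b s s"] zN(2) by simp
    also have "\<dots> = (\<Sum>t\<in>outn s. z (\<lambda>v. amul A (b s t) (hl t (?l t) v)))"
      unfolding es using hom_reg_act_in[OF rm(1) hl_t] b_in_arrow
      by (intro dual_apply_sum[OF rm(1) zN(1)]) auto
    also have "\<dots> = (\<Sum>t\<in>outn s. cf (h (\<theta> t (mact ?N z (b s t)))) s t)"
    proof (rule sum.cong[OF refl])
      fix t assume t: "t \<in> outn s"
      then have ts: "t \<in> sinks" by blast
      have "z (\<lambda>v. amul A (b s t) (hl t (?l t) v)) = mact ?N z (b s t) (hl t (?l t))"
        using nak_act(1)[OF hl_t[OF t]] by simp
      also have "\<dots> = cf (hl t (?l t) (\<theta> t (mact ?N z (b s t)))) t t"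
        using \<theta>[OF ts zp[OF t]] hl_t[OF t] by (simp add: W_def)
      also have "\<dots> = cf (h (\<theta> t (mact ?N z (b s t)))) s t"
        using cf_hl[OF ts \<theta>_piece[OF ts zp[OF t]]] by simp
      finally show "z (\<lambda>v. amul A (b s t) (hl t (?l t) v)) = cf (h (\<theta> t (mact ?N z (b s t)))) s t" .
    qed
    finally show ?thesis .
  qed

  \<comment> \<open>Verified directly on functionals: left multiplication by \<open>b s t\<close>
    commutes with \<open>pull\<close>, so the arrow preserves the kernel of \<nu>f.\<close>
  have Kpush: "mact ?N z (b s t) \<in> piece ?K t"
    if z: "z \<in> piece ?K s" and st: "(s, t) \<in> E" for z s t
  proof -
    have zN: "z \<in> mcar ?N" "\<And>h. h \<in> ?H0 \<Longrightarrow> z (pull h) = 0" using z K by (auto simp: piece_def)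
    have zlin: "lin_on (fun_scl (ascl A)) (*) ?H1 z" using zN by (simp add: nak_car)
    have m: "(\<lambda>v. amul A (b s t) (h v)) \<in> ?H1" if "h \<in> ?H1" for h
      by (rule hom_reg_act_in[OF rm(1) that b_in_arrow[OF st]])
    have "mact ?N z (b s t) \<in> mcar ?N"
      unfolding nak_car
    proof (intro conjI allI impI)
      show "lin_on (fun_scl (ascl A)) (*) ?H1 (mact ?N z (b s t))"
        unfolding lin_on_def
      proof (intro conjI ballI allI)
        fix h h' assume hh: "h \<in> ?H1" "h' \<in> ?H1"
        have "(\<lambda>v. amul A (b s t) ((h + h') v)) = (\<lambda>v. amul A (b s t) (h v)) + (\<lambda>v. amul A (b s t) (h' v))"
          using hom_reg_val[OF hh(1)] hom_reg_val[OF hh(2)] b_in_arrow[OF st]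
          by (auto simp: mul_add_right)
        then show "mact ?N z (b s t) (h + h') = mact ?N z (b s t) h + mact ?N z (b s t) h'"
          unfolding nak_act(1)[OF hh(1)] nak_act(1)[OF hh(2)] nak_act(1)[OF H.subspace_add[OF H1sub hh]]
          using lin_on_add[OF zlin m[OF hh(1)] m[OF hh(2)]] by simp
      next
        fix c h assume h: "h \<in> ?H1"
        have "(\<lambda>v. amul A (b s t) (fun_scl (ascl A) c h v)) = fun_scl (ascl A) c (\<lambda>v. amul A (b s t) (h v))"
          using hom_reg_val[OF h] b_in_arrow[OF st] by (auto simp: mul_scl_right fun_scl_def)
        then show "mact ?N z (b s t) (fun_scl (ascl A) c h) = c * mact ?N z (b s t) h"
          unfolding nak_act(1)[OF h] nak_act(1)[OF H.subspace_scale[OF H1sub h]]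
          using lin_on_scl[OF zlin m[OF h]] by simp
      qed
    qed (rule nak_act(2))
    moreover have "mact ?N z (b s t) (pull h) = 0" if h: "h \<in> ?H0" for h
    proof -
      have h': "(\<lambda>v. amul A (b s t) (h v)) \<in> ?H0"
        by (rule hom_reg_act_in[OF rm(2) h b_in_arrow[OF st]])
      have "(\<lambda>v. amul A (b s t) (pull h v)) = pull (\<lambda>v. amul A (b s t) (h v))"
        using b_in_arrow[OF st] by (auto simp: pull_def mul_zero_right)
      then show ?thesis using nak_act(1)[OF pull[OF h]] zN(2)[OF h'] by simp
    qed
    moreover have "mact ?N (mact ?N z (b s t)) (b t t) = mact ?N z (b s t)"
    proof
      fix h show "mact ?N (mact ?N z (b s t)) (b t t) h = mact ?N z (b s t) h"
      proof (cases "h \<in> ?H1")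
        case True
        have e: "(\<lambda>v. amul A (b t t) (h v)) \<in> ?H1"
          by (rule hom_reg_act_in[OF rm(1) True b_in_diag[OF E_V(2)[OF st]]])
        have "amul A (b s t) (amul A (b t t) (h v)) = amul A (b s t) (h v)" for v
          using mul_assoc[OF b_in_arrow[OF st] b_in_diag[OF E_V(2)[OF st]] hom_reg_val[OF True]]
            mul_arrow_diag[OF E_V(2)[OF st] st] by simp
        then show ?thesis using nak_act(1)[OF True] nak_act(1)[OF e] by simp
      qed (simp add: nak_act(2))
    qed
    ultimately show ?thesis unfolding piece_def using K Kact by simp
  qed

  \<comment> \<open>The composite of the identification of N e_t with P1 e_t, the decomposition of f
    into source components of P0, and p, which is injective at the sources.\<close>
  define u where "u s t \<phi> = p (Q t (\<theta> t \<phi>) s)" for s t \<phi>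
  have Qc: "Q t (\<theta> t \<phi>) s \<in> piece P0 s" if "(s, t) \<in> E" "\<phi> \<in> piece ?K t" for s t \<phi>
    using that by (intro Q(1) \<theta>_piece) auto
  have u_in: "u s t \<phi> \<in> piece M s" if "(s, t) \<in> E" "\<phi> \<in> piece ?K t" for s t \<phi>
    unfolding u_def using hom_piece[OF p Qc[OF that]] E_V that(1) by blast
  show ?thesis
    unfolding ar_seq_def
  proof (intro exI[of _ u] conjI allI impI ballI)
    fix s t assume st: "(s, t) \<in> E"
    then have t: "t \<in> sinks" and s: "s \<in> inn t" by auto
    \<comment> \<open>One statement for both halves of linearity. It holds because representing
      vectors and arrow decompositions are both unique.\<close>
    have comb: "Q t (\<theta> t \<chi>) s = mscl P0 c (Q t (\<theta> t \<phi>) s) + Q t (\<theta> t \<psi>) s"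
      if \<phi>: "\<phi> \<in> piece ?K t" and \<psi>: "\<psi> \<in> piece ?K t" and \<chi>: "\<chi> \<in> piece ?K t"
        and eq: "\<And>h. \<chi> h = c * \<phi> h + \<psi> h" for \<phi> \<psi> \<chi> c
    proof -
      let ?w = "mscl P1 c (\<theta> t \<phi>) + \<theta> t \<psi>"
      note w1 = \<theta>_piece[OF t \<phi>] and w2 = \<theta>_piece[OF t \<psi>]
      have pc: "P1.m.subspace (piece P1 t)" by (rule P1.piece_sub[OF sV[OF t]])
      have w: "?w \<in> piece P1 t" using w1 w2 P1.m.subspace_add[OF pc] P1.m.subspace_scale[OF pc] by blast
      have "W t \<chi> ?w"
      proof -
        have "cf (h ?w) t t = c * cf (h (\<theta> t \<phi>)) t t + cf (h (\<theta> t \<psi>)) t t" if "h \<in> ?H1" for h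
          using lin_on_add[OF cf_lin1[OF that] P1.m.subspace_scale[OF pc w1] w2]
            lin_on_scl[OF cf_lin1[OF that] w1] by simp
        then show ?thesis using w \<theta>[OF t \<phi>] \<theta>[OF t \<psi>] eq by (simp add: W_def)
      qed
      then have \<theta>w: "\<theta> t \<chi> = ?w" by (rule W_unique[OF t \<theta>[OF t \<chi>]])
      have q: "Q t (\<theta> t \<phi>) s \<in> piece P0 s" "Q t (\<theta> t \<psi>) s \<in> piece P0 s" if "s \<in> inn t" for s
        using Qc that \<phi> \<psi> by auto
      have "mscl P0 c (Q t (\<theta> t \<phi>) s) + Q t (\<theta> t \<psi>) s = Q t ?w s"
      proof (rule Q_unique[OF t w _ _ s])
        show "mscl P0 c (Q t (\<theta> t \<phi>) s) + Q t (\<theta> t \<psi>) s \<in> piece P0 s" if "s \<in> inn t" for s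
        proof -
          have "s \<in> V" using that E_V by blast
          note pc = P0.piece_sub[OF this]
          show ?thesis
            by (rule P0.m.subspace_add[OF pc P0.m.subspace_scale[OF pc q(1)[OF that]] q(2)[OF that]])
        qed
        have "f ?w = mscl P0 c (f (\<theta> t \<phi>)) + f (\<theta> t \<psi>)"
          using hom_add[OF f P1.car_scl[OF P1.piece_car[OF w1]] P1.piece_car[OF w2]]
            hom_scl[OF f P1.piece_car[OF w1]] by simp
        also have "\<dots> = (\<Sum>s\<in>inn t. mscl P0 c (mact P0 (Q t (\<theta> t \<phi>) s) (b s t)) + mact P0 (Q t (\<theta> t \<psi>) s) (b s t))"
          unfolding Q(2)[OF t w1] Q(2)[OF t w2] by (simp add: sum.distrib P0.m.scale_sum_right)
        also have "\<dots> = (\<Sum>s\<in>inn t. mact P0 (mscl P0 c (Q t (\<theta> t \<phi>) s) + Q t (\<theta> t \<psi>) s) (b s t))"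
        proof (rule sum.cong[OF refl])
          fix s assume s: "s \<in> inn t"
          then have "b s t \<in> acar A" using b_in_arrow by simp
          then show "mscl P0 c (mact P0 (Q t (\<theta> t \<phi>) s) (b s t)) + mact P0 (Q t (\<theta> t \<psi>) s) (b s t) =
              mact P0 (mscl P0 c (Q t (\<theta> t \<phi>) s) + Q t (\<theta> t \<psi>) s) (b s t)"
            using P0.piece_car[OF q(1)[OF s]] P0.piece_car[OF q(2)[OF s]]
            by (simp add: P0.act_add P0.act_scl P0.car_scl)
        qed
        finally show "f ?w = (\<Sum>s\<in>inn t. mact P0 (mscl P0 c (Q t (\<theta> t \<phi>) s) + Q t (\<theta> t \<psi>) s) (b s t))" .
      qed
      then show ?thesis using \<theta>w by simp
    qed
    have pcomb: "p (mscl P0 c x + y) = mscl M c (p x) + p y" if "x \<in> piece P0 s" "y \<in> piece P0 s" for c x y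
      using P0.piece_car[OF that(1)] P0.piece_car[OF that(2)] P0.car_scl hom_add[OF p] hom_scl[OF p] by simp
    have closed: "\<phi> + \<psi> \<in> piece ?K t" "mscl ?K c \<phi> \<in> piece ?K t"
      if \<phi>: "\<phi> \<in> piece ?K t" and \<psi>: "\<psi> \<in> piece ?K t" for \<phi> \<psi> c
    proof -
      have l: "lin_on (fun_scl (ascl A)) (*) ?H1 \<phi>" "lin_on (fun_scl (ascl A)) (*) ?H1 \<psi>"
        and off: "\<And>h. h \<notin> ?H1 \<Longrightarrow> \<phi> h = 0" "\<And>h. h \<notin> ?H1 \<Longrightarrow> \<psi> h = 0"
        and pl: "\<And>h. h \<in> ?H0 \<Longrightarrow> \<phi> (pull h) = 0" "\<And>h. h \<in> ?H0 \<Longrightarrow> \<psi> (pull h) = 0"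
        and act: "mact ?N \<phi> (b t t) = \<phi>" "mact ?N \<psi> (b t t) = \<psi>"
        using \<phi> \<psi> by (auto simp: piece_def K nak_car Kact)
      have pt: "\<phi> (\<lambda>v. amul A (b t t) (h v)) = \<phi> h" "\<psi> (\<lambda>v. amul A (b t t) (h v)) = \<psi> h" if "h \<in> ?H1" for h
        using nak_act(1)[OF that, of \<phi> "b t t"] nak_act(1)[OF that, of \<psi> "b t t"] act by simp_all
      have "mact ?N (\<phi> + \<psi>) (b t t) = \<phi> + \<psi>"
      proof
        fix h show "mact ?N (\<phi> + \<psi>) (b t t) h = (\<phi> + \<psi>) h"
          using pt[of h] off[of h] by (cases "h \<in> ?H1") (simp_all add: nak_act)
      qed
      moreover have "\<phi> + \<psi> \<in> mcar ?K"
        unfolding K nak_car using l off pl by (auto simp: lin_on_def distrib_left)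
      ultimately show "\<phi> + \<psi> \<in> piece ?K t" by (simp add: piece_def Kact)
      have "mact ?N (fun_scl (*) c \<phi>) (b t t) = fun_scl (*) c \<phi>"
      proof
        fix h show "mact ?N (fun_scl (*) c \<phi>) (b t t) h = fun_scl (*) c \<phi> h"
          using pt[of h] off[of h] by (cases "h \<in> ?H1") (simp_all add: nak_act fun_scl_def)
      qed
      moreover have "fun_scl (*) c \<phi> \<in> mcar ?K"
        unfolding K nak_car using l off pl by (auto simp: lin_on_def fun_scl_def distrib_left mult.left_commute)
      ultimately show "mscl ?K c \<phi> \<in> piece ?K t" by (simp add: piece_def Kact Kscl nak_scl)
    qed
    show "lin_on (mscl ?K) (mscl M) (piece ?K t) (u s t)"
      unfolding lin_on_def
    proof (intro conjI ballI allI)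
      fix \<phi> \<psi> assume *: "\<phi> \<in> piece ?K t" "\<psi> \<in> piece ?K t"
      have "Q t (\<theta> t (\<phi> + \<psi>)) s = mscl P0 1 (Q t (\<theta> t \<phi>) s) + Q t (\<theta> t \<psi>) s"
        by (rule comb) (use * closed in auto)
      then show "u s t (\<phi> + \<psi>) = u s t \<phi> + u s t \<psi>"
        using pcomb[OF Qc[OF st *(1)] Qc[OF st *(2)], of 1] by (simp add: u_def)
    next
      fix c \<phi> assume *: "\<phi> \<in> piece ?K t"
      \<comment> \<open>A multiple of \<phi> is written as (c - 1)\<phi> + \<phi>, so that
        \<open>comb\<close> applies with both arguments equal to \<phi>.\<close>
      have "Q t (\<theta> t (mscl ?K c \<phi>)) s = mscl P0 (c - 1) (Q t (\<theta> t \<phi>) s) + Q t (\<theta> t \<phi>) s"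
        by (rule comb) (use * closed in \<open>auto simp: Kscl nak_scl fun_scl_def algebra_simps\<close>)
      then have "u s t (mscl ?K c \<phi>) = mscl M (c - 1) (u s t \<phi>) + u s t \<phi>"
        using pcomb[OF Qc[OF st *] Qc[OF st *], of "c - 1"] by (simp add: u_def)
      also have "\<dots> = mscl M c (u s t \<phi>)" by (simp add: M.m.scale_left_diff_distrib)
      finally show "u s t (mscl ?K c \<phi>) = mscl M c (u s t \<phi>)" .
    qed
    show "u s t \<phi> \<in> piece M s" if "\<phi> \<in> piece ?K t" for \<phi> by (rule u_in[OF st that])
  next
    fix t \<phi> assume t: "t \<in> sinks" and \<phi>: "\<phi> \<in> piece ?K t"
    note w = \<theta>_piece[OF t \<phi>]
    have c: "Q t (\<theta> t \<phi>) s \<in> mcar P0" if "s \<in> inn t" for s using Q(1)[OF t w that] P0.piece_car by blast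
    have "p (f (\<theta> t \<phi>)) = (\<Sum>s\<in>inn t. p (mact P0 (Q t (\<theta> t \<phi>) s) (b s t)))"
      unfolding Q(2)[OF t w] using c P0.act_in b_in_arrow
      by (intro lin_on_sum[OF P0.vs M.vs P0.sub hom_lin[OF p]]) auto
    also have "\<dots> = (\<Sum>s\<in>inn t. mact M (u s t \<phi>) (b s t))"
      using hom_act[OF p c b_in_arrow] by (intro sum.cong refl) (auto simp: u_def)
    finally have pf: "p (f (\<theta> t \<phi>)) = (\<Sum>s\<in>inn t. mact M (u s t \<phi>) (b s t))" .
    have "f (\<theta> t \<phi>) \<in> {v \<in> mcar P0. p v = 0}" unfolding im[symmetric] using P1.piece_car[OF w] by blast
    then show "(\<Sum>s\<in>inn t. mact M (u s t \<phi>) (b s t)) = 0" using pf by simp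
    assume u0: "\<forall>s\<in>inn t. u s t \<phi> = 0"
    have "Q t (\<theta> t \<phi>) s = 0" if "s \<in> inn t" for s
      using pinj[OF E_source Q(1)[OF t w that]] u0 that by (simp add: u_def)
    then have "f (\<theta> t \<phi>) = 0" using Q(2)[OF t w] P0.act_zero[OF b_in_arrow] by simp
    then have "\<theta> t \<phi> = 0" by (rule finj[OF sV[OF t] w])
    then have "\<phi> h = 0" if "h \<in> ?H1" for h
      using \<theta>[OF t \<phi>] that lin_on_0[OF P1.vs _ P1.sub hom_lin[OF that]] vs_A
      by (simp add: W_def reg_mod_def)
    moreover have "\<phi> h = 0" if "h \<notin> ?H1" for h using \<phi> that by (simp add: piece_def K nak_car)
    ultimately show "\<phi> = 0" by (auto simp: fun_eq_iff)
  next
    fix t m assume t: "t \<in> sinks"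
      and m: "(\<forall>s\<in>inn t. m s \<in> piece M s) \<and> (\<Sum>s\<in>inn t. mact M (m s) (b s t)) = 0"
    \<comment> \<open>Exactness at the sinks: the given relation is lifted to P0, where its sum lies
      in Ker p = Im f and so comes from P1 e_t.\<close>
    have "\<forall>s\<in>inn t. \<exists>x. x \<in> piece P0 s \<and> p x = m s"
    proof
      fix s assume s: "s \<in> inn t"
      then have sV': "s \<in> V" using E_V by blast
      have ms: "m s \<in> mcar M" "mact M (m s) (b s s) = m s" using m s by (auto simp: piece_def)
      then have "m s \<in> p ` mcar P0" using psurj by simp
      then obtain x where x: "x \<in> mcar P0" "p x = m s" by auto
      then show "\<exists>x. x \<in> piece P0 s \<and> p x = m s"
        using P0.act_piece[OF x(1) sV'] hom_act[OF p x(1) b_in_diag[OF sV']] ms(2)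
        by (intro exI[of _ "mact P0 x (b s s)"]) simp
    qed
    from bchoice[OF this] obtain q where q': "\<forall>s\<in>inn t. q s \<in> piece P0 s \<and> p (q s) = m s" ..
    have q: "\<And>s. s \<in> inn t \<Longrightarrow> q s \<in> piece P0 s" "\<And>s. s \<in> inn t \<Longrightarrow> p (q s) = m s"
      using q' by simp_all
    let ?x = "\<Sum>s\<in>inn t. mact P0 (q s) (b s t)"
    have tP: "P0.m.subspace (piece P0 t)" by (rule P0.piece_sub[OF sV[OF t]])
    have x: "?x \<in> piece P0 t"
      using P0.act_arrow P0.piece_car[OF q(1)] by (intro P0.m.subspace_sum[OF tP]) auto
    have "p ?x = (\<Sum>s\<in>inn t. p (mact P0 (q s) (b s t)))"
      using P0.act_in P0.piece_car[OF q(1)] b_in_arrow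
      by (intro lin_on_sum[OF P0.vs M.vs P0.sub hom_lin[OF p]]) auto
    also have "\<dots> = (\<Sum>s\<in>inn t. mact M (m s) (b s t))"
      using hom_act[OF p P0.piece_car[OF q(1)] b_in_arrow] q(2) by (intro sum.cong refl) auto
    finally have "?x \<in> {v \<in> mcar P0. p v = 0}" using m P0.piece_car[OF x] by simp
    then obtain w' where w': "w' \<in> mcar P1" "f w' = ?x" unfolding im[symmetric] by auto
    let ?w = "mact P1 w' (b t t)"
    have w: "?w \<in> piece P1 t" by (rule P1.act_piece[OF w'(1) sV[OF t]])
    have fw: "f ?w = ?x"
      using hom_act[OF f w'(1) b_in_diag[OF sV[OF t]]] w'(2) P0.piece_act[OF x] by simp
    have "q s = Q t ?w s" if "s \<in> inn t" for s
      by (rule Q_unique[OF t w q(1) fw that])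
    then have "u s t (ev t ?w) = m s" if "s \<in> inn t" for s
      using \<theta>_ev[OF t w] q(2)[OF that] that by (simp add: u_def)
    then show "\<exists>\<phi>\<in>piece ?K t. \<forall>s\<in>inn t. u s t \<phi> = m s" using ev(1)[OF t w] by blast
  next
    fix s z assume s: "s \<in> sources" and z: "z \<in> piece ?K s"
    have sVV: "s \<in> V" using s by blast
    have zp: "mact ?N z (b s t) \<in> piece ?K t" if "t \<in> outn s" for t using Kpush[OF z] that by blast
    let ?w = "\<lambda>t. \<theta> t (mact ?N z (b s t))"
    have w: "?w t \<in> piece P1 t" if "t \<in> outn s" for t using \<theta>_piece[OF _ zp[OF that]] that by blast
    have qp: "Q t (?w t) s \<in> piece P0 s" if "t \<in> outn s" for t using Qc[OF _ zp[OF that]] that by blast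
    have qc: "Q t (?w t) s \<in> mcar P0" if "t \<in> outn s" for t using P0.piece_car[OF qp[OF that]] .
    let ?x = "\<Sum>t\<in>outn s. Q t (?w t) s"
    \<comment> \<open>If the sum were nonzero, a functional with value 1 on it would extend by
      projectivity to a homomorphism h from P0 to e_s A. Then z would take the value 1 on
      \<open>pull h\<close>, although z lies in the kernel of \<nu>f.\<close>
    have "?x = 0"
    proof (rule ccontr)
      assume "?x \<noteq> 0"
      then obtain l where l: "Vector_Spaces.linear (mscl P0) (*) l" "l ?x = (1::'k)"
        using functional_nonzero[OF P0.vs] by blast
      interpret l: Vector_Spaces.linear "mscl P0" "(*)" l by (rule l(1))
      have "\<forall>t. \<exists>\<mu>. (s, t) \<in> E \<longrightarrow> lin_on (mscl P0) (*) (piece P0 t) \<mu> \<and>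
        (\<forall>s' v. (s', t) \<in> E \<and> v \<in> piece P0 s' \<longrightarrow> \<mu> (mact P0 v (b s' t)) = (if s' = s then l v else 0))"
        using projective_functional[OF proj0 _ lin_on_linear[OF l(1)], of s] by blast
      from choice[OF this] obtain \<mu> where
        \<mu>': "\<forall>t. (s, t) \<in> E \<longrightarrow> lin_on (mscl P0) (*) (piece P0 t) (\<mu> t) \<and> (\<forall>s' v.
          (s', t) \<in> E \<and> v \<in> piece P0 s' \<longrightarrow> \<mu> t (mact P0 v (b s' t)) = (if s' = s then l v else 0))" ..
      have \<mu>: "\<And>t. (s, t) \<in> E \<Longrightarrow> lin_on (mscl P0) (*) (piece P0 t) (\<mu> t)"
        "\<And>t s' v. (s, t) \<in> E \<Longrightarrow> (s', t) \<in> E \<Longrightarrow> v \<in> piece P0 s' \<Longrightarrow>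
          \<mu> t (mact P0 v (b s' t)) = (if s' = s then l v else 0)"
        using \<mu>' by simp_all
      let ?m = "\<lambda>i. if i = s then l else \<mu> i"
      have "\<exists>h\<in>?H0. \<forall>i\<in>V. \<forall>v\<in>piece P0 i. h v = (if (s, i) \<in> R then ascl A (?m i v) (b s i) else 0)"
      proof (rule hom_reg_from_row[OF rm(2) sVV])
        show "lin_on (mscl P0) (*) (piece P0 i) (?m i)" if "(s, i) \<in> R" for i
          using that \<mu>(1) lin_on_linear[OF l(1)] by auto
        show "?m j (mact P0 v (b i j)) = (if i = s then ?m i v else 0)"
          if "(i, j) \<in> E" "(s, j) \<in> R" "v \<in> piece P0 i" for i j v
          using that \<mu>(2)[of j i v] s by auto
      qed
      then obtain h where h: "h \<in> ?H0" and h': "\<forall>i\<in>V. \<forall>v\<in>piece P0 i.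
          h v = (if (s, i) \<in> R then ascl A (?m i v) (b s i) else 0)" by blast
      have hs: "h v = ascl A (l v) (b s s)" if "v \<in> piece P0 s" for v
        using h'[rule_format, OF sVV that] Id_onI[OF sVV] by simp
      have "0 = z (pull h)" using z h by (simp add: piece_def K)
      also have "\<dots> = (\<Sum>t\<in>outn s. cf (pull h (?w t)) s t)" by (rule source_ev[OF s z pull[OF h] zp])
      also have "\<dots> = (\<Sum>t\<in>outn s. l (Q t (?w t) s))"
      proof (rule sum.cong[OF refl])
        fix t assume t: "t \<in> outn s"
        have "cf (pull h (?w t)) s t = cf (h (Q t (?w t) s)) s s"
          using K5(1)[OF h _ w[OF t]] t P1.piece_car[OF w[OF t]] by (simp add: pull_def)
        then show "cf (pull h (?w t)) s t = l (Q t (?w t) s)"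
          using hs[OF qp[OF t]] sVV by (simp add: cf_scl b_in_diag cf_b_diag)
      qed
      also have "\<dots> = 1" using l(2) by (simp add: l.sum)
      finally show False by simp
    qed
    moreover have "p ?x = (\<Sum>t\<in>outn s. p (Q t (?w t) s))"
      by (rule lin_on_sum[OF P0.vs M.vs P0.sub hom_lin[OF p] qc])
    ultimately show "(\<Sum>t\<in>outn s. u s t (mact ?K z (b s t))) = 0" using p0 by (simp add: u_def Kact)
    assume "\<forall>t\<in>outn s. mact ?K z (b s t) = 0"
    then have z0: "mact ?N z (b s t) = 0" if "t \<in> outn s" for t using that Kact by simp
    have w0: "cf (h (?w t)) s t = 0" if t: "t \<in> outn s" and h: "h \<in> ?H1" for t h
    proof -
      have ts: "t \<in> sinks" using t by blast
      have tV: "t \<in> V" using sV[OF ts] .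
      have "?w t = 0"
      proof (rule W_unique[OF ts \<theta>[OF ts zp[OF t]]])
        show "W t (mact ?N z (b s t)) 0"
          using z0[OF t] P1.m.subspace_0[OF P1.piece_sub[OF tV]]
            lin_on_0[OF P1.vs vector_space_mult P1.piece_sub[OF tV] cf_lin1]
          by (simp add: W_def)
      qed
      then show ?thesis
        using lin_on_0[OF P1.vs vector_space_mult P1.piece_sub[OF tV] cf_lin1[OF h]] by simp
    qed
    have "z h = 0" if "h \<in> ?H1" for h
      using source_ev[OF s z that zp] w0[OF _ that] by simp
    moreover have "z h = 0" if "h \<notin> ?H1" for h using z that by (simp add: piece_def K nak_car)
    ultimately show "z = 0" by (auto simp: fun_eq_iff)
  next
    fix s y assume s: "s \<in> sources"
      and y: "(\<forall>t\<in>outn s. y t \<in> piece ?K t) \<and> (\<Sum>t\<in>outn s. u s t (y t)) = 0"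
    have sVV: "s \<in> V" using s by blast
    have yp: "y t \<in> piece ?K t" if "t \<in> outn s" for t using y that by blast
    let ?w = "\<lambda>t. \<theta> t (y t)"
    have w: "?w t \<in> piece P1 t" if "t \<in> outn s" for t using \<theta>_piece[OF _ yp[OF that]] that by blast
    have qp: "Q t (?w t) s \<in> piece P0 s" if "t \<in> outn s" for t using Qc[OF _ yp[OF that]] that by blast
    have qc: "Q t (?w t) s \<in> mcar P0" if "t \<in> outn s" for t using P0.piece_car[OF qp[OF that]] .
    let ?x = "\<Sum>t\<in>outn s. Q t (?w t) s"
    have "p ?x = (\<Sum>t\<in>outn s. p (Q t (?w t) s))"
      by (rule lin_on_sum[OF P0.vs M.vs P0.sub hom_lin[OF p] qc])
    then have "p ?x = 0" using y by (simp add: u_def)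
    moreover have "?x \<in> piece P0 s" by (rule P0.m.subspace_sum[OF P0.piece_sub[OF sVV] qp])
    ultimately have x0: "?x = 0" using pinj[OF s] by blast
    \<comment> \<open>The formula of \<open>source_ev\<close> read backwards; it leaves no other
      choice for z.\<close>
    define z where "z = (\<lambda>h. if h \<in> ?H1 then \<Sum>t\<in>outn s. cf (h (?w t)) s t else 0)"
    have zN: "z \<in> mcar ?N"
      unfolding nak_car
      using lin_on_add[OF lin_ev] lin_on_scl[OF lin_ev] H.subspace_add[OF H1sub] H.subspace_scale[OF H1sub]
      by (auto simp: z_def lin_on_def sum.distrib sum_distrib_left)
    have "z (pull h) = 0" if h: "h \<in> ?H0" for h
    proof -
      have "z (pull h) = (\<Sum>t\<in>outn s. cf (pull h (?w t)) s t)" using pull[OF h] by (simp add: z_def)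
      also have "\<dots> = (\<Sum>t\<in>outn s. cf (h (Q t (?w t) s)) s s)"
        using K5(1)[OF h _ w] P1.piece_car[OF w] by (intro sum.cong refl) (simp add: pull_def)
      also have "\<dots> = cf (\<Sum>t\<in>outn s. h (Q t (?w t) s)) s s" by (rule cf_sum[symmetric]) (rule hom_reg_val[OF h])
      also have "(\<Sum>t\<in>outn s. h (Q t (?w t) s)) = h ?x"
        using vs_A qc by (intro lin_on_sum[OF P0.vs _ P0.sub hom_lin[OF h], symmetric]) (auto simp: reg_mod_def)
      also have "h ?x = 0"
        unfolding x0 using lin_on_0[OF P0.vs _ P0.sub hom_lin[OF h]] vs_A by (simp add: reg_mod_def)
      finally show ?thesis by simp
    qed
    then have zK: "z \<in> mcar ?K" using zN K by blast
    have "mact ?N z (b s s) = z"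
    proof
      fix h show "mact ?N z (b s s) h = z h"
        using nak_act[of h P1 z "b s s"] hom_reg_act_in[OF rm(1) _ b_in_diag[OF sVV], of h]
          val1[of h] sVV
        by (cases "h \<in> ?H1") (auto simp: z_def cf_mul_left_diag)
    qed
    then have zp: "z \<in> piece ?K s" using zK by (simp add: piece_def Kact)
    have "mact ?N z (b s t) = y t" if t: "t \<in> outn s" for t
    proof
      fix h
      have st: "(s, t) \<in> E" "t \<in> sinks" using t by auto
      show "mact ?N z (b s t) h = y t h"
      proof (cases "h \<in> ?H1")
        case True
        have "mact ?N z (b s t) h = (\<Sum>t'\<in>outn s. cf (amul A (b s t) (h (?w t'))) s t')"
          using nak_act(1)[OF True] hom_reg_act_in[OF rm(1) True b_in_arrow[OF st(1)]] by (simp add: z_def)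
        also have "\<dots> = (\<Sum>t'\<in>outn s. if t' = t then cf (h (?w t)) t t else 0)"
          using hom_reg_val[OF True] by (intro sum.cong refl) (simp add: cf_mul_left_arrow[OF _ st(1)])
        also have "\<dots> = cf (h (?w t)) t t" using t by simp
        also have "\<dots> = y t h" using \<theta>[OF st(2) yp[OF t]] True by (simp add: W_def)
        finally show ?thesis .
      next
        case False
        then show ?thesis using yp[OF t] nak_act(2)[OF False] by (simp add: piece_def K nak_car)
      qed
    qed
    then show "\<exists>z\<in>piece ?K s. \<forall>t\<in>outn s. mact ?K z (b s t) = y t" using zp Kact by auto
  qed
qed

lemma tau_ar_seq:
  assumes "tau_mod A M N" shows "\<exists>u. ar_seq M N u"
proof -
  have M: "is_rmod A M" and N: "is_rmod A N"
    using assms by (auto simp: tau_mod_def fg_mod_def)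
  obtain P1 P0 :: "('k, 'a) umod" and f p where *: "min_proj_pres A P1 f P0 p M"
    "iso_mod A N (ker_mod (nak A P1) (nak_map A P1 P0 f))"
    using assms unfolding tau_mod_def by blast
  then show ?thesis using ar_seq_kernel[OF *(1) M] ar_seq_iso[OF N *(2)] by blast
qed

end

section \<open>Indecomposability and surjectivity\<close>

context bipartite_algebra begin

definition decomposes where
  "decomposes M U X Y \<longleftrightarrow> module.subspace (mscl M) X \<and> module.subspace (mscl M) Y \<and>
    X \<subseteq> U \<and> Y \<subseteq> U \<and> X \<inter> Y \<subseteq> {0} \<and> (\<forall>v\<in>U. \<exists>x\<in>X. \<exists>y\<in>Y. v = x + y)"

text \<open>Direct sum decompositions are given by families of complementary subspaces of the
  components which the arrows preserve. The zero module satisfies this condition, so later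
  statements carry \<open>mcar N = {0}\<close> as a separate alternative.\<close>

definition indec where
  "indec M \<longleftrightarrow> (\<forall>X Y. (\<forall>i\<in>V. decomposes M (piece M i) (X i) (Y i)) \<and>
    (\<forall>s t. (s, t) \<in> E \<longrightarrow> (\<forall>v\<in>X s. mact M v (b s t) \<in> X t) \<and> (\<forall>v\<in>Y s. mact M v (b s t) \<in> Y t)) \<longrightarrow>
    (\<forall>i\<in>V. X i = {0}) \<or> (\<forall>i\<in>V. Y i = {0}))"

text \<open>The right exactness missing from \<open>ar_seq\<close> at the sinks;
  \<open>source_surj\<close> is its counterpart at the sources.\<close>

definition sink_surj where
  "sink_surj M \<longleftrightarrow> (\<forall>t\<in>sinks. \<forall>v\<in>piece M t.
    \<exists>m. (\<forall>s\<in>inn t. m s \<in> piece M s) \<and> v = (\<Sum>s\<in>inn t. mact M (m s) (b s t)))"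

definition source_surj where
  "source_surj M N u \<longleftrightarrow> (\<forall>s\<in>sources. \<forall>v\<in>piece M s.
    \<exists>y. (\<forall>t\<in>outn s. y t \<in> piece N t) \<and> v = (\<Sum>t\<in>outn s. u s t (y t)))"

text \<open>Left exactness in two rounds: if nothing reaches M, then N has no sink components, and
  then nothing at a source can be detected either.\<close>

lemma ar_zero:
  assumes N: "is_rmod A N" and seq: "ar_seq M N u"
    and 0: "\<And>s t y. (s, t) \<in> E \<Longrightarrow> y \<in> piece N t \<Longrightarrow> u s t y = 0"
  shows "mcar N = {0}"
proof -
  interpret N: bip_module A V E b cf N by (rule rmod_module[OF N])
  have sink: "y = 0" if "t \<in> sinks" "y \<in> piece N t" for t y
    by (rule ar_sink_inj[OF seq that]) (use 0 that in auto)
  have "z = 0" if s: "s \<in> sources" and z: "z \<in> piece N s" for s z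
    by (rule ar_source_inj[OF seq s z]) (use sink[OF _ N.act_arrow[OF N.piece_car[OF z]]] in blast)
  then have "piece N i = {0}" if "i \<in> V" for i
    using sink that N.m.subspace_0[OF N.piece_sub[OF that]] by blast
  then show ?thesis using N.piece_0_iff by blast
qed

lemma ar_zero_zero:
  assumes M: "is_rmod A M" and N: "is_rmod A N" and seq: "ar_seq M N u" and 0: "mcar M = {0}"
  shows "mcar N = {0}"
proof (rule ar_zero[OF N seq])
  fix s t y assume st: "(s, t) \<in> E" and y: "y \<in> piece N t"
  show "u s t y = 0" using ar_in[OF seq st y] 0 by (simp add: piece_def)
qed

text \<open>
  A decomposition at the sources which is compatible with \<open>N\<close> extends to all of \<open>M\<close>, since
  \<open>M e\<^sub>t\<close> is the cokernel of \<open>N e\<^sub>t \<rightarrow> \<Oplus>\<^sub>s M e\<^sub>s\<close>.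
\<close>

lemma indec_sources:
  assumes M: "is_rmod A M" and ind: "indec M" and surj: "sink_surj M" and seq: "ar_seq M N u"
    and dec: "\<And>s. s \<in> sources \<Longrightarrow> decomposes M (piece M s) (X s) (Y s)"
    and compat: "\<And>t y. t \<in> sinks \<Longrightarrow> y \<in> piece N t \<Longrightarrow> \<exists>y1 y2. y1 \<in> piece N t \<and> y2 \<in> piece N t \<and>
      y = y1 + y2 \<and> (\<forall>s\<in>inn t. u s t y1 \<in> X s \<and> u s t y2 \<in> Y s)"
  shows "(\<forall>s\<in>sources. X s = {0}) \<or> (\<forall>s\<in>sources. Y s = {0})"
proof -
  interpret M: bip_module A V E b cf M by (rule rmod_module[OF M])
  have X: "M.m.subspace (X s)" "X s \<subseteq> piece M s" and Y: "M.m.subspace (Y s)" "Y s \<subseteq> piece M s"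
    and XY: "X s \<inter> Y s \<subseteq> {0}" and split: "\<And>v. v \<in> piece M s \<Longrightarrow> \<exists>x\<in>X s. \<exists>y\<in>Y s. v = x + y"
    if "s \<in> sources" for s
    using dec[OF that] unfolding decomposes_def by blast+
  have src: "s \<in> sources" if "s \<in> inn t" for s t using that E_source by blast
  \<comment> \<open>The summands at a sink are forced: they have to contain the arrow images of the
    source summands, and surjectivity makes these images large enough.\<close>
  let ?X = "\<lambda>i. if i \<in> sinks then arrow_sums M X i else X i"
  let ?Y = "\<lambda>i. if i \<in> sinks then arrow_sums M Y i else Y i"
  have "decomposes M (piece M i) (?X i) (?Y i)" if i: "i \<in> V" for i
  proof (cases "i \<in> sinks")
    case True
    \<comment> \<open>A vector in both sums gives a relation between its two expressions, hence an
      element of N e_i. Splitting that element splits the relation, so each expression is itself a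
      relation and the vector is 0.\<close>
    have "arrow_sums M X i \<inter> arrow_sums M Y i \<subseteq> {0}"
    proof
      fix v assume "v \<in> arrow_sums M X i \<inter> arrow_sums M Y i"
      then obtain m m' where m: "\<forall>s\<in>inn i. m s \<in> X s" "v = (\<Sum>s\<in>inn i. mact M (m s) (b s i))"
        "\<forall>s\<in>inn i. m' s \<in> Y s" "v = (\<Sum>s\<in>inn i. mact M (m' s) (b s i))"
        unfolding arrow_sums_def by blast
      have mp: "m s \<in> piece M s" "m' s \<in> piece M s" if "s \<in> inn i" for s
        using m(1,3) that X(2)[OF src] Y(2)[OF src] by blast+
      have md: "m s - m' s \<in> piece M s" if "s \<in> inn i" for s
        using mp[OF that] M.m.subspace_diff[OF M.piece_sub] src[OF that] by blast
      have "mact M (m s - m' s) (b s i) = mact M (m s) (b s i) - mact M (m' s) (b s i)"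
        if s: "s \<in> inn i" for s
      proof -
        have "mact M ((m s - m' s) + m' s) (b s i) = mact M (m s - m' s) (b s i) + mact M (m' s) (b s i)"
          using M.piece_car[OF md[OF s]] M.piece_car[OF mp(2)[OF s]] b_in_arrow s
          by (intro M.act_add) auto
        then show ?thesis by (simp add: algebra_simps)
      qed
      then have "(\<Sum>s\<in>inn i. mact M (m s - m' s) (b s i)) = 0"
        using m(2,4) by (simp add: sum_subtractf)
      then obtain y where y: "y \<in> piece N i" "\<forall>s\<in>inn i. u s i y = m s - m' s"
        using ar_sink_ex[OF seq True, of "\<lambda>s. m s - m' s"] md by auto
      obtain y1 y2 where y12: "y1 \<in> piece N i" "y2 \<in> piece N i" "y = y1 + y2"
        "\<forall>s\<in>inn i. u s i y1 \<in> X s \<and> u s i y2 \<in> Y s"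
        using compat[OF True y(1)] by blast
      have "m s = u s i y1" if s: "s \<in> inn i" for s
      proof -
        have "(s, i) \<in> E" using s by simp
        then have "m s - m' s = u s i y1 + u s i y2"
          using y(2) s lin_on_add[OF ar_lin[OF seq] y12(1,2)] y12(3) by simp
        then have e: "m s - u s i y1 = m' s + u s i y2" by (simp add: algebra_simps)
        have "m s - u s i y1 \<in> X s"
          using m(1) y12(4) s M.m.subspace_diff[OF X(1)[OF src[OF s]]] by blast
        moreover have "m' s + u s i y2 \<in> Y s"
          using m(3) y12(4) s M.m.subspace_add[OF Y(1)[OF src[OF s]]] by blast
        ultimately have "m s - u s i y1 = 0" using XY[OF src[OF s]] e by auto
        then show ?thesis by simp
      qed
      then have "v = (\<Sum>s\<in>inn i. mact M (u s i y1) (b s i))" using m(2) by simp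
      then show "v \<in> {0}" using ar_sink_sum[OF seq True y12(1)] by simp
    qed
    moreover have "\<exists>x\<in>arrow_sums M X i. \<exists>y\<in>arrow_sums M Y i. v = x + y" if v: "v \<in> piece M i" for v
    proof -
      obtain m where m: "\<forall>s\<in>inn i. m s \<in> piece M s" "v = (\<Sum>s\<in>inn i. mact M (m s) (b s i))"
        using surj True v unfolding sink_surj_def by blast
      have "\<forall>s\<in>inn i. \<exists>xy. fst xy \<in> X s \<and> snd xy \<in> Y s \<and> m s = fst xy + snd xy"
        using split[OF src] m(1) by fastforce
      from bchoice[OF this] obtain xy where
        xy: "\<forall>s\<in>inn i. fst (xy s) \<in> X s \<and> snd (xy s) \<in> Y s \<and> m s = fst (xy s) + snd (xy s)" ..
      have "mact M (m s) (b s i) = mact M (fst (xy s)) (b s i) + mact M (snd (xy s)) (b s i)"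
        if s: "s \<in> inn i" for s
      proof -
        have "fst (xy s) \<in> mcar M" "snd (xy s) \<in> mcar M" "b s i \<in> acar A" "m s = fst (xy s) + snd (xy s)"
          using xy s X(2)[OF src[OF s]] Y(2)[OF src[OF s]] M.piece_car b_in_arrow by auto
        then show ?thesis using M.act_add by simp
      qed
      then have "v = (\<Sum>s\<in>inn i. mact M (fst (xy s)) (b s i)) + (\<Sum>s\<in>inn i. mact M (snd (xy s)) (b s i))"
        using m(2) by (simp add: sum.distrib)
      moreover have "(\<Sum>s\<in>inn i. mact M (fst (xy s)) (b s i)) \<in> arrow_sums M X i"
        unfolding arrow_sums_def by (intro CollectI exI[of _ "\<lambda>s. fst (xy s)"]) (use xy in simp)
      moreover have "(\<Sum>s\<in>inn i. mact M (snd (xy s)) (b s i)) \<in> arrow_sums M Y i"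
        unfolding arrow_sums_def by (intro CollectI exI[of _ "\<lambda>s. snd (xy s)"]) (use xy in simp)
      ultimately show ?thesis by blast
    qed
    ultimately show ?thesis
      using True arrow_sums_subspace[OF M X(1)[OF src] X(2)[OF src]] arrow_sums_piece[OF M i X(2)[OF src]]
        arrow_sums_subspace[OF M Y(1)[OF src] Y(2)[OF src]] arrow_sums_piece[OF M i Y(2)[OF src]]
      unfolding decomposes_def by simp
  next
    case False
    then show ?thesis using dec i by simp
  qed
  moreover have "mact M v (b s t) \<in> ?X t" if "(s, t) \<in> E" "v \<in> ?X s" for s t v
    using that E_source[OF that(1)] X M.m.subspace_0[OF X(1)[OF src]]
      arrow_sums_single[OF M that(1), of v X] by auto
  moreover have "mact M v (b s t) \<in> ?Y t" if "(s, t) \<in> E" "v \<in> ?Y s" for s t v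
    using that E_source[OF that(1)] Y M.m.subspace_0[OF Y(1)[OF src]]
      arrow_sums_single[OF M that(1), of v Y] by auto
  ultimately have "(\<forall>i\<in>V. ?X i = {0}) \<or> (\<forall>i\<in>V. ?Y i = {0})"
    using ind[unfolded indec_def, rule_format, of ?X ?Y] by blast
  then show ?thesis by auto
qed

lemma decomposes_triv:
  assumes "module.subspace (mscl M) U" "vector_space (mscl M)"
  shows "decomposes M U {0} U" "decomposes M U U {0}"
proof -
  interpret vector_space "mscl M" by fact
  show "decomposes M U {0} U" "decomposes M U U {0}"
    using assms(1) subspace_0[OF assms(1)] subspace_single_0 unfolding decomposes_def by auto
qed

text \<open>The kernel of a functional that vanishes on U' and takes the value 1 at v is a
  complement of the line through v containing U'.\<close>

lemma decomposes_line:
  assumes vs: "vector_space (mscl M :: 'k \<Rightarrow> _)" and U: "module.subspace (mscl M) U"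
    and U': "module.subspace (mscl M) U'" and v: "v \<in> U" "v \<notin> U'" and sub: "U' \<subseteq> U"
  shows "\<exists>H. decomposes M U {mscl M c v | c. True} H \<and> U' \<subseteq> H"
proof -
  interpret vector_space "mscl M" by (rule vs)
  obtain l where l: "Vector_Spaces.linear (mscl M) (*) l" "\<forall>u\<in>U'. l u = 0" "l v = (1::'k)"
    using functional_separates[OF vs U' v(2)] by blast
  interpret l: Vector_Spaces.linear "mscl M" "(*)" l by (rule l(1))
  let ?H = "{u \<in> U. l u = 0}"
  have "decomposes M U {mscl M c v | c. True} ?H"
    unfolding decomposes_def
  proof (intro conjI ballI)
    show "subspace {mscl M c v | c. True}"
    proof (rule subspaceI)
      show "0 \<in> {mscl M c v | c. True}" by (intro CollectI exI[of _ 0]) simp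
      show "x + y \<in> {mscl M c v | c. True}"
        if "x \<in> {mscl M c v | c. True}" "y \<in> {mscl M c v | c. True}" for x y
        using that scale_left_distrib[symmetric] by auto
      show "mscl M a x \<in> {mscl M c v | c. True}" if "x \<in> {mscl M c v | c. True}" for a x
        using that by auto
    qed
    show "subspace ?H"
      using subspace_0[OF U] subspace_add[OF U] subspace_scale[OF U]
      by (intro subspaceI) (auto simp: l.zero l.add l.scale)
    show "{mscl M c v | c. True} \<subseteq> U" using v(1) subspace_scale[OF U] by blast
    show "{mscl M c v | c. True} \<inter> ?H \<subseteq> {0}" using l(3) by (auto simp: l.scale)
    fix w assume w: "w \<in> U"
    have "w - mscl M (l w) v \<in> ?H"
      using w v(1) subspace_diff[OF U] subspace_scale[OF U] l(3) by (auto simp: l.diff l.scale)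
    moreover have "w = mscl M (l w) v + (w - mscl M (l w) v)" by simp
    ultimately show "\<exists>x\<in>{mscl M c v | c. True}. \<exists>y\<in>?H. w = x + y" by blast
  qed auto
  moreover have "U' \<subseteq> ?H" using l(2) sub by blast
  ultimately show ?thesis by blast
qed

lemma line_not_zero: "v \<noteq> 0 \<Longrightarrow> vector_space (mscl M) \<Longrightarrow> {mscl M c v | c. True} \<noteq> {0}"
proof -
  assume v: "v \<noteq> 0" and vs: "vector_space (mscl M)"
  interpret vector_space "mscl M" by (rule vs)
  have "v \<in> {mscl M c v | c. True}" by (intro CollectI exI[of _ 1]) simp
  then show ?thesis using v by blast
qed

text \<open>A vector at t outside the arrow images spans a direct summand S(t). An indecomposable M
  then has no source components, and N vanishes because it embeds into these.\<close>

lemma indec_sink_surj: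
  assumes M: "is_rmod A M" and N: "is_rmod A N" and ind: "indec M" and seq: "ar_seq M N u"
  shows "mcar N = {0} \<or> sink_surj M"
proof (rule disjCI)
  interpret M: bip_module A V E b cf M by (rule rmod_module[OF M])
  assume "\<not> sink_surj M"
  then obtain t v where t: "t \<in> sinks" and v: "v \<in> piece M t" "v \<notin> arrow_sums M (piece M) t"
    unfolding sink_surj_def arrow_sums_def by blast
  have tV: "t \<in> V" using t E_V by blast
  have sub: "M.m.subspace (arrow_sums M (piece M) t)"
    using M.piece_sub E_V by (intro arrow_sums_subspace[OF M]) auto
  have ps: "arrow_sums M (piece M) t \<subseteq> piece M t" by (rule arrow_sums_piece[OF M tV]) auto
  let ?L = "{mscl M c v | c. True}"
  obtain H where H: "decomposes M (piece M t) ?L H" "arrow_sums M (piece M) t \<subseteq> H"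
    using decomposes_line[OF M.vs M.piece_sub[OF tV] sub v ps] by blast
  let ?X = "\<lambda>i. if i = t then ?L else {0}" and ?Y = "\<lambda>i. if i = t then H else piece M i"
  have 0: "0 \<in> ?L" "0 \<in> H"
    using H(1) M.m.subspace_0 unfolding decomposes_def by blast+
  have "\<forall>i\<in>V. decomposes M (piece M i) (?X i) (?Y i)"
    using H(1) decomposes_triv(1)[OF M.piece_sub M.vs] by auto
  moreover have "mact M w (b s i) \<in> ?X i" if "(s, i) \<in> E" "w \<in> ?X s" for s i w
  proof -
    have "s \<noteq> t" using that(1) t E_source by blast
    then have "mact M w (b s i) = 0" using that M.act_zero[OF b_in_arrow] by simp
    then show ?thesis using 0 by simp
  qed
  moreover have "mact M w (b s i) \<in> ?Y i" if "(s, i) \<in> E" "w \<in> ?Y s" for s i w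
  proof -
    have "s \<noteq> t" using that(1) t E_source by blast
    then have w: "w \<in> piece M s" using that(2) by simp
    show ?thesis
    proof (cases "i = t")
      case True
      have "0 \<in> piece M s'" if "s' \<in> inn t" for s' using that M.m.subspace_0[OF M.piece_sub] E_V by blast
      then have "mact M w (b s t) \<in> arrow_sums M (piece M) t"
        using arrow_sums_single[OF M, of s t w "piece M"] that(1) True w by blast
      then show ?thesis using True H(2) by auto
    next
      case False
      then show ?thesis using M.act_arrow[OF M.piece_car[OF w] that(1)] by simp
    qed
  qed
  ultimately have "(\<forall>i\<in>V. ?X i = {0}) \<or> (\<forall>i\<in>V. ?Y i = {0})"
    using ind[unfolded indec_def, rule_format, of ?X ?Y] by blast
  moreover have "v \<noteq> 0" using v(2) M.m.subspace_0[OF sub] by blast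
  ultimately have Y0: "\<forall>i\<in>V. ?Y i = {0}" using line_not_zero[OF _ M.vs] tV by (metis (full_types))
  show "mcar N = {0}"
  proof (rule ar_zero[OF N seq])
    fix s t' y assume st: "(s, t') \<in> E" and y: "y \<in> piece N t'"
    have "s \<noteq> t" using st t E_source by blast
    then show "u s t' y = 0" using ar_in[OF seq st y] Y0 E_V(1)[OF st] by auto
  qed
qed

definition source_sums where
  "source_sums u Z s = {\<Sum>t\<in>outn s. u s t (y t) | y. \<forall>t\<in>outn s. y t \<in> Z t}"

lemma source_sums_subspace:
  assumes M: "is_rmod A M" and N: "is_rmod A N" and seq: "ar_seq M N u" and s: "s \<in> V"
    and Z: "\<forall>t\<in>V. module.subspace (mscl N) (Z t) \<and> Z t \<subseteq> piece N t"
  shows "module.subspace (mscl M) (source_sums u Z s)" "source_sums u Z s \<subseteq> piece M s"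
    and "(s, t) \<in> E \<Longrightarrow> y \<in> Z t \<Longrightarrow> u s t y \<in> source_sums u Z s"
proof -
  interpret M: bip_module A V E b cf M by (rule rmod_module[OF M])
  interpret N: bip_module A V E b cf N by (rule rmod_module[OF N])
  have outV: "t \<in> V" if "t \<in> outn s" for t using that E_V by blast
  have lin: "lin_on (mscl N) (mscl M) (piece N t) (u s t)" if "t \<in> outn s" for t
    using ar_lin[OF seq] that by blast
  have u0: "u s t 0 = 0" if "t \<in> outn s" for t
    by (rule lin_on_0[OF N.vs M.vs N.piece_sub[OF outV[OF that]] lin[OF that]])
  have Zs: "N.m.subspace (Z t)" if "t \<in> outn s" for t using Z outV[OF that] by blast
  have ZN: "y \<in> piece N t" if "t \<in> outn s" "y \<in> Z t" for y t using Z outV[OF that(1)] that(2) by blast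
  show "source_sums u Z s \<subseteq> piece M s"
    using ar_in[OF seq] ZN by (auto simp: source_sums_def intro!: M.m.subspace_sum[OF M.piece_sub[OF s]])
  show "M.m.subspace (source_sums u Z s)"
  proof (rule M.m.subspaceI)
    show "0 \<in> source_sums u Z s"
      unfolding source_sums_def using N.m.subspace_0[OF Zs] u0
      by (intro CollectI exI[of _ "\<lambda>_. 0"]) auto
    show "x + x' \<in> source_sums u Z s" if xx: "x \<in> source_sums u Z s" "x' \<in> source_sums u Z s" for x x'
    proof -
      obtain y y' where y: "\<forall>t\<in>outn s. y t \<in> Z t" "x = (\<Sum>t\<in>outn s. u s t (y t))"
        "\<forall>t\<in>outn s. y' t \<in> Z t" "x' = (\<Sum>t\<in>outn s. u s t (y' t))"
        using xx unfolding source_sums_def by blast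
      have "u s t (y t + y' t) = u s t (y t) + u s t (y' t)" if "t \<in> outn s" for t
        using lin_on_add[OF lin[OF that] ZN[OF that] ZN[OF that]] y that by blast
      then have "x + x' = (\<Sum>t\<in>outn s. u s t (y t + y' t))" using y by (simp add: sum.distrib)
      then show ?thesis
        unfolding source_sums_def using y N.m.subspace_add[OF Zs]
        by (intro CollectI exI[of _ "\<lambda>t. y t + y' t"]) auto
    qed
    show "mscl M c x \<in> source_sums u Z s" if x: "x \<in> source_sums u Z s" for c x
    proof -
      obtain y where y: "\<forall>t\<in>outn s. y t \<in> Z t" "x = (\<Sum>t\<in>outn s. u s t (y t))"
        using x unfolding source_sums_def by blast
      have "u s t (mscl N c (y t)) = mscl M c (u s t (y t))" if "t \<in> outn s" for t
        using lin_on_scl[OF lin[OF that] ZN[OF that]] y that by blast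
      then have "mscl M c x = (\<Sum>t\<in>outn s. u s t (mscl N c (y t)))"
        using y by (simp add: M.m.scale_sum_right)
      then show ?thesis
        unfolding source_sums_def using y N.m.subspace_scale[OF Zs]
        by (intro CollectI exI[of _ "\<lambda>t. mscl N c (y t)"]) auto
    qed
  qed
  show "u s t y \<in> source_sums u Z s" if st: "(s, t) \<in> E" and y: "y \<in> Z t"
  proof -
    let ?y = "\<lambda>t'. if t' = t then y else 0"
    have "u s t y = (\<Sum>t'\<in>outn s. if t' = t then u s t y else 0)" using st by simp
    also have "\<dots> = (\<Sum>t'\<in>outn s. u s t' (?y t'))"
      using u0 by (intro sum.cong refl) auto
    also have "\<dots> \<in> source_sums u Z s"
      unfolding source_sums_def using y N.m.subspace_0[OF Zs] by (intro CollectI exI[of _ ?y]) auto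
    finally show ?thesis .
  qed
qed

text \<open>A vector at s outside the image of N splits off at the sources, and
  \<open>indec_sources\<close> extends the splitting to M. The complement contains every value of u,
  so its vanishing gives N = 0.\<close>

lemma indec_source_surj:
  assumes M: "is_rmod A M" and N: "is_rmod A N" and ind: "indec M" and seq: "ar_seq M N u"
    and surj: "sink_surj M"
  shows "mcar N = {0} \<or> source_surj M N u"
proof (rule disjCI)
  interpret M: bip_module A V E b cf M by (rule rmod_module[OF M])
  interpret N: bip_module A V E b cf N by (rule rmod_module[OF N])
  assume "\<not> source_surj M N u"
  then obtain s v where s: "s \<in> sources" and v: "v \<in> piece M s" "v \<notin> source_sums u (piece N) s"
    unfolding source_surj_def source_sums_def by blast
  have sV: "s \<in> V" using s by blast
  have pN: "\<forall>t\<in>V. N.m.subspace (piece N t) \<and> piece N t \<subseteq> piece N t" using N.piece_sub by blast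
  note ss = source_sums_subspace[OF M N seq sV pN]
  let ?L = "{mscl M c v | c. True}"
  obtain H where H: "decomposes M (piece M s) ?L H" "source_sums u (piece N) s \<subseteq> H"
    using decomposes_line[OF M.vs M.piece_sub[OF sV] ss(1) v ss(2)] by blast
  let ?X = "\<lambda>i. if i = s then ?L else {0}" and ?Y = "\<lambda>i. if i = s then H else piece M i"
  have uH: "u s t y \<in> H" if "(s, t) \<in> E" "y \<in> piece N t" for t y
    using ss(3)[OF that] H(2) by blast
  have 0: "0 \<in> ?L" using H(1) M.m.subspace_0 unfolding decomposes_def by blast
  have "(\<forall>i\<in>sources. ?X i = {0}) \<or> (\<forall>i\<in>sources. ?Y i = {0})"
  proof (rule indec_sources[OF M ind surj seq])
    show "decomposes M (piece M i) (?X i) (?Y i)" if "i \<in> sources" for i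
      using H(1) decomposes_triv(1)[OF M.piece_sub M.vs] that by auto
    fix t y assume t: "t \<in> sinks" and y: "y \<in> piece N t"
    have tV: "t \<in> V" using t E_V by blast
    \<comment> \<open>All of N is sent into the second summand, so y = 0 + y is a compatible
      splitting.\<close>
    have "u s' t 0 = 0" if "(s', t) \<in> E" for s'
      using lin_on_0[OF N.vs M.vs N.piece_sub[OF tV] ar_lin[OF seq that]] .
    then show "\<exists>y1 y2. y1 \<in> piece N t \<and> y2 \<in> piece N t \<and> y = y1 + y2 \<and>
      (\<forall>s'\<in>inn t. u s' t y1 \<in> ?X s' \<and> u s' t y2 \<in> ?Y s')"
      using y N.m.subspace_0[OF N.piece_sub[OF tV]] uH ar_in[OF seq _ y] 0
      by (intro exI[of _ 0] exI[of _ y]) auto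
  qed
  moreover have "v \<noteq> 0" using v(2) M.m.subspace_0[OF ss(1)] by blast
  ultimately have Y0: "\<forall>i\<in>sources. ?Y i = {0}" using line_not_zero[OF _ M.vs] s by (metis (full_types))
  show "mcar N = {0}"
  proof (rule ar_zero[OF N seq])
    fix s' t' y assume st: "(s', t') \<in> E" and y: "y \<in> piece N t'"
    have "u s' t' y \<in> ?Y s'" using uH ar_in[OF seq st y] st y by auto
    then show "u s' t' y = 0" using Y0 E_source[OF st] by blast
  qed
qed

text \<open>Reflections carry decompositions back: the images in M e_s of two complementary
  submodules of N are complementary, because the relations among them form N e_s, which is itself
  decomposed. Indecomposability of M kills one family of images, and left exactness then kills the
  corresponding submodule of N.\<close>

lemma indec_step:
  assumes M: "is_rmod A M" and N: "is_rmod A N" and ind: "indec M" and seq: "ar_seq M N u"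
    and surj: "sink_surj M" and surj2: "source_surj M N u"
  shows "indec N"
  unfolding indec_def
proof (intro allI impI)
  interpret M: bip_module A V E b cf M by (rule rmod_module[OF M])
  interpret N: bip_module A V E b cf N by (rule rmod_module[OF N])
  fix X Y
  assume *: "(\<forall>i\<in>V. decomposes N (piece N i) (X i) (Y i)) \<and>
    (\<forall>s t. (s, t) \<in> E \<longrightarrow> (\<forall>v\<in>X s. mact N v (b s t) \<in> X t) \<and> (\<forall>v\<in>Y s. mact N v (b s t) \<in> Y t))"
  have X: "N.m.subspace (X i)" "X i \<subseteq> piece N i" and Y: "N.m.subspace (Y i)" "Y i \<subseteq> piece N i"
    and XY: "X i \<inter> Y i \<subseteq> {0}" and split: "\<And>v. v \<in> piece N i \<Longrightarrow> \<exists>x\<in>X i. \<exists>y\<in>Y i. v = x + y"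
    if "i \<in> V" for i
    using * that unfolding decomposes_def by blast+
  have aX: "mact N v (b s t) \<in> X t" if "(s, t) \<in> E" "v \<in> X s" for s t v using * that by blast
  have aY: "mact N v (b s t) \<in> Y t" if "(s, t) \<in> E" "v \<in> Y s" for s t v using * that by blast
  have outV: "t \<in> V" if "t \<in> outn s" for s t using that E_V by blast
  have lin: "lin_on (mscl N) (mscl M) (piece N t) (u s t)" if "t \<in> outn s" for s t
    using ar_lin[OF seq] that by blast
  let ?im = "source_sums u"
  have X': "\<forall>t\<in>V. N.m.subspace (X t) \<and> X t \<subseteq> piece N t"
    and Y': "\<forall>t\<in>V. N.m.subspace (Y t) \<and> Y t \<subseteq> piece N t"
    using X Y by blast+
  note imX = source_sums_subspace[OF M N seq _ X'] and imY = source_sums_subspace[OF M N seq _ Y']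
  have "decomposes M (piece M s) (?im X s) (?im Y s)" if s: "s \<in> sources" for s
  proof -
    have sV: "s \<in> V" using s by blast
    \<comment> \<open>A common value v gives a relation, hence an element z of N e_s. The part of z
      in X accounts for all the y t, and the two maps of the sequence compose to zero, so v =
      0.\<close>
    have "?im X s \<inter> ?im Y s \<subseteq> {0}"
    proof
      fix v assume "v \<in> ?im X s \<inter> ?im Y s"
      then obtain y y' where y: "\<forall>t\<in>outn s. y t \<in> X t" "v = (\<Sum>t\<in>outn s. u s t (y t))"
        "\<forall>t\<in>outn s. y' t \<in> Y t" "v = (\<Sum>t\<in>outn s. u s t (y' t))"
        unfolding source_sums_def by blast
      have yp: "y t \<in> piece N t" "y' t \<in> piece N t" if "t \<in> outn s" for t
        using y(1,3) that X(2)[OF outV[OF that]] Y(2)[OF outV[OF that]] by blast+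
      have yd: "y t - y' t \<in> piece N t" if "t \<in> outn s" for t
        using yp[OF that] N.m.subspace_diff[OF N.piece_sub[OF outV[OF that]]] by blast
      have "u s t (y t - y' t) = u s t (y t) - u s t (y' t)" if t: "t \<in> outn s" for t
        using lin_on_add[OF lin[OF t] yd[OF t] yp(2)[OF t]] by (simp add: algebra_simps)
      then have "(\<Sum>t\<in>outn s. u s t (y t - y' t)) = 0" using y(2,4) by (simp add: sum_subtractf)
      then obtain z where z: "z \<in> piece N s" "\<forall>t\<in>outn s. mact N z (b s t) = y t - y' t"
        using ar_source_ex[OF seq s, of "\<lambda>t. y t - y' t"] yd by auto
      obtain z1 z2 where z12: "z1 \<in> X s" "z2 \<in> Y s" "z = z1 + z2" using split[OF sV z(1)] by blast
      have zc: "z1 \<in> piece N s" "z2 \<in> piece N s" using z12 X(2)[OF sV] Y(2)[OF sV] by blast+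
      have "y t = mact N z1 (b s t)" if t: "t \<in> outn s" for t
      proof -
        have st: "(s, t) \<in> E" using t by simp
        have "mact N z (b s t) = mact N z1 (b s t) + mact N z2 (b s t)"
          using N.act_add[OF N.piece_car[OF zc(1)] N.piece_car[OF zc(2)] b_in_arrow[OF st]] z12(3) by simp
        then have "y t - y' t = mact N z1 (b s t) + mact N z2 (b s t)" using z(2) t by simp
        then have e: "y t - mact N z1 (b s t) = y' t + mact N z2 (b s t)" by (simp add: algebra_simps)
        have "y t - mact N z1 (b s t) \<in> X t"
          using y(1) t aX[OF st z12(1)] N.m.subspace_diff[OF X(1)[OF outV[OF t]]] by blast
        moreover have "y' t + mact N z2 (b s t) \<in> Y t"
          using y(3) t aY[OF st z12(2)] N.m.subspace_add[OF Y(1)[OF outV[OF t]]] by blast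
        ultimately have "y t - mact N z1 (b s t) = 0" using XY[OF outV[OF t]] e by auto
        then show ?thesis by simp
      qed
      then have "v = (\<Sum>t\<in>outn s. u s t (mact N z1 (b s t)))" using y(2) by simp
      then show "v \<in> {0}" using ar_source_sum[OF seq s zc(1)] by simp
    qed
    moreover have "\<exists>x\<in>?im X s. \<exists>y\<in>?im Y s. v = x + y" if v: "v \<in> piece M s" for v
    proof -
      obtain y where y: "\<forall>t\<in>outn s. y t \<in> piece N t" "v = (\<Sum>t\<in>outn s. u s t (y t))"
        using surj2 s v unfolding source_surj_def by blast
      have "\<forall>t\<in>outn s. \<exists>xy. fst xy \<in> X t \<and> snd xy \<in> Y t \<and> y t = fst xy + snd xy"
        using split[OF outV] y(1) by fastforce
      from bchoice[OF this] obtain xy where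
        xy: "\<forall>t\<in>outn s. fst (xy t) \<in> X t \<and> snd (xy t) \<in> Y t \<and> y t = fst (xy t) + snd (xy t)" ..
      have "u s t (y t) = u s t (fst (xy t)) + u s t (snd (xy t))" if t: "t \<in> outn s" for t
      proof -
        have "fst (xy t) \<in> piece N t" "snd (xy t) \<in> piece N t" "y t = fst (xy t) + snd (xy t)"
          using xy t X(2)[OF outV[OF t]] Y(2)[OF outV[OF t]] by auto
        then show ?thesis using lin_on_add[OF lin[OF t]] by simp
      qed
      then have "v = (\<Sum>t\<in>outn s. u s t (fst (xy t))) + (\<Sum>t\<in>outn s. u s t (snd (xy t)))"
        using y(2) by (simp add: sum.distrib)
      moreover have "(\<Sum>t\<in>outn s. u s t (fst (xy t))) \<in> ?im X s"
        unfolding source_sums_def by (intro CollectI exI[of _ "\<lambda>t. fst (xy t)"]) (use xy in simp)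
      moreover have "(\<Sum>t\<in>outn s. u s t (snd (xy t))) \<in> ?im Y s"
        unfolding source_sums_def by (intro CollectI exI[of _ "\<lambda>t. snd (xy t)"]) (use xy in simp)
      ultimately show ?thesis by blast
    qed
    ultimately show ?thesis
      using imX(1,2)[OF sV] imY(1,2)[OF sV] unfolding decomposes_def by blast
  qed
  moreover have "\<exists>y1 y2. y1 \<in> piece N t \<and> y2 \<in> piece N t \<and> y = y1 + y2 \<and>
      (\<forall>s\<in>inn t. u s t y1 \<in> ?im X s \<and> u s t y2 \<in> ?im Y s)"
    if t: "t \<in> sinks" and y: "y \<in> piece N t" for t y
  proof -
    have tV: "t \<in> V" using t E_V by blast
    obtain y1 y2 where y12: "y1 \<in> X t" "y2 \<in> Y t" "y = y1 + y2" using split[OF tV y] by blast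
    then show ?thesis
      using imX(3) imY(3) X(2)[OF tV] Y(2)[OF tV] E_V
      by (intro exI[of _ y1] exI[of _ y2]) auto
  qed
  ultimately have zero: "(\<forall>s\<in>sources. ?im X s = {0}) \<or> (\<forall>s\<in>sources. ?im Y s = {0})"
    by (rule indec_sources[OF M ind surj seq])
  \<comment> \<open>Injectivity towards M removes the sink components, and injectivity along the
    arrows then removes the source components.\<close>
  have all0: "\<forall>i\<in>V. Z i = {0}"
    if Z: "\<And>i. i \<in> V \<Longrightarrow> N.m.subspace (Z i)" "\<And>i. i \<in> V \<Longrightarrow> Z i \<subseteq> piece N i"
      and aZ: "\<And>s t v. (s, t) \<in> E \<Longrightarrow> v \<in> Z s \<Longrightarrow> mact N v (b s t) \<in> Z t"
      and 0: "\<forall>s\<in>sources. ?im Z s = {0}" for Z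
  proof -
    have Z': "\<forall>t\<in>V. N.m.subspace (Z t) \<and> Z t \<subseteq> piece N t" using Z by blast
    have snk: "y = 0" if t: "t \<in> sinks" and y: "y \<in> Z t" for t y
    proof (rule ar_sink_inj[OF seq t])
      show "y \<in> piece N t" using Z(2) y t E_V by blast
      fix s assume "s \<in> inn t"
      then have "(s, t) \<in> E" by simp
      then show "u s t y = 0"
        using source_sums_subspace(3)[OF M N seq _ Z' _ y] 0 E_V E_source by blast
    qed
    have "z = 0" if i: "i \<in> V" and z: "z \<in> Z i" for i z
    proof (cases "i \<in> sinks")
      case True
      then show ?thesis using snk z by blast
    next
      case False
      show ?thesis
      proof (rule ar_source_inj[OF seq])
        show "i \<in> sources" using i False by blast
        show "z \<in> piece N i" using Z(2)[OF i] z by blast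
        show "mact N z (b i t) = 0" if "t \<in> outn i" for t using snk aZ z that by blast
      qed
    qed
    then show ?thesis using N.m.subspace_0[OF Z(1)] by blast
  qed
  show "(\<forall>i\<in>V. X i = {0}) \<or> (\<forall>i\<in>V. Y i = {0})"
    using zero all0[of X, OF X aX] all0[of Y, OF Y aY] by blast
qed

section \<open>Dimension counts for the two short exact sequences\<close>

lemma ar_dim_sink:
  assumes M: "fg_mod A M" and N: "fg_mod A N" and seq: "ar_seq M N u" and surj: "sink_surj M"
    and t: "t \<in> sinks"
  shows "vector_space.dim (mscl N) (piece N t) + vector_space.dim (mscl M) (piece M t) =
    (\<Sum>s\<in>inn t. vector_space.dim (mscl M) (piece M s))"
proof -
  have tV: "t \<in> V" using t E_V by blast
  interpret M: bip_module A V E b cf M by (rule fg_module[OF M])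
  interpret N: bip_module A V E b cf N by (rule fg_module[OF N])
  note vsf = vector_space_fun_scl[OF M.vs]
  let ?P = "prod_space (inn t) (piece M)"
  have fdP: "fd_space (fun_scl (mscl M)) ?P" and
    dimP: "vector_space.dim (fun_scl (mscl M)) ?P = (\<Sum>s\<in>inn t. vector_space.dim (mscl M) (piece M s))"
    using prod_space_dim[OF M.vs finite_inn, of t "piece M"] M.fd_piece[OF fg_fd[OF M]] E_V by auto
  let ?f = "\<lambda>F. \<Sum>s\<in>inn t. mact M (F s) (b s t)"
  have car: "F s \<in> mcar M" if "F \<in> ?P" "s \<in> inn t" for F s
    using that M.piece_car by (auto simp: prod_space_def)
  have lin: "lin_on (fun_scl (mscl M)) (mscl M) ?P ?f"
    using car b_in_arrow
    by (simp add: lin_on_def fun_scl_def M.act_add M.act_scl sum.distrib M.m.scale_sum_right)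
  have im: "?f ` ?P = piece M t"
  proof
    show "?f ` ?P \<subseteq> piece M t"
      using car M.act_arrow by (auto intro!: M.m.subspace_sum[OF M.piece_sub[OF tV]])
    show "piece M t \<subseteq> ?f ` ?P"
    proof
      fix v assume "v \<in> piece M t"
      then obtain m where m: "\<forall>s\<in>inn t. m s \<in> piece M s" "v = (\<Sum>s\<in>inn t. mact M (m s) (b s t))"
        using surj t unfolding sink_surj_def by blast
      then show "v \<in> ?f ` ?P"
        by (intro image_eqI[of _ _ "\<lambda>s. if s \<in> inn t then m s else 0"]) (auto simp: prod_space_def)
    qed
  qed
  let ?g = "\<lambda>y s. if s \<in> inn t then u s t y else 0"
  have ul: "lin_on (mscl N) (mscl M) (piece N t) (u s t)" if "s \<in> inn t" for s
    using ar_lin[OF seq] that by blast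
  have glin: "lin_on (mscl N) (fun_scl (mscl M)) (piece N t) ?g"
    using lin_on_add[OF ul] lin_on_scl[OF ul] by (auto simp: lin_on_def fun_scl_def fun_eq_iff)
  have gim: "?g ` piece N t = {F \<in> ?P. ?f F = 0}"
  proof
    show "?g ` piece N t \<subseteq> {F \<in> ?P. ?f F = 0}"
      using ar_in[OF seq] ar_sink_sum[OF seq t] by (auto simp: prod_space_def)
    show "{F \<in> ?P. ?f F = 0} \<subseteq> ?g ` piece N t"
    proof
      fix F assume F: "F \<in> {F \<in> ?P. ?f F = 0}"
      then obtain y where y: "y \<in> piece N t" "\<forall>s\<in>inn t. u s t y = F s"
        using ar_sink_ex[OF seq t, of F] by (auto simp: prod_space_def)
      have "F s = ?g y s" for s using F y(2) by (auto simp: prod_space_def)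
      then show "F \<in> ?g ` piece N t" using y(1) by blast
    qed
  qed
  have "vector_space.dim (fun_scl (mscl M)) (?g ` piece N t) = vector_space.dim (mscl N) (piece N t)"
  proof (rule dim_inj_image[OF N.fd_piece[OF fg_fd[OF N] tV] vsf glin])
    fix y assume y: "y \<in> piece N t" "?g y = 0"
    have "u s t y = 0" if "s \<in> inn t" for s using fun_cong[OF y(2), of s] that by simp
    then show "y = 0" by (rule ar_sink_inj[OF seq t y(1)])
  qed
  then show ?thesis
    using rank_nullity[OF fdP M.vs lin] dimP unfolding im gim by simp
qed

lemma ar_dim_source:
  assumes M: "fg_mod A M" and N: "fg_mod A N" and seq: "ar_seq M N u" and surj: "source_surj M N u"
    and s: "s \<in> sources"
  shows "vector_space.dim (mscl N) (piece N s) + vector_space.dim (mscl M) (piece M s) =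
    (\<Sum>t\<in>outn s. vector_space.dim (mscl N) (piece N t))"
proof -
  have sV: "s \<in> V" using s by blast
  interpret M: bip_module A V E b cf M by (rule fg_module[OF M])
  interpret N: bip_module A V E b cf N by (rule fg_module[OF N])
  note vsf = vector_space_fun_scl[OF N.vs]
  let ?P = "prod_space (outn s) (piece N)"
  have fdP: "fd_space (fun_scl (mscl N)) ?P" and
    dimP: "vector_space.dim (fun_scl (mscl N)) ?P = (\<Sum>t\<in>outn s. vector_space.dim (mscl N) (piece N t))"
    using prod_space_dim[OF N.vs finite_outn, of s "piece N"] N.fd_piece[OF fg_fd[OF N]] E_V by auto
  let ?f = "\<lambda>F. \<Sum>t\<in>outn s. u s t (F t)"
  have ul: "lin_on (mscl N) (mscl M) (piece N t) (u s t)" if "t \<in> outn s" for t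
    using ar_lin[OF seq] that by blast
  have lin: "lin_on (fun_scl (mscl N)) (mscl M) ?P ?f"
    using lin_on_add[OF ul] lin_on_scl[OF ul]
    by (simp add: lin_on_def prod_space_def fun_scl_def sum.distrib M.m.scale_sum_right)
  have im: "?f ` ?P = piece M s"
  proof
    show "?f ` ?P \<subseteq> piece M s"
      using ar_in[OF seq] by (auto simp: prod_space_def intro!: M.m.subspace_sum[OF M.piece_sub[OF sV]])
    show "piece M s \<subseteq> ?f ` ?P"
    proof
      fix v assume "v \<in> piece M s"
      then obtain m where m: "\<forall>t\<in>outn s. m t \<in> piece N t" "v = (\<Sum>t\<in>outn s. u s t (m t))"
        using surj s unfolding source_surj_def by blast
      then show "v \<in> ?f ` ?P"
        by (intro image_eqI[of _ _ "\<lambda>t. if t \<in> outn s then m t else 0"]) (auto simp: prod_space_def)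
    qed
  qed
  let ?g = "\<lambda>z t. if t \<in> outn s then mact N z (b s t) else 0"
  have glin: "lin_on (mscl N) (fun_scl (mscl N)) (piece N s) ?g"
    using N.piece_car b_in_arrow
    by (auto simp: lin_on_def fun_scl_def fun_eq_iff N.act_add N.act_scl)
  have gim: "?g ` piece N s = {F \<in> ?P. ?f F = 0}"
  proof
    show "?g ` piece N s \<subseteq> {F \<in> ?P. ?f F = 0}"
      using N.act_arrow N.piece_car ar_source_sum[OF seq s] by (auto simp: prod_space_def)
    show "{F \<in> ?P. ?f F = 0} \<subseteq> ?g ` piece N s"
    proof
      fix F assume F: "F \<in> {F \<in> ?P. ?f F = 0}"
      then obtain z where z: "z \<in> piece N s" "\<forall>t\<in>outn s. mact N z (b s t) = F t"
        using ar_source_ex[OF seq s, of F] by (auto simp: prod_space_def)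
      have "F t = ?g z t" for t using F z(2) by (auto simp: prod_space_def)
      then show "F \<in> ?g ` piece N s" using z(1) by blast
    qed
  qed
  have "vector_space.dim (fun_scl (mscl N)) (?g ` piece N s) = vector_space.dim (mscl N) (piece N s)"
  proof (rule dim_inj_image[OF N.fd_piece[OF fg_fd[OF N] sV] vsf glin])
    fix z assume z: "z \<in> piece N s" "?g z = 0"
    have "mact N z (b s t) = 0" if "t \<in> outn s" for t using fun_cong[OF z(2), of t] that by simp
    then show "z = 0" by (rule ar_source_inj[OF seq s z(1)])
  qed
  then show ?thesis
    using rank_nullity[OF fdP M.vs lin] dimP unfolding im gim by simp
qed

end

section \<open>Dimensions of the Nakayama functor\<close>

text \<open>Rank-nullity for addition from X \<times> Y to X + Y; the kernel is the antidiagonal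
  copy of the intersection. The product is indexed by \<open>bool\<close>.\<close>

lemma dim_sum_Int:
  assumes X: "fd_space s X" and Y: "fd_space s Y"
  shows "vector_space.dim s {x + y | x y. x \<in> X \<and> y \<in> Y} + vector_space.dim s (X \<inter> Y) =
    vector_space.dim s X + vector_space.dim s Y"
proof -
  interpret vector_space s using X unfolding fd_space_def by blast
  have sX: "subspace X" and sY: "subspace Y" using X Y unfolding fd_space_def by auto
  let ?P = "prod_space UNIV (\<lambda>i::bool. if i then X else Y)"
  let ?f = "\<lambda>F. F True + F False"
  note vsf = vector_space_fun_scl[OF vector_space_axioms]
  have P: "fd_space (fun_scl s) ?P" and dP: "vector_space.dim (fun_scl s) ?P = dim X + dim Y"
    using prod_space_dim[OF vector_space_axioms, of "UNIV :: bool set" "\<lambda>i. if i then X else Y"] X Y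
    by (auto simp: UNIV_bool)
  have lin: "lin_on (fun_scl s) s ?P ?f" by (auto simp: lin_on_def fun_scl_def scale_right_distrib)
  have im: "?f ` ?P = {x + y | x y. x \<in> X \<and> y \<in> Y}"
  proof
    show "{x + y | x y. x \<in> X \<and> y \<in> Y} \<subseteq> ?f ` ?P"
    proof
      fix v assume "v \<in> {x + y | x y. x \<in> X \<and> y \<in> Y}"
      then obtain x y where "x \<in> X" "y \<in> Y" "v = x + y" by blast
      then show "v \<in> ?f ` ?P"
        by (intro image_eqI[of _ _ "\<lambda>i. if i then x else y"]) (auto simp: prod_space_def)
    qed
  qed (auto simp: prod_space_def)
  let ?g = "\<lambda>x i. if i then x else - x"
  have gim: "?g ` (X \<inter> Y) = {F \<in> ?P. ?f F = 0}"
  proof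
    show "?g ` (X \<inter> Y) \<subseteq> {F \<in> ?P. ?f F = 0}"
      using subspace_neg[OF sY] by (auto simp: prod_space_def)
    show "{F \<in> ?P. ?f F = 0} \<subseteq> ?g ` (X \<inter> Y)"
    proof
      fix F assume F: "F \<in> {F \<in> ?P. ?f F = 0}"
      then have *: "F True \<in> X" "F False \<in> Y" "F True = - F False"
        by (auto simp: prod_space_def eq_neg_iff_add_eq_0 dest: spec[of _ True] spec[of _ False])
      have "F = ?g (F True)"
      proof
        fix i show "F i = ?g (F True) i" using *(3) by (cases i) auto
      qed
      then show "F \<in> ?g ` (X \<inter> Y)" using * subspace_neg[OF sY *(2)] by (intro image_eqI) auto
    qed
  qed
  have XY: "fd_space s (X \<inter> Y)" by (rule fd_space_subset[OF X _ subspace_inter[OF sX sY]]) blast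
  have "vector_space.dim (fun_scl s) (?g ` (X \<inter> Y)) = dim (X \<inter> Y)"
  proof (rule dim_inj_image[OF XY vsf])
    show "lin_on s (fun_scl s) (X \<inter> Y) ?g"
      by (auto simp: lin_on_def fun_scl_def fun_eq_iff)
    show "v = 0" if "?g v = 0" for v using fun_cong[OF that, of True] by simp
  qed
  then show ?thesis using rank_nullity[OF P vector_space_axioms lin] dP unfolding im gim by simp
qed

context bipartite_algebra begin

text \<open>Restriction identifies (DL) e_j with the dual of e_j L; the inverse precomposes a
  functional with the idempotent.\<close>

lemma dual_piece_dim:
  fixes L :: "('k, 'a, 'v::ab_group_add) rmod"
  assumes L: "is_rmod (op_alg A) L" and fd: "fd_space (mscl L) (mcar L)" and j: "j \<in> V"
  shows "vector_space.dim (mscl (dual_mod L)) (piece (dual_mod L) j) = vector_space.dim (mscl L) (piece L j)"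
proof -
  interpret op: bipartite_algebra "op_alg A" V "E\<inverse>" "\<lambda>i j. b j i" "\<lambda>x i j. cf x j i" by (rule op_bipartite)
  interpret L: bip_module "op_alg A" V "E\<inverse>" "\<lambda>i j. b j i" "\<lambda>x i j. cf x j i" L
    by (rule op.rmod_module[OF L])
  have pc: "op.piece L j = piece L j" by (simp add: op.piece_def piece_def)
  have eA: "b j j \<in> acar (op_alg A)" using op.b_in_diag[OF j] .
  have sub: "L.m.subspace (piece L j)" using L.piece_sub[OF j] pc by simp
  have proj: "mact L v (b j j) \<in> piece L j" if "v \<in> mcar L" for v using L.act_piece[OF that j] pc by simp
  have fdp: "fd_space (mscl L) (piece L j)" using L.fd_piece[OF fd j] pc by simp
  have scl: "mscl (dual_mod L) = fun_scl (*)" by (simp add: dual_mod_def fun_scl_def fun_eq_iff)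
  have car: "mcar (dual_mod L) = dual_space (mscl L) (mcar L)"
    by (auto simp: dual_mod_def dual_space_def lin_on_def)
  interpret f: vector_space "fun_scl (*) :: 'k \<Rightarrow> ('v \<Rightarrow> 'k) \<Rightarrow> _"
    by (rule vector_space_fun_scl[OF vector_space_mult])
  let ?D = "piece (dual_mod L) j"
  have D: "\<phi> \<in> ?D \<longleftrightarrow> \<phi> \<in> dual_space (mscl L) (mcar L) \<and> (\<forall>v\<in>mcar L. \<phi> (mact L v (b j j)) = \<phi> v)" for \<phi>
    unfolding piece_def car by (auto simp: dual_mod_def dual_space_def fun_eq_iff)
  have subD: "f.subspace ?D"
    by (rule f.subspaceI)
      (auto simp: D dual_space_def lin_on_def fun_scl_def distrib_left mult.left_commute)
  have fdD: "fd_space (fun_scl (*)) ?D"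
    by (rule fd_space_subset[OF conjunct1[OF dual_space_dim[OF fd]] _ subD]) (auto simp: D)
  let ?r = "\<lambda>\<phi> v. if v \<in> piece L j then \<phi> v else (0::'k)"
  have rim: "?r ` ?D = dual_space (mscl L) (piece L j)"
  proof
    show "?r ` ?D \<subseteq> dual_space (mscl L) (piece L j)"
    proof (rule image_subsetI)
      fix \<phi> assume "\<phi> \<in> ?D"
      then have "lin_on (mscl L) (*) (mcar L) \<phi>" by (simp add: D dual_space_def)
      then have l: "lin_on (mscl L) (*) (piece L j) \<phi>" by (rule lin_on_subset) (auto simp: piece_def)
      show "?r \<phi> \<in> dual_space (mscl L) (piece L j)"
        using lin_on_add[OF l] lin_on_scl[OF l] L.m.subspace_add[OF sub] L.m.subspace_scale[OF sub]
        by (auto simp: dual_space_def lin_on_def)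
    qed
    show "dual_space (mscl L) (piece L j) \<subseteq> ?r ` ?D"
    proof
      fix l assume l: "l \<in> dual_space (mscl L) (piece L j)"
      then have ll: "lin_on (mscl L) (*) (piece L j) l" and off: "\<And>v. v \<notin> piece L j \<Longrightarrow> l v = 0"
        by (auto simp: dual_space_def)
      let ?\<phi> = "\<lambda>v. if v \<in> mcar L then l (mact L v (b j j)) else 0"
      have idem: "mact L (mact L v (b j j)) (b j j) = mact L v (b j j)" if "v \<in> mcar L" for v
        using proj[OF that] by (simp add: piece_def)
      have "?\<phi> \<in> ?D"
        using lin_on_add[OF ll proj proj] lin_on_scl[OF ll proj] idem
        by (auto simp: D dual_space_def lin_on_def L.car_add L.car_scl L.act_add L.act_scl L.act_in eA)
      moreover have "l = ?r ?\<phi>"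
      proof
        fix v show "l v = ?r ?\<phi> v" using off[of v] by (auto simp: piece_def)
      qed
      ultimately show "l \<in> ?r ` ?D" by (intro image_eqI[where x = ?\<phi>])
    qed
  qed
  have "f.dim (?r ` ?D) = f.dim ?D"
  proof (rule dim_inj_image[OF fdD f.vector_space_axioms])
    show "lin_on (fun_scl (*)) (fun_scl (*)) ?D ?r" by (auto simp: lin_on_def fun_scl_def)
    fix \<phi> assume \<phi>: "\<phi> \<in> ?D" "?r \<phi> = 0"
    have "\<phi> v = 0" for v
    proof (cases "v \<in> mcar L")
      case True
      then show ?thesis using fun_cong[OF \<phi>(2), of "mact L v (b j j)"] proj[OF True] \<phi>(1) by (simp add: D)
    next
      case False
      then show ?thesis using \<phi>(1) by (simp add: D dual_space_def)
    qed
    then show "\<phi> = 0" by (simp add: fun_eq_iff)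
  qed
  then show ?thesis using dual_space_dim[OF fdp] unfolding rim scl by simp
qed

text \<open>e_k Hom(P,A), that is, the homomorphisms from P with values in e_k A.\<close>

definition row_space where
  "row_space P k = {h \<in> hom_mod A P (reg_mod A). \<forall>v. amul A (b k k) (h v) = h v}"

text \<open>The dual of the component at t of the top P / rad P. For a projective P its dimension is
  the multiplicity of P(t) in P.\<close>

definition ann where
  "ann P t = {l \<in> dual_space (mscl P) (piece P t).
    \<forall>s v. (s, t) \<in> E \<and> v \<in> piece P s \<longrightarrow> l (mact P v (b s t)) = 0}"

lemma row_space_piece: "piece (hom_reg A P) k = row_space P k"
  by (auto simp: piece_def row_space_def hom_reg_car hom_reg_act fun_eq_iff)

lemma cf_hom_piece:
  assumes "h \<in> hom_mod A P (reg_mod A)" "v \<in> mcar P" "i \<in> V"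
  shows "cf (h (mact P v (b i i))) k i = cf (h v) k i"
  using hom_reg_mul[OF assms(1,2) b_in_diag[OF assms(3)]] hom_reg_val[OF assms(1)] assms(3)
  by (simp add: cf_mul_right_diag)

lemma row_space_inj:
  assumes P: "is_rmod A P" and k: "k \<in> V" and h: "h \<in> row_space P k"
    and 0: "\<And>i v. (k, i) \<in> R \<Longrightarrow> v \<in> piece P i \<Longrightarrow> cf (h v) k i = 0"
  shows "h = 0"
proof
  interpret P: bip_module A V E b cf P by (rule rmod_module[OF P])
  have hH: "h \<in> hom_mod A P (reg_mod A)" using h by (simp add: row_space_def)
  fix v
  have "h v = 0"
  proof (cases "v \<in> mcar P")
    case True
    show ?thesis
    proof (rule cf_ext[OF hom_reg_val[OF hH] A_zero])
      fix i j assume ij: "(i, j) \<in> R"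
      have jV: "j \<in> V" using ij E_V by auto
      have "cf (h v) i j = cf (amul A (b k k) (h v)) i j" using h by (simp add: row_space_def)
      also have "\<dots> = (if i = k then cf (h v) i j else 0)"
        using cf_mul_left_diag[OF hom_reg_val[OF hH] k] .
      also have "\<dots> = 0"
        using cf_hom_piece[OF hH True jV, of k] 0[of j "mact P v (b j j)"] ij P.act_piece[OF True jV]
        by auto
      finally show "cf (h v) i j = cf 0 i j" by simp
    qed
  next
    case False
    then show ?thesis using hom_off[OF hH] by simp
  qed
  then show "h v = 0 v" by simp
qed

lemma row_space_ex:
  assumes P: "is_rmod A P" and k: "k \<in> V"
    and lin: "\<And>i. (k, i) \<in> R \<Longrightarrow> lin_on (mscl P) (*) (piece P i) (m i)"
    and arrow: "\<And>i j v. (i, j) \<in> E \<Longrightarrow> (k, j) \<in> R \<Longrightarrow> v \<in> piece P i \<Longrightarrow>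
      m j (mact P v (b i j)) = (if i = k then m i v else 0)"
  shows "\<exists>h\<in>row_space P k. \<forall>i v. (k, i) \<in> R \<and> v \<in> piece P i \<longrightarrow> cf (h v) k i = m i v"
proof -
  obtain h where h: "h \<in> hom_mod A P (reg_mod A)"
    "\<forall>i\<in>V. \<forall>v\<in>piece P i. h v = (if (k, i) \<in> R then ascl A (m i v) (b k i) else 0)"
    using hom_reg_from_row[OF P k lin arrow] by blast
  \<comment> \<open>Multiplying by the idempotent puts the values into row k without changing the
    coefficients of that row.\<close>
  let ?h = "\<lambda>v. amul A (b k k) (h v)"
  note val = hom_reg_val[OF h(1)]
  have "amul A (b k k) (?h v) = ?h v" for v
    using mul_assoc[OF b_in_diag[OF k] b_in_diag[OF k] val] mul_diag_diag[OF k k] by simp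
  then have "?h \<in> row_space P k"
    using hom_reg_act_in[OF P h(1) b_in_diag[OF k]] by (simp add: row_space_def)
  moreover have "cf (?h v) k i = m i v" if "(k, i) \<in> R" "v \<in> piece P i" for i v
  proof -
    have "i \<in> V" using that(1) E_V by auto
    then have "h v = ascl A (m i v) (b k i)" using h(2) that by simp
    then have "cf (h v) k i = m i v" using b_in[OF that(1)] cf_b[OF that(1)] by (simp add: cf_scl)
    then show ?thesis using cf_mul_left_diag[OF val k] by simp
  qed
  ultimately show ?thesis by (intro bexI[of _ ?h]) auto
qed

lemma restrict_dual:
  assumes "is_rmod A P" "i \<in> V" "lin_on (mscl P) (*) (piece P i) l"
  shows "(\<lambda>v. if v \<in> piece P i then l v else 0) \<in> dual_space (mscl P) (piece P i)"
proof -
  interpret P: bip_module A V E b cf P by (rule rmod_module[OF assms(1)])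
  show ?thesis
    using lin_on_add[OF assms(3)] lin_on_scl[OF assms(3)] P.m.subspace_add[OF P.piece_sub[OF assms(2)]]
      P.m.subspace_scale[OF P.piece_sub[OF assms(2)]]
    by (auto simp: dual_space_def lin_on_def)
qed

text \<open>Dual form of the injectivity of the arrows on a projective: restricting functionals on P
  e_t along all incoming arrows is surjective with kernel \<open>ann P t\<close>.\<close>

lemma ann_dim:
  fixes P :: "('k, 'a, 'v::ab_group_add) rmod"
  assumes P: "projective_mod A P" and t: "t \<in> V"
  shows "fd_space (fun_scl (*)) (ann P t)" (is ?fd)
    and "vector_space.dim (fun_scl (*)) (ann P t) + (\<Sum>s\<in>inn t. vector_space.dim (mscl P) (piece P s)) =
      vector_space.dim (mscl P) (piece P t)" (is ?dim)
proof -
  have fg: "fg_mod A P" using P by (simp add: projective_mod_def)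
  interpret P: bip_module A V E b cf P by (rule fg_module[OF fg])
  note fdp = P.fd_piece[OF fg_fd[OF fg]]
  let ?D = "\<lambda>i. dual_space (mscl P) (piece P i)"
  let ?Q = "prod_space (inn t) ?D"
  have vsf: "vector_space (fun_scl (*) :: 'k \<Rightarrow> ('v \<Rightarrow> 'k) \<Rightarrow> _)"
    by (rule vector_space_fun_scl[OF vector_space_mult])
  have Dt: "fd_space (fun_scl (*)) (?D t)" "vector_space.dim (fun_scl (*)) (?D t) = vector_space.dim (mscl P) (piece P t)"
    using dual_space_dim[OF fdp[OF t]] by auto
  have Ds: "fd_space (fun_scl (*)) (?D s)" "vector_space.dim (fun_scl (*)) (?D s) = vector_space.dim (mscl P) (piece P s)"
    if "s \<in> inn t" for s using dual_space_dim[OF fdp] that E_V by auto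
  have Q: "vector_space.dim (fun_scl (fun_scl (*))) ?Q = (\<Sum>s\<in>inn t. vector_space.dim (mscl P) (piece P s))"
    using prod_space_dim[OF vsf finite_inn, of t ?D] Ds by simp
  let ?f = "\<lambda>l s v. if s \<in> inn t \<and> v \<in> piece P s then l (mact P v (b s t)) else (0::'k)"
  have lin: "lin_on (fun_scl (*)) (fun_scl (fun_scl (*))) (?D t) ?f"
    by (auto simp: lin_on_def fun_scl_def fun_eq_iff)
  have act_lin: "lin_on (mscl P) (*) (piece P s) (\<lambda>v. l (mact P v (b s t)))" if "l \<in> ?D t" "s \<in> inn t" for l s
    using that P.act_arrow P.piece_car b_in_arrow
    by (auto simp: lin_on_def dual_space_def P.act_add P.act_scl)
  have im: "?f ` ?D t = ?Q"
  proof
    show "?f ` ?D t \<subseteq> ?Q"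
    proof (clarsimp simp: prod_space_def, intro conjI allI impI)
      fix l s assume l: "l \<in> ?D t" and s: "(s, t) \<in> E"
      show "(\<lambda>v. if v \<in> piece P s then l (mact P v (b s t)) else 0) \<in> ?D s"
        using restrict_dual[OF P.rmod E_V(1)[OF s] act_lin[OF l]] s by simp
    qed (auto simp: fun_eq_iff)
    show "?Q \<subseteq> ?f ` ?D t"
    proof
      fix F assume F: "F \<in> ?Q"
      have "\<forall>s\<in>inn t. \<exists>\<mu>. lin_on (mscl P) (*) (piece P t) \<mu> \<and> (\<forall>s' v. (s', t) \<in> E \<and> v \<in> piece P s' \<longrightarrow>
          \<mu> (mact P v (b s' t)) = (if s' = s then F s v else 0))"
        using projective_functional[OF P] F by (auto simp: prod_space_def dual_space_def)
      from bchoice[OF this] obtain \<mu> where \<mu>: "\<forall>s\<in>inn t. lin_on (mscl P) (*) (piece P t) (\<mu> s) \<and>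
        (\<forall>s' v. (s', t) \<in> E \<and> v \<in> piece P s' \<longrightarrow> \<mu> s (mact P v (b s' t)) = (if s' = s then F s v else 0))" ..
      \<comment> \<open>Each \<open>\<mu> s\<close> realises one prescribed functional and vanishes
        along the other arrows into t, so the sum realises all of them at once.\<close>
      let ?m = "\<lambda>v. \<Sum>s\<in>inn t. \<mu> s v"
      let ?l = "\<lambda>v. if v \<in> piece P t then ?m v else 0"
      have "lin_on (mscl P) (*) (piece P t) ?m"
        using \<mu> by (auto simp: lin_on_def sum.distrib sum_distrib_left intro!: sum.cong)
      then have lD: "?l \<in> ?D t" by (rule restrict_dual[OF P.rmod t])
      have "F s v = ?f ?l s v" for s v
      proof (cases "s \<in> inn t \<and> v \<in> piece P s")
        case True
        have "?m (mact P v (b s t)) = (\<Sum>s'\<in>inn t. if s = s' then F s' v else 0)"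
          using \<mu> True by (intro sum.cong refl) auto
        also have "\<dots> = F s v" using True by simp
        finally show ?thesis using True P.act_arrow[of v s t] P.piece_car by auto
      next
        case False
        have "F s v = 0"
        proof (cases "s \<in> inn t")
          case True
          then have "F s \<in> ?D s" using F by (simp add: prod_space_def)
          then show ?thesis using False True by (simp add: dual_space_def)
        next
          case False
          then show ?thesis using F by (simp add: prod_space_def)
        qed
        then show ?thesis using False by (simp only: if_False)
      qed
      then have "F = ?f ?l" by (intro ext)
      then show "F \<in> ?f ` ?D t" using lD by (rule image_eqI)
    qed
  qed
  have ker: "{l \<in> ?D t. ?f l = 0} = ann P t"
    by (auto simp: ann_def fun_eq_iff)
  have V: "vector_space (fun_scl (fun_scl (*)) :: 'k \<Rightarrow> ('q \<Rightarrow> 'v \<Rightarrow> 'k) \<Rightarrow> _)"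
    by (rule vector_space_fun_scl[OF vsf])
  show ?dim using rank_nullity[OF Dt(1) V lin] Q Dt(2) unfolding im ker by simp
  have sD: "module.subspace (fun_scl (*)) (?D t)" using Dt(1) unfolding fd_space_def by blast
  show ?fd
    using fd_space_subset[OF Dt(1) _ subspace_kernel[OF vsf V sD lin]] unfolding ker by (auto simp: ann_def)
qed

text \<open>A homomorphism into A is determined by its coefficients, which are functionals on the
  components of P indexed by the finite set R.\<close>

lemma row_fd:
  fixes P :: "('k, 'a, 'v::ab_group_add) rmod"
  assumes P: "fg_mod A P" and k: "k \<in> V"
  shows "fd_space (fun_scl (ascl A)) (hom_mod A P (reg_mod A))" "fd_space (fun_scl (ascl A)) (row_space P k)"
proof -
  interpret P: bip_module A V E b cf P by (rule fg_module[OF P])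
  note fdp = P.fd_piece[OF fg_fd[OF P]]
  interpret op: bipartite_algebra "op_alg A" V "E\<inverse>" "\<lambda>i j. b j i" "\<lambda>x i j. cf x j i" by (rule op_bipartite)
  interpret H: bip_module "op_alg A" V "E\<inverse>" "\<lambda>i j. b j i" "\<lambda>x i j. cf x j i" "hom_reg A P"
    by (rule op.rmod_module[OF hom_reg_rmod[OF P.rmod]])
  let ?D = "\<lambda>(p::'q \<times> 'q). dual_space (mscl P) (piece P (snd p))"
  let ?f = "\<lambda>h (p::'q \<times> 'q) v. if p \<in> R \<and> v \<in> piece P (snd p) then cf (h v) (fst p) (snd p) else 0"
  have vsf: "vector_space (fun_scl (*) :: 'k \<Rightarrow> ('v \<Rightarrow> 'k) \<Rightarrow> _)"
    by (rule vector_space_fun_scl[OF vector_space_mult])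
  have V: "vector_space (fun_scl (fun_scl (*)) :: 'k \<Rightarrow> ('q \<times> 'q \<Rightarrow> 'v \<Rightarrow> 'k) \<Rightarrow> _)"
    by (rule vector_space_fun_scl[OF vsf])
  have RV: "snd p \<in> V" if "p \<in> R" for p using that E_V by (cases p) auto
  have Q: "fd_space (fun_scl (fun_scl (*))) (prod_space R ?D)"
    using prod_space_dim[OF vsf finite_R, of ?D] dual_space_dim[OF fdp[OF RV]] by simp
  let ?H = "hom_mod A P (reg_mod A)"
  have sub: "module.subspace (fun_scl (ascl A)) ?H" "vector_space (fun_scl (ascl A) :: 'k \<Rightarrow> ('v \<Rightarrow> 'a) \<Rightarrow> _)"
    using H.sub H.vs by (simp_all add: hom_reg_car hom_reg_scl)
  have lin: "lin_on (fun_scl (ascl A)) (fun_scl (fun_scl (*))) ?H ?f"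
    using cf_add[OF hom_reg_val hom_reg_val] cf_scl[OF hom_reg_val]
    by (auto simp: lin_on_def fun_scl_def fun_eq_iff)
  have im: "?f ` ?H \<subseteq> prod_space R ?D"
  proof -
    have l: "lin_on (mscl P) (*) (piece P j) (\<lambda>v. cf (h v) i j)" if h: "h \<in> ?H" for h i j
      using hom_add[OF h] hom_scl[OF h] P.piece_car cf_add[OF hom_reg_val[OF h] hom_reg_val[OF h]]
        cf_scl[OF hom_reg_val[OF h]]
      by (auto simp: lin_on_def reg_mod_def)
    have "?f h \<in> prod_space R ?D" if h: "h \<in> ?H" for h
      unfolding prod_space_def
    proof (intro CollectI conjI ballI allI impI)
      fix p assume p: "p \<in> R"
      have "(\<lambda>v. if v \<in> piece P (snd p) then cf (h v) (fst p) (snd p) else 0) \<in> ?D p"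
        by (rule restrict_dual[OF P.rmod RV[OF p] l[OF h]])
      then show "?f h p \<in> ?D p" using p by simp
    next
      fix p assume "p \<notin> R"
      then show "?f h p = 0" by (simp add: fun_eq_iff)
    qed
    then show ?thesis by blast
  qed
  interpret V: vector_space_pair "fun_scl (ascl A) :: 'k \<Rightarrow> ('v \<Rightarrow> 'a) \<Rightarrow> _"
    "fun_scl (fun_scl (*)) :: 'k \<Rightarrow> ('q \<times> 'q \<Rightarrow> 'v \<Rightarrow> 'k) \<Rightarrow> _"
    using sub(2) V by (simp add: vector_space_pair_def)
  have imsub: "V.vs2.subspace (?f ` ?H)"
  proof -
    obtain g where "Vector_Spaces.linear (fun_scl (ascl A)) (fun_scl (fun_scl (*))) g" "\<forall>v\<in>?H. g v = ?f v"
      using lin_on_extend[OF sub(2) V sub(1) lin] by blast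
    then show ?thesis using V.linear_subspace_image[OF _ sub(1)] by (metis (no_types, lifting) image_cong)
  qed
  have ker: "{h \<in> ?H. ?f h = 0} = {0}"
  proof -
    have "h = 0" if h: "h \<in> ?H" "?f h = 0" for h
    proof
      fix v
      show "h v = 0 v"
      proof (cases "v \<in> mcar P")
        case True
        have "h v = 0"
        proof (rule cf_ext[OF hom_reg_val[OF h(1)] A_zero])
          fix i j assume ij: "(i, j) \<in> R"
          have jV: "j \<in> V" using RV[OF ij] by simp
          have "cf (h (mact P v (b j j))) i j = 0"
            using fun_cong[OF fun_cong[OF h(2), of "(i, j)"], of "mact P v (b j j)"] ij P.act_piece[OF True jV] by simp
          then show "cf (h v) i j = cf 0 i j" using cf_hom_piece[OF h(1) True jV, of i] by simp
        qed
        then show ?thesis by simp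
      qed (simp add: hom_off[OF h(1)])
    qed
    moreover have "0 \<in> ?H" using V.vs1.subspace_0[OF sub(1)] .
    ultimately show ?thesis by (auto simp: fun_eq_iff)
  qed
  show fdH: "fd_space (fun_scl (ascl A)) ?H"
    by (rule fd_space_ext[OF sub(2,1) lin fd_space_subset[OF Q im imsub]])
      (simp only: ker fd_space_zero[OF sub(2)])
  have "module.subspace (mscl (hom_reg A P)) (op.piece (hom_reg A P) k)" by (rule H.piece_sub[OF k])
  moreover have "op.piece (hom_reg A P) k = row_space P k"
    using row_space_piece[of P k] by (simp add: op.piece_def piece_def)
  ultimately show "fd_space (fun_scl (ascl A)) (row_space P k)"
    by (intro fd_space_subset[OF fdH]) (auto simp: hom_reg_scl row_space_def)
qed

lemma nak_dim_row:
  assumes P: "fg_mod A P" and k: "k \<in> V"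
  shows "vector_space.dim (mscl (nak A P)) (piece (nak A P) k) =
    vector_space.dim (fun_scl (ascl A)) (row_space P k)"
proof -
  have "is_rmod A P" using P by (simp add: fg_mod_def)
  then show ?thesis
    using dual_piece_dim[OF hom_reg_rmod _ k] row_fd(1)[OF P k]
    by (simp add: nak_def hom_reg_scl hom_reg_car row_space_piece)
qed

lemma cf_row_lin:
  assumes "is_rmod A P" "h \<in> hom_mod A P (reg_mod A)"
  shows "lin_on (mscl P) (*) (piece P i) (\<lambda>v. cf (h v) k i)"
proof -
  interpret P: bip_module A V E b cf P by (rule rmod_module[OF assms(1)])
  show ?thesis
    using hom_add[OF assms(2)] hom_scl[OF assms(2)] P.piece_car
      cf_add[OF hom_reg_val[OF assms(2)] hom_reg_val[OF assms(2)]] cf_scl[OF hom_reg_val[OF assms(2)]]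
    by (auto simp: lin_on_def reg_mod_def)
qed

text \<open>At a sink e_t A is one-dimensional, and compatibility with the arrows into t says
  exactly that the functional kills the radical of P.\<close>

lemma nak_dim_sink:
  fixes P :: "('k, 'a, 'v::ab_group_add) rmod"
  assumes P: "projective_mod A P" and t: "t \<in> sinks"
  shows "vector_space.dim (mscl (nak A P)) (piece (nak A P) t) = vector_space.dim (fun_scl (*)) (ann P t)"
proof -
  have fg: "fg_mod A P" using P by (simp add: projective_mod_def)
  interpret P: bip_module A V E b cf P by (rule fg_module[OF fg])
  have tV: "t \<in> V" using t E_V by blast
  have tt: "(t, i) \<in> R \<longleftrightarrow> i = t" for i using t tV bipartite by auto
  let ?r = "\<lambda>h v. if v \<in> piece P t then cf (h v) t t else 0"
  have vsf: "vector_space (fun_scl (*) :: 'k \<Rightarrow> ('v \<Rightarrow> 'k) \<Rightarrow> _)"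
    by (rule vector_space_fun_scl[OF vector_space_mult])
  have im: "?r ` row_space P t = ann P t"
  proof
    show "?r ` row_space P t \<subseteq> ann P t"
    proof
      fix l assume "l \<in> ?r ` row_space P t"
      then obtain h where h: "h \<in> row_space P t" "l = ?r h" by blast
      have hH: "h \<in> hom_mod A P (reg_mod A)" using h(1) by (simp add: row_space_def)
      have "cf (h (mact P v (b s t))) t t = 0" if "(s, t) \<in> E" "v \<in> piece P s" for s v
        using hom_reg_mul[OF hH P.piece_car[OF that(2)] b_in_arrow[OF that(1)]] E_neq[OF that(1)]
          cf_mul_right_arrow[OF hom_reg_val[OF hH] that(1)] by simp
      then show "l \<in> ann P t"
        using restrict_dual[OF P.rmod tV cf_row_lin[OF P.rmod hH]] h(2) by (simp add: ann_def)
    qed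
    show "ann P t \<subseteq> ?r ` row_space P t"
    proof
      fix l assume l: "l \<in> ann P t"
      have "\<exists>h\<in>row_space P t. \<forall>i v. (t, i) \<in> R \<and> v \<in> piece P i \<longrightarrow> cf (h v) t i = l v"
      proof (rule row_space_ex[OF P.rmod tV, where m = "\<lambda>_. l"])
        show "lin_on (mscl P) (*) (piece P i) l" if "(t, i) \<in> R" for i
          using that tt l by (simp add: ann_def dual_space_def)
        fix i j v assume ij: "(i, j) \<in> E" "(t, j) \<in> R" "v \<in> piece P i"
        then have "j = t" using tt by blast
        then show "l (mact P v (b i j)) = (if i = t then l v else 0)"
          using ij l E_neq[OF ij(1)] by (simp add: ann_def)
      qed
      then obtain h where h: "h \<in> row_space P t" "\<And>v. v \<in> piece P t \<Longrightarrow> cf (h v) t t = l v"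
        using tt by blast
      have "l = ?r h" using h(2) l by (auto simp: ann_def dual_space_def fun_eq_iff)
      then show "l \<in> ?r ` row_space P t" using h(1) by (rule image_eqI)
    qed
  qed
  have "vector_space.dim (fun_scl (*)) (?r ` row_space P t) = vector_space.dim (fun_scl (ascl A)) (row_space P t)"
  proof (rule dim_inj_image[OF row_fd(2)[OF fg tV] vsf])
    show "lin_on (fun_scl (ascl A)) (fun_scl (*)) (row_space P t) ?r"
      using cf_add[OF hom_reg_val hom_reg_val] cf_scl[OF hom_reg_val]
      by (auto simp: lin_on_def fun_scl_def fun_eq_iff row_space_def)
    fix h assume h: "h \<in> row_space P t" "?r h = 0"
    have "cf (h v) t t = 0" if "v \<in> piece P t" for v using fun_cong[OF h(2), of v] that by simp
    then show "h = 0" using tt by (intro row_space_inj[OF P.rmod tV h(1)]) simp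
  qed
  then show ?thesis using nak_dim_row[OF fg tV] im by simp
qed

text \<open>The (s,s) coefficient of a homomorphism into e_s A can be any functional on P e_s, since
  projectivity supplies matching coefficients at the sinks. Two homomorphisms with the same (s,s)
  coefficient differ by coefficients that kill the radical, one for each arrow out of s.\<close>

lemma nak_dim_source:
  fixes P :: "('k, 'a, 'v::ab_group_add) rmod"
  assumes P: "projective_mod A P" and s: "s \<in> sources"
  shows "vector_space.dim (mscl (nak A P)) (piece (nak A P) s) =
    vector_space.dim (mscl P) (piece P s) + (\<Sum>t\<in>outn s. vector_space.dim (fun_scl (*)) (ann P t))"
proof -
  have fg: "fg_mod A P" using P by (simp add: projective_mod_def)
  interpret P: bip_module A V E b cf P by (rule fg_module[OF fg])
  have sV: "s \<in> V" using s by blast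
  have ss: "(s, s) \<in> R" using Id_onI[OF sV] by blast
  have vsf: "vector_space (fun_scl (*) :: 'k \<Rightarrow> ('v \<Rightarrow> 'k) \<Rightarrow> _)"
    by (rule vector_space_fun_scl[OF vector_space_mult])
  have V: "vector_space (fun_scl (fun_scl (*)) :: 'k \<Rightarrow> ('q \<Rightarrow> 'v \<Rightarrow> 'k) \<Rightarrow> _)"
    by (rule vector_space_fun_scl[OF vsf])
  let ?D = "dual_space (mscl P) (piece P s)"
  let ?r = "\<lambda>h v. if v \<in> piece P s then cf (h v) s s else 0"
  have hH: "h \<in> hom_mod A P (reg_mod A)" if "h \<in> row_space P s" for h using that by (simp add: row_space_def)
  have arr: "cf (h (mact P v (b i t))) s t = (if i = s then cf (h v) s s else 0)"
    if "h \<in> row_space P s" "(i, t) \<in> E" "v \<in> piece P i" for h i t v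
    using hom_reg_mul[OF hH[OF that(1)] P.piece_car[OF that(3)] b_in_arrow[OF that(2)]]
      cf_mul_right_arrow[OF hom_reg_val[OF hH[OF that(1)]] that(2)] by auto
  have lin: "lin_on (fun_scl (ascl A)) (fun_scl (*)) (row_space P s) ?r"
    using cf_add[OF hom_reg_val[OF hH] hom_reg_val[OF hH]] cf_scl[OF hom_reg_val[OF hH]]
    by (auto simp: lin_on_def fun_scl_def fun_eq_iff)
  have im: "?r ` row_space P s = ?D"
  proof
    show "?r ` row_space P s \<subseteq> ?D"
      using restrict_dual[OF P.rmod sV cf_row_lin[OF P.rmod hH]] by blast
    show "?D \<subseteq> ?r ` row_space P s"
    proof
      fix l assume l: "l \<in> ?D"
      then have ll: "lin_on (mscl P) (*) (piece P s) l" by (simp add: dual_space_def)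
      have "\<forall>t\<in>outn s. \<exists>\<mu>. lin_on (mscl P) (*) (piece P t) \<mu> \<and> (\<forall>s' v. (s', t) \<in> E \<and> v \<in> piece P s' \<longrightarrow>
          \<mu> (mact P v (b s' t)) = (if s' = s then l v else 0))"
        using projective_functional[OF P _ ll] by blast
      from bchoice[OF this] obtain \<mu> where \<mu>: "\<forall>t\<in>outn s. lin_on (mscl P) (*) (piece P t) (\<mu> t) \<and>
        (\<forall>s' v. (s', t) \<in> E \<and> v \<in> piece P s' \<longrightarrow> \<mu> t (mact P v (b s' t)) = (if s' = s then l v else 0))" ..
      let ?m = "\<lambda>i. if i = s then l else \<mu> i"
      have "\<exists>h\<in>row_space P s. \<forall>i v. (s, i) \<in> R \<and> v \<in> piece P i \<longrightarrow> cf (h v) s i = ?m i v"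
      proof (rule row_space_ex[OF P.rmod sV])
        show "lin_on (mscl P) (*) (piece P i) (?m i)" if "(s, i) \<in> R" for i
          using that \<mu> ll by auto
        show "?m j (mact P v (b i j)) = (if i = s then ?m i v else 0)"
          if "(i, j) \<in> E" "(s, j) \<in> R" "v \<in> piece P i" for i j v
          using that \<mu> s by auto
      qed
      then obtain h where h1: "h \<in> row_space P s"
        and h2: "\<forall>i v. (s, i) \<in> R \<and> v \<in> piece P i \<longrightarrow> cf (h v) s i = ?m i v" by blast
      have h: "h \<in> row_space P s" "\<And>v. v \<in> piece P s \<Longrightarrow> cf (h v) s s = l v"
        using h1 h2[rule_format, of s] ss by simp_all
      have "l = ?r h" using h(2) l by (auto simp: dual_space_def fun_eq_iff)
      then show "l \<in> ?r ` row_space P s" using h(1) by (rule image_eqI)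
    qed
  qed
  \<comment> \<open>With the (s,s) coefficient zero, the (s,t) coefficients decouple and range
    independently over \<open>ann P t\<close>.\<close>
  let ?K = "{h \<in> row_space P s. ?r h = 0}"
  let ?g = "\<lambda>h t v. if t \<in> outn s \<and> v \<in> piece P t then cf (h v) s t else 0"
  have K0: "cf (h v) s s = 0" if "h \<in> ?K" "v \<in> piece P s" for h v
    using that fun_cong[of "?r h" 0 v] by simp
  have gim: "?g ` ?K = prod_space (outn s) (ann P)"
  proof
    show "?g ` ?K \<subseteq> prod_space (outn s) (ann P)"
    proof
      fix F assume "F \<in> ?g ` ?K"
      then obtain h where h: "h \<in> ?K" "F = ?g h" by blast
      have hr: "h \<in> row_space P s" using h(1) by simp
      have "F t \<in> ann P t" if t: "t \<in> outn s" for t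
      proof -
        have tV: "t \<in> V" using t E_V by blast
        have "(\<lambda>v. if v \<in> piece P t then cf (h v) s t else 0) \<in> dual_space (mscl P) (piece P t)"
          by (rule restrict_dual[OF P.rmod tV cf_row_lin[OF P.rmod hH[OF hr]]])
        moreover have "cf (h (mact P v (b i t))) s t = 0" if "(i, t) \<in> E" "v \<in> piece P i" for i v
          using arr[OF hr that] K0[OF h(1)] that(2) by auto
        ultimately show ?thesis using h(2) t by (simp add: ann_def)
      qed
      moreover have "F t = 0" if "t \<notin> outn s" for t using h(2) that by (auto simp: fun_eq_iff)
      ultimately show "F \<in> prod_space (outn s) (ann P)" by (simp add: prod_space_def)
    qed
    show "prod_space (outn s) (ann P) \<subseteq> ?g ` ?K"
    proof
      fix F assume F: "F \<in> prod_space (outn s) (ann P)"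
      have Ft: "F t \<in> ann P t" if "t \<in> outn s" for t using F that by (simp add: prod_space_def)
      let ?m = "\<lambda>i. if i = s then (\<lambda>_. 0) else F i"
      have "\<exists>h\<in>row_space P s. \<forall>i v. (s, i) \<in> R \<and> v \<in> piece P i \<longrightarrow> cf (h v) s i = ?m i v"
      proof (rule row_space_ex[OF P.rmod sV])
        show "lin_on (mscl P) (*) (piece P i) (?m i)" if "(s, i) \<in> R" for i
          using that Ft[of i] by (auto simp: ann_def dual_space_def lin_on_def)
        show "?m j (mact P v (b i j)) = (if i = s then ?m i v else 0)"
          if "(i, j) \<in> E" "(s, j) \<in> R" "v \<in> piece P i" for i j v
          using that Ft[of j] by (auto simp: ann_def)
      qed
      then obtain h where h: "h \<in> row_space P s"
        "\<And>i v. (s, i) \<in> R \<Longrightarrow> v \<in> piece P i \<Longrightarrow> cf (h v) s i = ?m i v" by blast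
      have "?r h = 0" using h(2)[OF ss] by (auto simp: fun_eq_iff)
      moreover have "F t v = ?g h t v" for t v
      proof (cases "t \<in> outn s \<and> v \<in> piece P t")
        case True
        then show ?thesis using h(2)[of t v] E_neq[of s t] by auto
      next
        case False
        have "F t v = 0"
        proof (cases "t \<in> outn s")
          case True
          then show ?thesis using Ft[OF True] False by (simp add: ann_def dual_space_def)
        next
          case False
          then show ?thesis using F by (simp add: prod_space_def)
        qed
        then show ?thesis using False by (simp only: if_False)
      qed
      then have "F = ?g h" by (intro ext)
      ultimately show "F \<in> ?g ` ?K" using h(1) by (intro image_eqI) auto
    qed
  qed
  have subR: "module.subspace (fun_scl (ascl A)) (row_space P s)"
    and vsR: "vector_space (fun_scl (ascl A) :: 'k \<Rightarrow> ('v \<Rightarrow> 'a) \<Rightarrow> _)"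
    using row_fd(2)[OF fg sV] unfolding fd_space_def by blast+
  have fdK: "fd_space (fun_scl (ascl A)) ?K"
    by (rule fd_space_subset[OF row_fd(2)[OF fg sV] _ subspace_kernel[OF vsR vsf subR lin]]) blast
  have "vector_space.dim (fun_scl (fun_scl (*))) (?g ` ?K) = vector_space.dim (fun_scl (ascl A)) ?K"
  proof (rule dim_inj_image[OF fdK V])
    show "lin_on (fun_scl (ascl A)) (fun_scl (fun_scl (*))) ?K ?g"
      using cf_add[OF hom_reg_val[OF hH] hom_reg_val[OF hH]] cf_scl[OF hom_reg_val[OF hH]]
      by (auto simp: lin_on_def fun_scl_def fun_eq_iff)
    fix h assume h: "h \<in> ?K" "?g h = 0"
    have hr: "h \<in> row_space P s" using h(1) by simp
    show "h = 0"
    proof (rule row_space_inj[OF P.rmod sV hr])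
      fix i v assume i: "(s, i) \<in> R" "v \<in> piece P i"
      show "cf (h v) s i = 0"
      proof (cases "i = s")
        case True
        then show ?thesis using K0[OF h(1)] i(2) by simp
      next
        case False
        then show ?thesis using i fun_cong[OF fun_cong[OF h(2), of i], of v] by auto
      qed
    qed
  qed
  moreover have "vector_space.dim (fun_scl (fun_scl (*))) (prod_space (outn s) (ann P)) =
      (\<Sum>t\<in>outn s. vector_space.dim (fun_scl (*)) (ann P t))"
    using prod_space_dim[OF vsf finite_outn, of s "ann P"] ann_dim(1)[OF P] E_V by auto
  moreover have "vector_space.dim (fun_scl (*)) ?D = vector_space.dim (mscl P) (piece P s)"
    using dual_space_dim[OF P.fd_piece[OF fg_fd[OF fg] sV]] by blast
  ultimately show ?thesis
    using rank_nullity[OF row_fd(2)[OF fg sV] vsf lin] nak_dim_row[OF fg sV] unfolding im gim by simp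
qed

end

section \<open>Euler characteristics in the derived category\<close>

context bipartite_algebra begin

definition pdim where
  "pdim M i = int (vector_space.dim (mscl M) (piece M i))"

definition supp where
  "supp C = {j. mcar (cobj C j) \<noteq> {0}}"

definition euler where
  "euler C i = (\<Sum>j\<in>supp C. (if even j then 1 else - 1) * pdim (cobj C j) i)"

lemma pdim_zero:
  assumes "is_rmod A M" "mcar M = {0}" "i \<in> V"
  shows "pdim M i = 0"
proof -
  interpret M: bip_module A V E b cf M by (rule rmod_module) fact
  have "piece M i = {0}" using assms M.piece_0_iff by blast
  then show ?thesis by (simp add: pdim_def dim_zero_space[OF M.vs])
qed

lemma bounded_rmod: "bounded_cpx A C \<Longrightarrow> is_rmod A (cobj C j)"
  and bounded_fg: "bounded_cpx A C \<Longrightarrow> fg_mod A (cobj C j)"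
  and bounded_hom: "bounded_cpx A C \<Longrightarrow> cdif C j \<in> hom_mod A (cobj C j) (cobj C (j + 1))"
  and bounded_dd: "bounded_cpx A C \<Longrightarrow> v \<in> mcar (cobj C j) \<Longrightarrow> cdif C (j + 1) (cdif C j v) = 0"
  and bounded_supp: "bounded_cpx A C \<Longrightarrow> finite (supp C)"
  by (auto simp: bounded_cpx_def fg_mod_def supp_def)

text \<open>Summands outside the support vanish; enlarging the index set lets two complexes be
  compared over the same degrees.\<close>

lemma euler_superset:
  assumes "\<And>j. is_rmod A (cobj C j)" "finite J" "supp C \<subseteq> J" "i \<in> V"
  shows "euler C i = (\<Sum>j\<in>J. (if even j then 1 else - 1) * pdim (cobj C j) i)"
  unfolding euler_def
  by (rule sum.mono_neutral_left[OF assms(2,3)]) (use assms(1,4) pdim_zero in \<open>auto simp: supp_def\<close>)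

text \<open>\<open>cyc C j i - bnd C j i\<close> is the dimension of the component at i of the
  cohomology in degree j, obtained without forming a quotient. Integer values allow the
  subtraction.\<close>

definition cyc where
  "cyc C j i = int (vector_space.dim (mscl (cobj C j)) {v \<in> piece (cobj C j) i. cdif C j v = 0})"

definition bnd where
  "bnd C j i = int (vector_space.dim (mscl (cobj C j)) (cdif C (j - 1) ` piece (cobj C (j - 1)) i))"

lemma fd_bounded_piece:
  assumes "bounded_cpx A C" "i \<in> V" shows "fd_space (mscl (cobj C j)) (piece (cobj C j) i)"
proof -
  interpret bip_module A V E b cf "cobj C j" by (rule fg_module[OF bounded_fg[OF assms(1)]])
  show ?thesis by (rule fd_piece[OF fg_fd[OF bounded_fg[OF assms(1)]] assms(2)])
qed

lemma dif_lin:
  assumes "bounded_cpx A C"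
  shows "lin_on (mscl (cobj C j)) (mscl (cobj C (j + 1))) (piece (cobj C j) i) (cdif C j)"
  by (rule lin_on_subset[OF hom_lin[OF bounded_hom[OF assms]]]) (auto simp: piece_def)

lemma bounded_vs: "bounded_cpx A C \<Longrightarrow> vector_space (mscl (cobj C j))"
  using bounded_rmod[of C j] by (simp add: is_rmod_def)

lemma pdim_cyc_bnd:
  assumes C: "bounded_cpx A C" and i: "i \<in> V"
  shows "pdim (cobj C j) i = cyc C j i + bnd C (j + 1) i"
  using rank_nullity[OF fd_bounded_piece[OF C i] bounded_vs[OF C] dif_lin[OF C], of j]
  by (simp add: pdim_def cyc_def bnd_def)

lemma bnd_zero:
  assumes C: "bounded_cpx A C" and i: "i \<in> V" and j: "j \<notin> supp C \<or> j - 1 \<notin> supp C"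
  shows "bnd C j i = 0"
proof -
  interpret C1: bip_module A V E b cf "cobj C (j - 1)" by (rule rmod_module[OF bounded_rmod[OF C]])
  interpret C0: bip_module A V E b cf "cobj C j" by (rule rmod_module[OF bounded_rmod[OF C]])
  have hom: "cdif C (j - 1) \<in> hom_mod A (cobj C (j - 1)) (cobj C j)" using bounded_hom[OF C, of "j - 1"] by simp
  have z: "cdif C (j - 1) 0 = 0" using lin_on_0[OF C1.vs C0.vs C1.sub hom_lin[OF hom]] .
  have "cdif C (j - 1) v = 0" if v: "v \<in> piece (cobj C (j - 1)) i" for v
  proof (cases "j \<in> supp C")
    case True
    then have "v = 0" using j C1.piece_car[OF v] by (simp add: supp_def)
    then show ?thesis using z by simp
  next
    case False
    then show ?thesis using hom_car[OF hom C1.piece_car[OF v]] by (simp add: supp_def)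
  qed
  moreover have "0 \<in> piece (cobj C (j - 1)) i" by (rule C1.m.subspace_0[OF C1.piece_sub[OF i]])
  ultimately have "cdif C (j - 1) ` piece (cobj C (j - 1)) i = {0}" by force
  then show ?thesis by (simp add: bnd_def dim_zero_space[OF C0.vs])
qed

text \<open>Rank-nullity writes each term as its cocycles plus the coboundaries one degree higher;
  after reindexing the coboundaries enter with the opposite sign.\<close>

lemma euler_cohomology:
  assumes C: "bounded_cpx A C" and i: "i \<in> V" and J: "finite J" "supp C \<subseteq> J"
  shows "euler C i = (\<Sum>j\<in>J. (if even j then 1 else - 1) * (cyc C j i - bnd C j i))"
proof -
  let ?s = "\<lambda>j::int. if even j then 1 else - 1 :: int"
  have "euler C i = (\<Sum>j\<in>J. ?s j * (cyc C j i + bnd C (j + 1) i))"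
    using euler_superset[OF bounded_rmod[OF C] J i] by (simp add: pdim_cyc_bnd[OF C i])
  also have "\<dots> = (\<Sum>j\<in>J. ?s j * cyc C j i) + (\<Sum>j\<in>J. ?s j * bnd C (j + 1) i)"
    by (simp add: distrib_left sum.distrib)
  also have "(\<Sum>j\<in>J. ?s j * bnd C (j + 1) i) = (\<Sum>j\<in>(\<lambda>j. j + 1) ` J. - (?s j * bnd C j i))"
    by (subst sum.reindex) (auto intro!: sum.cong simp: inj_on_def)
  \<comment> \<open>J and its translate differ only in degrees where the coboundaries vanish, so
    both sums are compared with the sum over the union.\<close>
  also have "\<dots> = (\<Sum>j\<in>J \<union> (\<lambda>j. j + 1) ` J. - (?s j * bnd C j i))"
  proof (rule sum.mono_neutral_left)
    show "\<forall>j\<in>J \<union> (\<lambda>j. j + 1) ` J - (\<lambda>j. j + 1) ` J. - (?s j * bnd C j i) = 0"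
    proof
      fix j assume j: "j \<in> J \<union> (\<lambda>j. j + 1) ` J - (\<lambda>j. j + 1) ` J"
      have "j - 1 \<notin> J"
      proof
        assume "j - 1 \<in> J"
        then have "j \<in> (\<lambda>j. j + 1) ` J" by (rule rev_image_eqI) simp
        then show False using j by blast
      qed
      then show "- (?s j * bnd C j i) = 0" using bnd_zero[OF C i, of j] J(2) by auto
    qed
  qed (use J in auto)
  also have "\<dots> = (\<Sum>j\<in>J. - (?s j * bnd C j i))"
    by (rule sum.mono_neutral_right) (use J bnd_zero[OF C i] in auto)
  finally show ?thesis by (simp add: right_diff_distrib sum_subtractf sum_negf)
qed

text \<open>Surjectivity on cohomology says that the cocycles of C are f(Z-cocycles) plus
  coboundaries, and injectivity that these two spaces meet in the image of the coboundaries of Z.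
  The kernel of f is the same on cocycles and on coboundaries of Z, so its dimension cancels from
  the two rank-nullity counts.\<close>

lemma quasi_iso_cohomology:
  assumes Z: "bounded_cpx A Z" and C: "bounded_cpx A C" and q: "quasi_iso A Z C f" and i: "i \<in> V"
  shows "cyc Z j i - bnd Z j i = cyc C j i - bnd C j i"
proof -
  interpret Z: bip_module A V E b cf "cobj Z j" by (rule rmod_module[OF bounded_rmod[OF Z]])
  interpret C: bip_module A V E b cf "cobj C j" by (rule rmod_module[OF bounded_rmod[OF C]])
  interpret Z1: bip_module A V E b cf "cobj Z (j - 1)" by (rule rmod_module[OF bounded_rmod[OF Z]])
  interpret C1: bip_module A V E b cf "cobj C (j - 1)" by (rule rmod_module[OF bounded_rmod[OF C]])
  have e: "b i i \<in> acar A" by (rule b_in_diag[OF i])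
  have cm: "\<And>j. f j \<in> hom_mod A (cobj Z j) (cobj C j)"
    "\<And>j v. v \<in> mcar (cobj Z j) \<Longrightarrow> f (j + 1) (cdif Z j v) = cdif C j (f j v)"
    using q unfolding quasi_iso_def chain_map_def by simp_all
  note f = cm(1)[of j] cm(1)[of "j - 1"]
  have fd: "\<And>v. v \<in> mcar (cobj Z (j - 1)) \<Longrightarrow> f j (cdif Z (j - 1) v) = cdif C (j - 1) (f (j - 1) v)"
    "\<And>v. v \<in> mcar (cobj Z j) \<Longrightarrow> f (j + 1) (cdif Z j v) = cdif C j (f j v)"
    using cm(2)[of _ "j - 1"] cm(2)[of _ j] by simp_all
  have inj: "\<And>v. v \<in> cocycles Z j \<Longrightarrow> f j v \<in> coboundaries C j \<Longrightarrow> v \<in> coboundaries Z j"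
    and surj: "\<And>w. w \<in> cocycles C j \<Longrightarrow> \<exists>v\<in>cocycles Z j. w - f j v \<in> coboundaries C j"
    using q unfolding quasi_iso_def by blast+
  have dZ1: "cdif Z (j - 1) \<in> hom_mod A (cobj Z (j - 1)) (cobj Z j)"
    and dC1: "cdif C (j - 1) \<in> hom_mod A (cobj C (j - 1)) (cobj C j)"
    using bounded_hom[OF Z, of "j - 1"] bounded_hom[OF C, of "j - 1"] by simp_all
  let ?ZZ = "{v \<in> piece (cobj Z j) i. cdif Z j v = 0}" and ?BZ = "cdif Z (j - 1) ` piece (cobj Z (j - 1)) i"
  let ?ZC = "{v \<in> piece (cobj C j) i. cdif C j v = 0}" and ?BC = "cdif C (j - 1) ` piece (cobj C (j - 1)) i"
  have fdZ: "fd_space (mscl (cobj Z j)) ?ZZ"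
    by (rule fd_space_subset[OF fd_bounded_piece[OF Z i] _
        subspace_kernel[OF Z.vs bounded_vs[OF Z] Z.piece_sub[OF i] dif_lin[OF Z]]]) auto
  have fdBZ: "fd_space (mscl (cobj Z j)) ?BZ"
    using fd_space_image[OF fd_bounded_piece[OF Z i] bounded_vs[OF Z] dif_lin[OF Z], of "j - 1"] by simp
  have fdBC: "fd_space (mscl (cobj C j)) ?BC"
    using fd_space_image[OF fd_bounded_piece[OF C i] bounded_vs[OF C] dif_lin[OF C], of "j - 1"] by simp
  have BZ: "v \<in> ?BZ" if v: "v \<in> coboundaries Z j" "v \<in> piece (cobj Z j) i" for v
  proof -
    obtain w where w: "w \<in> mcar (cobj Z (j - 1))" "v = cdif Z (j - 1) w"
      using v(1) unfolding coboundaries_def by blast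
    have "v = cdif Z (j - 1) (mact (cobj Z (j - 1)) w (b i i))"
      using hom_act[OF dZ1 w(1) e] w(2) Z.piece_act[OF v(2)] by simp
    then show ?thesis using Z1.act_piece[OF w(1) i] by (rule image_eqI)
  qed
  have BC: "v \<in> ?BC" if v: "v \<in> coboundaries C j" "v \<in> piece (cobj C j) i" for v
  proof -
    obtain w where w: "w \<in> mcar (cobj C (j - 1))" "v = cdif C (j - 1) w"
      using v(1) unfolding coboundaries_def by blast
    have "v = cdif C (j - 1) (mact (cobj C (j - 1)) w (b i i))"
      using hom_act[OF dC1 w(1) e] w(2) C.piece_act[OF v(2)] by simp
    then show ?thesis using C1.act_piece[OF w(1) i] by (rule image_eqI)
  qed
  have BZZ: "?BZ \<subseteq> ?ZZ"
    using hom_piece[OF dZ1 _ i] bounded_dd[OF Z, of _ "j - 1"] Z1.piece_car by auto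
  have BCZ: "?BC \<subseteq> ?ZC"
    using hom_piece[OF dC1 _ i] bounded_dd[OF C, of _ "j - 1"] C1.piece_car by auto
  have fp: "f j v \<in> ?ZC" if "v \<in> ?ZZ" for v
  proof -
    have "module.subspace (mscl (cobj Z (j + 1))) (mcar (cobj Z (j + 1)))"
      using bounded_rmod[OF Z, of "j + 1"] by (simp add: is_rmod_def)
    then have "f (j + 1) 0 = 0"
      by (rule lin_on_0[OF bounded_vs[OF Z] bounded_vs[OF C] _ hom_lin[OF cm(1)]])
    then show ?thesis using that hom_piece[OF f(1) _ i] fd(2)[of v] Z.piece_car[of v i] by auto
  qed
  have fB: "f j v \<in> ?BC" if v: "v \<in> ?BZ" for v
  proof -
    obtain w where w: "w \<in> piece (cobj Z (j - 1)) i" "v = cdif Z (j - 1) w" using v by blast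
    then have "f j v = cdif C (j - 1) (f (j - 1) w)" using fd(1)[OF Z1.piece_car] by simp
    then show ?thesis using hom_piece[OF f(2) w(1) i] by (rule image_eqI)
  qed
  have co: "v \<in> cocycles Z j" if "v \<in> ?ZZ" for v
    using that Z.piece_car by (auto simp: cocycles_def)
  have bC: "v \<in> coboundaries C j" if "v \<in> ?BC" for v
    using that C1.piece_car by (auto simp: coboundaries_def)
  have inj': "v \<in> ?BZ" if "v \<in> ?ZZ" "f j v \<in> ?BC" for v
    using BZ[OF inj[OF co[OF that(1)] bC[OF that(2)]]] that(1) by blast
  have lin: "lin_on (mscl (cobj Z j)) (mscl (cobj C j)) ?ZZ (f j)"
    by (rule lin_on_subset[OF hom_lin[OF f(1)]]) (use Z.piece_car in auto)
  have fdf: "fd_space (mscl (cobj C j)) (f j ` ?ZZ)" by (rule fd_space_image[OF fdZ C.vs lin])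
  \<comment> \<open>The correction given by surjectivity need not lie at vertex i; multiplying the
    whole identity by the idempotent moves it there.\<close>
  have sum: "{x + y | x y. x \<in> f j ` ?ZZ \<and> y \<in> ?BC} = ?ZC"
  proof
    have "C.m.subspace ?ZC"
      by (rule subspace_kernel[OF C.vs bounded_vs[OF C] C.piece_sub[OF i] dif_lin[OF C]])
    then show "{x + y | x y. x \<in> f j ` ?ZZ \<and> y \<in> ?BC} \<subseteq> ?ZC"
      using fp BCZ C.m.subspace_add by blast
    show "?ZC \<subseteq> {x + y | x y. x \<in> f j ` ?ZZ \<and> y \<in> ?BC}"
    proof
      fix w assume w: "w \<in> ?ZC"
      then have wp: "w \<in> piece (cobj C j) i" by simp
      have "w \<in> cocycles C j" using w C.piece_car by (auto simp: cocycles_def)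
      then obtain v where v: "v \<in> cocycles Z j" "w - f j v \<in> coboundaries C j" using surj by blast
      have vc: "v \<in> mcar (cobj Z j)" "cdif Z j v = 0" using v(1) by (auto simp: cocycles_def)
      let ?v = "mact (cobj Z j) v (b i i)"
      have "cdif Z j ?v = mact (cobj Z (j + 1)) 0 (b i i)"
        using hom_act[OF bounded_hom[OF Z] vc(1) e] vc(2) by simp
      also have "\<dots> = 0"
        using bip_module.act_zero[OF rmod_module[OF bounded_rmod[OF Z]] e] .
      finally have vZ: "?v \<in> ?ZZ" using Z.act_piece[OF vc(1) i] by simp
      obtain x where x: "x \<in> mcar (cobj C (j - 1))" "w - f j v = cdif C (j - 1) x"
        using v(2) unfolding coboundaries_def by blast
      have fv: "f j v \<in> mcar (cobj C j)" by (rule hom_car[OF f(1) vc(1)])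
      have "w = cdif C (j - 1) x + f j v" using x(2) by (simp add: diff_eq_eq)
      then have "w = mact (cobj C j) (cdif C (j - 1) x + f j v) (b i i)" using C.piece_act[OF wp] by simp
      also have "\<dots> = mact (cobj C j) (cdif C (j - 1) x) (b i i) + f j ?v"
        using C.act_add[OF hom_car[OF dC1 x(1)] fv e] hom_act[OF f(1) vc(1) e] by simp
      also have "mact (cobj C j) (cdif C (j - 1) x) (b i i) = cdif C (j - 1) (mact (cobj C (j - 1)) x (b i i))"
        using hom_act[OF dC1 x(1) e] by simp
      finally have "w = f j ?v + cdif C (j - 1) (mact (cobj C (j - 1)) x (b i i))"
        by (simp add: add.commute)
      then show "w \<in> {x + y | x y. x \<in> f j ` ?ZZ \<and> y \<in> ?BC}"
        using vZ C1.act_piece[OF x(1) i] by blast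
    qed
  qed
  have int: "f j ` ?ZZ \<inter> ?BC = f j ` ?BZ"
    using inj' fB BZZ by blast
  have z: "0 \<in> ?BC"
  proof -
    have "cdif C (j - 1) 0 = 0" by (rule lin_on_0[OF C1.vs C.vs C1.sub hom_lin[OF dC1]])
    then show ?thesis using C1.m.subspace_0[OF C1.piece_sub[OF i]] by (intro image_eqI[of _ _ 0]) simp_all
  qed
  have ker: "{v \<in> ?ZZ. f j v = 0} = {v \<in> ?BZ. f j v = 0}"
    using inj' z BZZ by auto
  show ?thesis
    using dim_sum_Int[OF fdf fdBC] rank_nullity[OF fdZ C.vs lin]
      rank_nullity[OF fdBZ C.vs lin_on_subset[OF lin BZZ]]
    unfolding sum int ker cyc_def bnd_def by linarith
qed

lemma euler_quasi_iso:
  assumes "bounded_cpx A Z" "bounded_cpx A C" "quasi_iso A Z C f" "i \<in> V"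
  shows "euler Z i = euler C i"
  using euler_cohomology[OF assms(1,4), of "supp Z \<union> supp C"] euler_cohomology[OF assms(2,4), of "supp Z \<union> supp C"]
    bounded_supp[OF assms(1)] bounded_supp[OF assms(2)] quasi_iso_cohomology[OF assms]
  by simp

lemma euler_Db_iso: "Db_iso A C D \<Longrightarrow> i \<in> V \<Longrightarrow> euler C i = euler D i"
proof -
  assume CD: "Db_iso A C D" and i: "i \<in> V"
  obtain Z :: "('k, 'a) ucpx" and f g where Z: "bounded_cpx A Z" "quasi_iso A Z C f" "quasi_iso A Z D g"
    using CD unfolding Db_iso_def by blast
  have "bounded_cpx A C" "bounded_cpx A D" using CD by (simp_all add: Db_iso_def)
  then show ?thesis using euler_quasi_iso[OF Z(1) _ Z(2) i] euler_quasi_iso[OF Z(1) _ Z(3) i] by simp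
qed

text \<open>The Coxeter transformation as a relation: reflections at all sinks, then at all sources,
  the latter using the new values at the sinks. Values off V are left free.\<close>

definition cox where
  "cox x y \<longleftrightarrow> (\<forall>t\<in>sinks. y t = (\<Sum>s\<in>inn t. x s) - x t) \<and>
    (\<forall>s\<in>sources. y s = (\<Sum>t\<in>outn s. y t) - (x s :: int))"

text \<open>Up to sign this is the double reflection: for x the dimension vector of P and y the
  negative of that of \<nu>P, these are the equations of \<open>cox\<close>.\<close>

lemma nak_pdim:
  assumes P: "projective_mod A P"
  shows "t \<in> sinks \<Longrightarrow> pdim (nak A P) t = pdim P t - (\<Sum>s\<in>inn t. pdim P s)"
    and "s \<in> sources \<Longrightarrow> pdim (nak A P) s = pdim P s + (\<Sum>t\<in>outn s. pdim (nak A P) t)"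
proof -
  have ann: "int (vector_space.dim (fun_scl (*)) (ann P t)) = pdim P t - (\<Sum>s\<in>inn t. pdim P s)"
    if "t \<in> V" for t
    using arg_cong[OF ann_dim(2)[OF P that], of int] by (simp add: pdim_def)
  show sink: "pdim (nak A P) t = pdim P t - (\<Sum>s\<in>inn t. pdim P s)" if "t \<in> sinks" for t
    using nak_dim_sink[OF P that] ann[of t] that E_V by (auto simp: pdim_def)
  show "pdim (nak A P) s = pdim P s + (\<Sum>t\<in>outn s. pdim (nak A P) t)" if s: "s \<in> sources"
  proof -
    have "(\<Sum>t\<in>outn s. pdim (nak A P) t) = (\<Sum>t\<in>outn s. int (vector_space.dim (fun_scl (*)) (ann P t)))"
      using nak_dim_sink[OF P RangeI] by (intro sum.cong refl) (auto simp: pdim_def)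
    then show ?thesis using nak_dim_source[OF P s] by (simp add: pdim_def)
  qed
qed

text \<open>The shift by -1 supplies the sign by which \<nu> differs from the double reflection on
  projectives, and the alternating sum over degrees carries the identity from the terms of P to
  P.\<close>

lemma euler_tau_Db:
  assumes "tau_Db A X Y"
  shows "cox (euler X) (euler Y)"
proof -
  obtain P :: "('k, 'a) ucpx" where P: "bounded_cpx A P" "\<And>j. projective_mod A (cobj P j)"
    "Db_iso A P X" "Db_iso A (shift_cpx (- 1) (nak_cpx A P)) Y"
    using assms unfolding tau_Db_def by blast
  let ?N = "shift_cpx (- 1) (nak_cpx A P)"
  have N: "bounded_cpx A ?N" using P(4) unfolding Db_iso_def by blast
  have cN: "cobj ?N j = nak A (cobj P (j - 1))" for j by (simp add: shift_cpx_def nak_cpx_def)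
  \<comment> \<open>The degree j - 1 of P sits in degree j of the shifted complex, so this set
    covers both supports after translation.\<close>
  let ?J = "supp P \<union> (\<lambda>j. j - 1) ` supp ?N"
  let ?s = "\<lambda>j::int. if even j then 1 else - 1 :: int"
  have J: "finite ?J" using bounded_supp[OF P(1)] bounded_supp[OF N] by simp
  have eP: "euler P i = (\<Sum>j\<in>?J. ?s j * pdim (cobj P j) i)" if "i \<in> V" for i
    by (rule euler_superset[OF bounded_rmod[OF P(1)] J _ that]) blast
  have eN: "euler ?N i = - (\<Sum>j\<in>?J. ?s j * pdim (nak A (cobj P j)) i)" if "i \<in> V" for i
  proof -
    have "supp ?N \<subseteq> (\<lambda>j. j + 1) ` ?J"
    proof
      fix j assume "j \<in> supp ?N"
      then show "j \<in> (\<lambda>j. j + 1) ` ?J" by (intro image_eqI[of _ _ "j - 1"]) auto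
    qed
    then have "euler ?N i = (\<Sum>j\<in>(\<lambda>j. j + 1) ` ?J. ?s j * pdim (cobj ?N j) i)"
      using J by (intro euler_superset[OF bounded_rmod[OF N] _ _ that]) auto
    also have "\<dots> = (\<Sum>j\<in>?J. - (?s j * pdim (nak A (cobj P j)) i))"
      by (subst sum.reindex) (auto intro!: sum.cong simp: inj_on_def cN)
    finally show ?thesis by (simp add: sum_negf)
  qed
  have X: "euler X i = euler P i" and Y: "euler Y i = euler ?N i" if "i \<in> V" for i
    using euler_Db_iso[OF P(3) that] euler_Db_iso[OF P(4) that] by simp_all
  show ?thesis
    unfolding cox_def
  proof (intro conjI ballI)
    fix t assume t: "t \<in> sinks"
    then have tV: "t \<in> V" using E_V by blast
    have "euler Y t = - (\<Sum>j\<in>?J. ?s j * (pdim (cobj P j) t - (\<Sum>s\<in>inn t. pdim (cobj P j) s)))"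
      using Y[OF tV] eN[OF tV] nak_pdim(1)[OF P(2) t] by simp
    also have "\<dots> = (\<Sum>j\<in>?J. \<Sum>s\<in>inn t. ?s j * pdim (cobj P j) s) - euler P t"
      unfolding eP[OF tV] by (simp add: right_diff_distrib sum_subtractf sum_distrib_left)
    also have "(\<Sum>j\<in>?J. \<Sum>s\<in>inn t. ?s j * pdim (cobj P j) s) = (\<Sum>s\<in>inn t. euler P s)"
      by (subst sum.swap) (auto intro!: sum.cong simp: eP[OF E_V(1)])
    also have "\<dots> = (\<Sum>s\<in>inn t. euler X s)"
      using X E_V by (intro sum.cong refl) auto
    finally show "euler Y t = (\<Sum>s\<in>inn t. euler X s) - euler X t" using X[OF tV] by simp
  next
    fix s assume s: "s \<in> sources"
    then have sV: "s \<in> V" by blast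
    have "euler Y s = - (\<Sum>j\<in>?J. ?s j * (pdim (cobj P j) s + (\<Sum>t\<in>outn s. pdim (nak A (cobj P j)) t)))"
      using Y[OF sV] eN[OF sV] nak_pdim(2)[OF P(2) s] by simp
    also have "\<dots> = - (\<Sum>j\<in>?J. \<Sum>t\<in>outn s. ?s j * pdim (nak A (cobj P j)) t) - euler P s"
      unfolding eP[OF sV] by (simp add: distrib_left sum.distrib sum_distrib_left)
    also have "(\<Sum>j\<in>?J. \<Sum>t\<in>outn s. ?s j * pdim (nak A (cobj P j)) t) = (\<Sum>t\<in>outn s. - euler Y t)"
      by (subst sum.swap) (auto intro!: sum.cong simp: Y[OF E_V(2)] eN[OF E_V(2)])
    finally show "euler Y s = (\<Sum>t\<in>outn s. euler Y t) - euler X s"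
      using X[OF sV] by (simp add: sum_negf)
  qed
qed

text \<open>If N \<noteq> 0, neither kind of projective summand splits off from M, so both sequences
  are short exact.\<close>

lemma tau_mod_cox:
  assumes "tau_mod A M N" "indec M"
  shows "mcar N = {0} \<or> (indec N \<and> cox (pdim M) (pdim N))"
proof -
  have M: "fg_mod A M" "is_rmod A M" and N: "fg_mod A N" "is_rmod A N"
    using assms(1) by (auto simp: tau_mod_def fg_mod_def)
  obtain u where u: "ar_seq M N u" using tau_ar_seq[OF assms(1)] by blast
  show ?thesis
  proof (rule disjCI)
    assume nz: "\<not> (indec N \<and> cox (pdim M) (pdim N))"
    show "mcar N = {0}"
    proof (rule ccontr)
      assume N0: "mcar N \<noteq> {0}"
      then have s1: "sink_surj M" using indec_sink_surj[OF M(2) N(2) assms(2) u] by blast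
      then have s2: "source_surj M N u" using indec_source_surj[OF M(2) N(2) assms(2) u] N0 by blast
      have "cox (pdim M) (pdim N)"
        unfolding cox_def
      proof (intro conjI ballI)
        show "pdim N t = (\<Sum>s\<in>inn t. pdim M s) - pdim M t" if "t \<in> sinks" for t
          using arg_cong[OF ar_dim_sink[OF M(1) N(1) u s1 that], of int] by (simp add: pdim_def)
        show "pdim N s = (\<Sum>t\<in>outn s. pdim N t) - pdim M s" if "s \<in> sources" for s
          using arg_cong[OF ar_dim_source[OF M(1) N(1) u s2 that], of int] by (simp add: pdim_def)
      qed
      then show False using nz indec_step[OF M(2) N(2) assms(2) u s1 s2] by blast
    qed
  qed
qed

lemma tau_mod_zero:
  assumes "tau_mod A M N" "mcar M = {0}"
  shows "mcar N = {0}"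
  using tau_ar_seq[OF assms(1)] ar_zero_zero[OF _ _ _ assms(2)] assms(1)
  by (auto simp: tau_mod_def fg_mod_def)

end

section \<open>The weights and the root system\<close>

abbreviation fverts :: "folding \<Rightarrow> vertex set" where "fverts \<Delta> \<equiv> qverts (fold_quiver \<Delta>)"
abbreviation farrows :: "folding \<Rightarrow> (vertex \<times> vertex) set" where "farrows \<Delta> \<equiv> qarrows (fold_quiver \<Delta>)"

definition angle :: "folding \<Rightarrow> real" where "angle \<Delta> = pi / (2 * fold_n \<Delta>)"

lemma fold_n_ge: "admissible \<Delta> \<Longrightarrow> fold_n \<Delta> \<ge> 2"
  by (cases \<Delta>) auto

lemma angle_bounds:
  assumes "admissible \<Delta>" shows "0 < angle \<Delta>" "angle \<Delta> < pi / 2"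
  using fold_n_ge[OF assms] by (auto simp: angle_def field_simps)

lemma cos_angle_pos: "admissible \<Delta> \<Longrightarrow> 0 < cos (angle \<Delta>)"
  using angle_bounds[of \<Delta>] by (intro cos_gt_zero) auto

lemma sin_angle_pos: "admissible \<Delta> \<Longrightarrow> 0 < sin (angle \<Delta>)"
  using angle_bounds[of \<Delta>] by (intro sin_gt_zero) auto

lemma sigma_V1: "sigma \<Delta> V1 = 2 * cos (angle \<Delta>) * sigma \<Delta> V0"
  by (cases \<Delta>) (auto simp: angle_def)

lemma sigma_V0_pos: "0 < sigma \<Delta> V0"
  by (cases \<Delta>) auto

lemma finite_fverts: "finite (fverts \<Delta>)"
  by (cases \<Delta>) auto

lemma farrows_sub: "admissible \<Delta> \<Longrightarrow> farrows \<Delta> \<subseteq> fverts \<Delta> \<times> fverts \<Delta>"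
  by (cases \<Delta>) (auto split: if_splits)

lemma farrows_parity_D:
  assumes "n \<ge> 3" "(i, j) \<in> farrows (FD n)"
  defines "level \<equiv> \<lambda>v. case v of Std k \<Rightarrow> k | Plus k \<Rightarrow> k | Minus k \<Rightarrow> k | _ \<Rightarrow> 0"
  shows "even (level i) \<and> odd (level j)"
proof -
  obtain m where "n = m + 3" using assms(1) by (metis add.commute le_Suc_ex)
  then show ?thesis using assms(2) unfolding level_def by (auto split: if_splits)
qed

lemma farrows_bipartite:
  assumes "admissible \<Delta>" "(i, j) \<in> farrows \<Delta>" shows "(j, l) \<notin> farrows \<Delta>"
proof (cases \<Delta>)
  case (FD n)
  then show ?thesis using farrows_parity_D[of n i j] farrows_parity_D[of n j l] assms by auto
qed (use assms in auto)

section \<open>\<kappa> as an eigenvector of the adjacency matrix, case by case\<close>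

lemma chebU_step: "k > 0 \<Longrightarrow> chebU (k - 1) x + chebU (k + 1) x = 2 * x * chebU k x"
  by (cases k) auto

lemma chebU_2: "chebU 2 x = 4 * x ^ 2 - 1"
  by (simp add: numeral_2_eq_2 power2_eq_square algebra_simps)

definition nbs :: "folding \<Rightarrow> vertex \<Rightarrow> vertex set" where
  "nbs \<Delta> i = {j. (i, j) \<in> farrows \<Delta> \<or> (j, i) \<in> farrows \<Delta>}"

lemma eigen_A:
  assumes "n \<ge> 2" "i \<in> fverts (FA n)"
  shows "(\<Sum>j\<in>nbs (FA n) i. kappa (FA n) j) = 2 * cos (angle (FA n)) * kappa (FA n) i"
proof -
  let ?t = "angle (FA n)"
  obtain k where k: "i = Std k" "k \<le> 2 * n - 2" using assms(2) by auto
  have nb: "nbs (FA n) i = Std ` {j. j \<le> 2 * n - 2 \<and> (j = k + 1 \<or> k = j + 1)}"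
    using k by (auto simp: nbs_def)
  have "(\<Sum>j\<in>nbs (FA n) i. kappa (FA n) j) =
      (\<Sum>j | j \<le> 2 * n - 2 \<and> (j = k + 1 \<or> k = j + 1). chebU j (cos ?t))"
    unfolding nb by (subst sum.reindex) (auto simp: inj_on_def angle_def)
  also have "\<dots> = 2 * cos ?t * chebU k (cos ?t)"
  proof -
    consider "k = 0" | "0 < k" "k < 2 * n - 2" | "k = 2 * n - 2" "0 < k" using k(2) by linarith
    then show ?thesis
    proof cases
      case 1
      then have "{j. j \<le> 2 * n - 2 \<and> (j = k + 1 \<or> k = j + 1)} = {1}" using assms(1) by auto
      then show ?thesis using 1 by simp
    next
      case 2
      then have "{j. j \<le> 2 * n - 2 \<and> (j = k + 1 \<or> k = j + 1)} = {k - 1, k + 1}" by auto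
      then show ?thesis using chebU_step[OF 2(1), of "cos ?t"] by simp
    next
      case 3
      then have s: "{j. j \<le> 2 * n - 2 \<and> (j = k + 1 \<or> k = j + 1)} = {k - 1}" by auto
      \<comment> \<open>At the right end k + 2 = 2n, so the missing neighbour would have weight
        U_{2n-1} = sin \<pi> / sin t = 0.\<close>
      have "real (k + 1 + 1) * ?t = pi" using 3 assms(1) by (simp add: angle_def of_nat_diff field_simps)
      then have "chebU (k + 1) (cos ?t) * sin ?t = 0" using chebU_cos[of "k + 1" ?t] by simp
      then have "chebU (k + 1) (cos ?t) = 0" using sin_angle_pos[of "FA n"] assms(1) by simp
      then show ?thesis using s chebU_step[OF 3(2), of "cos ?t"] by simp
    qed
  qed
  finally show ?thesis using k(1) by (simp add: angle_def)
qed

lemma eigen_D: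
  assumes "n \<ge> 3" "i \<in> fverts (FD n)"
  shows "(\<Sum>j\<in>nbs (FD n) i. kappa (FD n) j) = 2 * cos (angle (FD n)) * kappa (FD n) i"
proof -
  let ?t = "angle (FD n)"
  have kap: "kappa (FD n) (Std j) = 2 * chebU j (cos ?t)" "kappa (FD n) (Plus j) = chebU j (cos ?t)"
    "kappa (FD n) (Minus j) = chebU j (cos ?t)" for j by (simp_all add: angle_def)
  have st: "0 < sin ?t" using sin_angle_pos[of "FD n"] assms(1) by simp
  \<comment> \<open>Since nt = \<pi>/2, the values U_k are symmetric about k = n - 1. At the two
    forked ends the missing neighbour n is replaced by n - 2, and the factor 2 on the trunk
    compensates.\<close>
  have last: "chebU n (cos ?t) = chebU (n - 2) (cos ?t)"
  proof -
    have nt: "real n * ?t = pi / 2" using assms(1) by (simp add: angle_def)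
    have "chebU n (cos ?t) * sin ?t = sin (real n * ?t + ?t)"
      using chebU_cos[of n ?t] by (simp add: algebra_simps)
    also have "\<dots> = sin (real n * ?t - ?t)" unfolding nt by (simp add: sin_add sin_diff)
    also have "\<dots> = chebU (n - 2) (cos ?t) * sin ?t"
    proof -
      have "real (n - 2 + 1) * ?t = real n * ?t - ?t" using assms(1) by (simp add: of_nat_diff algebra_simps)
      then show ?thesis using chebU_cos[of "n - 2" ?t] by simp
    qed
    finally show ?thesis using st by simp
  qed
  consider (std) k where "i = Std k" "k < n - 2" | (mid) "i = Std (n - 2)" | (pm) "i = Plus (n - 1) \<or> i = Minus (n - 1)"
    using assms(2) by fastforce
  then show ?thesis
  proof cases
    case std
    show ?thesis
    proof (cases "k = 0")
      case True
      have "nbs (FD n) i = {Std 1}" using std True assms(1) by (auto simp: nbs_def split: if_splits)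
      then show ?thesis using std True kap by simp
    next
      case False
      have "nbs (FD n) i = {Std (k - 1), Std (k + 1)}"
        using std False by (auto simp: nbs_def split: if_splits)
      then show ?thesis using std kap chebU_step[of k "cos ?t"] False by (simp add: algebra_simps)
    qed
  next
    case mid
    have "nbs (FD n) i = {Std (n - 3), Plus (n - 1), Minus (n - 1)}"
      using mid assms(1) by (auto simp: nbs_def split: if_splits)
    then have "(\<Sum>j\<in>nbs (FD n) i. kappa (FD n) j) = 2 * (chebU (n - 3) (cos ?t) + chebU (n - 1) (cos ?t))"
      using kap by simp
    also have "chebU (n - 3) (cos ?t) + chebU (n - 1) (cos ?t) = 2 * cos ?t * chebU (n - 2) (cos ?t)"
      using chebU_step[of "n - 2" "cos ?t"] assms(1) by (simp add: Suc_diff_Suc numeral_3_eq_3 numeral_2_eq_2)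
    finally show ?thesis using mid kap by simp
  next
    case pm
    have "nbs (FD n) i = {Std (n - 2)}"
      using pm assms(1) by (auto simp: nbs_def split: if_splits)
    moreover have "2 * chebU (n - 2) (cos ?t) = 2 * cos ?t * chebU (n - 1) (cos ?t)"
      using chebU_step[of "n - 1" "cos ?t"] last assms(1) by (simp add: numeral_2_eq_2 Suc_diff_Suc)
    ultimately show ?thesis using pm kap by auto
  qed
qed

lemma eigen_E6:
  assumes "i \<in> fverts FE6"
  shows "(\<Sum>j\<in>nbs FE6 i. kappa FE6 j) = 2 * cos (angle FE6) * kappa FE6 i"
proof -
  define c where "c = cos (pi / 12)"
  have ang: "cos (angle FE6) = c" by (simp add: angle_def c_def)
  have c0: "0 < c" unfolding c_def by (rule cos_gt_zero) auto
  have "2 * c ^ 2 = 1 + cos (pi / 6)" using cos_double_cos[of "pi / 12"] by (simp add: c_def)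
  then have c2: "4 * c ^ 2 = 2 + sqrt 3" by (simp add: cos_30)
  \<comment> \<open>cos(\<pi>/12) is known only through its square; the root may be taken because
    both sides are nonnegative.\<close>
  have "(2 * sqrt 2 * c) ^ 2 = 2 * (4 * c ^ 2)" by (simp add: power_mult_distrib)
  also have "\<dots> = (1 + sqrt 3) ^ 2" unfolding c2 by (simp add: power2_sum)
  finally have "(2 * sqrt 2 * c) ^ 2 = (1 + sqrt 3) ^ 2" .
  moreover have "0 \<le> 2 * sqrt 2 * c" "0 \<le> 1 + sqrt 3" using c0 by simp_all
  ultimately have s: "2 * sqrt 2 * c = 1 + sqrt 3" by (rule power2_eq_imp_eq)
  \<comment> \<open>This is the equation at the branch vertex \<open>Std 2\<close>, where the two
    outer neighbours cancel against part of the right-hand side; \<open>s\<close> is the equation at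
    \<open>Exc\<close>.\<close>
  have s2: "2 * c * (sqrt 3 - 1) = sqrt 2"
  proof -
    have "sqrt 2 * (2 * c * (sqrt 3 - 1)) = (2 * sqrt 2 * c) * (sqrt 3 - 1)" by simp
    also have "\<dots> = sqrt 2 * sqrt 2" unfolding s by (simp add: algebra_simps)
    finally show ?thesis by (rule mult_left_cancel[THEN iffD1, rotated]) simp
  qed
  have U2: "chebU 2 c = 1 + sqrt 3" using c2 by (simp add: chebU_2)
  have cc: "c * (c * 4) = 2 + sqrt 3" using c2 by (simp add: power2_eq_square)
  have "i \<in> {Plus 0, Minus 0, Plus 1, Minus 1, Std 2, Exc}" using assms by simp
  then consider "i = Plus 0" | "i = Minus 0" | "i = Plus 1" | "i = Minus 1" | "i = Std 2" | "i = Exc" by blast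
  then show ?thesis
  proof cases
    case 1
    have "nbs FE6 i = {Plus 1}" unfolding 1 by (auto simp: nbs_def)
    then show ?thesis unfolding 1 ang by (simp add: c_def)
  next
    case 2
    have "nbs FE6 i = {Minus 1}" unfolding 2 by (auto simp: nbs_def)
    then show ?thesis unfolding 2 ang by (simp add: c_def)
  next
    case 3
    have "nbs FE6 i = {Plus 0, Std 2}" unfolding 3 by (auto simp: nbs_def)
    then show ?thesis unfolding 3 ang using U2 cc by (simp add: c_def[symmetric] algebra_simps)
  next
    case 4
    have "nbs FE6 i = {Minus 0, Std 2}" unfolding 4 by (auto simp: nbs_def)
    then show ?thesis unfolding 4 ang using U2 cc by (simp add: c_def[symmetric] algebra_simps)
  next
    case 5
    have "nbs FE6 i = {Plus 1, Minus 1, Exc}" unfolding 5 by (auto simp: nbs_def)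
    then show ?thesis unfolding 5 ang using U2 s2 by (simp add: c_def[symmetric] algebra_simps)
  next
    case 6
    have "nbs FE6 i = {Std 2}" unfolding 6 by (auto simp: nbs_def)
    then show ?thesis unfolding 6 ang using U2 s by (simp add: c_def[symmetric] algebra_simps)
  qed
qed

lemma two_cos_mult: "2 * cos a * (2 * cos b) = 2 * cos (a + b) + 2 * cos (a - b)" for a b :: real
  by (simp add: cos_add cos_diff)

text \<open>Writing U_k as a sum of terms 2 cos(jt) turns multiplication by 2 cos t into a shift of
  frequencies, by \<open>two_cos_mult\<close>.\<close>

lemma chebU_two_cos:
  fixes t :: real
  shows "chebU (Suc 0) (cos t) = 2 * cos t" "chebU 2 (cos t) = 1 + 2 * cos (2 * t)"
    "chebU 3 (cos t) = 2 * cos t + 2 * cos (3 * t)" "chebU 4 (cos t) = 1 + 2 * cos (2 * t) + 2 * cos (4 * t)"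
proof -
  show "chebU (Suc 0) (cos t) = 2 * cos t" by simp
  have "chebU 2 (cos t) = 2 * cos t * (2 * cos t) - 1" by (simp add: numeral_2_eq_2)
  then show 2: "chebU 2 (cos t) = 1 + 2 * cos (2 * t)" unfolding two_cos_mult by simp
  have "chebU 3 (cos t) = 2 * cos t * chebU 2 (cos t) - 2 * cos t"
    by (simp add: numeral_3_eq_3 numeral_2_eq_2)
  also have "\<dots> = 2 * cos t * (2 * cos (2 * t))" unfolding 2 by (simp add: algebra_simps)
  finally show 3: "chebU 3 (cos t) = 2 * cos t + 2 * cos (3 * t)"
    unfolding two_cos_mult using cos_minus[of t] by (simp add: algebra_simps)
  have "chebU 4 (cos t) = 2 * cos t * chebU 3 (cos t) - chebU 2 (cos t)"
    by (simp add: eval_nat_numeral)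
  also have "\<dots> = 2 * cos t * (2 * cos t) + 2 * cos t * (2 * cos (3 * t)) - chebU 2 (cos t)"
    unfolding 3 by (simp add: algebra_simps)
  finally show "chebU 4 (cos t) = 1 + 2 * cos (2 * t) + 2 * cos (4 * t)"
    unfolding two_cos_mult 2 using cos_minus[of "2 * t"] by (simp add: algebra_simps)
qed

lemma eigen_E7:
  assumes "i \<in> fverts FE7"
  shows "(\<Sum>j\<in>nbs FE7 i. kappa FE7 j) = 2 * cos (angle FE7) * kappa FE7 i"
proof -
  define t :: real where "t = pi / 18"
  have ang: "cos (angle FE7) = cos t" by (simp add: angle_def t_def)
  have t9: "pi / 9 = 2 * t" "5 * pi / 18 = 5 * t" by (simp_all add: t_def)
  have kap: "kappa FE7 (Std k) = chebU k (cos t)" "kappa FE7 (Tilde k) = chebU k (cos (2 * t))"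
    "kappa FE7 Exc = 2 * cos (5 * t)" for k
    by (simp_all add: t9 flip: t_def)
  \<comment> \<open>Needed only for the equation at \<open>Exc\<close>. With the weights written in
    t, the equations at the other vertices are identities in t.\<close>
  have six: "2 * cos (6 * t) = 1"
  proof -
    have "6 * t = pi / 3" by (simp add: t_def)
    then have "cos (6 * t) = 1 / 2" by (simp only: cos_60)
    then show ?thesis by simp
  qed
  have m: "2 * cos t * (2 * cos (2 * t)) = 2 * cos (3 * t) + 2 * cos t"
    "2 * cos t * (2 * cos (4 * t)) = 2 * cos (5 * t) + 2 * cos (3 * t)"
    "2 * cos t * (2 * cos (5 * t)) = 2 * cos (6 * t) + 2 * cos (4 * t)"
    using cos_minus[of t] cos_minus[of "3 * t"] cos_minus[of "4 * t"]
    unfolding two_cos_mult by simp_all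
  note U = chebU_two_cos
  have "i \<in> {Std 0, Std 1, Std 2, Std 3, Tilde 1, Tilde 2, Exc}" using assms by simp
  then consider "i = Std 0" | "i = Std 1" | "i = Std 2" | "i = Std 3" | "i = Tilde 1" | "i = Tilde 2" | "i = Exc"
    by blast
  then show ?thesis
  proof cases
    case 1
    have "nbs FE7 i = {Std 1}" unfolding 1 by (auto simp: nbs_def)
    then show ?thesis unfolding 1 ang by (simp add: kap del: kappa.simps)
  next
    case 2
    have "nbs FE7 i = {Std 0, Std 2}" unfolding 2 by (auto simp: nbs_def)
    then show ?thesis unfolding 2 ang using chebU_step[of 1 "cos t"]
      by (simp add: kap numeral_2_eq_2 del: kappa.simps)
  next
    case 3
    have "nbs FE7 i = {Std 1, Std 3}" unfolding 3 by (auto simp: nbs_def)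
    then show ?thesis unfolding 3 ang using chebU_step[of 2 "cos t"]
      by (simp add: kap numeral_3_eq_3 numeral_2_eq_2 del: kappa.simps chebU.simps)
  next
    case 4
    have "nbs FE7 i = {Std 2, Tilde 1, Tilde 2}" unfolding 4 by (auto simp: nbs_def)
    then have "(\<Sum>j\<in>nbs FE7 i. kappa FE7 j) =
        1 + 2 * cos (2 * t) + (2 * cos (2 * t) + (1 + 2 * cos (2 * (2 * t))))"
      using U(2)[of t] U(2)[of "2 * t"] by (simp add: kap del: kappa.simps)
    also have "\<dots> = 2 * cos t * (2 * cos t) + 2 * cos t * (2 * cos (3 * t))"
      unfolding two_cos_mult using cos_minus[of "2 * t"] by simp
    finally show ?thesis unfolding 4 ang kap U by (simp add: algebra_simps)
  next
    case 5
    have "nbs FE7 i = {Std 3}" unfolding 5 by (auto simp: nbs_def)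
    then show ?thesis unfolding 5 ang using m(1) U(3)[of t] by (simp add: kap del: kappa.simps)
  next
    case 6
    have "nbs FE7 i = {Std 3, Exc}" unfolding 6 by (auto simp: nbs_def)
    then show ?thesis unfolding 6 ang using m(2) U(3)[of t] U(2)[of "2 * t"]
      by (simp add: kap algebra_simps del: kappa.simps)
  next
    case 7
    have "nbs FE7 i = {Tilde 2}" unfolding 7 by (auto simp: nbs_def)
    then show ?thesis unfolding 7 ang using m(3) six U(2)[of "2 * t"]
      by (simp add: kap del: kappa.simps)
  qed
qed

text \<open>From cos(3\<pi>/5) = -cos(2\<pi>/5), the multiple-angle formulas give a cubic for x =
  cos(\<pi>/5) with the extraneous factor x + 1, excluded by x > 0.\<close>

lemma golden_square: "golden ^ 2 = golden + 1"
proof -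
  define x where "x = cos (pi / 5)"
  have x0: "0 < x" unfolding x_def by (rule cos_gt_zero) auto
  have "cos (3 * (pi / 5)) = - cos (2 * (pi / 5))"
    using cos_pi_minus[of "2 * (pi / 5)"] by (simp add: field_simps)
  then have "4 * x ^ 3 - 3 * x = - (2 * x ^ 2 - 1)"
    unfolding cos_treble_cos cos_double_cos x_def .
  then have "(x + 1) * (4 * x ^ 2 - 2 * x - 1) = 0"
    by (simp add: algebra_simps power2_eq_square power3_eq_cube)
  then have "4 * x ^ 2 - 2 * x - 1 = 0" using x0 by simp
  then show ?thesis by (simp add: golden_def x_def power2_eq_square algebra_simps)
qed

lemma eigen_E8:
  assumes "i \<in> fverts FE8"
  shows "(\<Sum>j\<in>nbs FE8 i. kappa FE8 j) = 2 * cos (angle FE8) * kappa FE8 i"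
proof -
  define t :: real where "t = pi / 30"
  define U where "U k = chebU k (cos t)" for k
  let ?g = golden
  have ang: "cos (angle FE8) = cos t" by (simp add: angle_def t_def)
  have kap: "kappa FE8 (Std k) = U k" "kappa FE8 (Phi k) = ?g * U k" "kappa FE8 Exc = inverse ?g * U 3" for k
    by (simp_all add: U_def flip: t_def)
  have g0: "0 < ?g" unfolding golden_def by (auto intro!: mult_pos_pos cos_gt_zero)
  have g2: "?g * ?g = ?g + 1" using golden_square by (simp add: power2_eq_square)
  have gi: "inverse ?g = ?g - 1"
    using g0 g2 by (simp add: field_simps)
  have g6: "?g = 2 * cos (6 * t)" by (simp add: golden_def t_def)
  \<comment> \<open>The values special to t = \<pi>/30 are 5t = \<pi>/6, 3t = \<pi>/2 - 12t and 6t =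
    \<pi>/5; they relate cos 2t and cos 8t through the golden ratio.\<close>
  have "2 * cos (2 * t) - 2 * cos (8 * t) = 4 * sin (5 * t) * sin (3 * t)"
    using cos_diff_cos[of "2 * t" "8 * t"] by simp
  also have "sin (5 * t) = 1 / 2"
  proof -
    have "5 * t = pi / 6" by (simp add: t_def)
    then show ?thesis by (simp only: sin_30)
  qed
  also have "sin (3 * t) = cos (2 * (6 * t))"
  proof -
    have "2 * (6 * t) = pi / 2 - 3 * t" by (simp add: t_def field_simps)
    moreover have "sin (3 * t) = cos (pi / 2 - 3 * t)" by (simp add: cos_diff)
    ultimately show ?thesis by (simp only:)
  qed
  also have "4 * (1 / 2) * cos (2 * (6 * t)) = ?g * ?g - 2"
    unfolding cos_double_cos g6 by (simp add: power2_eq_square)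
  finally have star: "1 + 2 * cos (2 * t) = ?g + 2 * cos (8 * t)" using g2 by simp
  \<comment> \<open>The relation behind the golden factors in \<kappa>: it settles the branch vertex
    \<open>Std 4\<close> and its neighbours \<open>Exc\<close> and \<open>Phi 1\<close>, while the
    other vertices need only the recursion.\<close>
  have g42: "U 4 = ?g * U 2"
  proof -
    have "?g * U 2 = ?g + ?g * (2 * cos (2 * t))"
      unfolding U_def chebU_two_cos by (simp add: algebra_simps)
    also have "\<dots> = ?g + 2 * cos (6 * t) * (2 * cos (2 * t))" by (simp only: g6)
    also have "\<dots> = ?g + 2 * cos (8 * t) + 2 * cos (4 * t)" unfolding two_cos_mult by simp
    finally show ?thesis using star unfolding U_def chebU_two_cos by simp
  qed
  have r: "U 1 = 2 * cos t * U 0" "U 0 + U 2 = 2 * cos t * U 1" "U 1 + U 3 = 2 * cos t * U 2"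
    "U 2 + U 4 = 2 * cos t * U 3"
    by (simp_all add: U_def eval_nat_numeral)
  have "i \<in> {Std 0, Std 1, Std 2, Std 3, Std 4, Exc, Phi 0, Phi 1}" using assms by simp
  then consider "i = Std 0" | "i = Std 1" | "i = Std 2" | "i = Std 3" | "i = Std 4" | "i = Exc"
    | "i = Phi 0" | "i = Phi 1" by blast
  then show ?thesis
  proof cases
    case 1
    have "nbs FE8 i = {Std 1}" unfolding 1 by (auto simp: nbs_def)
    then show ?thesis unfolding 1 ang using r(1) by (simp add: kap del: kappa.simps)
  next
    case 2
    have "nbs FE8 i = {Std 0, Std 2}" unfolding 2 by (auto simp: nbs_def)
    then show ?thesis unfolding 2 ang using r(2) by (simp add: kap del: kappa.simps)
  next
    case 3
    have "nbs FE8 i = {Std 1, Std 3}" unfolding 3 by (auto simp: nbs_def)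
    then show ?thesis unfolding 3 ang using r(3) by (simp add: kap del: kappa.simps)
  next
    case 4
    have "nbs FE8 i = {Std 2, Std 4}" unfolding 4 by (auto simp: nbs_def)
    then show ?thesis unfolding 4 ang using r(4) by (simp add: kap del: kappa.simps)
  next
    case 5
    have "nbs FE8 i = {Std 3, Exc, Phi 1}" unfolding 5 by (auto simp: nbs_def)
    then have "(\<Sum>j\<in>nbs FE8 i. kappa FE8 j) = U 3 + ((?g - 1) * U 3 + ?g * U 1)"
      by (simp add: kap gi del: kappa.simps)
    also have "\<dots> = ?g * (U 1 + U 3)" by (simp add: algebra_simps)
    also have "\<dots> = 2 * cos t * U 4" unfolding r(3) g42 by simp
    finally show ?thesis unfolding 5 ang kap .
  next
    case 6
    have "nbs FE8 i = {Std 4}" unfolding 6 by (auto simp: nbs_def)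
    then have "(\<Sum>j\<in>nbs FE8 i. kappa FE8 j) = ?g * U 2" by (simp add: kap g42 del: kappa.simps)
    also have "\<dots> = (?g * ?g - 1) * U 2" unfolding g2 by simp
    also have "\<dots> = (?g - 1) * (U 2 + U 4)" unfolding g42 by (simp add: algebra_simps)
    also have "\<dots> = 2 * cos t * (inverse ?g * U 3)" unfolding r(4) gi by simp
    finally show ?thesis unfolding 6 ang kap .
  next
    case 7
    have "nbs FE8 i = {Phi 1}" unfolding 7 by (auto simp: nbs_def)
    then show ?thesis unfolding 7 ang using r(1) by (simp add: kap del: kappa.simps)
  next
    case 8
    have "nbs FE8 i = {Std 4, Phi 0}" unfolding 8 by (auto simp: nbs_def)
    then have "(\<Sum>j\<in>nbs FE8 i. kappa FE8 j) = ?g * (U 0 + U 2)"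
      by (simp add: kap g42 algebra_simps del: kappa.simps)
    then show ?thesis unfolding 8 ang kap r(2) by simp
  qed
qed

lemma eigen:
  assumes "admissible \<Delta>" "i \<in> fverts \<Delta>"
  shows "(\<Sum>j\<in>nbs \<Delta> i. kappa \<Delta> j) = 2 * cos (angle \<Delta>) * kappa \<Delta> i"
proof (cases \<Delta>)
  case (FA n) then show ?thesis using eigen_A assms by simp
next
  case (FD n) then show ?thesis using eigen_D assms by simp
next
  case FE6 then show ?thesis using eigen_E6 assms by simp
next
  case FE7 then show ?thesis using eigen_E7 assms by simp
next
  case FE8 then show ?thesis using eigen_E8 assms by simp
qed

lemma eigen_source:
  assumes "admissible \<Delta>" "s \<in> fverts \<Delta> - Range (farrows \<Delta>)"
  shows "(\<Sum>t | (s, t) \<in> farrows \<Delta>. kappa \<Delta> t) = 2 * cos (angle \<Delta>) * kappa \<Delta> s"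
proof -
  have "nbs \<Delta> s = {t. (s, t) \<in> farrows \<Delta>}" using assms(2) by (auto simp: nbs_def)
  then show ?thesis using eigen[OF assms(1), of s] assms(2) by simp
qed

lemma eigen_sink:
  assumes "admissible \<Delta>" "t \<in> Range (farrows \<Delta>)"
  shows "(\<Sum>s | (s, t) \<in> farrows \<Delta>. kappa \<Delta> s) = 2 * cos (angle \<Delta>) * kappa \<Delta> t"
proof -
  have "nbs \<Delta> t = {s. (s, t) \<in> farrows \<Delta>}"
    using assms farrows_bipartite[OF assms(1)] by (auto simp: nbs_def)
  moreover have "t \<in> fverts \<Delta>" using assms farrows_sub[OF assms(1)] by blast
  ultimately show ?thesis using eigen[OF assms(1), of t] by simp
qed

section \<open>From dimension vectors to points of the plane\<close>

lemma fold_map_V1: "fold_map \<Delta> i = V1 \<longleftrightarrow> i \<in> Range (farrows \<Delta>)"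
  and fold_map_V0: "fold_map \<Delta> i = V0 \<longleftrightarrow> i \<notin> Range (farrows \<Delta>)"
  by (auto simp: fold_map_def)

text \<open>The long simple root points in the direction \<pi> - \<pi>/2n, the opposite of
  -\<pi>/2n, hence the minus sign.\<close>

lemma root_point_polar:
  assumes "admissible \<Delta>"
  shows "root_point \<Delta> v = of_real (sigma \<Delta> V0) *
    (of_real (fst v) - of_real (2 * cos (angle \<Delta>) * snd v) * cis (- angle \<Delta>))"
proof -
  let ?n = "fold_n \<Delta>"
  have "real (2 * ?n - 1) * pi / (2 * ?n) = pi - angle \<Delta>"
    using fold_n_ge[OF assms] by (simp add: angle_def of_nat_diff field_simps)
  moreover have "exp (of_real x * \<i>) = cis x" for x
    by (simp add: cis_conv_exp mult.commute)
  moreover have "cis (pi - angle \<Delta>) = - cis (- angle \<Delta>)" by (simp add: complex_eq_iff)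
  ultimately have "exp (of_real (real (2 * ?n - 1) * pi / (2 * ?n)) * \<i>) = - cis (- angle \<Delta>)"
    by (simp only:)
  then show ?thesis
    by (simp add: root_point_def Let_def angle_def algebra_simps)
qed

lemma two_cos_cis: "of_real (2 * cos t) = cis t + cis (- t)"
  by (simp add: complex_eq_iff)

text \<open>The eigenvector equation moves the weights across the arrows, so the reflections act on
  just two numbers, the weighted sums over sources and over sinks. On these they become the two
  simple reflections of the plane, whose product is the rotation by \<pi>/n.\<close>

lemma d_F_cox:
  assumes adm: "admissible \<Delta>"
    and sink: "\<And>t. t \<in> Range (farrows \<Delta>) \<Longrightarrow> y t = (\<Sum>s | (s, t) \<in> farrows \<Delta>. x s) - x t"
    and source: "\<And>s. s \<in> fverts \<Delta> - Range (farrows \<Delta>) \<Longrightarrow>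
      y s = (\<Sum>t | (s, t) \<in> farrows \<Delta>. y t) - x s"
  shows "root_point \<Delta> (d_F \<Delta> y) = cis (2 * angle \<Delta>) * root_point \<Delta> (d_F \<Delta> x)"
proof -
  let ?E = "farrows \<Delta>" and ?k = "kappa \<Delta>" and ?c = "2 * cos (angle \<Delta>)"
  let ?S = "fverts \<Delta> - Range ?E" and ?T = "Range ?E"
  have TV: "?T \<subseteq> fverts \<Delta>" using farrows_sub[OF adm] by blast
  have sets: "{i \<in> fverts \<Delta>. fold_map \<Delta> i = V0} = ?S" "{i \<in> fverts \<Delta>. fold_map \<Delta> i = V1} = ?T"
    using TV by (auto simp: fold_map_V0 fold_map_V1)
  have fin: "finite ?S" "finite ?T" using finite_fverts finite_subset[OF TV] by auto
  have ES: "(s, t) \<in> ?E \<Longrightarrow> s \<in> ?S" and ET: "(s, t) \<in> ?E \<Longrightarrow> t \<in> ?T" for s t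
    using farrows_bipartite[OF adm] farrows_sub[OF adm] by blast+
  define p where "p u = (\<Sum>i\<in>?S. ?k i * real_of_int (u i))" for u
  define q where "q u = (\<Sum>i\<in>?T. ?k i * real_of_int (u i))" for u
  have dF: "d_F \<Delta> u = (p u / sigma \<Delta> V0, q u / sigma \<Delta> V1)" for u
    unfolding d_F_def sets p_def q_def by (simp add: sum_divide_distrib)
  \<comment> \<open>The order of summation over arrows is exchanged through a sum over all
    source-sink pairs; the inner sum of weights is then an eigenvector equation at a source.\<close>
  have qy: "q y = ?c * p x - q x"
  proof -
    have "q y = (\<Sum>t\<in>?T. \<Sum>s | (s, t) \<in> ?E. ?k t * real_of_int (x s)) - q x"
      unfolding q_def sum_subtractf[symmetric]
      by (intro sum.cong refl) (simp add: sink right_diff_distrib sum_distrib_left)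
    also have "(\<Sum>t\<in>?T. \<Sum>s | (s, t) \<in> ?E. ?k t * real_of_int (x s)) =
        (\<Sum>t\<in>?T. \<Sum>s\<in>?S. if (s, t) \<in> ?E then ?k t * real_of_int (x s) else 0)"
      using fin ES by (intro sum.cong refl sum.mono_neutral_cong_left) auto
    also have "\<dots> = (\<Sum>s\<in>?S. \<Sum>t\<in>?T. if (s, t) \<in> ?E then ?k t * real_of_int (x s) else 0)"
      by (rule sum.swap)
    also have "\<dots> = (\<Sum>s\<in>?S. \<Sum>t | (s, t) \<in> ?E. ?k t * real_of_int (x s))"
      using fin ET by (intro sum.cong refl sum.mono_neutral_cong_right) auto
    also have "\<dots> = (\<Sum>s\<in>?S. (\<Sum>t | (s, t) \<in> ?E. ?k t) * real_of_int (x s))"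
      by (simp add: sum_distrib_right)
    also have "\<dots> = ?c * p x"
      unfolding p_def sum_distrib_left using eigen_source[OF adm] by (intro sum.cong) auto
    finally show ?thesis .
  qed
  have py: "p y = ?c * q y - p x"
  proof -
    have "p y = (\<Sum>s\<in>?S. \<Sum>t | (s, t) \<in> ?E. ?k s * real_of_int (y t)) - p x"
      unfolding p_def sum_subtractf[symmetric]
      by (intro sum.cong refl) (simp add: source right_diff_distrib sum_distrib_left)
    also have "(\<Sum>s\<in>?S. \<Sum>t | (s, t) \<in> ?E. ?k s * real_of_int (y t)) =
        (\<Sum>s\<in>?S. \<Sum>t\<in>?T. if (s, t) \<in> ?E then ?k s * real_of_int (y t) else 0)"
      using fin ET by (intro sum.cong refl sum.mono_neutral_cong_left) auto
    also have "\<dots> = (\<Sum>t\<in>?T. \<Sum>s\<in>?S. if (s, t) \<in> ?E then ?k s * real_of_int (y t) else 0)"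
      by (rule sum.swap)
    also have "\<dots> = (\<Sum>t\<in>?T. \<Sum>s | (s, t) \<in> ?E. ?k s * real_of_int (y t))"
      using fin ES by (intro sum.cong refl sum.mono_neutral_cong_right) auto
    also have "\<dots> = (\<Sum>t\<in>?T. (\<Sum>s | (s, t) \<in> ?E. ?k s) * real_of_int (y t))"
      by (simp add: sum_distrib_right)
    also have "\<dots> = ?c * q y"
      unfolding q_def sum_distrib_left using eigen_sink[OF adm] by (intro sum.cong) auto
    finally show ?thesis .
  qed
  have rp: "root_point \<Delta> (d_F \<Delta> u) = of_real (p u) - of_real (q u) * cis (- angle \<Delta>)" for u
    using sigma_V0_pos[of \<Delta>] cos_angle_pos[OF adm]
    by (simp add: root_point_polar[OF adm] dF sigma_V1 right_diff_distrib)
  let ?w = "cis (angle \<Delta>)" and ?v = "cis (- angle \<Delta>)"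
  have wv: "?w * ?v = 1" by (simp add: cis_mult)
  have w2: "cis (2 * angle \<Delta>) = ?w * ?w" by (simp add: cis_mult)
  have c: "of_real ?c = ?w + ?v" by (rule two_cos_cis)
  have "root_point \<Delta> (d_F \<Delta> y) = of_real (q y) * (of_real ?c - ?v) - of_real (p x)"
    unfolding rp py by (simp add: algebra_simps)
  also have "\<dots> = (of_real ?c * of_real (p x) - of_real (q x)) * ?w - of_real (p x)"
    unfolding c qy using c by simp
  also have "\<dots> = ?w * ?w * of_real (p x) + (?w * ?v) * of_real (p x) - of_real (q x) * ?w - of_real (p x)"
    unfolding c by (simp add: algebra_simps)
  also have "\<dots> = ?w * ?w * of_real (p x) - of_real (q x) * (?w * (?w * ?v))"
    unfolding wv by simp
  also have "\<dots> = cis (2 * angle \<Delta>) * root_point \<Delta> (d_F \<Delta> x)"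
    unfolding rp w2 by (simp add: algebra_simps)
  finally show ?thesis .
qed

text \<open>The name refers to injective modules: x is the dimension vector of I(i), supported at i
  and its predecessors. If i is a sink, the predecessors contribute the eigenvalue 2 cos(\<pi>/2n),
  and subtracting exp(-i\<pi>/2n) leaves exp(i\<pi>/2n), the direction for m = 0.\<close>

lemma root_point_injective:
  assumes adm: "admissible \<Delta>" and i: "i \<in> fverts \<Delta>"
    and x: "\<And>j. j \<in> fverts \<Delta> \<Longrightarrow> x j = (if j = i \<or> (j, i) \<in> farrows \<Delta> then 1 else 0)"
  shows "fold_map \<Delta> i = V0 \<Longrightarrow> root_point \<Delta> (d_F \<Delta> x) = of_real (weight \<Delta> i * sigma \<Delta> V0)"
    and "fold_map \<Delta> i = V1 \<Longrightarrow>
      root_point \<Delta> (d_F \<Delta> x) = of_real (weight \<Delta> i * sigma \<Delta> V1) * cis (angle \<Delta>)"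
proof -
  let ?E = "farrows \<Delta>" and ?k = "kappa \<Delta>" and ?c = "2 * cos (angle \<Delta>)"
  let ?S = "fverts \<Delta> - Range ?E" and ?T = "Range ?E"
  have TV: "?T \<subseteq> fverts \<Delta>" using farrows_sub[OF adm] by blast
  have sets: "{i \<in> fverts \<Delta>. fold_map \<Delta> i = V0} = ?S" "{i \<in> fverts \<Delta>. fold_map \<Delta> i = V1} = ?T"
    using TV by (auto simp: fold_map_V0 fold_map_V1)
  have fin: "finite ?S" "finite ?T" using finite_fverts finite_subset[OF TV] by auto
  have ES: "(s, t) \<in> ?E \<Longrightarrow> s \<in> ?S" for s t
    using farrows_bipartite[OF adm] farrows_sub[OF adm] by blast
  have l0: "sigma \<Delta> V0 \<noteq> 0" "cos (angle \<Delta>) \<noteq> 0" using sigma_V0_pos[of \<Delta>] cos_angle_pos[OF adm] by auto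
  have dF: "d_F \<Delta> x = ((\<Sum>j\<in>?S. ?k j * real_of_int (x j)) / sigma \<Delta> V0, (\<Sum>j\<in>?T. ?k j * real_of_int (x j)) / sigma \<Delta> V1)"
    unfolding d_F_def sets by (simp add: sum_divide_distrib)
  show "root_point \<Delta> (d_F \<Delta> x) = of_real (weight \<Delta> i * sigma \<Delta> V0)" if V0: "fold_map \<Delta> i = V0"
  proof -
    have iS: "i \<notin> ?T" using V0 fold_map_V0 by blast
    have "(\<Sum>j\<in>?S. ?k j * real_of_int (x j)) = (\<Sum>j\<in>?S. if j = i then ?k i else 0)"
      using x iS by (intro sum.cong refl) auto
    moreover have "(\<Sum>j\<in>?T. ?k j * real_of_int (x j)) = 0"
    proof (rule sum.neutral, rule ballI)
      fix j assume j: "j \<in> ?T"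
      then have "j \<noteq> i" "(j, i) \<notin> ?E" using iS by blast+
      then show "?k j * real_of_int (x j) = 0" using x[of j] TV j by auto
    qed
    ultimately show ?thesis
      using iS i fin l0 V0 by (simp add: dF root_point_polar[OF adm] weight_def)
  qed
  show "root_point \<Delta> (d_F \<Delta> x) = of_real (weight \<Delta> i * sigma \<Delta> V1) * cis (angle \<Delta>)"
    if V1: "fold_map \<Delta> i = V1"
  proof -
    have iT: "i \<in> ?T" using V1 fold_map_V1 by blast
    have "(\<Sum>j\<in>?S. ?k j * real_of_int (x j)) = (\<Sum>j | (j, i) \<in> ?E. ?k j)"
      using x iT fin ES by (intro sum.mono_neutral_cong_right) auto
    then have p: "(\<Sum>j\<in>?S. ?k j * real_of_int (x j)) = ?c * ?k i" using eigen_sink[OF adm iT] by simp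
    have "(\<Sum>j\<in>?T. ?k j * real_of_int (x j)) = (\<Sum>j\<in>?T. if j = i then ?k i else 0)"
    proof (rule sum.cong[OF refl])
      fix j assume j: "j \<in> ?T"
      then have "(j, i) \<notin> ?E" using ES by blast
      then show "?k j * real_of_int (x j) = (if j = i then ?k i else 0)" using x TV j by auto
    qed
    then have q: "(\<Sum>j\<in>?T. ?k j * real_of_int (x j)) = ?k i" using fin iT by simp
    have "root_point \<Delta> (d_F \<Delta> x) = of_real (?c * ?k i) - of_real (?k i) * cis (- angle \<Delta>)"
      using l0 by (simp add: root_point_polar[OF adm] dF p q sigma_V1 right_diff_distrib)
    also have "\<dots> = of_real (?k i) * (of_real ?c - cis (- angle \<Delta>))" by (simp add: algebra_simps)
    also have "\<dots> = of_real (?k i) * cis (angle \<Delta>)" unfolding two_cos_cis by simp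
    finally show ?thesis using l0 V1 by (simp add: weight_def sigma_V1)
  qed
qed

lemma root_point_linear: "root_point \<Delta> (r *\<^sub>R v) = of_real r * root_point \<Delta> v"
  by (simp add: root_point_def Let_def algebra_simps)

lemma root_point_inj:
  assumes adm: "admissible \<Delta>" and eq: "root_point \<Delta> v = root_point \<Delta> w"
  shows "v = w"
proof -
  let ?a = "angle \<Delta>"
  have "of_real (fst v) - of_real (2 * cos ?a * snd v) * cis (- ?a) =
      of_real (fst w) - of_real (2 * cos ?a * snd w) * cis (- ?a)"
    using eq sigma_V0_pos[of \<Delta>] unfolding root_point_polar[OF adm] by simp
  then have re: "fst v - 2 * cos ?a * snd v * cos ?a = fst w - 2 * cos ?a * snd w * cos ?a"
    and im: "2 * cos ?a * snd v * sin ?a = 2 * cos ?a * snd w * sin ?a"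
    by (simp_all add: complex_eq_iff)
  then have "snd v = snd w" using cos_angle_pos[OF adm] sin_angle_pos[OF adm] by simp
  then show ?thesis using re by (simp add: prod_eq_iff)
qed

text \<open>\<open>root_coords\<close> is a definite description, so unique solvability is required:
  the imaginary part determines the long coordinate, and the real part then the short one.\<close>

lemma root_point_coords:
  assumes adm: "admissible \<Delta>" shows "root_point \<Delta> (root_coords \<Delta> z) = z"
proof -
  let ?a = "angle \<Delta>" and ?l = "sigma \<Delta> V0"
  have nz: "?l \<noteq> 0" "cos ?a \<noteq> 0" "sin ?a \<noteq> 0"
    using sigma_V0_pos[of \<Delta>] cos_angle_pos[OF adm] sin_angle_pos[OF adm] by auto
  define y where "y = Im z / (?l * 2 * cos ?a * sin ?a)"
  define x where "x = Re z / ?l + 2 * cos ?a * y * cos ?a"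
  have "root_point \<Delta> (x, y) = z"
    unfolding root_point_polar[OF adm] using nz by (simp add: complex_eq_iff x_def y_def field_simps)
  then have "\<exists>!v. root_point \<Delta> v = z"
    by (intro ex1I[of _ "(x, y)"]) (simp_all add: root_point_inj[OF adm])
  from theI'[OF this] show ?thesis unfolding root_coords_def .
qed

lemma eq_root_coords:
  assumes "admissible \<Delta>" "root_point \<Delta> d = of_real w * z"
  shows "d = w *\<^sub>R root_coords \<Delta> z"
  by (rule root_point_inj[OF assms(1)]) (simp add: assms(2) root_point_linear root_point_coords[OF assms(1)])

section \<open>Path algebras and injective modules\<close>

context bipartite_algebra begin

text \<open>The shape of I(i) as a representation: a line at i, an isomorphism onto it along each
  arrow into i, zero elsewhere. The condition is invariant under isomorphism, so it passes from the
  dual, which lives in a function type, to its copies in \<open>nat => 'k\<close>.\<close>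

definition inj_at where
  "inj_at i X \<longleftrightarrow> (\<exists>w\<in>piece X i. w \<noteq> 0 \<and> (\<forall>v\<in>piece X i. \<exists>c. v = mscl X c w)) \<and>
    (\<forall>j\<in>V. j \<noteq> i \<and> (j, i) \<notin> E \<longrightarrow> piece X j = {0}) \<and>
    (\<forall>j. (j, i) \<in> E \<longrightarrow> (\<forall>v\<in>piece X j. mact X v (b j i) = 0 \<longrightarrow> v = 0) \<and>
      (\<exists>v\<in>piece X j. mact X v (b j i) \<noteq> 0))"

lemma inj_at_generator: "inj_at i X \<Longrightarrow> \<exists>w\<in>piece X i. w \<noteq> 0 \<and> (\<forall>v\<in>piece X i. \<exists>c. v = mscl X c w)"
  and inj_at_zero: "inj_at i X \<Longrightarrow> j \<in> V \<Longrightarrow> j \<noteq> i \<Longrightarrow> (j, i) \<notin> E \<Longrightarrow> piece X j = {0}"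
  and inj_at_mono: "inj_at i X \<Longrightarrow> (j, i) \<in> E \<Longrightarrow> v \<in> piece X j \<Longrightarrow> mact X v (b j i) = 0 \<Longrightarrow> v = 0"
  and inj_at_nonzero: "inj_at i X \<Longrightarrow> (j, i) \<in> E \<Longrightarrow> \<exists>v\<in>piece X j. mact X v (b j i) \<noteq> 0"
  unfolding inj_at_def by simp_all

lemma inj_at_iso:
  assumes X: "is_rmod A X" and Y: "is_rmod A Y" and iso: "iso_mod A X Y" and i: "i \<in> V" and inj: "inj_at i Y"
  shows "inj_at i X"
proof -
  interpret X: bip_module A V E b cf X by (rule rmod_module) fact
  interpret Y: bip_module A V E b cf Y by (rule rmod_module) fact
  obtain g where g: "g \<in> hom_mod A X Y" "bij_betw g (mcar X) (mcar Y)"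
    using iso unfolding iso_mod_def by blast
  have g_inj: "y = y'" if "y \<in> mcar X" "y' \<in> mcar X" "g y = g y'" for y y'
    using that g(2) unfolding bij_betw_def inj_on_def by blast
  have g0: "g 0 = 0" using lin_on_0[OF X.vs Y.vs X.sub hom_lin[OF g(1)]] .
  have zero: "x = 0" if "x \<in> mcar X" "g x = 0" for x
    using g_inj[OF that(1) X.car_zero] that g0 by simp
  have into: "g y \<in> piece Y j" if "y \<in> piece X j" "j \<in> V" for y j
    by (rule hom_piece[OF g(1) that])
  have onto: "\<exists>y\<in>piece X j. g y = z" if z: "z \<in> piece Y j" and j: "j \<in> V" for z j
  proof -
    have "z \<in> g ` mcar X" using z g(2) by (simp add: piece_def bij_betw_def)
    then obtain y where y: "y \<in> mcar X" "g y = z" by auto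
    have "g (mact X y (b j j)) = z"
      using hom_act[OF g(1) y(1) b_in_diag[OF j]] y(2) z by (simp add: piece_def)
    then show ?thesis using X.act_piece[OF y(1) j] by blast
  qed
  have arr: "g (mact X y (b s t)) = mact Y (g y) (b s t)" if "y \<in> piece X j" "(s, t) \<in> E" for y s t j
    using hom_act[OF g(1) X.piece_car[OF that(1)] b_in_arrow[OF that(2)]] .
  show ?thesis
    unfolding inj_at_def
  proof (intro conjI ballI allI impI)
    obtain w where w: "w \<in> piece Y i" "w \<noteq> 0" "\<And>v. v \<in> piece Y i \<Longrightarrow> \<exists>c. v = mscl Y c w"
      using inj_at_generator[OF inj] by blast
    obtain w' where w': "w' \<in> piece X i" "g w' = w" using onto[OF w(1) i] by blast
    have "\<exists>c. v = mscl X c w'" if v: "v \<in> piece X i" for v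
    proof -
      obtain c where "g v = mscl Y c w" using w(3)[OF into[OF v i]] by blast
      then have "g v = g (mscl X c w')" using hom_scl[OF g(1) X.piece_car[OF w'(1)]] w'(2) by simp
      then have "v = mscl X c w'"
        by (rule g_inj[OF X.piece_car[OF v] X.car_scl[OF X.piece_car[OF w'(1)]]])
      then show ?thesis by blast
    qed
    moreover have "w' \<noteq> 0" using w'(2) w(2) g0 by auto
    ultimately show "\<exists>w\<in>piece X i. w \<noteq> 0 \<and> (\<forall>v\<in>piece X i. \<exists>c. v = mscl X c w)"
      by (intro bexI[OF _ w'(1)]) simp
  next
    fix j assume j: "j \<in> V" "j \<noteq> i \<and> (j, i) \<notin> E"
    then have "piece Y j = {0}" by (intro inj_at_zero[OF inj]) auto
    then have "v = 0" if "v \<in> piece X j" for v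
      using into[OF that j(1)] zero[OF X.piece_car[OF that]] by simp
    then show "piece X j = {0}" using X.m.subspace_0[OF X.piece_sub[OF j(1)]] by blast
  next
    fix j v assume ji: "(j, i) \<in> E" and v: "v \<in> piece X j" and 0: "mact X v (b j i) = 0"
    have "mact Y (g v) (b j i) = 0" using arr[OF v ji] 0 g0 by simp
    then have "g v = 0" by (rule inj_at_mono[OF inj ji into[OF v E_V(1)[OF ji]]])
    then show "v = 0" by (rule zero[OF X.piece_car[OF v]])
  next
    fix j assume ji: "(j, i) \<in> E"
    obtain v where v: "v \<in> piece Y j" "mact Y v (b j i) \<noteq> 0"
      using inj_at_nonzero[OF inj ji] by blast
    obtain x where x: "x \<in> piece X j" "g x = v" using onto[OF v(1) E_V(1)[OF ji]] by blast
    then have "mact X x (b j i) \<noteq> 0" using arr[OF x(1) ji] v(2) g0 by auto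
    then show "\<exists>v\<in>piece X j. mact X v (b j i) \<noteq> 0" using x(1) by blast
  qed
qed

lemma inj_at_injective:
  assumes i: "i \<in> V" shows "inj_at i (dual_mod (principal_mod (op_alg A) (b i i)))"
proof -
  let ?L = "principal_mod (op_alg A) (b i i)" and ?e = "b i i"
  let ?D = "dual_mod ?L"
  have ei: "?e \<in> acar A" by (rule b_in_diag[OF i])
  have L: "mcar ?L = {amul A a ?e | a. a \<in> acar A}" "mscl ?L = ascl A" "mact ?L = (\<lambda>x a. amul A a x)"
    by (simp_all add: principal_mod_def reg_mod_def op_alg_def)
  have Lc: "x \<in> mcar ?L \<longleftrightarrow> x \<in> acar A \<and> amul A x ?e = x" for x
  proof
    assume "x \<in> mcar ?L"
    then obtain a where a: "a \<in> acar A" "x = amul A a ?e" unfolding L by blast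
    then show "x \<in> acar A \<and> amul A x ?e = x"
      using mul_assoc[OF a(1) ei ei] mul_diag_diag[OF i i] ei by (simp add: mul_in)
  next
    assume "x \<in> acar A \<and> amul A x ?e = x"
    then show "x \<in> mcar ?L" unfolding L by (intro CollectI exI[of _ x]) simp
  qed
  have bL: "b j i \<in> mcar ?L" if "(j, i) \<in> R" for j
    using that b_in[OF that] i by (auto simp: Lc mul_diag_diag mul_arrow_diag)
  have mL: "amul A a x \<in> mcar ?L" if "a \<in> acar A" "x \<in> mcar ?L" for a x
    using that mul_assoc[of a x ?e] ei by (simp add: Lc mul_in)
  have D: "\<phi> \<in> mcar ?D \<longleftrightarrow> (\<forall>x. x \<notin> mcar ?L \<longrightarrow> \<phi> x = 0) \<and> lin_on (ascl A) (*) (mcar ?L) \<phi>" for \<phi>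
    by (auto simp: dual_mod_def lin_on_def L(2))
  have Dact: "mact ?D \<phi> a x = (if x \<in> mcar ?L then \<phi> (amul A a x) else 0)" for \<phi> a x
    by (simp add: dual_mod_def L(3))
  have Dscl: "mscl ?D c \<phi> x = c * \<phi> x" for c \<phi> x by (simp add: dual_mod_def)
  \<comment> \<open>A e_i has at most one basis element in each row j, namely
    \<open>b j i\<close>.\<close>
  have left: "amul A (b j j) x = (if (j, i) \<in> R then ascl A (cf x j i) (b j i) else 0)"
    if x: "x \<in> mcar ?L" and j: "j \<in> V" for x j
  proof (rule cf_ext)
    have xA: "x \<in> acar A" and xe: "amul A x ?e = x" using x Lc by auto
    show "amul A (b j j) x \<in> acar A" by (rule mul_in[OF b_in_diag[OF j] xA])
    show "(if (j, i) \<in> R then ascl A (cf x j i) (b j i) else 0) \<in> acar A"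
      using A_scl[OF b_in] A_zero by simp
    fix k l assume "(k, l) \<in> R"
    have "cf x k l = (if l = i then cf x k l else 0)"
      using cf_mul_right_diag[OF xA i, of k l] xe by simp
    then have "cf (amul A (b j j) x) k l = (if k = j \<and> l = i then cf x j i else 0)"
      using cf_mul_left_diag[OF xA j, of k l] by auto
    moreover have "cf x j i = 0" if "(j, i) \<notin> R" using cf_off[OF xA that] .
    ultimately show "cf (amul A (b j j) x) k l = cf (if (j, i) \<in> R then ascl A (cf x j i) (b j i) else 0) k l"
      using cf_scl[OF b_in] cf_b by (cases "(j, i) \<in> R") auto
  qed
  have val: "\<phi> x = (if (j, i) \<in> R then cf x j i * \<phi> (b j i) else 0)"
    if \<phi>: "\<phi> \<in> piece ?D j" and x: "x \<in> mcar ?L" and j: "j \<in> V" for \<phi> x j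
  proof -
    have lin: "lin_on (ascl A) (*) (mcar ?L) \<phi>" and act: "mact ?D \<phi> (b j j) = \<phi>"
      using \<phi> D by (auto simp: piece_def)
    have "\<phi> x = \<phi> (amul A (b j j) x)" using fun_cong[OF act, of x] x by (simp add: Dact)
    moreover have "\<phi> (0 :: 'a) = 0"
    proof -
      have "\<phi> (ascl A 0 ?e) = 0" using lin_on_scl[OF lin, of ?e 0] bL[of i] i by auto
      moreover interpret va: vector_space "ascl A" by (rule vs_A)
      have "ascl A 0 ?e = 0" by simp
      ultimately show ?thesis by simp
    qed
    ultimately show ?thesis
      using left[OF x j] lin_on_scl[OF lin bL] by (cases "(j, i) \<in> R") auto
  qed
  \<comment> \<open>The coordinate functional dual to \<open>b j i\<close>; it generates the
    component of the dual at j whenever that component is nonzero.\<close>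
  define \<delta> where "\<delta> j = (\<lambda>x. if x \<in> mcar ?L then cf x j i else 0)" for j
  have \<delta>: "\<delta> j \<in> piece ?D j" if j: "j \<in> V" for j
  proof -
    have Ladd: "x + y \<in> mcar ?L" if "x \<in> mcar ?L" "y \<in> mcar ?L" for x y
      using that ei by (simp add: Lc A_add mul_add_left)
    have Lscl: "ascl A c x \<in> mcar ?L" if "x \<in> mcar ?L" for c x
      using that ei by (simp add: Lc A_scl mul_scl_left)
    have "\<delta> j \<in> mcar ?D"
      unfolding D using Ladd Lscl by (auto simp: \<delta>_def lin_on_def Lc cf_add cf_scl)
    moreover have "mact ?D (\<delta> j) (b j j) = \<delta> j"
      using mL[OF b_in_diag[OF j]] by (auto simp: Dact \<delta>_def fun_eq_iff cf_mul_left_diag[OF _ j] Lc)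
    ultimately show ?thesis by (simp add: piece_def)
  qed
  have zD: "0 \<in> piece ?D j" for j
    by (auto simp: piece_def D lin_on_def Dact fun_eq_iff)
  have ii: "(i, i) \<in> R" using Id_onI[OF i] by blast
  have eL: "?e \<in> mcar ?L" by (rule bL[OF ii])
  show ?thesis
    unfolding inj_at_def
  proof (intro conjI ballI allI impI)
    have "v = mscl ?D (v ?e) (\<delta> i)" if v: "v \<in> piece ?D i" for v
    proof
      fix x show "v x = mscl ?D (v ?e) (\<delta> i) x"
      proof (cases "x \<in> mcar ?L")
        case True
        then show ?thesis using val[OF v True i] ii by (simp add: Dscl \<delta>_def)
      next
        case False
        then show ?thesis using v by (simp add: piece_def D Dscl \<delta>_def)
      qed
    qed
    moreover have "\<delta> i ?e = 1" using eL i by (simp add: \<delta>_def cf_b_diag)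
    then have "\<delta> i \<noteq> 0" by (auto simp: fun_eq_iff intro!: exI[of _ ?e])
    ultimately show "\<exists>w\<in>piece ?D i. w \<noteq> 0 \<and> (\<forall>v\<in>piece ?D i. \<exists>c. v = mscl ?D c w)"
      using \<delta>[OF i] by blast
  next
    fix j assume j: "j \<in> V" "j \<noteq> i \<and> (j, i) \<notin> E"
    have "\<phi> = 0" if \<phi>: "\<phi> \<in> piece ?D j" for \<phi>
    proof
      fix x show "\<phi> x = 0 x"
        using val[OF \<phi> _ j(1), of x] j(2) \<phi> by (cases "x \<in> mcar ?L") (auto simp: piece_def D)
    qed
    then show "piece ?D j = {0}" using zD by blast
  next
    fix j \<phi> assume ji: "(j, i) \<in> E" and \<phi>: "\<phi> \<in> piece ?D j" and 0: "mact ?D \<phi> (b j i) = 0"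
    have "\<phi> (b j i) = 0"
      using fun_cong[OF 0, of ?e] eL mul_arrow_diag[OF i ji] by (simp add: Dact)
    then have "\<phi> x = 0" for x
      using val[OF \<phi> _ E_V(1)[OF ji], of x] \<phi> by (cases "x \<in> mcar ?L") (auto simp: piece_def D)
    then show "\<phi> = 0" by (simp add: fun_eq_iff)
  next
    fix j assume ji: "(j, i) \<in> E"
    have "mact ?D (\<delta> j) (b j i) ?e = 1"
      using eL mul_arrow_diag[OF i ji] bL[of j] ji by (simp add: Dact \<delta>_def cf_b_arrow)
    then have "mact ?D (\<delta> j) (b j i) \<noteq> 0" by auto
    then show "\<exists>v\<in>piece ?D j. mact ?D v (b j i) \<noteq> 0" using \<delta>[OF E_V(1)[OF ji]] by blast
  qed
qed

lemma inj_at_span: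
  assumes X: "is_rmod A X" and inj: "inj_at i X" and i: "i \<in> V"
    and v: "v \<in> piece X i" "v \<noteq> 0" and w: "w \<in> piece X i"
  shows "\<exists>c. w = mscl X c v"
proof -
  interpret X: bip_module A V E b cf X by (rule rmod_module) fact
  obtain u where u: "\<And>v. v \<in> piece X i \<Longrightarrow> \<exists>c. v = mscl X c u"
    using inj_at_generator[OF inj] by blast
  obtain c d where c: "v = mscl X c u" and d: "w = mscl X d u" using u[OF v(1)] u[OF w] by blast
  have "c \<noteq> 0" using c v(2) by auto
  then have "w = mscl X (d / c) v" unfolding c d by simp
  then show ?thesis by blast
qed

lemma inj_at_pdim:
  assumes X: "is_rmod A X" and inj: "inj_at i X" and i: "i \<in> V" and j: "j \<in> V"
  shows "pdim X j = (if j = i \<or> (j, i) \<in> E then 1 else 0)"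
proof -
  interpret X: bip_module A V E b cf X by (rule rmod_module) fact
  consider "j = i" | "(j, i) \<in> E" | "j \<noteq> i" "(j, i) \<notin> E" by blast
  then show ?thesis
  proof cases
    case 1
    obtain w where "w \<in> piece X i" "w \<noteq> 0" "\<And>v. v \<in> piece X i \<Longrightarrow> \<exists>c. v = mscl X c w"
      using inj_at_generator[OF inj] by blast
    then show ?thesis using dim_one[OF X.vs, of w "piece X i"] 1 by (simp add: pdim_def)
  next
    case 2
    obtain v where v: "v \<in> piece X j" "mact X v (b j i) \<noteq> 0"
      using inj_at_nonzero[OF inj 2] by blast
    have inj0: "x = 0" if "x \<in> piece X j" "mact X x (b j i) = 0" for x
      by (rule inj_at_mono[OF inj 2 that])
    have bA: "b j i \<in> acar A" by (rule b_in_arrow[OF 2])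
    have "\<exists>c. w = mscl X c v" if w: "w \<in> piece X j" for w
    proof -
      obtain c where c: "mact X w (b j i) = mscl X c (mact X v (b j i))"
        using inj_at_span[OF X inj i X.act_arrow[OF X.piece_car[OF v(1)] 2] v(2)
            X.act_arrow[OF X.piece_car[OF w] 2]] by blast
      have d: "w - mscl X c v \<in> piece X j"
        using X.m.subspace_diff[OF X.piece_sub[OF j] w] X.m.subspace_scale[OF X.piece_sub[OF j] v(1)] by blast
      have "mact X ((w - mscl X c v) + mscl X c v) (b j i) =
          mact X (w - mscl X c v) (b j i) + mact X (mscl X c v) (b j i)"
        by (rule X.act_add[OF X.piece_car[OF d] X.car_scl[OF X.piece_car[OF v(1)]] bA])
      then have "mact X (w - mscl X c v) (b j i) = 0"
        using c X.act_scl[OF X.piece_car[OF v(1)] bA] by simp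
      then have "w - mscl X c v = 0" by (rule inj0[OF d])
      then show ?thesis by auto
    qed
    moreover have "v \<noteq> 0" using v(2) X.act_zero[OF bA] by auto
    ultimately show ?thesis using dim_one[OF X.vs _ v(1)] 2 by (simp add: pdim_def)
  next
    case 3
    then have "piece X j = {0}" by (intro inj_at_zero[OF inj j])
    then show ?thesis using 3 dim_zero_space[OF X.vs] by (simp add: pdim_def)
  qed
qed

text \<open>The socle is the line at i, and every nonzero submodule contains it. Of two
  complementary submodules one misses this line, and that one is zero.\<close>

lemma inj_at_indec:
  assumes X: "is_rmod A X" and inj: "inj_at i X" and i: "i \<in> V"
  shows "indec X"
  unfolding indec_def
proof (intro allI impI)
  interpret X: bip_module A V E b cf X by (rule rmod_module) fact
  fix Y Z
  assume *: "(\<forall>j\<in>V. decomposes X (piece X j) (Y j) (Z j)) \<and>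
    (\<forall>s t. (s, t) \<in> E \<longrightarrow> (\<forall>v\<in>Y s. mact X v (b s t) \<in> Y t) \<and> (\<forall>v\<in>Z s. mact X v (b s t) \<in> Z t))"
  have Y: "X.m.subspace (Y j)" "Y j \<subseteq> piece X j" and Z: "X.m.subspace (Z j)" "Z j \<subseteq> piece X j"
    and YZ: "Y j \<inter> Z j \<subseteq> {0}" and split: "\<And>v. v \<in> piece X j \<Longrightarrow> \<exists>x\<in>Y j. \<exists>y\<in>Z j. v = x + y"
    if "j \<in> V" for j
    using * that unfolding decomposes_def by blast+
  have all: "\<forall>j\<in>V. W j = {0}"
    if W: "\<And>j. j \<in> V \<Longrightarrow> X.m.subspace (W j)" "\<And>j. j \<in> V \<Longrightarrow> W j \<subseteq> piece X j"
      and aW: "\<And>s t v. (s, t) \<in> E \<Longrightarrow> v \<in> W s \<Longrightarrow> mact X v (b s t) \<in> W t" and W0: "W i = {0}" for W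
  proof
    fix j assume j: "j \<in> V"
    have "v = 0" if v: "v \<in> W j" for v
    proof -
      consider "j = i" | "(j, i) \<in> E" | "j \<noteq> i" "(j, i) \<notin> E" by blast
      then show ?thesis
      proof cases
        case 1 then show ?thesis using W0 v by simp
      next
        case 2
        then have "mact X v (b j i) = 0" using aW[OF 2 v] W0 by simp
        moreover have "v \<in> piece X j" using v W(2)[OF j] by blast
        ultimately show ?thesis using inj_at_mono[OF inj 2] by blast
      next
        case 3
        then show ?thesis using inj_at_zero[OF inj j] v W(2)[OF j] by blast
      qed
    qed
    then show "W j = {0}" using X.m.subspace_0[OF W(1)[OF j]] by blast
  qed
  obtain w where w: "w \<in> piece X i" "w \<noteq> 0" using inj_at_generator[OF inj] by blast
  obtain y z where yz: "y \<in> Y i" "z \<in> Z i" "w = y + z" using split[OF i w(1)] by blast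
  have line: "x \<in> U" if "X.m.subspace U" "u \<in> U" "u \<noteq> 0" "u \<in> piece X i" "x \<in> piece X i" for U u x
    using inj_at_span[OF X inj i that(4,3,5)] X.m.subspace_scale[OF that(1,2)] by blast
  show "(\<forall>j\<in>V. Y j = {0}) \<or> (\<forall>j\<in>V. Z j = {0})"
  proof (cases "y = 0")
    case True
    then have "z \<noteq> 0" "z \<in> piece X i" using w(2) yz Z(2)[OF i] by auto
    then have "x = 0" if "x \<in> Y i" for x
      using line[OF Z(1)[OF i] yz(2)] that Y(2)[OF i] YZ[OF i] by blast
    then have "Y i = {0}" using X.m.subspace_0[OF Y(1)[OF i]] by blast
    then show ?thesis using all[of Y, OF Y(1) Y(2)] * by blast
  next
    case False
    then have "x = 0" if "x \<in> Z i" for x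
      using line[OF Y(1)[OF i] yz(1)] that yz(1) Y(2)[OF i] Z(2)[OF i] YZ[OF i] by blast
    then have "Z i = {0}" using X.m.subspace_0[OF Z(1)[OF i]] by blast
    then show ?thesis using all[of Z, OF Z(1) Z(2)] * by blast
  qed
qed

section \<open>Vanishing of the negative \<tau>-powers of an injective module\<close>

lemma dual_piece_apply:
  assumes X: "is_rmod A X" and \<phi>: "\<phi> \<in> piece (dual_mod X) s"
    and 0: "\<And>v. v \<in> piece X s \<Longrightarrow> \<phi> v = 0" and s: "s \<in> V"
  shows "\<phi> = 0"
proof
  interpret X: bip_module A V E b cf X by (rule rmod_module) fact
  fix v
  have act: "mact (dual_mod X) \<phi> (b s s) = \<phi>" and car: "\<phi> \<in> mcar (dual_mod X)"
    using \<phi> by (auto simp: piece_def)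
  show "\<phi> v = 0 v"
  proof (cases "v \<in> mcar X")
    case True
    then have "\<phi> v = \<phi> (mact X v (b s s))" using fun_cong[OF act, of v] by (simp add: dual_mod_def)
    then show ?thesis using 0[OF X.act_piece[OF True s]] by simp
  qed (use car in \<open>simp add: dual_mod_def\<close>)
qed

text \<open>\<open>D I(i)\<close> is a projective left module, so \<open>\<tau>\<^sup>- I(i) = 0\<close>.\<close>

lemma tau_inv_injective:
  assumes X: "is_rmod A X" and inj: "inj_at i X" and i: "i \<in> V"
    and tau: "tau_mod (op_alg A) (dual_mod X) N"
  shows "mcar N = {0}"
proof -
  interpret X: bip_module A V E b cf X by (rule rmod_module) fact
  interpret op: bipartite_algebra "op_alg A" V "E\<inverse>" "\<lambda>i j. b j i" "\<lambda>x i j. cf x j i" by (rule op_bipartite)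
  have N: "is_rmod (op_alg A) N" and D: "is_rmod (op_alg A) (dual_mod X)"
    using tau by (auto simp: tau_mod_def fg_mod_def)
  interpret D: bip_module "op_alg A" V "E\<inverse>" "\<lambda>i j. b j i" "\<lambda>x i j. cf x j i" "dual_mod X"
    by (rule op.rmod_module[OF D])
  obtain u where u: "op.ar_seq (dual_mod X) N u" using op.tau_ar_seq[OF tau] by blast
  show ?thesis
  proof (rule op.ar_zero[OF N u])
    fix s t y assume st: "(s, t) \<in> E\<inverse>" and y: "y \<in> op.piece N t"
    have ts: "(t, s) \<in> E" using st by simp
    have uD: "u s' t y \<in> piece (dual_mod X) s'" if "(t, s') \<in> E" for s'
      using op.ar_in[OF u _ y, of s'] that by (simp add: op.piece_def piece_def)
    \<comment> \<open>X has no component at s': that vertex is a sink different from i, so it has no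
      arrow to i.\<close>
    have other: "u s' t y = 0" if s': "(t, s') \<in> E" "s' \<noteq> i" for s'
    proof (rule dual_piece_apply[OF X uD[OF s'(1)] _ E_V(2)[OF s'(1)]])
      have "(s', i) \<notin> E" using bipartite[OF s'(1)] .
      then have "piece X s' = {0}" by (rule inj_at_zero[OF inj E_V(2)[OF s'(1)] s'(2)])
      then have z: "v = 0" if "v \<in> piece X s'" for v using that by blast
      show "u s' t y v = 0" if "v \<in> piece X s'" for v
      proof -
        have "lin_on (mscl X) (*) (mcar X) (u s' t y)"
          using uD[OF s'(1)] by (simp add: piece_def dual_mod_def lin_on_def)
        then show ?thesis using lin_on_0[OF X.vs vector_space_mult X.sub] z[OF that] by simp
      qed
    qed
    show "u s t y = 0"
    proof (cases "s = i")
      case False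
      then show ?thesis using other ts by blast
    next
      case True
      have ti: "(t, i) \<in> E" using ts True by simp
      let ?\<phi> = "u i t y"
      have sums: "(\<Sum>s'\<in>{s'. (s', t) \<in> E\<inverse>}. mact (dual_mod X) (u s' t y) (b t s')) = 0"
        by (rule op.ar_sink_sum[OF u _ y]) (use st in blast)
      have "(\<Sum>s'\<in>{s'. (s', t) \<in> E\<inverse>}. mact (dual_mod X) (u s' t y) (b t s')) =
          (\<Sum>s'\<in>{s'. (s', t) \<in> E\<inverse>}. if s' = i then mact (dual_mod X) ?\<phi> (b t i) else 0)"
      proof (rule sum.cong[OF refl])
        fix s' assume "s' \<in> {s'. (s', t) \<in> E\<inverse>}"
        then show "mact (dual_mod X) (u s' t y) (b t s') = (if s' = i then mact (dual_mod X) ?\<phi> (b t i) else 0)"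
          using other[of s'] D.act_zero[OF op.b_in_arrow[of s' t]] by auto
      qed
      also have "\<dots> = mact (dual_mod X) ?\<phi> (b t i)"
      proof -
        have "finite {s'. (s', t) \<in> E\<inverse>}" by (rule op.finite_inn)
        then show ?thesis using ti by simp
      qed
      finally have z: "mact (dual_mod X) ?\<phi> (b t i) = 0" using sums by simp
      \<comment> \<open>Only the term at i survives in the relation at t, so the functional vanishes
        on the image of the arrow from t to i. That image is the whole line at i.\<close>
      obtain v where v: "v \<in> piece X t" "mact X v (b t i) \<noteq> 0"
        using inj_at_nonzero[OF inj ti] by blast
      have "?\<phi> (mact X v (b t i)) = 0"
        using fun_cong[OF z, of v] X.piece_car[OF v(1)] by (simp add: dual_mod_def)
      moreover have "\<exists>c. x = mscl X c (mact X v (b t i))" if "x \<in> piece X i" for x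
        by (rule inj_at_span[OF X inj i X.act_arrow[OF X.piece_car[OF v(1)] ti] v(2) that])
      moreover have "?\<phi> (mscl X c x) = c * ?\<phi> x" if "x \<in> mcar X" for c x
        using uD[OF ti] that by (simp add: piece_def dual_mod_def)
      ultimately have "?\<phi> x = 0" if "x \<in> piece X i" for x
        using that X.act_in[OF X.piece_car[OF v(1)] b_in_arrow[OF ti]] by fastforce
      then have "?\<phi> = 0" by (rule dual_piece_apply[OF X uD[OF ti] _ i])
      then show ?thesis using True by simp
    qed
  qed
qed

lemma dual_zero_iff:
  assumes N: "is_rmod A N" shows "mcar (dual_mod N) = {0} \<longleftrightarrow> mcar N = {0}"
proof -
  interpret N: bip_module A V E b cf N by (rule rmod_module) fact
  have D: "\<phi> \<in> mcar (dual_mod N) \<longleftrightarrow> (\<forall>v. v \<notin> mcar N \<longrightarrow> \<phi> v = 0) \<and> lin_on (mscl N) (*) (mcar N) \<phi>" for \<phi>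
    by (auto simp: dual_mod_def lin_on_def)
  show ?thesis
  proof
    assume 0: "mcar (dual_mod N) = {0}"
    have "v = 0" if v: "v \<in> mcar N" for v
    proof (rule ccontr)
      assume "v \<noteq> 0"
      then obtain l where l: "Vector_Spaces.linear (mscl N) (*) l" "l v = (1::'k)"
        using functional_nonzero[OF N.vs] by blast
      have ll: "lin_on (mscl N) (*) (mcar N) l" by (rule lin_on_linear[OF l(1)])
      have "(\<lambda>x. if x \<in> mcar N then l x else 0) \<in> mcar (dual_mod N)"
        unfolding D using lin_on_add[OF ll] lin_on_scl[OF ll] by (auto simp: lin_on_def N.car_add N.car_scl)
      then have "(\<lambda>x. if x \<in> mcar N then l x else 0) = 0" using 0 by blast
      then show False using fun_cong[of "\<lambda>x. if x \<in> mcar N then l x else 0" 0 v] v l(2) by simp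
    qed
    then show "mcar N = {0}" using N.car_zero by blast
  next
    assume 0: "mcar N = {0}"
    have "\<phi> = 0" if \<phi>: "\<phi> \<in> mcar (dual_mod N)" for \<phi>
    proof
      fix v show "\<phi> v = 0 v"
        using \<phi> 0 lin_on_0[OF N.vs vector_space_mult N.sub, of \<phi>] unfolding D by (cases "v = 0") auto
    qed
    moreover have "0 \<in> mcar (dual_mod N)" unfolding D by (simp add: lin_on_def)
    ultimately show "mcar (dual_mod N) = {0}" by blast
  qed
qed

lemma tau_inv_zero:
  assumes "tau_inv_mod A M N" "mcar M = {0}" shows "mcar N = {0}"
proof -
  interpret op: bipartite_algebra "op_alg A" V "E\<inverse>" "\<lambda>i j. b j i" "\<lambda>x i j. cf x j i" by (rule op_bipartite)
  have M: "is_rmod A M" and N: "is_rmod A N" and t: "tau_mod (op_alg A) (dual_mod M) (dual_mod N)"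
    using assms(1) by (auto simp: tau_inv_mod_def fg_mod_def)
  have "mcar (dual_mod M) = {0}" by (rule dual_zero_iff[OF M, THEN iffD2, OF assms(2)])
  then have "mcar (dual_mod N) = {0}" by (rule op.tau_mod_zero[OF t])
  then show ?thesis by (rule dual_zero_iff[OF N, THEN iffD1])
qed

text \<open>The first step already gives zero, and zero persists; hence a nonzero
  \<open>\<tau>\<close>-power of I(i) on modules has nonnegative exponent.\<close>

lemma tau_inv_pow_injective:
  fixes X N :: "('k, 'a) umod"
  assumes X: "is_rmod A X" "inj_at i X" "i \<in> V" and pow: "(tau_inv_mod A ^^ Suc n) X N"
  shows "mcar N = {0}"
  using pow
proof (induction n arbitrary: N)
  case 0
  then have t: "tau_inv_mod A X N" by auto
  then have N: "is_rmod A N" "tau_mod (op_alg A) (dual_mod X) (dual_mod N)"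
    by (auto simp: tau_inv_mod_def fg_mod_def)
  show ?case by (rule dual_zero_iff[OF N(1), THEN iffD1, OF tau_inv_injective[OF X N(2)]])
next
  case (Suc n)
  obtain Y :: "('k, 'a) umod" where Y: "(tau_inv_mod A ^^ Suc n) X Y" "tau_inv_mod A Y N"
    by (rule relpowp_Suc_E[OF Suc.prems]) (rule that)
  show ?case by (rule tau_inv_zero[OF Y(2) Suc.IH[OF Y(1)]])
qed

text \<open>F stands for any function on dimension vectors that the Coxeter transformation
  multiplies by z. Indecomposability is carried through the induction because the next step needs
  it, and zero is absorbing.\<close>

lemma tau_pow_mod_invariant:
  fixes F :: "('q \<Rightarrow> int) \<Rightarrow> complex" and X N :: "('k, 'a) umod"
  assumes F: "\<And>x y. cox x y \<Longrightarrow> F y = z * F x"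
    and X: "indec X" and pow: "(tau_mod A ^^ n) X N"
  shows "mcar N = {0} \<or> (indec N \<and> F (pdim N) = z ^ n * F (pdim X))"
  using pow
proof (induction n arbitrary: N)
  case (Suc n)
  obtain Y :: "('k, 'a) umod" where Y: "(tau_mod A ^^ n) X Y" "tau_mod A Y N"
    by (rule relpowp_Suc_E[OF Suc.prems]) (rule that)
  show ?case
  proof (cases "mcar Y = {0}")
    case True
    then show ?thesis using tau_mod_zero[OF Y(2)] by blast
  next
    case False
    then have IH: "indec Y" "F (pdim Y) = z ^ n * F (pdim X)" using Suc.IH[OF Y(1)] by blast+
    have "indec N \<and> F (pdim N) = z ^ Suc n * F (pdim X)" if "mcar N \<noteq> {0}"
      using tau_mod_cox[OF Y(2) IH(1)] that F[of "pdim Y" "pdim N"] IH(2) by simp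
    then show ?thesis by blast
  qed
qed (use X in auto)

lemma tau_pow_Db_invariant:
  fixes F :: "('q \<Rightarrow> int) \<Rightarrow> complex" and X Y :: "('k, 'a) ucpx"
  assumes F: "\<And>x y. cox x y \<Longrightarrow> F y = z * F x" and pow: "(tau_Db A ^^ n) X Y"
  shows "F (euler Y) = z ^ n * F (euler X)"
  using pow
proof (induction n arbitrary: Y)
  case (Suc n)
  obtain W :: "('k, 'a) ucpx" where W: "(tau_Db A ^^ n) X W" "tau_Db A W Y"
    by (rule relpowp_Suc_E[OF Suc.prems]) (rule that)
  then show ?case using Suc.IH[OF W(1)] F[OF euler_tau_Db[OF W(2)]] by simp
qed auto

end

section \<open>Path algebras of bipartite quivers\<close>

definition path_basis :: "'q \<Rightarrow> 'q \<Rightarrow> 'q list \<Rightarrow> 'k::field" where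
  "path_basis i j = (\<lambda>p. if p = (if i = j then [i] else [i, j]) then 1 else 0)"

definition path_coeff :: "('q list \<Rightarrow> 'k) \<Rightarrow> 'q \<Rightarrow> 'q \<Rightarrow> 'k" where
  "path_coeff f i j = (if i = j then f [i] else f [i, j])"

lemma path_basis_diag: "path_basis i i = idem i"
  by (simp add: path_basis_def idem_def)

lemma path_alg_bipartite:
  assumes fin: "finite (qverts Q)" and sub: "qarrows Q \<subseteq> qverts Q \<times> qverts Q"
    and bip: "\<And>i j l. (i, j) \<in> qarrows Q \<Longrightarrow> (j, l) \<notin> qarrows Q"
  shows "bipartite_algebra (path_alg Q :: ('k::field, 'q list \<Rightarrow> 'k) alg) (qverts Q) (qarrows Q) path_basis path_coeff"
proof -
  let ?A = "path_alg Q :: ('k, 'q list \<Rightarrow> 'k) alg"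
  let ?R = "Id_on (qverts Q) \<union> qarrows Q"
  have p1: "is_path Q [i] \<longleftrightarrow> i \<in> qverts Q" for i by (simp add: is_path_def)
  have p2: "is_path Q [i, j] \<longleftrightarrow> (i, j) \<in> qarrows Q" for i j using sub by (auto simp: is_path_def)
  have ne: "i \<noteq> j" if "(i, j) \<in> qarrows Q" for i j using bip that by blast
  \<comment> \<open>The head of an arrow is never the tail of another, so a path has at most two
    vertices.\<close>
  have long: "\<not> is_path Q (i # j # l # p)" for i j l p using bip by (auto simp: is_path_def)
  have cases: "(\<exists>i\<in>qverts Q. p = [i]) \<or> (\<exists>i j. (i, j) \<in> qarrows Q \<and> p = [i, j])" if "is_path Q p" for p
  proof -
    have "p \<noteq> []" using that by (simp add: is_path_def)
    then obtain i r where r: "p = i # r" by (cases p) auto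
    show ?thesis
    proof (cases r)
      case Nil then show ?thesis using r that p1 by blast
    next
      case (Cons j r')
      then show ?thesis using r that p2 long by (cases r') auto
    qed
  qed
  have fp: "finite {p. is_path Q p}"
  proof (rule finite_subset)
    show "{p. is_path Q p} \<subseteq> (\<lambda>i. [i]) ` qverts Q \<union> (\<lambda>(i, j). [i, j]) ` qarrows Q"
    proof
      fix p assume "p \<in> {p. is_path Q p}"
      then consider i where "i \<in> qverts Q" "p = [i]" | i j where "(i, j) \<in> qarrows Q" "p = [i, j]"
        using cases by blast
      then show "p \<in> (\<lambda>i. [i]) ` qverts Q \<union> (\<lambda>(i, j). [i, j]) ` qarrows Q" by cases force+
    qed
    show "finite ((\<lambda>i. [i]) ` qverts Q \<union> (\<lambda>(i, j). [i, j]) ` qarrows Q)"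
      using fin finite_subset[OF sub] by auto
  qed
  have acar: "f \<in> acar ?A \<longleftrightarrow> (\<forall>p. f p \<noteq> 0 \<longrightarrow> is_path Q p)" for f
  proof -
    have "finite {p. f p \<noteq> 0}" if "\<forall>p. f p \<noteq> 0 \<longrightarrow> is_path Q p"
      by (rule finite_subset[OF _ fp]) (use that in blast)
    then show ?thesis by (auto simp: path_alg_def)
  qed
  have scl: "ascl ?A = fun_scl (*)" by (simp add: path_alg_def fun_scl_def fun_eq_iff)
  have mul: "amul ?A f g p = (\<Sum>k<length p. f (take (Suc k) p) * g (drop k p))" for f g p
    by (simp add: path_alg_def)
  have one: "aone ?A = (\<lambda>p. if \<exists>i\<in>qverts Q. p = [i] then 1 else 0)" by (simp add: path_alg_def)
  \<comment> \<open>Closure under multiplication: a list that is cut at a vertex into two paths is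
    again a path. A cut beyond the second vertex is impossible, as the initial piece would be too
    long.\<close>
  have glue: "is_path Q p" if g: "is_path Q (take (Suc k) p)" "is_path Q (drop k p)" "k < length p" for k p
  proof (cases k)
    case 0 then show ?thesis using g by simp
  next
    case (Suc m)
    then obtain i j r where p: "p = i # j # r" using g(3) by (cases p; cases "tl p") auto
    show ?thesis
    proof (cases "m = 0")
      case True
      then have "(i, j) \<in> qarrows Q" "is_path Q (j # r)" using g Suc p p2 by auto
      then show ?thesis using cases[of "j # r"] bip[of i j] p p2 by auto
    next
      case False
      then have "Suc k \<ge> 3" using Suc by simp
      moreover have "length (take (Suc k) p) \<le> 2" using cases[OF g(1)] by (auto simp del: length_take)
      ultimately show ?thesis using g(3) by simp
    qed
  qed
  interpret f: vector_space "fun_scl (*) :: 'k \<Rightarrow> ('q list \<Rightarrow> 'k) \<Rightarrow> _"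
    by (rule vector_space_fun_scl[OF vector_space_mult])
  show ?thesis
  proof (intro bipartite_algebra.intro)
    show "vector_space (ascl ?A)" unfolding scl by (rule f.vector_space_axioms)
    show "module.subspace (ascl ?A) (acar ?A)"
      unfolding scl
    proof (rule f.subspaceI)
      fix x y :: "'q list \<Rightarrow> 'k" assume xy: "x \<in> acar ?A" "y \<in> acar ?A"
      have "x p = 0 \<and> y p = 0" if "\<not> is_path Q p" for p using xy that unfolding acar by blast
      then show "x + y \<in> acar ?A" unfolding acar by force
    qed (auto simp: acar fun_scl_def)
    show "path_basis i j \<in> acar ?A" if "(i, j) \<in> ?R" for i j
      using that p1 p2 ne[of i j] by (auto simp: acar path_basis_def)
    show "path_coeff (x + y) i j = path_coeff x i j + path_coeff y i j" for x y :: "'q list \<Rightarrow> 'k" and i j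
      by (simp add: path_coeff_def)
    show "path_coeff (ascl ?A c x) i j = c * path_coeff x i j" for c x i j
      by (simp add: path_coeff_def scl fun_scl_def)
    show "path_coeff (path_basis i j) k l = (if k = i \<and> l = j then (1::'k) else 0)" for i j k l
      by (auto simp: path_coeff_def path_basis_def)
    show "x = y" if xy: "x \<in> acar ?A" "y \<in> acar ?A" "\<And>i j. (i, j) \<in> ?R \<Longrightarrow> path_coeff x i j = path_coeff y i j" for x y
    proof
      fix p
      show "x p = y p"
      proof (cases "is_path Q p")
        case True
        then consider i where "i \<in> qverts Q" "p = [i]" | i j where "(i, j) \<in> qarrows Q" "p = [i, j]"
          using cases by blast
        then show ?thesis
        proof cases
          case 1 then show ?thesis using xy(3)[of i i] by (auto simp: path_coeff_def)
        next
          case 2 then show ?thesis using xy(3)[of i j] ne[OF 2(1)] by (auto simp: path_coeff_def)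
        qed
      next
        case False
        then have "x p = 0" "y p = 0" using xy(1,2) unfolding acar by blast+
        then show ?thesis by simp
      qed
    qed
    show "path_coeff x i j = 0" if "x \<in> acar ?A" "(i, j) \<notin> ?R" for x i j
    proof (cases "i = j")
      case True
      then have "\<not> is_path Q [i]" using that(2) p1 by auto
      then show ?thesis using that(1) True unfolding acar path_coeff_def by auto
    next
      case False
      then have "\<not> is_path Q [i, j]" using that(2) p2 by auto
      then show ?thesis using that(1) False unfolding acar path_coeff_def by auto
    qed
    show "amul ?A x y \<in> acar ?A" if "x \<in> acar ?A" "y \<in> acar ?A" for x y
      unfolding acar
    proof (intro allI impI)
      fix p assume p: "amul ?A x y p \<noteq> 0"
      have "\<exists>k<length p. x (take (Suc k) p) * y (drop k p) \<noteq> 0"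
      proof (rule ccontr)
        assume "\<not> ?thesis"
        then have "amul ?A x y p = 0" unfolding mul by (intro sum.neutral) blast
        then show False using p by simp
      qed
      then obtain k where k: "k < length p" "x (take (Suc k) p) \<noteq> 0" "y (drop k p) \<noteq> 0" by auto
      then show "is_path Q p" using that glue[of k p] unfolding acar by blast
    qed
    show "path_coeff (amul ?A x y) i i = path_coeff x i i * path_coeff y i i" for x y i
      by (simp add: path_coeff_def mul)
    show "path_coeff (amul ?A x y) i j = path_coeff x i i * path_coeff y i j + path_coeff x i j * path_coeff y j j"
      if "(i, j) \<in> qarrows Q" for x y i j
      using ne[OF that] by (simp add: path_coeff_def mul numeral_2_eq_2)
    show "aone ?A \<in> acar ?A" using p1 by (auto simp: acar one)
    show "path_coeff (aone ?A) i j = (if i = j \<and> i \<in> qverts Q then 1 else 0)" for i j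
      by (auto simp: path_coeff_def one)
  qed (use fin sub bip in auto)
qed

section \<open>The orbits of the injective modules\<close>

lemma d_F_cong: "(\<And>i. i \<in> fverts \<Delta> \<Longrightarrow> u i = v i) \<Longrightarrow> d_F \<Delta> u = d_F \<Delta> v"
  by (auto simp: d_F_def intro!: sum.cong)

lemma d_F_sum: "d_F \<Delta> (\<lambda>i. \<Sum>j\<in>J. c j * u j i) = (\<Sum>j\<in>J. real_of_int (c j) *\<^sub>R d_F \<Delta> (u j))"
proof -
  have swap: "(\<Sum>i\<in>I. a i * real_of_int (\<Sum>j\<in>J. c j * u j i)) =
      (\<Sum>j\<in>J. real_of_int (c j) * (\<Sum>i\<in>I. a i * real_of_int (u j i)))" for I and a :: "vertex \<Rightarrow> real"
    by (simp add: sum_distrib_left mult.left_commute) (rule sum.swap)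
  show ?thesis
    unfolding d_F_def swap by (simp add: prod_eq_iff fst_sum snd_sum)
qed

text \<open>The even and odd parts combine into d_F of an alternating sum of dimension vectors, the
  form in which Euler characteristics appear.\<close>

lemma delta_Db_sum:
  fixes M :: "int \<Rightarrow> ('k::field, vertex list \<Rightarrow> 'k, 'v::ab_group_add) rmod"
  assumes "finite {j. mcar (M j) \<noteq> {0}}"
  shows "delta_Db \<Delta> M = d_F \<Delta> (\<lambda>i. \<Sum>j | mcar (M j) \<noteq> {0}. (if even j then 1 else - 1) * dimvec (M j) i)"
proof -
  let ?S = "{j. mcar (M j) \<noteq> {0}}"
  have "d_F \<Delta> (\<lambda>i. \<Sum>j\<in>?S. (if even j then 1 else - 1) * dimvec (M j) i) =
      (\<Sum>j\<in>?S. (if even j then delta_mod \<Delta> (M j) else 0) - (if odd j then delta_mod \<Delta> (M j) else 0))"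
    unfolding d_F_sum by (intro sum.cong) (auto simp: delta_mod_def)
  also have "\<dots> = (\<Sum>j\<in>{j\<in>?S. even j}. delta_mod \<Delta> (M j)) - (\<Sum>j\<in>{j\<in>?S. odd j}. delta_mod \<Delta> (M j))"
    unfolding sum_subtractf by (simp only: sum.inter_filter[OF assms])
  also have "\<dots> = delta_Db \<Delta> M"
    unfolding delta_Db_def by (intro arg_cong2[where f = "(-)"] sum.cong) auto
  finally show ?thesis ..
qed

lemma relpowp_conversepD:
  fixes P :: "'x \<Rightarrow> 'x \<Rightarrow> bool"
  shows "(P\<inverse>\<inverse> ^^ n) x y \<Longrightarrow> (P ^^ n) y x"
proof (induction n arbitrary: y)
  case (Suc n)
  obtain z where z: "(P\<inverse>\<inverse> ^^ n) x z" "P\<inverse>\<inverse> z y"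
    by (rule relpowp_Suc_E[OF Suc.prems]) (rule that)
  show ?case by (rule relpowp_Suc_I2[OF conversepD[OF z(2)] Suc.IH[OF z(1)]])
qed auto

theorem theorem3p5:
  fixes \<Delta> :: folding and i :: vertex and m :: int
    and KQ :: "('k::alg_closed_field, vertex list \<Rightarrow> 'k) alg"
    and N :: "('k, vertex list \<Rightarrow> 'k) umod"
    and M :: "int \<Rightarrow> ('k, vertex list \<Rightarrow> 'k) umod"
    and zs zl :: complex and \<alpha> \<beta> :: "real \<times> real"
  assumes "admissible \<Delta>"
    and "KQ = path_alg (fold_quiver \<Delta>)"
    and "i \<in> qverts (fold_quiver \<Delta>)"
    and "zs = of_real (sigma \<Delta> V0) * exp (of_real (m * pi / fold_n \<Delta>) * \<i>)"
    and "zl = of_real (sigma \<Delta> V1) * exp (of_real ((2 * m + 1) * pi / (2 * fold_n \<Delta>)) * \<i>)"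
    and "\<alpha> = root_coords \<Delta> zs"
    and "\<beta> = root_coords \<Delta> zl"
  shows "zs \<in> short_roots \<Delta> \<and> zl \<in> long_roots \<Delta> \<and>
    (tau_pow_mod KQ m (I_mod (fold_quiver \<Delta>) i) N \<and> mcar N \<noteq> {0} \<longrightarrow>
       (fold_map \<Delta> i = V0 \<longrightarrow> delta_mod \<Delta> N = weight \<Delta> i *\<^sub>R \<alpha>) \<and>
       (fold_map \<Delta> i = V1 \<longrightarrow> delta_mod \<Delta> N = weight \<Delta> i *\<^sub>R \<beta>)) \<and>
    (tau_pow_Db KQ m (stalk_cpx (I_mod (fold_quiver \<Delta>) i)) (shift_sum_cpx M) \<longrightarrow>
       (fold_map \<Delta> i = V0 \<longrightarrow> delta_Db \<Delta> M = weight \<Delta> i *\<^sub>R \<alpha>) \<and>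
       (fold_map \<Delta> i = V1 \<longrightarrow> delta_Db \<Delta> M = weight \<Delta> i *\<^sub>R \<beta>))"
proof -
  note adm = assms(1) and iV = assms(3)
  let ?I = "I_mod (fold_quiver \<Delta>) i :: ('k, vertex list \<Rightarrow> 'k, (vertex list \<Rightarrow> 'k) \<Rightarrow> 'k) rmod"
  interpret bipartite_algebra KQ "fverts \<Delta>" "farrows \<Delta>" path_basis path_coeff
    unfolding assms(2)
    by (rule path_alg_bipartite[OF finite_fverts farrows_sub[OF adm] farrows_bipartite[OF adm]])
  have n0: "fold_n \<Delta> > 0" using fold_n_ge[OF adm] by simp
  have expcis: "exp (of_real x * \<i>) = cis x" for x by (simp add: cis_conv_exp mult.commute)
  have a1: "of_int m * pi / real (fold_n \<Delta>) = 2 * angle \<Delta> * m"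
    using n0 by (simp add: angle_def field_simps)
  have a2: "(2 * of_int m + 1) * pi / (2 * real (fold_n \<Delta>)) = 2 * angle \<Delta> * m + angle \<Delta>"
    using n0 by (simp add: angle_def field_simps)
  have zs: "zs = of_real (sigma \<Delta> V0) * cis (2 * angle \<Delta> * m)"
    unfolding assms(4) expcis using a1 by simp
  have zl: "zl = of_real (sigma \<Delta> V1) * (cis (2 * angle \<Delta> * m) * cis (angle \<Delta>))"
    unfolding assms(5) expcis cis_mult using a2 by simp
  have roots: "zs \<in> short_roots \<Delta>" "zl \<in> long_roots \<Delta>"
  proof -
    show "zs \<in> short_roots \<Delta>" unfolding short_roots_def Let_def assms(4) by (rule rangeI)
    have "2 * sigma \<Delta> V0 * cos (pi / (2 * fold_n \<Delta>)) = sigma \<Delta> V1"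
      by (simp add: sigma_V1 angle_def)
    then show "zl \<in> long_roots \<Delta>" unfolding long_roots_def Let_def assms(5)
      by (intro image_eqI[of _ _ m]) simp_all
  qed
  \<comment> \<open>The function shared by the module and the derived case: the plane point of a
    dimension vector, an eigenfunction of the Coxeter transformation for exp(i\<pi>/n).\<close>
  define F where "F u = root_point \<Delta> (d_F \<Delta> u)" for u
  let ?z = "cis (2 * angle \<Delta>)"
  have F_cox: "F y = ?z * F x" if "cox x y" for x y
    unfolding F_def using that unfolding cox_def by (intro d_F_cox[OF adm]) auto
  have F_cong: "F u = F v" if "\<And>j. j \<in> fverts \<Delta> \<Longrightarrow> u j = v j" for u v
    unfolding F_def using d_F_cong[of \<Delta> u v] that by simp
  have F_init: "fold_map \<Delta> i = V0 \<Longrightarrow> F x = of_real (weight \<Delta> i * sigma \<Delta> V0)"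
    "fold_map \<Delta> i = V1 \<Longrightarrow> F x = of_real (weight \<Delta> i * sigma \<Delta> V1) * cis (angle \<Delta>)"
    if "\<And>j. j \<in> fverts \<Delta> \<Longrightarrow> x j = (if j = i \<or> (j, i) \<in> farrows \<Delta> then 1 else 0)" for x
    using root_point_injective[OF adm iV that] unfolding F_def by blast+
  \<comment> \<open>The common conclusion; d will be \<open>delta_mod \<Delta> N\<close> or
    \<open>delta_Db \<Delta> M\<close>, and x the dimension vector of an injective at i.\<close>
  have final: "(fold_map \<Delta> i = V0 \<longrightarrow> d = weight \<Delta> i *\<^sub>R \<alpha>) \<and> (fold_map \<Delta> i = V1 \<longrightarrow> d = weight \<Delta> i *\<^sub>R \<beta>)"
    if x: "\<And>j. j \<in> fverts \<Delta> \<Longrightarrow> x j = (if j = i \<or> (j, i) \<in> farrows \<Delta> then 1 else 0)"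
      and d: "root_point \<Delta> d = cis (2 * angle \<Delta> * m) * F x" for d x
  proof (intro conjI impI)
    show "d = weight \<Delta> i *\<^sub>R \<alpha>" if "fold_map \<Delta> i = V0"
      unfolding assms(6) by (rule eq_root_coords[OF adm]) (simp add: d F_init(1)[OF x that] zs)
    show "d = weight \<Delta> i *\<^sub>R \<beta>" if "fold_map \<Delta> i = V1"
      unfolding assms(7) by (rule eq_root_coords[OF adm]) (simp add: d F_init(2)[OF x that] zl)
  qed
  have pow_pos: "?z ^ nat m = cis (2 * angle \<Delta> * m)" if "m \<ge> 0"
    using that by (simp add: DeMoivre mult.commute)
  have I_inj: "inj_at i ?I"
    using inj_at_injective[OF iV] unfolding assms(2) I_mod_def path_basis_diag .
  have dimv: "dimvec X j = pdim X j" if "is_rmod KQ X" "j \<in> fverts \<Delta>"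
    for X :: "('k, vertex list \<Rightarrow> 'k) umod" and j
  proof -
    interpret X: bip_module KQ "fverts \<Delta>" "farrows \<Delta>" path_basis path_coeff X by (rule rmod_module[OF that(1)])
    show ?thesis using X.piece_image[OF that(2)] by (simp add: dimvec_def pdim_def path_basis_diag)
  qed
  have modpart: "(fold_map \<Delta> i = V0 \<longrightarrow> delta_mod \<Delta> N = weight \<Delta> i *\<^sub>R \<alpha>) \<and>
      (fold_map \<Delta> i = V1 \<longrightarrow> delta_mod \<Delta> N = weight \<Delta> i *\<^sub>R \<beta>)"
    if tau: "tau_pow_mod KQ m ?I N" and N0: "mcar N \<noteq> {0}"
  proof -
    obtain X :: "('k, vertex list \<Rightarrow> 'k) umod" where X: "fg_mod KQ ?I" "fg_mod KQ X" "iso_mod KQ X ?I"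
      "if m \<ge> 0 then (tau_mod KQ ^^ nat m) X N else (tau_inv_mod KQ ^^ nat (- m)) X N"
      using tau unfolding tau_pow_mod_def by blast
    have rX: "is_rmod KQ X" and rI: "is_rmod KQ ?I" using X by (simp_all add: fg_mod_def)
    have iX: "inj_at i X" by (rule inj_at_iso[OF rX rI X(3) iV I_inj])
    have m0: "m \<ge> 0"
    proof (rule ccontr)
      assume m: "\<not> m \<ge> 0"
      then obtain k where "nat (- m) = Suc k" by (cases "nat (- m)") auto
      then show False using tau_inv_pow_injective[OF rX iX iV, of k N] X(4) m N0 by simp
    qed
    \<comment> \<open>For m = 0 no \<open>tau_mod\<close> step certifies that N is a module; then N
      is X itself.\<close>
    have rN: "is_rmod KQ N"
    proof (cases "nat m")
      case 0
      then show ?thesis using X(4) m0 rX by simp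
    next
      case (Suc k)
      then have "(tau_mod KQ ^^ Suc k) X N" using X(4) m0 by simp
      then obtain Y :: "('k, vertex list \<Rightarrow> 'k) umod" where "tau_mod KQ Y N"
        by (auto elim: relpowp_Suc_E)
      then show ?thesis by (simp add: tau_mod_def fg_mod_def)
    qed
    have "F (pdim N) = ?z ^ nat m * F (pdim X)"
      using tau_pow_mod_invariant[where F = F, OF F_cox inj_at_indec[OF rX iX iV]] X(4) m0 N0 by auto
    then have "root_point \<Delta> (delta_mod \<Delta> N) = cis (2 * angle \<Delta> * m) * F (pdim X)"
      using F_cong[of "dimvec N" "pdim N"] dimv[OF rN] pow_pos[OF m0] by (simp add: F_def delta_mod_def)
    then show ?thesis by (intro final[of "pdim X"] inj_at_pdim[OF rX iX iV])
  qed
  have Dbpart: "(fold_map \<Delta> i = V0 \<longrightarrow> delta_Db \<Delta> M = weight \<Delta> i *\<^sub>R \<alpha>) \<and>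
      (fold_map \<Delta> i = V1 \<longrightarrow> delta_Db \<Delta> M = weight \<Delta> i *\<^sub>R \<beta>)"
    if tau: "tau_pow_Db KQ m (stalk_cpx ?I) (shift_sum_cpx M)"
  proof -
    obtain X :: "('k, vertex list \<Rightarrow> 'k) ucpx" where X: "Db_iso KQ X (stalk_cpx ?I)"
      "if m \<ge> 0 then (tau_Db KQ ^^ nat m) X (shift_sum_cpx M)
       else ((tau_Db KQ)\<inverse>\<inverse> ^^ nat (- m)) X (shift_sum_cpx M)"
      using tau unfolding tau_pow_Db_def by blast
    let ?Y = "shift_sum_cpx M"
    have bI: "bounded_cpx KQ (stalk_cpx ?I)" and bX: "bounded_cpx KQ X"
      using X(1) by (simp_all add: Db_iso_def)
    have rI: "is_rmod KQ ?I" using bounded_rmod[OF bI, of 0] by (simp add: stalk_cpx_def)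
    have eX: "euler X j = pdim ?I j" if "j \<in> fverts \<Delta>" for j
    proof -
      have "supp (stalk_cpx ?I) \<subseteq> {0}" by (auto simp: supp_def stalk_cpx_def)
      then have "euler (stalk_cpx ?I) j = (\<Sum>k\<in>{0}. (if even k then 1 else - 1) * pdim (cobj (stalk_cpx ?I) k) j)"
        by (intro euler_superset[OF bounded_rmod[OF bI] _ _ that]) auto
      then show ?thesis using euler_Db_iso[OF X(1) that] by (simp add: stalk_cpx_def)
    qed
    \<comment> \<open>Boundedness comes from a neighbouring step of the orbit, on either side
      according to the sign of m, or from X when m = 0.\<close>
    have bY: "bounded_cpx KQ ?Y"
    proof (cases "m = 0")
      case True
      then show ?thesis using X(2) bX by simp
    next
      case False
      have "\<exists>W :: ('k, vertex list \<Rightarrow> 'k) ucpx. tau_Db KQ W ?Y \<or> tau_Db KQ ?Y W"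
      proof (cases "m \<ge> 0")
        case True
        then obtain k where "nat m = Suc k" using \<open>m \<noteq> 0\<close> by (cases "nat m") auto
        then have "(tau_Db KQ ^^ Suc k) X ?Y" using X(2) True by simp
        then show ?thesis by (auto elim: relpowp_Suc_E)
      next
        case False
        then obtain k where "nat (- m) = Suc k" by (cases "nat (- m)") auto
        then have "((tau_Db KQ)\<inverse>\<inverse> ^^ Suc k) X ?Y" using X(2) False by simp
        then show ?thesis by (auto elim: relpowp_Suc_E)
      qed
      then show ?thesis by (auto simp: tau_Db_def Db_iso_def)
    qed
    have FY: "F (euler ?Y) = cis (2 * angle \<Delta> * m) * F (euler X)"
    proof (cases "m \<ge> 0")
      case True
      then show ?thesis
        using tau_pow_Db_invariant[where F = F, OF F_cox] X(2) pow_pos[OF True] by simp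
    next
      case False
      \<comment> \<open>A negative power is an orbit from \<open>?Y\<close> back to X. The
        invariance is applied in that direction and the rotation is then inverted.\<close>
      then have "((tau_Db KQ)\<inverse>\<inverse> ^^ nat (- m)) X ?Y" using X(2) by simp
      then have "(tau_Db KQ ^^ nat (- m)) ?Y X" by (rule relpowp_conversepD)
      then have "F (euler X) = ?z ^ nat (- m) * F (euler ?Y)"
        using tau_pow_Db_invariant[where F = F, OF F_cox] by blast
      also have "?z ^ nat (- m) = cis (- (2 * angle \<Delta> * m))"
        using False by (simp add: DeMoivre mult.commute)
      finally have "cis (2 * angle \<Delta> * m) * F (euler X) =
          (cis (2 * angle \<Delta> * m) * cis (- (2 * angle \<Delta> * m))) * F (euler ?Y)"
        by simp
      then show ?thesis by (simp add: cis_mult)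
    qed
    \<comment> \<open>\<open>M j\<close> sits in degree -j; negation preserves parity, so the signs
      in the Euler characteristic agree with those in \<open>delta_Db\<close>.\<close>
    have sY: "supp ?Y = uminus ` {j. mcar (M j) \<noteq> {0}}"
    proof -
      have "j \<in> uminus ` {j. mcar (M j) \<noteq> {0}}" if "j \<in> supp ?Y" for j
        using that by (intro image_eqI[of _ _ "- j"]) (auto simp: supp_def shift_sum_cpx_def)
      then show ?thesis by (auto simp: supp_def shift_sum_cpx_def)
    qed
    have finM: "finite {j. mcar (M j) \<noteq> {0}}"
      using bounded_supp[OF bY] unfolding sY by (rule finite_imageD) (simp add: inj_on_def)
    have rM: "is_rmod KQ (M j)" for j
      using bounded_rmod[OF bY, of "- j"] by (simp add: shift_sum_cpx_def)
    have "euler ?Y j = (\<Sum>k | mcar (M k) \<noteq> {0}. (if even k then 1 else - 1) * dimvec (M k) j)"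
      if "j \<in> fverts \<Delta>" for j
      unfolding euler_def sY
      by (subst sum.reindex) (auto simp: inj_on_def shift_sum_cpx_def dimv[OF rM that])
    then have "root_point \<Delta> (delta_Db \<Delta> M) = F (euler ?Y)"
      unfolding delta_Db_sum[OF finM] F_def by (simp cong: d_F_cong)
    moreover have "F (euler X) = F (pdim ?I)" by (rule F_cong[OF eX])
    ultimately have "root_point \<Delta> (delta_Db \<Delta> M) = cis (2 * angle \<Delta> * m) * F (pdim ?I)"
      using FY by simp
    then show ?thesis by (intro final[of "pdim ?I"] inj_at_pdim[OF rI I_inj iV])
  qed
  show ?thesis using roots modpart Dbpart by blast
qed

end
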